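(* Let $\omega\in\overline{\mathfrak{T}}$, with associated data $I,L,L',J,M,M',\sigma$, numbers $s=\#L$, $t=\#M$, and bijections $w_{\mathfrak{k},+},w_{\mathfrak{k},-},w_{\mathfrak{s},+},w_{\mathfrak{s},-}$ as defined in the context. (1) The image of $\mathbb{O}_\omega$ by the symmetrized Steinberg map is $\Phi_{\mathfrak{k}}(\mathbb{O}_\omega)=\mathfrak{O}_{\lambda,\mu}$, where $$(\lambda,\mu)=\big(\mathrm{shape}(\mathrm{RS}_1(w_{\mathfrak{k},+})),\ \mathrm{shape}(\mathrm{RS}_1(w_{\mathfrak{k},-}))\big).$$ (2) The image of $\mathbb{O}_\omega$ by the exotic Steinberg map is $\Phi_{\mathfrak{s}}(\mathbb{O}_\omega)=\mathfrak{O}_\Lambda$, where $\Lambda$ is the signed Young diagram determined as follows: (a) for every even $c\ge 1$, $$\#\Lambda_{\le c}(+)=\#\lambda_{\le c}\quad\text{and}\quad\#\Lambda_{\le c}(-)=\#\mu_{\le c},$$ with $(\lambda,\mu)$ the pair of Young diagrams of part (1); (b) for every odd $c\ge 1$, $$\#\Lambda_{\le c}(+)=s-t+\#\lambda'_{\le c}\quad\text{and}\quad\#\Lambda_{\le c}(-)=t-s+\#\mu'_{\le c},$$ where $(\lambda',\mu')=\big(\mathrm{shape}(\mathrm{RS}_1(w_{\mathfrak{s},+})),\ \mathrm{shape}(\mathrm{RS}_1(w_{\mathfrak{s},-}))\big)$.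
   Context: Setting. Let $p,q\ge 1$ and $0\le r\le p+q$ be integers. $V=\mathbb{C}^{p+q}=V^+\oplus V^-$ with $V^+=\mathbb{C}^p\times\{0\}^q$, $V^-=\{0\}^p\times\mathbb{C}^q$; $\mathfrak{X}=\mathrm{Gr}(V,r)\times\mathrm{Fl}(V^+)\times\mathrm{Fl}(V^-)$ (Grassmannian of $r$-dimensional subspaces and varieties of complete flags) with the diagonal action of $K=\mathrm{GL}(V^+)\times\mathrm{GL}(V^-)\cong\mathrm{GL}_p(\mathbb{C})\times\mathrm{GL}_q(\mathbb{C})$. The standard flags are $\mathcal{F}_0^+=(\mathbb{C}^i\times\{0\}^{p-i}\times\{0\}^q)_{i=0}^p$, $\mathcal{F}_0^-=(\{0\}^p\times\mathbb{C}^j\times\{0\}^{q-j})_{j=0}^q$. Orbits. $\mathfrak{T}$ is the set of $(p+q)\times r$ matrices of rank $r$ of the form $\omega=\begin{pmatrix}\tau_1\\ \tau_2\end{pmatrix}$, where $\tau_1$ ($p\times r$) and $\tau_2$ ($q\times r$) have entries in $\{0,1\}$ with at most one $1$ in each row and each column; $\overline{\mathfrak{T}}=\mathfrak{T}/\mathfrak{S}_r$ (column permutations). $[\omega]\in \mathrm{Gr}(V,r)$ is the column space of $\omega$, and $\mathbb{O}_\omega=K\cdot([\omega],\mathcal{F}_0^+,\mathcal{F}_0^-)$; these are all the $K$-orbits of $\mathfrak{X}$, without repetition (finitely many). Steinberg maps. Let $\mathfrak{k}=\left\{\begin{pmatrix}a&0\\0&d\end{pmatrix}\right\}$ and $\mathfrak{s}=\left\{\begin{pmatrix}0&b\\c&0\end{pmatrix}\right\}$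 inside $\mathfrak{gl}(V)=\mathfrak{gl}_{p+q}(\mathbb{C})$ (blocks $a:p\times p$, $b:p\times q$, $c:q\times p$, $d:q\times q$); write $x=x_{\mathfrak{k}}+x_{\mathfrak{s}}$ for the corresponding decomposition of $x\in\mathfrak{gl}(V)$. $\mathcal{N}_{\mathfrak{k}},\mathcal{N}_{\mathfrak{s}}$ are the sets of nilpotent elements of $\mathfrak{k},\mathfrak{s}$; each is a finite union of adjoint $K$-orbits. For a complete flag $\mathcal{F}=(F_i)_i$ of a space $V'$, $\mathfrak{nil}(\mathcal{F})=\{x\in\mathfrak{gl}(V'):x(F_i)\subset F_{i-1}\ \forall i\ge1\}$; for $W\subset V$, $\mathfrak{nil}(W)=\{x\in\mathfrak{gl}(V):\mathrm{Im}\,x\subset W\subset\ker x\}$. The conormal variety is $$\mathcal{Y}=\{(W,\mathcal{F}^+,\mathcal{F}^-,x)\in\mathfrak{X}\times\mathfrak{gl}(V):x\in\mathfrak{nil}(W),\ x_{\mathfrak{k}}\in\mathfrak{nil}(\mathcal{F}^+)\times\mathfrak{nil}(\mathcal{F}^-)\},$$ and for a $K$-orbit $\mathbb{O}\subset\mathfrak{X}$, $T^*_{\mathbb{O}}\mathfrak{X}=\{(W,\mathcal{F}^+,\mathcal{F}^-,x)\in\mathcal{Y}:(W,\mathcal{F}^+,\mathcal{F}^-)\in\mathbb{O}\}$ (irreducible). The maps $\phi_{\mathfrak{k}}:(W,\mathcal{F}^+,\mathcal{F}^-,x)\mapsto x_{\mathfrak{k}}$ and $\phi_{\mathfrak{s}}:(W,\mathcal{F}^+,\mathcal{F}^-,x)\mapsto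 x_{\mathfrak{s}}$ send $\mathcal{Y}$ into $\mathcal{N}_{\mathfrak{k}}$ and $\mathcal{N}_{\mathfrak{s}}$ respectively. $\Phi_{\mathfrak{k}}(\mathbb{O})$ (symmetrized Steinberg map), resp. $\Phi_{\mathfrak{s}}(\mathbb{O})$ (exotic Steinberg map), is the unique nilpotent $K$-orbit of $\mathcal N_{\mathfrak k}$, resp. $\mathcal N_{\mathfrak s}$, that is open and dense in $\phi_{\mathfrak{k}}(T^*_{\mathbb{O}}\mathfrak{X})$, resp. $\phi_{\mathfrak{s}}(T^*_{\mathbb{O}}\mathfrak{X})$. Parametrization of nilpotent orbits. For partitions $\lambda\vdash p$, $\mu\vdash q$ (viewed as Young diagrams), $\mathfrak{O}_{\lambda,\mu}\subset\mathcal{N}_{\mathfrak{k}}$ is the $K$-orbit of the $\begin{pmatrix}a&0\\0&d\end{pmatrix}$ such that for all $k\ge1$ the number of boxes in the first $k$ columns of $\lambda$ (resp. $\mu$) is $\dim\ker a^k$ (resp. $\dim\ker d^k$). A signed Young diagram of signature $(p,q)$ is a Young diagram of size $p+q$ with boxes filled by $p$ signs $+$ and $q$ signs $-$, alternating along each row, up to permutation of rows of equal length; $\mathfrak{O}_\Lambda\subset\mathcal{N}_{\mathfrak{s}}$ is the $K$-orbit of those $x$ such that for all $k\geq 1$ the number of $+$'s (resp. $-$'s) in the first $k$ columns of $\Lambda$ is $\dim V^+\cap\ker x^k$ (resp. $\dim V^-\cap\ker x^k$). $\#\lambda_{\le c}$ is the number of boxes in the first $c$ columns of $\lambda$; $\#\Lambda_{\le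 c}(\pm)$ is the number of $\pm$'s in the first $c$ columns of $\Lambda$. Combinatorial data of $\omega$. $I$ is the set of pairs' positive indices and $J$ of negative indices as follows: a column of $\omega$ with exactly two $1$'s, in row $i$ of $\tau_1$ and row $j$ of $\tau_2$, puts $i\in I$, $j\in J$ and $\sigma(j)=i$, which defines a bijection $\sigma:J\to I$. $L\subset\{1,\dots,p\}$ (resp. $M\subset\{1,\dots,q\}$) is the set of $i$ (resp. $j$) such that some column of $\omega$ has exactly one $1$, located in row $i$ of $\tau_1$ (resp. row $j$ of $\tau_2$). $L'=\{1,\dots,p\}\setminus(I\cup L)$, $M'=\{1,\dots,q\}\setminus(J\cup M)$. Write $I=\{i_1<\dots<i_k\}$, $J=\{j_1<\dots<j_k\}$, $L=\{\ell_1<\dots<\ell_s\}$, $L'=\{\ell'_1<\dots<\ell'_{s'}\}$, $M=\{m_1<\dots<m_t\}$, $M'=\{m'_1<\dots<m'_{t'}\}$. In two-line notation, $$w_{\mathfrak{k},+}=\begin{pmatrix}1&\cdots&s&s+1&\cdots&s+k&s+k+1&\cdots&p\\ \ell_s&\cdots&\ell_1&\sigma(j_1)&\cdots&\sigma(j_k)&\ell'_{s'}&\cdots&\ell'_1\end{pmatrix}\in\mathfrak{S}_p,$$ $$w_{\mathfrak{k},-}=\begin{pmatrix}1&\cdots&t&t+1&\cdots&t+k&t+k+1&\cdots&q\\ m_t&\cdots&m_1&\sigma^{-1}(i_1)&\cdots&\sigma^{-1}(i_k)&m'_{t'}&\cdots&m'_1\end{pmatrix}\in\mathfrak{S}_q,$$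 $$w_{\mathfrak{s},+}=\begin{pmatrix}m_1&\cdots&m_t&j_1&\cdots&j_k&q+1&\cdots&q+s'\\ -1&\cdots&-t&\sigma(j_1)&\cdots&\sigma(j_k)&\ell'_{s'}&\cdots&\ell'_1\end{pmatrix}$$ (a bijection from $J\cup M\cup\{q+1,\dots,q+s'\}$ to $\{-t,\dots,-1\}\cup I\cup L'$), and $$w_{\mathfrak{s},-}=\begin{pmatrix}\ell_1&\cdots&\ell_s&i_1&\cdots&i_k&p+1&\cdots&p+t'\\ -1&\cdots&-s&\sigma^{-1}(i_1)&\cdots&\sigma^{-1}(i_k)&m'_{t'}&\cdots&m'_1\end{pmatrix}$$ (a bijection from $I\cup L\cup\{p+1,\dots,p+t'\}$ to $\{-s,\dots,-1\}\cup J\cup M'$). Robinson--Schensted. For a bijection $w:S\to R$ between finite sets of integers, $S=\{s_1<\dots<s_n\}$, $(\mathrm{RS}_1(w),\mathrm{RS}_2(w))$ is the pair of Young tableaux given by the Robinson--Schensted correspondence: $\mathrm{RS}_1(w)$ (entries $R$) is the row-insertion tableau of the word $w(s_1)w(s_2)\cdots w(s_n)$ and $\mathrm{RS}_2(w)$ (entries $S$) is the recording tableau. *)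

theory Defs
  imports
    "HOL-Analysis.Abstract_Topology"
    "HOL-Library.Multiset"
    "Jordan_Normal_Form.DL_Rank"
    "Jordan_Normal_Form.Matrix_Kernel"
begin

definition is_subspace :: "nat \<Rightarrow> complex vec set \<Rightarrow> bool" where
  "is_subspace n W \<longleftrightarrow> VectorSpace.subspace class_ring W (module_vec TYPE(complex) n)"

definition subspace_dim :: "nat \<Rightarrow> complex vec set \<Rightarrow> nat" where
  "subspace_dim n W =
    vectorspace.dim class_ring (module_vec TYPE(complex) n\<lparr>carrier := W\<rparr>)"

definition V_plus :: "nat \<Rightarrow> nat \<Rightarrow> complex vec set" where
  "V_plus p q = {v \<in> carrier_vec (p + q). \<forall>i < p + q. p \<le> i \<longrightarrow> v $ i = 0}"

definition V_minus :: "nat \<Rightarrow> nat \<Rightarrow> complex vec set" where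
  "V_minus p q = {v \<in> carrier_vec (p + q). \<forall>i < p. v $ i = 0}"

definition Grassmannian :: "nat \<Rightarrow> nat \<Rightarrow> complex vec set set" where
  "Grassmannian n r = {W. is_subspace n W \<and> subspace_dim n W = r}"

text \<open>A complete flag $F_0 \subset F_1 \subset \dots \subset F_{\dim U}$ of a subspace
  $U$ of $\mathbb{C}^n$ is the list of its members, so that \<open>F ! i\<close> is $F_i$.\<close>

definition complete_flags :: "nat \<Rightarrow> complex vec set \<Rightarrow> complex vec set list set" where
  "complete_flags n U = {F. length F = subspace_dim n U + 1 \<and>
     (\<forall>i < length F. is_subspace n (F ! i) \<and> F ! i \<subseteq> U \<and> subspace_dim n (F ! i) = i) \<and>
     (\<forall>i. i + 1 < length F \<longrightarrow> F ! i \<subseteq> F ! (i + 1))}"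

type_synonym point = "complex vec set \<times> complex vec set list \<times> complex vec set list"

definition X_variety :: "nat \<Rightarrow> nat \<Rightarrow> nat \<Rightarrow> point set" where
  "X_variety p q r =
    Grassmannian (p + q) r \<times> complete_flags (p + q) (V_plus p q) \<times>
    complete_flags (p + q) (V_minus p q)"

definition K_group :: "nat \<Rightarrow> nat \<Rightarrow> complex mat set" where
  "K_group p q = {four_block_mat a (0\<^sub>m p q) (0\<^sub>m q p) d | a d.
     a \<in> carrier_mat p p \<and> invertible_mat a \<and> d \<in> carrier_mat q q \<and> invertible_mat d}"

fun act :: "complex mat \<Rightarrow> point \<Rightarrow> point" where
  "act g (W, Fp, Fm) =
    ((\<lambda>v. g *\<^sub>v v) ` W, map (\<lambda>U. (\<lambda>v. g *\<^sub>v v) ` U) Fp, map (\<lambda>U. (\<lambda>v. g *\<^sub>v v) ` U) Fm)"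

definition std_flag_plus :: "nat \<Rightarrow> nat \<Rightarrow> complex vec set list" where
  "std_flag_plus p q =
    map (\<lambda>i. {v \<in> carrier_vec (p + q). \<forall>l < p + q. i \<le> l \<longrightarrow> v $ l = 0}) [0..<p + 1]"

definition std_flag_minus :: "nat \<Rightarrow> nat \<Rightarrow> complex vec set list" where
  "std_flag_minus p q =
    map (\<lambda>j. {v \<in> carrier_vec (p + q). \<forall>l < p + q. l < p \<or> p + j \<le> l \<longrightarrow> v $ l = 0}) [0..<q + 1]"

definition partial_perm_mat :: "complex mat \<Rightarrow> bool" where
  "partial_perm_mat t \<longleftrightarrow>
    (\<forall>i < dim_row t. \<forall>c < dim_col t. t $$ (i, c) \<in> {0, 1}) \<and>
    (\<forall>i < dim_row t. card {c. c < dim_col t \<and> t $$ (i, c) = 1} \<le> 1) \<and>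
    (\<forall>c < dim_col t. card {i. i < dim_row t \<and> t $$ (i, c) = 1} \<le> 1)"

text \<open>Elements of the quotient by column permutations are handled through representatives:
  the orbit and all the data below depend only on the set of columns of $\omega$.\<close>

definition T_mats :: "nat \<Rightarrow> nat \<Rightarrow> nat \<Rightarrow> complex mat set" where
  "T_mats p q r = {\<omega>. \<omega> \<in> carrier_mat (p + q) r \<and> vec_space.rank (p + q) \<omega> = r \<and>
     (\<exists>\<tau>1 \<tau>2. \<tau>1 \<in> carrier_mat p r \<and> \<tau>2 \<in> carrier_mat q r \<and> \<omega> = \<tau>1 @\<^sub>r \<tau>2 \<and>
       partial_perm_mat \<tau>1 \<and> partial_perm_mat \<tau>2)}"

definition orbit_of :: "nat \<Rightarrow> nat \<Rightarrow> complex mat \<Rightarrow> point set" where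
  "orbit_of p q \<omega> =
    {act g (vec_space.col_space (p + q) \<omega>, std_flag_plus p q, std_flag_minus p q) | g.
     g \<in> K_group p q}"

text \<open>The index sets $I, J, L, M, L', M'$ are 1-based, whereas matrix entries are 0-based:
  row $i$ of $\tau_1$ is row \<open>i - 1\<close> of $\omega$, and row $j$ of $\tau_2$ is row \<open>p + j - 1\<close>.\<close>

definition col_ones :: "complex mat \<Rightarrow> nat \<Rightarrow> nat set" where
  "col_ones \<omega> c = {l. l < dim_row \<omega> \<and> \<omega> $$ (l, c) = 1}"

definition matched :: "nat \<Rightarrow> nat \<Rightarrow> complex mat \<Rightarrow> nat \<Rightarrow> nat \<Rightarrow> bool" where
  "matched p q \<omega> i j \<longleftrightarrow> i \<in> {1..p} \<and> j \<in> {1..q} \<and>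
     (\<exists>c < dim_col \<omega>. col_ones \<omega> c = {i - 1, p + j - 1})"

definition I_set :: "nat \<Rightarrow> nat \<Rightarrow> complex mat \<Rightarrow> nat set" where
  "I_set p q \<omega> = {i. \<exists>j. matched p q \<omega> i j}"

definition J_set :: "nat \<Rightarrow> nat \<Rightarrow> complex mat \<Rightarrow> nat set" where
  "J_set p q \<omega> = {j. \<exists>i. matched p q \<omega> i j}"

definition sigma :: "nat \<Rightarrow> nat \<Rightarrow> complex mat \<Rightarrow> nat \<Rightarrow> nat" where
  "sigma p q \<omega> j = (THE i. matched p q \<omega> i j)"

definition sigma_inv :: "nat \<Rightarrow> nat \<Rightarrow> complex mat \<Rightarrow> nat \<Rightarrow> nat" where
  "sigma_inv p q \<omega> = inv_into (J_set p q \<omega>) (sigma p q \<omega>)"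

definition L_set :: "nat \<Rightarrow> nat \<Rightarrow> complex mat \<Rightarrow> nat set" where
  "L_set p q \<omega> = {i \<in> {1..p}. \<exists>c < dim_col \<omega>. col_ones \<omega> c = {i - 1}}"

definition M_set :: "nat \<Rightarrow> nat \<Rightarrow> complex mat \<Rightarrow> nat set" where
  "M_set p q \<omega> = {j \<in> {1..q}. \<exists>c < dim_col \<omega>. col_ones \<omega> c = {p + j - 1}}"

definition L'_set :: "nat \<Rightarrow> nat \<Rightarrow> complex mat \<Rightarrow> nat set" where
  "L'_set p q \<omega> = {1..p} - (I_set p q \<omega> \<union> L_set p q \<omega>)"

definition M'_set :: "nat \<Rightarrow> nat \<Rightarrow> complex mat \<Rightarrow> nat set" where
  "M'_set p q \<omega> = {1..q} - (J_set p q \<omega> \<union> M_set p q \<omega>)"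

text \<open>The map given in two-line notation; the upper line need not be increasing.\<close>

definition two_line :: "int list \<Rightarrow> int list \<Rightarrow> int \<Rightarrow> int" where
  "two_line upper lower x = the (map_of (zip upper lower) x)"

abbreviation incr :: "nat set \<Rightarrow> nat list" where
  "incr A \<equiv> sorted_list_of_set A"

definition w_k_plus :: "nat \<Rightarrow> nat \<Rightarrow> complex mat \<Rightarrow> int \<Rightarrow> int" where
  "w_k_plus p q \<omega> = two_line (map int [1..<p + 1])
     (map int (rev (incr (L_set p q \<omega>)) @ map (sigma p q \<omega>) (incr (J_set p q \<omega>)) @
               rev (incr (L'_set p q \<omega>))))"

definition w_k_minus :: "nat \<Rightarrow> nat \<Rightarrow> complex mat \<Rightarrow> int \<Rightarrow> int" where
  "w_k_minus p q \<omega> = two_line (map int [1..<q + 1])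
     (map int (rev (incr (M_set p q \<omega>)) @ map (sigma_inv p q \<omega>) (incr (I_set p q \<omega>)) @
               rev (incr (M'_set p q \<omega>))))"

definition dom_s_plus :: "nat \<Rightarrow> nat \<Rightarrow> complex mat \<Rightarrow> int set" where
  "dom_s_plus p q \<omega> =
    int ` (J_set p q \<omega> \<union> M_set p q \<omega> \<union> {q + 1..q + card (L'_set p q \<omega>)})"

definition w_s_plus :: "nat \<Rightarrow> nat \<Rightarrow> complex mat \<Rightarrow> int \<Rightarrow> int" where
  "w_s_plus p q \<omega> = two_line
     (map int (incr (M_set p q \<omega>) @ incr (J_set p q \<omega>) @
               [q + 1..<q + card (L'_set p q \<omega>) + 1]))
     (map (\<lambda>i. - int i) [1..<card (M_set p q \<omega>) + 1] @
      map int (map (sigma p q \<omega>) (incr (J_set p q \<omega>)) @ rev (incr (L'_set p q \<omega>))))"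

definition dom_s_minus :: "nat \<Rightarrow> nat \<Rightarrow> complex mat \<Rightarrow> int set" where
  "dom_s_minus p q \<omega> =
    int ` (I_set p q \<omega> \<union> L_set p q \<omega> \<union> {p + 1..p + card (M'_set p q \<omega>)})"

definition w_s_minus :: "nat \<Rightarrow> nat \<Rightarrow> complex mat \<Rightarrow> int \<Rightarrow> int" where
  "w_s_minus p q \<omega> = two_line
     (map int (incr (L_set p q \<omega>) @ incr (I_set p q \<omega>) @
               [p + 1..<p + card (M'_set p q \<omega>) + 1]))
     (map (\<lambda>i. - int i) [1..<card (L_set p q \<omega>) + 1] @
      map int (map (sigma_inv p q \<omega>) (incr (I_set p q \<omega>)) @ rev (incr (M'_set p q \<omega>))))"

text \<open>Tableaux are lists of rows. \<open>row_insert\<close> returns the new row together with the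
  bumped entry, if any.\<close>

fun row_insert :: "int \<Rightarrow> int list \<Rightarrow> int list \<times> int option" where
  "row_insert x [] = ([x], None)"
| "row_insert x (y # ys) =
    (if x < y then (x # ys, Some y)
     else (case row_insert x ys of (zs, b) \<Rightarrow> (y # zs, b)))"

fun tableau_insert :: "int \<Rightarrow> int list list \<Rightarrow> int list list" where
  "tableau_insert x [] = [[x]]"
| "tableau_insert x (xs # T) =
    (case row_insert x xs of
       (ys, None) \<Rightarrow> ys # T
     | (ys, Some y) \<Rightarrow> ys # tableau_insert y T)"

definition RS1 :: "int set \<Rightarrow> (int \<Rightarrow> int) \<Rightarrow> int list list" where
  "RS1 S w = fold tableau_insert (map w (sorted_list_of_set S)) []"

text \<open>Young diagrams are given by their lists of row lengths.\<close>

definition shape :: "int list list \<Rightarrow> nat list" where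
  "shape T = map length T"

definition boxes_upto :: "nat list \<Rightarrow> nat \<Rightarrow> nat" where
  "boxes_upto lam c = (\<Sum>l\<leftarrow>lam. min l c)"

text \<open>A signed Young diagram is considered up to permutation of rows of equal length, that
  is, as the multiset of its rows.\<close>

datatype sign = Plus | Minus

type_synonym signed_diagram = "sign list multiset"

definition signed_young_diagram :: "nat \<Rightarrow> nat \<Rightarrow> signed_diagram \<Rightarrow> bool" where
  "signed_young_diagram p q \<Lambda> \<longleftrightarrow>
    (\<forall>\<rho> \<in># \<Lambda>. \<rho> \<noteq> [] \<and> successively (\<noteq>) \<rho>) \<and>
    (\<Sum>\<rho>\<in>#\<Lambda>. count_list \<rho> Plus) = p \<and> (\<Sum>\<rho>\<in>#\<Lambda>. count_list \<rho> Minus) = q"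

definition signs_upto :: "signed_diagram \<Rightarrow> nat \<Rightarrow> sign \<Rightarrow> nat" where
  "signs_upto \<Lambda> c e = (\<Sum>\<rho>\<in>#\<Lambda>. count_list (take c \<rho>) e)"

definition k_alg :: "nat \<Rightarrow> nat \<Rightarrow> complex mat set" where
  "k_alg p q = {four_block_mat a (0\<^sub>m p q) (0\<^sub>m q p) d | a d.
     a \<in> carrier_mat p p \<and> d \<in> carrier_mat q q}"

definition s_alg :: "nat \<Rightarrow> nat \<Rightarrow> complex mat set" where
  "s_alg p q = {four_block_mat (0\<^sub>m p p) b c (0\<^sub>m q q) | b c.
     b \<in> carrier_mat p q \<and> c \<in> carrier_mat q p}"

definition k_part :: "nat \<Rightarrow> nat \<Rightarrow> complex mat \<Rightarrow> complex mat" where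
  "k_part p q x =
    (case split_block x p p of (a, b, c, d) \<Rightarrow> four_block_mat a (0\<^sub>m p q) (0\<^sub>m q p) d)"

definition s_part :: "nat \<Rightarrow> nat \<Rightarrow> complex mat \<Rightarrow> complex mat" where
  "s_part p q x =
    (case split_block x p p of (a, b, c, d) \<Rightarrow> four_block_mat (0\<^sub>m p p) b c (0\<^sub>m q q))"

definition nilpotents :: "nat \<Rightarrow> complex mat set" where
  "nilpotents n = {x \<in> carrier_mat n n. \<exists>m. x ^\<^sub>m m = 0\<^sub>m n n}"

definition N_k :: "nat \<Rightarrow> nat \<Rightarrow> complex mat set" where
  "N_k p q = k_alg p q \<inter> nilpotents (p + q)"

definition N_s :: "nat \<Rightarrow> nat \<Rightarrow> complex mat set" where
  "N_s p q = s_alg p q \<inter> nilpotents (p + q)"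

definition adjoint_orbit :: "nat \<Rightarrow> nat \<Rightarrow> complex mat \<Rightarrow> complex mat set" where
  "adjoint_orbit p q x =
    {g * x * h | g h. g \<in> K_group p q \<and> h \<in> carrier_mat (p + q) (p + q) \<and>
       inverts_mat g h \<and> inverts_mat h g}"

text \<open>\<open>orbit_k\<close> and \<open>orbit_s\<close> are the sets of all nilpotent elements with the prescribed
  kernel dimensions; that each of them is a single $K$-orbit (when nonempty) is a theorem.\<close>

definition orbit_k :: "nat \<Rightarrow> nat \<Rightarrow> nat list \<Rightarrow> nat list \<Rightarrow> complex mat set" where
  "orbit_k p q lam mu =
    {four_block_mat a (0\<^sub>m p q) (0\<^sub>m q p) d | a d.
       a \<in> carrier_mat p p \<and> d \<in> carrier_mat q q \<and>
       four_block_mat a (0\<^sub>m p q) (0\<^sub>m q p) d \<in> N_k p q \<and>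
       (\<forall>k \<ge> 1. boxes_upto lam k = kernel_dim (a ^\<^sub>m k) \<and>
                boxes_upto mu k = kernel_dim (d ^\<^sub>m k))}"

definition orbit_s :: "nat \<Rightarrow> nat \<Rightarrow> signed_diagram \<Rightarrow> complex mat set" where
  "orbit_s p q \<Lambda> =
    {x \<in> N_s p q. \<forall>k \<ge> 1.
       signs_upto \<Lambda> k Plus = subspace_dim (p + q) (V_plus p q \<inter> mat_kernel (x ^\<^sub>m k)) \<and>
       signs_upto \<Lambda> k Minus = subspace_dim (p + q) (V_minus p q \<inter> mat_kernel (x ^\<^sub>m k))}"

text \<open>The members of a flag of $V^+$ or $V^-$ are subspaces of $V$, so $x_{\mathfrak{k}}$ is
  applied to them directly instead of passing to its diagonal blocks.\<close>

definition nil_flag :: "complex vec set list \<Rightarrow> complex mat \<Rightarrow> bool" where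
  "nil_flag F x \<longleftrightarrow> (\<forall>i. 1 \<le> i \<and> i < length F \<longrightarrow> (\<lambda>v. x *\<^sub>v v) ` (F ! i) \<subseteq> F ! (i - 1))"

definition nil_subspace :: "nat \<Rightarrow> complex vec set \<Rightarrow> complex mat set" where
  "nil_subspace n W =
    {x \<in> carrier_mat n n. (\<lambda>v. x *\<^sub>v v) ` carrier_vec n \<subseteq> W \<and> W \<subseteq> mat_kernel x}"

definition conormal_variety :: "nat \<Rightarrow> nat \<Rightarrow> nat \<Rightarrow> (point \<times> complex mat) set" where
  "conormal_variety p q r =
    {((W, Fp, Fm), x) | W Fp Fm x.
       (W, Fp, Fm) \<in> X_variety p q r \<and> x \<in> nil_subspace (p + q) W \<and>
       nil_flag Fp (k_part p q x) \<and> nil_flag Fm (k_part p q x)}"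

definition conormal_bundle ::
    "nat \<Rightarrow> nat \<Rightarrow> nat \<Rightarrow> point set \<Rightarrow> (point \<times> complex mat) set" where
  "conormal_bundle p q r Ob = {y \<in> conormal_variety p q r. fst y \<in> Ob}"

definition phi_k :: "nat \<Rightarrow> nat \<Rightarrow> point \<times> complex mat \<Rightarrow> complex mat" where
  "phi_k p q y = k_part p q (snd y)"

definition phi_s :: "nat \<Rightarrow> nat \<Rightarrow> point \<times> complex mat \<Rightarrow> complex mat" where
  "phi_s p q y = s_part p q (snd y)"

text \<open>The topology is the Zariski topology, built from the polynomial functions in the
  matrix entries.\<close>

inductive_set poly_funs :: "nat \<Rightarrow> (complex mat \<Rightarrow> complex) set" for n :: nat where
  const: "(\<lambda>x. c) \<in> poly_funs n"
| coord: "i < n \<Longrightarrow> j < n \<Longrightarrow> (\<lambda>x. x $$ (i, j)) \<in> poly_funs n"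
| add: "f \<in> poly_funs n \<Longrightarrow> g \<in> poly_funs n \<Longrightarrow> (\<lambda>x. f x + g x) \<in> poly_funs n"
| mult: "f \<in> poly_funs n \<Longrightarrow> g \<in> poly_funs n \<Longrightarrow> (\<lambda>x. f x * g x) \<in> poly_funs n"

definition zero_locus :: "nat \<Rightarrow> (complex mat \<Rightarrow> complex) set \<Rightarrow> complex mat set" where
  "zero_locus n P = {x \<in> carrier_mat n n. \<forall>f \<in> P. f x = 0}"

definition zariski :: "nat \<Rightarrow> complex mat topology" where
  "zariski n = topology (\<lambda>U. \<exists>P \<subseteq> poly_funs n. U = carrier_mat n n - zero_locus n P)"

lemma openin_zariski:
  "openin (zariski n) U \<longleftrightarrow> (\<exists>P \<subseteq> poly_funs n. U = carrier_mat n n - zero_locus n P)"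
proof -
  let ?op = "\<lambda>U. \<exists>P \<subseteq> poly_funs n. U = carrier_mat n n - zero_locus n P"
  have "istopology ?op"
    unfolding istopology_def
  proof (intro conjI allI impI)
    fix S T assume "?op S" "?op T"
    then obtain P Q where P: "P \<subseteq> poly_funs n" "S = carrier_mat n n - zero_locus n P"
      and Q: "Q \<subseteq> poly_funs n" "T = carrier_mat n n - zero_locus n Q" by auto
    define R where "R = (\<lambda>(f, g) x. f x * g x) ` (P \<times> Q)"
    have "R \<subseteq> poly_funs n"
      unfolding R_def using P(1) Q(1) by (auto intro!: poly_funs.mult)
    moreover have "x \<in> S \<inter> T \<longleftrightarrow> x \<in> carrier_mat n n - zero_locus n R" for x
    proof -
      have "(\<forall>h \<in> R. h x = 0) \<longleftrightarrow> (\<forall>f \<in> P. \<forall>g \<in> Q. f x * g x = 0)"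
        unfolding R_def by simp
      also have "\<dots> \<longleftrightarrow> (\<forall>f \<in> P. f x = 0) \<or> (\<forall>g \<in> Q. g x = 0)"
        by (metis mult_eq_0_iff)
      finally show ?thesis
        unfolding P(2) Q(2) zero_locus_def by simp blast
    qed
    then have "S \<inter> T = carrier_mat n n - zero_locus n R" by (rule Set.set_eqI)
    ultimately show "?op (S \<inter> T)" by blast
  next
    fix \<U> assume all: "\<forall>U\<in>\<U>. ?op U"
    define R where "R = {f \<in> poly_funs n. \<exists>U\<in>\<U>. {x \<in> carrier_mat n n. f x \<noteq> 0} \<subseteq> U}"
    have "\<Union>\<U> = carrier_mat n n - zero_locus n R"
    proof
      show "\<Union>\<U> \<subseteq> carrier_mat n n - zero_locus n R"
      proof
        fix x assume "x \<in> \<Union>\<U>"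
        then obtain U where U: "U \<in> \<U>" "x \<in> U" by auto
        with all obtain P where P: "P \<subseteq> poly_funs n" "U = carrier_mat n n - zero_locus n P"
          by blast
        with U obtain f where f: "f \<in> P" "f x \<noteq> 0" "x \<in> carrier_mat n n"
          unfolding zero_locus_def by auto
        have "{x \<in> carrier_mat n n. f x \<noteq> 0} \<subseteq> U"
          using f(1) unfolding P(2) zero_locus_def by auto
        then have "f \<in> R" unfolding R_def using f(1) P(1) U(1) by blast
        then show "x \<in> carrier_mat n n - zero_locus n R"
          using f(2,3) unfolding zero_locus_def by auto
      qed
      show "carrier_mat n n - zero_locus n R \<subseteq> \<Union>\<U>"
        unfolding R_def zero_locus_def by blast
    qed
    moreover have "R \<subseteq> poly_funs n" unfolding R_def by auto
    ultimately show "?op (\<Union>\<U>)" by blast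
  qed
  then show ?thesis unfolding zariski_def by (simp add: topology_inverse')
qed

definition open_dense_in :: "'a topology \<Rightarrow> 'a set \<Rightarrow> 'a set \<Rightarrow> bool" where
  "open_dense_in T A X \<longleftrightarrow>
    openin (subtopology T X) A \<and> (subtopology T X) closure_of A = X"

text \<open>Since two subsets that are open and dense in the same nonempty space intersect, at most
  one $K$-orbit satisfies the descriptions below.\<close>

definition Phi_k :: "nat \<Rightarrow> nat \<Rightarrow> nat \<Rightarrow> point set \<Rightarrow> complex mat set" where
  "Phi_k p q r Ob = (THE N. N \<in> adjoint_orbit p q ` N_k p q \<and>
     open_dense_in (zariski (p + q)) N (phi_k p q ` conormal_bundle p q r Ob))"

definition Phi_s :: "nat \<Rightarrow> nat \<Rightarrow> nat \<Rightarrow> point set \<Rightarrow> complex mat set" where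
  "Phi_s p q r Ob = (THE N. N \<in> adjoint_orbit p q ` N_s p q \<and>
     open_dense_in (zariski (p + q)) N (phi_s p q ` conormal_bundle p q r Ob))"

end

theory Submission
  imports Defs "HOL-Combinatorics.List_Permutation"
begin

text \<open>Over the base point $([\omega], \mathcal{F}_0^+, \mathcal{F}_0^-)$ the fibre of the conormal
  bundle is a linear slice: the equations for $x$ say that certain rows and columns vanish, that
  matched rows agree and matched columns are opposite, and that $x_{\mathfrak{k}}$ is strictly
  upper triangular. The image of the conormal bundle is the $K$-saturation of the corresponding
  part of this slice. On the slice $x^2 = 0$, so $x_{\mathfrak{s}}^2 = - x_{\mathfrak{k}}^2$ and the
  ranks of the powers of $x_{\mathfrak{s}}$ on $V^\pm$ are those of $x_{\mathfrak{k}}^{2m}$ and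
  $x_{\mathfrak{s}} x_{\mathfrak{k}}^{2m}$. These matrices have their supports in the posets of
  points of the four two-line arrays, so Greene's theorem bounds the ranks by box counts in the
  Robinson--Schensted shapes: antichain covers give upper bounds, and 0/1 matrices built from
  families of chains attain them. Homogeneous nilpotent matrices have graded Jordan frames, hence
  their $K$-orbits are determined by the graded kernel dimensions; the orbit on which all
  rank bounds are attained is open and dense in the saturation because lines in the slice are not
  contained in the zero sets of the relevant minors.\<close>

section \<open>Greene's theorem for row insertion\<close>

text \<open>Two optimisation problems bound the same rank. Chains in the poset of a two-line array
  give elements of the slice for which a product of \<open>m\<close> factors has rank at least the
  sum of \<open>l - m\<close> over the row lengths \<open>l\<close>; antichains give a cut that
  bounds this rank on the whole slice by \<open>card Y - boxes_upto lam m\<close>. The numbers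
  agree, as a row has \<open>min l m\<close> boxes in the first \<open>m\<close> columns. So it is
  enough that families of the sizes read off the tableau exist; they are carried from its reading
  word back to the given word by moves that never destroy a family. Odd powers force the second pair
  of arrays: a path contributing to \<open>x_s x_k^(2m)\<close> first crosses from an index of
  \<open>J\<close> or \<open>M\<close> to one of \<open>I\<close> or \<open>L'\<close> and then
  stays in that part. Identifying each index of \<open>I\<close> with its mate makes it a path in
  one poset on \<open>J\<close>, \<open>M\<close> and \<open>L'\<close>. That poset has
  \<open>p + t - s\<close> points, which is the origin of the shift \<open>s - t\<close> in the odd
  columns. Different bounds may be attained at different elements; as the slice contains the line
  through any two of its points, finitely many polynomials, each nonzero somewhere on it, have a
  common nonzero.\<close>

definition colour_less :: "(int \<Rightarrow> nat) \<Rightarrow> nat set \<Rightarrow> int \<Rightarrow> int \<Rightarrow> bool" where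
  "colour_less c C a b \<longleftrightarrow> (c a = c b \<longrightarrow> c a \<in> C \<longrightarrow> a < b)"

text \<open>Each colour in \<open>C\<close> marks one increasing subsequence, possibly empty;
  letters with a colour outside \<open>C\<close> are uncovered. Fixing \<open>C\<close> and letting
  only the colouring vary keeps the number of subsequences constant under the moves below.\<close>

definition inc_family :: "nat set \<Rightarrow> nat \<Rightarrow> int list \<Rightarrow> bool" where
  "inc_family C N ws \<longleftrightarrow> (\<exists>c. sorted_wrt (colour_less c C) ws \<and> card {v \<in> set ws. c v \<in> C} = N)"

section \<open>Families of increasing subsequences under elementary moves of a word\<close>

lemma sorted_wrt_swap:
  assumes "sorted_wrt R (u @ z # x # v)" "R x z"
  shows "sorted_wrt R (u @ x # z # v)"
  using assms by (simp add: sorted_wrt_append; blast)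

lemma sorted_wrt_split3:
  "sorted_wrt R (u @ y # x # z # v) \<longleftrightarrow> sorted_wrt R u \<and> sorted_wrt R v \<and>
    (\<forall>a\<in>set u. \<forall>b\<in>set v. R a b) \<and> (\<forall>a\<in>set u. R a y \<and> R a x \<and> R a z) \<and>
    (\<forall>b\<in>set v. R y b \<and> R x b \<and> R z b) \<and> R y x \<and> R y z \<and> R x z"
  by (simp add: sorted_wrt_append; blast)

text \<open>Removing a descent imposes no new constraint: the only new ordered pair is
  \<open>x\<close>, \<open>z\<close>, which is increasing, so the same colouring serves.\<close>

lemma inc_family_swap:
  assumes "x < z" "inc_family C N (u @ z # x # v)"
  shows "inc_family C N (u @ x # z # v)"
proof -
  from assms(2) obtain c where c: "sorted_wrt (colour_less c C) (u @ z # x # v)"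
    "card {a \<in> set (u @ z # x # v). c a \<in> C} = N" unfolding inc_family_def by blast
  have "colour_less c C x z" using assms(1) by (simp add: colour_less_def)
  with c(1) have "sorted_wrt (colour_less c C) (u @ x # z # v)" by (rule sorted_wrt_swap)
  moreover have "set (u @ x # z # v) = set (u @ z # x # v)" by auto
  ultimately show ?thesis using c(2) unfolding inc_family_def by (intro exI[of _ c]) simp
qed

text \<open>If a colour class uses the step from \<open>x\<close> to \<open>z\<close>, it is rerouted through \<open>y\<close>,
  exchanging the tails of the classes of \<open>x\<close> and of \<open>y\<close>.\<close>

lemma inc_family_knuth:
  assumes dist: "distinct (u @ y # x # z # v)" and xy: "x < y" and yz: "y < z"
    and fam: "inc_family C N (u @ y # x # z # v)"
  shows "inc_family C N (u @ y # z # x # v)"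
proof -
  from fam obtain c where c: "sorted_wrt (colour_less c C) (u @ y # x # z # v)"
    and N: "card {a \<in> set (u @ y # x # z # v). c a \<in> C} = N"
    unfolding inc_family_def by blast
  have set_eq: "set (u @ y # z # x # v) = set (u @ y # x # z # v)" by auto
  let ?R = "colour_less c C"
  have su: "sorted_wrt ?R u" and sv: "sorted_wrt ?R v"
    and uv: "\<And>a b. a \<in> set u \<Longrightarrow> b \<in> set v \<Longrightarrow> ?R a b"
    and um: "\<And>a. a \<in> set u \<Longrightarrow> ?R a x" "\<And>a. a \<in> set u \<Longrightarrow> ?R a y" "\<And>a. a \<in> set u \<Longrightarrow> ?R a z"
    and mv: "\<And>b. b \<in> set v \<Longrightarrow> ?R x b" "\<And>b. b \<in> set v \<Longrightarrow> ?R y b" "\<And>b. b \<in> set v \<Longrightarrow> ?R z b"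
    and m: "?R y x" "?R y z" "?R x z"
    using c unfolding sorted_wrt_split3 by blast+
  have fresh: "x \<notin> set u" "y \<notin> set u" "z \<notin> set u" "x \<notin> set v" "y \<notin> set v" "z \<notin> set v"
    "set u \<inter> set v = {}"
    using dist by auto
  have cy: "c y \<noteq> c x \<or> c x \<notin> C" using m(1) xy by (auto simp: colour_less_def)
  show ?thesis
  proof (cases "c x = c z \<and> c x \<in> C")
    case False
    then have "?R z x" by (auto simp: colour_less_def)
    then have "sorted_wrt ?R (u @ y # z # x # v)"
      unfolding sorted_wrt_split3 using su sv uv um mv m by blast
    then show ?thesis unfolding inc_family_def using N set_eq by (intro exI[of _ c]) simp
  next
    case True
    then have cz: "c z = c x" "c x \<in> C" "c y \<noteq> c x" using cy by auto
    show ?thesis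
    proof (cases "c y \<in> C")
      case True
      \<comment> \<open>Old classes: \<open>... x z P\<close> and \<open>... y Q\<close> with tails
        \<open>P\<close>, \<open>Q\<close> in \<open>v\<close>. New classes:
        \<open>... y z P\<close> and \<open>... x Q\<close>; the first increases because
        \<open>y < z\<close>, the second because \<open>x < y < Q\<close>. Hence \<open>z\<close>
        takes the colour of \<open>y\<close>, and the two colours are exchanged on \<open>v\<close>.
        Both lie in \<open>C\<close>, so the covered set is the same.\<close>
      define c' where "c' = (\<lambda>a. if a = z then c y else if a \<in> set v then
        (if c a = c x then c y else if c a = c y then c x else c a) else c a)"
      let ?R' = "colour_less c' C"
      have c'x: "c' x = c x" and c'y: "c' y = c y" and c'z: "c' z = c y"
        using xy yz fresh by (auto simp: c'_def)
      have c'u: "c' a = c a" if "a \<in> set u" for a using that fresh by (auto simp: c'_def)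
      have c'v: "c' a = (if c a = c x then c y else if c a = c y then c x else c a)" if "a \<in> set v" for a
        using that fresh by (auto simp: c'_def)
      have "sorted_wrt ?R' u"
        by (rule sorted_wrt_mono_rel[OF _ su]) (simp add: colour_less_def c'u)
      moreover have "sorted_wrt ?R' v"
        by (rule sorted_wrt_mono_rel[OF _ sv])
          (use cz True in \<open>simp add: colour_less_def c'v split: if_splits\<close>)
      moreover have "?R' a b" if a: "a \<in> set u" and b: "b \<in> set v" for a b
      proof -
        have "?R a b" "a < x" if "c a = c x" using uv[OF a b] um(1)[OF a] that cz by (auto simp: colour_less_def)
        moreover have "y < b" if "c b = c y" using mv(2)[OF b] that True by (auto simp: colour_less_def)
        moreover have "a < y" if "c a = c y" using um(2)[OF a] that True by (auto simp: colour_less_def)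
        moreover have "x < b" if "c b = c x" using mv(1)[OF b] that cz by (auto simp: colour_less_def)
        moreover have "z < b" if "c b = c x" using mv(3)[OF b] that cz by (auto simp: colour_less_def)
        ultimately show ?thesis using uv[OF a b] xy yz
          unfolding colour_less_def c'u[OF a] c'v[OF b] by (smt (verit))
      qed
      moreover have "?R' a x \<and> ?R' a y \<and> ?R' a z" if a: "a \<in> set u" for a
        using um[OF a] yz unfolding colour_less_def c'u[OF a] c'x c'y c'z by auto
      moreover have "?R' x b \<and> ?R' y b \<and> ?R' z b" if b: "b \<in> set v" for b
        using mv[OF b] xy yz cz True unfolding colour_less_def c'v[OF b] c'x c'y c'z by (smt (verit))
      moreover have "?R' y z" "?R' y x" "?R' z x"
        using yz cz unfolding colour_less_def c'x c'y c'z by auto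
      ultimately have "sorted_wrt ?R' (u @ y # z # x # v)"
        unfolding sorted_wrt_split3 by blast
      moreover have "c' a \<in> C \<longleftrightarrow> c a \<in> C" for a
        using True cz by (auto simp: c'_def)
      ultimately show ?thesis unfolding inc_family_def using N set_eq by (intro exI[of _ c']) simp
    next
      case cyC: False
      \<comment> \<open>Here \<open>y\<close> is uncovered and can take the place of
        \<open>x\<close> in front of \<open>z\<close>: the class \<open>... x z P\<close> becomes
        \<open>... y z P\<close>, and what precedes \<open>x\<close> is below \<open>x < y\<close>.
        The covered set loses \<open>x\<close> and gains \<open>y\<close>, so its size is
        kept.\<close>
      define d where "d = c(x := c y, y := c x)"
      let ?R' = "colour_less d C"
      have dx: "d x = c y" and dy: "d y = c x" and dz: "d z = c x" using xy yz cz by (auto simp: d_def)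
      have du: "d a = c a" if "a \<in> set u" for a using that fresh by (auto simp: d_def)
      have dv: "d a = c a" if "a \<in> set v" for a using that fresh by (auto simp: d_def)
      have "sorted_wrt ?R' u"
        by (rule sorted_wrt_mono_rel[OF _ su]) (simp add: colour_less_def du)
      moreover have "sorted_wrt ?R' v"
        by (rule sorted_wrt_mono_rel[OF _ sv]) (simp add: colour_less_def dv)
      moreover have "?R' a b" if "a \<in> set u" "b \<in> set v" for a b
        using uv that by (simp add: colour_less_def du dv)
      moreover have "?R' a x \<and> ?R' a y \<and> ?R' a z" if a: "a \<in> set u" for a
        using um[OF a] xy cyC unfolding colour_less_def du[OF a] dx dy dz using cz by auto
      moreover have "?R' x b \<and> ?R' y b \<and> ?R' z b" if b: "b \<in> set v" for b
        using mv[OF b] yz cz cyC unfolding colour_less_def dv[OF b] dx dy dz by auto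
      moreover have "?R' y z" "?R' y x" "?R' z x"
        using yz cz cyC unfolding colour_less_def dx dy dz by auto
      ultimately have "sorted_wrt ?R' (u @ y # z # x # v)"
        unfolding sorted_wrt_split3 by blast
      moreover define S where "S = {a \<in> set (u @ y # x # z # v). c a \<in> C}"
      have "{a \<in> set (u @ y # z # x # v). d a \<in> C} = insert y (S - {x})"
        using cz cyC xy by (auto simp: d_def S_def)
      moreover have "card (insert y (S - {x})) = card S"
        using cz cyC card_Suc_Diff1[of S x] by (simp add: S_def)
      ultimately have "sorted_wrt ?R' (u @ y # z # x # v)"
        "card {a \<in> set (u @ y # z # x # v). d a \<in> C} = N"
        using N unfolding S_def by simp_all
      then show ?thesis unfolding inc_family_def by blast
    qed
  qed
qed

lemma inc_family_move_right:
  assumes "\<forall>a\<in>set A. a < y" "inc_family C N (u @ y # A @ v)"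
  shows "inc_family C N (u @ A @ y # v)"
  using assms
proof (induction A arbitrary: u)
  case (Cons a A)
  have "inc_family C N (u @ a # y # A @ v)"
    by (rule inc_family_swap) (use Cons.prems in auto)
  then show ?case using Cons.IH[of "u @ [a]"] Cons.prems(1) by simp
qed simp

lemma inc_family_move_left:
  assumes "\<forall>b\<in>set B. x < b" "inc_family C N (u @ B @ x # v)"
  shows "inc_family C N (u @ x # B @ v)"
  using assms
proof (induction B arbitrary: u)
  case (Cons b B)
  have "inc_family C N ((u @ [b]) @ x # B @ v)"
    by (rule Cons.IH) (use Cons.prems in auto)
  then show ?case using Cons.prems(1) inc_family_swap[of x b C N u "B @ v"] by simp
qed simp

text \<open>Iterated Knuth moves \<open>y x b\<close> to \<open>y b x\<close>. After each move
  \<open>b\<close> is the pivot for the next one, which is why \<open>y # B\<close> has to be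
  increasing.\<close>

lemma inc_family_knuth_right:
  assumes "x < y" "sorted_wrt (<) (y # B)" "distinct (u @ y # x # B @ v)"
    "inc_family C N (u @ y # x # B @ v)"
  shows "inc_family C N (u @ y # B @ x # v)"
  using assms
proof (induction B arbitrary: u y)
  case (Cons b B)
  have *: "inc_family C N (u @ y # b # x # B @ v)"
    by (rule inc_family_knuth) (use Cons.prems in auto)
  have "inc_family C N ((u @ [y]) @ b # B @ x # v)"
    by (rule Cons.IH) (use * Cons.prems in auto)
  then show ?case by simp
qed simp

text \<open>The form needed for reversed words. The letter \<open>y\<close> moves left through
  \<open>Z\<close> from its right end; each move exchanges it with the letter \<open>a\<close>
  before it, and the pivot is the letter before \<open>a\<close>.\<close>

lemma inc_family_knuth_left:
  assumes "x < y" "sorted_wrt (>) (x # Z)" "distinct (u @ x # Z @ y # v)"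
    "inc_family C N (u @ x # Z @ y # v)"
  shows "inc_family C N (u @ x # y # Z @ v)"
  using assms
proof (induction Z arbitrary: u x)
  case (Cons a Z)
  have "inc_family C N ((u @ [x]) @ a # y # Z @ v)"
    by (rule Cons.IH) (use Cons.prems in auto)
  then have *: "inc_family C N (u @ x # a # y # Z @ v)" by simp
  have "inc_family C N (u @ x # y # a # Z @ v)"
    by (rule inc_family_knuth) (use * Cons.prems in auto)
  then show ?case by simp
qed simp

section \<open>Row insertion as a sequence of moves\<close>

lemma row_insert_cases:
  assumes "sorted_wrt (<) xs" "x \<notin> set xs"
  obtains "row_insert x xs = (xs @ [x], None)" "\<forall>a\<in>set xs. a < x"
  | A y B where "xs = A @ y # B" "\<forall>a\<in>set A. a < x" "x < y" "row_insert x xs = (A @ x # B, Some y)"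
proof -
  have "(row_insert x xs = (xs @ [x], None) \<and> (\<forall>a\<in>set xs. a < x)) \<or>
    (\<exists>A y B. xs = A @ y # B \<and> (\<forall>a\<in>set A. a < x) \<and> x < y \<and> row_insert x xs = (A @ x # B, Some y))"
    using assms
  proof (induction xs)
    case (Cons a xs)
    show ?case
    proof (cases "x < a")
      case True
      then show ?thesis by (intro disjI2 exI[of _ "[]"]) auto
    next
      case False
      then have ax: "a < x" using Cons.prems by auto
      from Cons have "(row_insert x xs = (xs @ [x], None) \<and> (\<forall>a\<in>set xs. a < x)) \<or>
        (\<exists>A y B. xs = A @ y # B \<and> (\<forall>a\<in>set A. a < x) \<and> x < y \<and> row_insert x xs = (A @ x # B, Some y))"
        by auto
      then show ?thesis
      proof (elim disjE exE conjE)
        fix A y B assume "xs = A @ y # B" "\<forall>a\<in>set A. a < x" "x < y"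
          "row_insert x xs = (A @ x # B, Some y)"
        then show ?thesis using ax False by (intro disjI2 exI[of _ "a # A"]) auto
      qed (use ax False in auto)
    qed
  qed simp
  then show ?thesis using that by blast
qed

abbreviation reading_word :: "int list list \<Rightarrow> int list" where
  "reading_word T \<equiv> concat (rev T)"

lemma set_tableau_insert:
  assumes "\<forall>r\<in>set T. sorted_wrt (<) r" "x \<notin> set (concat T)" "distinct (concat T)"
  shows "set (concat (tableau_insert x T)) = insert x (set (concat T)) \<and>
    distinct (concat (tableau_insert x T))"
  using assms
proof (induction T arbitrary: x)
  case (Cons r T)
  have r: "sorted_wrt (<) r" "x \<notin> set r" using Cons.prems by auto
  show ?case
  proof (cases rule: row_insert_cases[OF r])
    case (2 A y B)
    have "y \<notin> set (concat T)" using Cons.prems 2 by auto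
    then have "set (concat (tableau_insert y T)) = insert y (set (concat T)) \<and>
      distinct (concat (tableau_insert y T))"
      using Cons by auto
    then show ?thesis using 2 Cons.prems by auto
  qed (use Cons.prems in auto)
qed simp

text \<open>The reading word lists the rows from the bottom up, so undoing the bump of
  \<open>y\<close> by \<open>x\<close> in the row \<open>A y B\<close> has to turn
  \<open>y A x B\<close> into \<open>A y B x\<close>. First \<open>y\<close> passes the smaller
  letters \<open>A\<close>, then \<open>x\<close> passes \<open>B\<close> by Knuth moves with pivot
  \<open>y\<close>. By induction the insertion of \<open>y\<close> into the lower rows has been
  undone before.\<close>

lemma inc_family_uninsert:
  assumes "\<forall>r\<in>set T. sorted_wrt (<) r" "distinct (u @ reading_word T @ x # v)"
    "inc_family C N (u @ reading_word (tableau_insert x T) @ v)"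
  shows "inc_family C N (u @ reading_word T @ x # v)"
  using assms
proof (induction T arbitrary: x v)
  case (Cons r T)
  have r: "sorted_wrt (<) r" "x \<notin> set r" using Cons.prems by auto
  show ?case
  proof (cases rule: row_insert_cases[OF r])
    case (2 A y B)
    have d: "distinct (u @ reading_word T @ y # (A @ x # B) @ v)"
      using Cons.prems(2) 2(1) by auto
    have "inc_family C N (u @ reading_word T @ y # (A @ x # B) @ v)"
      by (rule Cons.IH) (use Cons.prems d 2 in simp_all)
    moreover have "\<forall>a\<in>set A. a < y" using 2 by auto
    ultimately have *: "inc_family C N ((u @ reading_word T) @ A @ y # x # B @ v)"
      using inc_family_move_right[of A y C N "u @ reading_word T" "x # B @ v"] by simp
    have "inc_family C N ((u @ reading_word T @ A) @ y # B @ x # v)"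
    proof (rule inc_family_knuth_right)
      show "sorted_wrt (<) (y # B)" using r 2(1) by (simp add: sorted_wrt_append)
    qed (use * d 2 in auto)
    then show ?thesis using 2 by simp
  qed (use Cons.prems in simp)
qed simp

text \<open>Decreasing subsequences are increasing ones of the reversed word. There the bump is
  undone by turning \<open>rev B, x, rev A, y\<close> into \<open>x, rev B, y, rev A\<close>: now
  \<open>y\<close> passes \<open>rev A\<close> by Knuth moves with pivot \<open>x\<close>, and
  afterwards the descents between \<open>rev B\<close> and \<open>x\<close> are removed.\<close>

lemma dec_family_uninsert:
  assumes "\<forall>r\<in>set T. sorted_wrt (<) r" "distinct (u @ reading_word T @ x # v)"
    "inc_family C N (rev (u @ reading_word (tableau_insert x T) @ v))"
  shows "inc_family C N (rev (u @ reading_word T @ x # v))"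
  using assms
proof (induction T arbitrary: x v)
  case (Cons r T)
  have r: "sorted_wrt (<) r" "x \<notin> set r" using Cons.prems by auto
  show ?case
  proof (cases rule: row_insert_cases[OF r])
    case (2 A y B)
    have d: "distinct (u @ reading_word T @ y # (A @ x # B) @ v)"
      using Cons.prems(2) 2(1) by auto
    have "inc_family C N (rev (u @ reading_word T @ y # (A @ x # B) @ v))"
      by (rule Cons.IH) (use Cons.prems d 2 in simp_all)
    then have *: "inc_family C N ((rev v @ rev B) @ x # rev A @ y # rev (u @ reading_word T))"
      by simp
    have "inc_family C N ((rev v @ rev B) @ x # y # rev A @ rev (u @ reading_word T))"
    proof (rule inc_family_knuth_left)
      show "sorted_wrt (>) (x # rev A)"
        using r 2 by (simp add: sorted_wrt_append sorted_wrt_rev)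
    qed (use * d 2 in auto)
    then have *: "inc_family C N (rev v @ rev B @ x # y # rev A @ rev (u @ reading_word T))"
      by simp
    have "inc_family C N (rev v @ x # rev B @ y # rev A @ rev (u @ reading_word T))"
    proof (rule inc_family_move_left[OF _ *])
      show "\<forall>b\<in>set (rev B). x < b" using r 2 by (force simp: sorted_wrt_append)
    qed
    then show ?thesis using 2 by simp
  qed (use Cons.prems in simp)
qed simp

section \<open>Young tableaux and the bumping route\<close>

definition row_dominates :: "int list \<Rightarrow> int list \<Rightarrow> bool" where
  "row_dominates r r' \<longleftrightarrow> length r' \<le> length r \<and> (\<forall>i<length r'. r ! i < r' ! i)"

lemma row_dominates_trans: "row_dominates a b \<Longrightarrow> row_dominates b c \<Longrightarrow> row_dominates a c"
  unfolding row_dominates_def by (meson less_le_trans order_less_trans order_trans)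

definition young_tableau :: "int list list \<Rightarrow> bool" where
  "young_tableau T \<longleftrightarrow> (\<forall>r\<in>set T. sorted_wrt (<) r) \<and> sorted_wrt row_dominates T"

lemma tableau_insert_nonempty: "tableau_insert x T \<noteq> []"
  by (cases T) (auto split: prod.splits option.splits)

text \<open>The bumped entry lands in the next row no further right than the column it left, and the
  entries of the row it left do not grow, so columns stay strictly increasing. Transitivity of
  \<open>row_dominates\<close> reduces the check to the first of the lower rows.\<close>

lemma young_tableau_insert:
  assumes "young_tableau T" "x \<notin> set (concat T)" "distinct (concat T)"
  shows "young_tableau (tableau_insert x T)"
  using assms
proof (induction T arbitrary: x)
  case Nil
  then show ?case by (simp add: young_tableau_def)
next
  case (Cons r T)
  have r: "sorted_wrt (<) r" and T: "young_tableau T" and rT: "\<forall>r'\<in>set T. row_dominates r r'"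
    using Cons.prems by (auto simp: young_tableau_def)
  have xr: "x \<notin> set r" using Cons.prems by simp
  show ?case
  proof (cases rule: row_insert_cases[OF r xr])
    case 1
    have "row_dominates (r @ [x]) r'" if "r' \<in> set T" for r'
      using rT that unfolding row_dominates_def by (auto simp: nth_append)
    then show ?thesis using 1 r T by (auto simp: young_tableau_def sorted_wrt_append)
  next
    case (2 A y B)
    let ?r = "A @ x # B"
    have yT: "y \<notin> set (concat T)" using Cons.prems 2 by auto
    have IH: "young_tableau (tableau_insert y T)"
      using Cons.IH[OF T yT] Cons.prems by auto
    have sr: "sorted_wrt (<) ?r" using r 2 by (auto simp: sorted_wrt_append)
    have le: "?r ! i \<le> r ! i" if "i < length r" for i
      using that 2 by (auto simp: nth_append nth_Cons split: nat.split)
    have small: "?r ! i < y" if "i \<le> length A" for i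
    proof (cases "i = length A")
      case False
      then have "A ! i \<in> set A" using that by simp
      then have "A ! i < y" using 2(2,3) by fastforce
      then show ?thesis using False that by (simp add: nth_append)
    qed (use 2 in simp)
    have rAy: "r ! length A = y" using 2 by simp
    have dom: "row_dominates ?r (hd (tableau_insert y T))"
    proof (cases T)
      case Nil
      then show ?thesis using small[of 0] by (auto simp: row_dominates_def)
    next
      case (Cons r1 T1)
      have d1: "row_dominates r r1" and s1: "sorted_wrt (<) r1" "y \<notin> set r1"
        using rT T yT Cons by (auto simp: young_tableau_def)
      show ?thesis
      proof (cases rule: row_insert_cases[OF s1])
        case ap: 1
        \<comment> \<open>Otherwise \<open>r1\<close> would have an entry directly below the old
          place of \<open>y\<close>, hence larger than \<open>y\<close>, although \<open>y\<close>
          was appended to \<open>r1\<close> because all its entries are smaller.\<close>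
        have "length r1 \<le> length A"
        proof (rule ccontr)
          assume "\<not> ?thesis"
          then have "r ! length A < r1 ! length A" "r1 ! length A \<in> set r1"
            using d1 by (auto simp: row_dominates_def)
          then show False using ap rAy by auto
        qed
        then show ?thesis using ap Cons small d1 le 2(1)
          by (fastforce simp: row_dominates_def nth_append less_Suc_eq)
      next
        case ins: (2 A1 y1 B1)
        have "length A1 \<le> length A"
        proof (rule ccontr)
          assume "\<not> ?thesis"
          then have "r1 ! length A \<in> set A1" "length A < length r1"
            using ins(1) by (auto simp: nth_append)
          moreover have "r ! length A < r1 ! length A"
            using d1 \<open>length A < length r1\<close> by (auto simp: row_dominates_def)
          ultimately have "r ! length A < r1 ! length A" "r1 ! length A \<in> set A1" by auto
          then show False using ins rAy by auto
        qed
        then have "?r ! i < (A1 @ y # B1) ! i" if "i < length r1" for i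
        proof (cases "i = length A1")
          case False
          then have "(A1 @ y # B1) ! i = r1 ! i"
            using ins(1) by (auto simp: nth_append nth_Cons split: nat.split)
          moreover have "i < length r" "r ! i < r1 ! i" using d1 that by (auto simp: row_dominates_def)
          ultimately show ?thesis using le[of i] by linarith
        qed (use small in auto)
        then show ?thesis using ins Cons d1 2(1) by (auto simp: row_dominates_def)
      qed
    qed
    obtain h t where ht: "tableau_insert y T = h # t"
      using tableau_insert_nonempty by (meson neq_Nil_conv)
    have "\<forall>r'\<in>set (h # t). row_dominates ?r r'"
      using dom IH ht by (auto simp: young_tableau_def intro: row_dominates_trans)
    then show ?thesis using 2 sr IH ht by (auto simp: young_tableau_def)
  qed
qed

lemma fold_tableau_insert:
  assumes "young_tableau T" "distinct (reading_word T @ ws)"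
  shows "young_tableau (fold tableau_insert ws T) \<and> distinct (concat (fold tableau_insert ws T)) \<and>
    set (concat (fold tableau_insert ws T)) = set (concat T) \<union> set ws \<and>
    (inc_family C N (reading_word (fold tableau_insert ws T)) \<longrightarrow>
      inc_family C N (reading_word T @ ws)) \<and>
    (inc_family C N (rev (reading_word (fold tableau_insert ws T))) \<longrightarrow>
      inc_family C N (rev (reading_word T @ ws)))"
  using assms
proof (induction ws arbitrary: T)
  case Nil
  then show ?case by simp
next
  case (Cons x ws)
  have d: "distinct (concat T)" "x \<notin> set (concat T)" "set ws \<inter> set (concat T) = {}" "distinct ws" "x \<notin> set ws"
    using Cons.prems(2) by auto
  have rows: "\<forall>r\<in>set T. sorted_wrt (<) r" using Cons.prems by (auto simp: young_tableau_def)
  note ins = set_tableau_insert[OF rows d(2,1)]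
  have y: "young_tableau (tableau_insert x T)"
    using Cons.prems(1) d(2,1) by (rule young_tableau_insert)
  have dd: "distinct (reading_word (tableau_insert x T) @ ws)"
    using ins d by auto
  have dist: "distinct ([] @ reading_word T @ x # ws)" using Cons.prems by simp
  from Cons.IH[OF y dd] ins inc_family_uninsert[OF rows dist, of C N]
    dec_family_uninsert[OF rows dist, of C N] show ?case by (auto simp del: concat.simps)
qed

section \<open>Families read off from a tableau\<close>

lemma exists_colouring:
  assumes "distinct (concat T)"
  shows "\<exists>c. \<forall>i<length T. \<forall>j<length (T ! i). c (T ! i ! j) = (f i j :: nat)"
  using assms
proof (induction T arbitrary: f)
  case (Cons r T)
  from Cons.IH[of "\<lambda>i. f (Suc i)"] Cons.prems obtain c
    where c: "\<forall>i<length T. \<forall>j<length (T ! i). c (T ! i ! j) = f (Suc i) j" by auto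
  define c' where "c' = (\<lambda>v. if v \<in> set r then f 0 (THE j. j < length r \<and> r ! j = v) else c v)"
  have r: "distinct r" "set r \<inter> set (concat T) = {}" using Cons.prems by auto
  have "c' (r ! j) = f 0 j" if "j < length r" for j
  proof -
    have "(THE k. k < length r \<and> r ! k = r ! j) = j"
      using r(1) that by (intro the_equality) (auto simp: nth_eq_iff_index_eq)
    then show ?thesis using that by (simp add: c'_def)
  qed
  moreover have "c' (T ! i ! j) = f (Suc i) j" if "i < length T" "j < length (T ! i)" for i j
  proof -
    have "T ! i ! j \<in> set (concat T)" using nth_mem[OF that(1)] nth_mem[OF that(2)] by auto
    then have "T ! i ! j \<notin> set r" using r by blast
    then show ?thesis using c that by (simp add: c'_def)
  qed
  ultimately show ?case by (intro exI[of _ c']) (auto simp: less_Suc_eq_0_disj)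
qed simp

lemma card_tableau_colouring:
  assumes "distinct (concat T)" "\<forall>i<length T. \<forall>j<length (T ! i). (c (T ! i ! j) \<in> C) = P i j"
  shows "card {v \<in> set (concat T). c v \<in> C} = (\<Sum>i<length T. card {j. j < length (T ! i) \<and> P i j})"
  using assms
proof (induction T arbitrary: P)
  case (Cons r T)
  have "{v \<in> set (concat (r # T)). c v \<in> C} =
      {v \<in> set r. c v \<in> C} \<union> {v \<in> set (concat T). c v \<in> C}" by auto
  moreover have "{v \<in> set r. c v \<in> C} \<inter> {v \<in> set (concat T). c v \<in> C} = {}"
    using Cons.prems(1) by auto
  ultimately have "card {v \<in> set (concat (r # T)). c v \<in> C} =
      card {v \<in> set r. c v \<in> C} + card {v \<in> set (concat T). c v \<in> C}"
    by (simp add: card_Un_disjoint)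
  moreover have "{v \<in> set r. c v \<in> C} = (!) r ` {j. j < length r \<and> P 0 j}"
    using Cons.prems(2) by (force simp: in_set_conv_nth)
  moreover have "inj_on ((!) r) {j. j < length r \<and> P 0 j}"
    using Cons.prems(1) by (auto simp: inj_on_def nth_eq_iff_index_eq)
  moreover have "\<forall>i<length T. \<forall>j<length (T ! i). (c (T ! i ! j) \<in> C) = P (Suc i) j"
    using Cons.prems(2) by auto
  then have "card {v \<in> set (concat T). c v \<in> C} = (\<Sum>i<length T. card {j. j < length (T ! i) \<and> P (Suc i) j})"
    using Cons.IH[of "\<lambda>i. P (Suc i)"] Cons.prems(1) by auto
  ultimately show ?case by (simp add: card_image sum.lessThan_Suc_shift del: sum.lessThan_Suc)
qed simp

lemma sorted_wrt_reading_word: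
  assumes "\<forall>r\<in>set T. sorted_wrt R r"
    "\<And>i i' a b. i < i' \<Longrightarrow> i' < length T \<Longrightarrow> a \<in> set (T ! i') \<Longrightarrow> b \<in> set (T ! i) \<Longrightarrow> R a b"
  shows "sorted_wrt R (reading_word T)"
  using assms
proof (induction T)
  case (Cons r T)
  have "sorted_wrt R (reading_word T)"
    by (rule Cons.IH) (use Cons.prems(1) Cons.prems(2)[of "Suc _" "Suc _"] in auto)
  moreover have "R a b" if a: "a \<in> set (concat T)" and b: "b \<in> set r" for a b
  proof -
    obtain r' where "r' \<in> set T" "a \<in> set r'" using a by auto
    then obtain i where "i < length T" "a \<in> set (T ! i)" by (metis in_set_conv_nth)
    then show ?thesis using Cons.prems(2)[of 0 "Suc i" a b] b by simp
  qed
  ultimately show ?case using Cons.prems(1) by (auto simp: sorted_wrt_append)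
qed simp

text \<open>Colour by row and keep the rows of length at least \<open>m\<close>. Such a row covers
  \<open>m + (l - m)\<close> letters, while shorter rows add nothing to the sum of truncated
  differences, so the count is exact. The summand with \<open>card\<close> is set apart because a
  chain loses its last \<open>m\<close> elements when paths of length \<open>m\<close> are counted
  later.\<close>

lemma inc_family_tableau:
  assumes "young_tableau T" "distinct (concat T)"
  shows "inc_family {i. i < length T \<and> m \<le> length (T ! i)}
    (m * card {i. i < length T \<and> m \<le> length (T ! i)} + (\<Sum>l\<leftarrow>shape T. l - m)) (reading_word T)"
proof -
  let ?C = "{i. i < length T \<and> m \<le> length (T ! i)}"
  from exists_colouring[OF assms(2), of "\<lambda>i j. i"] obtain c
    where c: "\<forall>i<length T. \<forall>j<length (T ! i). c (T ! i ! j) = i" by auto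
  have c': "c a = i" if "i < length T" "a \<in> set (T ! i)" for a i
    using c that by (auto simp: in_set_conv_nth)
  have "sorted_wrt (colour_less c ?C) (reading_word T)"
  proof (rule sorted_wrt_reading_word)
    show "\<forall>r\<in>set T. sorted_wrt (colour_less c ?C) r"
      using assms(1) by (auto simp: young_tableau_def colour_less_def elim!: sorted_wrt_mono_rel[rotated])
    show "colour_less c ?C a b" if "i < i'" "i' < length T" "a \<in> set (T ! i')" "b \<in> set (T ! i)" for i i' a b
      using c'[of i a] c'[of i' a] c'[of i b] that by (simp add: colour_less_def)
  qed
  moreover have "card {v \<in> set (concat T). c v \<in> ?C} =
      (\<Sum>i<length T. card {j. j < length (T ! i) \<and> m \<le> length (T ! i)})"
    by (rule card_tableau_colouring[OF assms(2)]) (use c in auto)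
  moreover have "card {j. j < length (T ! i) \<and> m \<le> length (T ! i)} =
      (if m \<le> length (T ! i) then m else 0) + (length (T ! i) - m)" for i
    by auto
  moreover have "(\<Sum>i<length T. if m \<le> length (T ! i) then m else 0) = m * card ?C"
    by (simp add: sum.If_cases Int_def)
  moreover have "(\<Sum>l\<leftarrow>shape T. l - m) = (\<Sum>i<length T. length (T ! i) - m)"
    by (simp add: shape_def comp_def sum_list_sum_nth atLeast0LessThan)
  ultimately show ?thesis unfolding inc_family_def
    by (intro exI[of _ c]) (simp add: sum.distrib)
qed

text \<open>Colour by column. Lower rows are read first and columns increase downwards, so a column
  is a decreasing subsequence of the reading word; two entries of one row never share a
  colour.\<close>

lemma dec_family_tableau:
  assumes "young_tableau T" "distinct (concat T)"
  shows "inc_family {..<m} (boxes_upto (shape T) m) (rev (reading_word T))"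
proof -
  from exists_colouring[OF assms(2), of "\<lambda>i j. j"] obtain c
    where c: "\<forall>i<length T. \<forall>j<length (T ! i). c (T ! i ! j) = j" by auto
  have "sorted_wrt (\<lambda>a b. colour_less c {..<m} b a) (reading_word T)"
  proof (rule sorted_wrt_reading_word)
    have "colour_less c {..<m} (r ! j) (r ! i)" if r: "r \<in> set T" and ij: "i < j" "j < length r" for r i j
    proof -
      obtain k where "k < length T" "r = T ! k" using r by (metis in_set_conv_nth)
      then have "c (r ! i) = i" "c (r ! j) = j" using c ij by auto
      then show ?thesis using ij by (simp add: colour_less_def)
    qed
    then show "\<forall>r\<in>set T. sorted_wrt (\<lambda>a b. colour_less c {..<m} b a) r"
      by (auto simp: sorted_wrt_iff_nth_less)
    show "colour_less c {..<m} b a" if i: "i < i'" "i' < length T" "a \<in> set (T ! i')" "b \<in> set (T ! i)" for i i' a b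
    proof -
      obtain k l where kl: "k < length (T ! i')" "a = T ! i' ! k" "l < length (T ! i)" "b = T ! i ! l"
        using i by (auto simp: in_set_conv_nth)
      have "row_dominates (T ! i) (T ! i')"
        using assms(1) i by (auto simp: young_tableau_def sorted_wrt_iff_nth_less)
      moreover have "c a = k" "c b = l" using c kl i by auto
      ultimately show ?thesis using kl by (auto simp: colour_less_def row_dominates_def)
    qed
  qed
  moreover have "card {v \<in> set (concat T). c v \<in> {..<m}} =
      (\<Sum>i<length T. card {j. j < length (T ! i) \<and> j < m})"
    by (rule card_tableau_colouring[OF assms(2)]) (use c in auto)
  moreover have "{j. j < length (T ! i) \<and> j < m} = {..<min (length (T ! i)) m}" for i
    by auto
  moreover have "boxes_upto (shape T) m = (\<Sum>i<length T. min (length (T ! i)) m)"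
    by (simp add: boxes_upto_def shape_def comp_def sum_list_sum_nth atLeast0LessThan)
  ultimately show ?thesis unfolding inc_family_def
    by (intro exI[of _ c]) (simp add: sorted_wrt_rev)
qed

lemma sorted_wrt_sorted_list:
  fixes xs :: "int list"
  assumes "sorted_wrt P xs" "sorted_wrt (<) xs" "a \<in> set xs" "b \<in> set xs" "a < b"
  shows "P a b"
proof -
  obtain i j where ij: "i < length xs" "a = xs ! i" "j < length xs" "b = xs ! j"
    using assms(3,4) by (auto simp: in_set_conv_nth)
  have "i < j"
    using ij assms(2,5) by (metis linorder_cases order_less_asym order_less_irrefl sorted_wrt_nth_less)
  then show ?thesis using ij assms(1) by (simp add: sorted_wrt_nth_less)
qed

section \<open>Greene families of a bijection between sets of integers\<close>

context
  fixes S :: "int set" and w :: "int \<Rightarrow> int"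
  assumes fin: "finite S" and inj: "inj_on w S"
begin

private lemma RS1_props:
  "young_tableau (RS1 S w)" "distinct (concat (RS1 S w))" "set (concat (RS1 S w)) = w ` S"
  "inc_family C N (reading_word (RS1 S w)) \<Longrightarrow> inc_family C N (map w (sorted_list_of_set S))"
  "inc_family C N (rev (reading_word (RS1 S w))) \<Longrightarrow> inc_family C N (rev (map w (sorted_list_of_set S)))"
proof -
  have "distinct (reading_word [] @ map w (sorted_list_of_set S))"
    using fin inj by (simp add: distinct_map)
  from fold_tableau_insert[OF _ this, of C N] fin
  show "young_tableau (RS1 S w)" "distinct (concat (RS1 S w))" "set (concat (RS1 S w)) = w ` S"
    "inc_family C N (reading_word (RS1 S w)) \<Longrightarrow> inc_family C N (map w (sorted_list_of_set S))"
    "inc_family C N (rev (reading_word (RS1 S w))) \<Longrightarrow> inc_family C N (rev (map w (sorted_list_of_set S)))"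
    unfolding RS1_def by (simp_all add: young_tableau_def)
qed

lemma sum_list_shape_RS1: "sum_list (shape (RS1 S w)) = card S"
proof -
  have "sum_list (shape (RS1 S w)) = length (concat (RS1 S w))"
    by (simp add: shape_def length_concat)
  also have "\<dots> = card (w ` S)" using RS1_props(2,3) distinct_card by fastforce
  finally show ?thesis using inj by (simp add: card_image)
qed

private lemma card_colour: "card {v \<in> w ` S. P v} = card {s \<in> S. P (w s)}"
proof -
  have "{v \<in> w ` S. P v} = w ` {s \<in> S. P (w s)}" by auto
  moreover have "inj_on w {s \<in> S. P (w s)}" using inj by (rule inj_on_subset) auto
  ultimately show ?thesis by (simp add: card_image)
qed

text \<open>The colouring of values obtained from the reading word is pulled back along
  \<open>w\<close> to the positions in \<open>S\<close>.\<close>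

theorem greene_increasing:
  "\<exists>(c :: int \<Rightarrow> nat) C. finite C \<and>
    (\<forall>s\<in>S. \<forall>s'\<in>S. s < s' \<longrightarrow> c s = c s' \<longrightarrow> c s \<in> C \<longrightarrow> w s < w s') \<and>
    card {s \<in> S. c s \<in> C} = m * card C + (\<Sum>l\<leftarrow>shape (RS1 S w). l - m)"
proof -
  let ?C = "{i. i < length (RS1 S w) \<and> m \<le> length (RS1 S w ! i)}"
  from RS1_props(4)[OF inc_family_tableau[OF RS1_props(1,2)]] obtain c
    where c: "sorted_wrt (colour_less c ?C) (map w (sorted_list_of_set S))"
      "card {v \<in> set (map w (sorted_list_of_set S)). c v \<in> ?C} =
        m * card ?C + (\<Sum>l\<leftarrow>shape (RS1 S w). l - m)"
    unfolding inc_family_def by blast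
  have "colour_less c ?C (w s) (w s')" if "s \<in> S" "s' \<in> S" "s < s'" for s s'
    by (rule sorted_wrt_sorted_list[of "\<lambda>a b. colour_less c ?C (w a) (w b)" "sorted_list_of_set S"])
      (use c(1) that fin in \<open>auto simp: sorted_wrt_map\<close>)
  then show ?thesis using c(2) fin
    by (intro exI[of _ "c \<circ> w"] exI[of _ ?C]) (auto simp: colour_less_def card_colour simp del: mem_Collect_eq)
qed

theorem greene_decreasing:
  "\<exists>c :: int \<Rightarrow> nat. (\<forall>s\<in>S. \<forall>s'\<in>S. s < s' \<longrightarrow> c s = c s' \<longrightarrow> c s < m \<longrightarrow> w s' < w s) \<and>
    card {s \<in> S. c s < m} = boxes_upto (shape (RS1 S w)) m"
proof -
  from RS1_props(5)[OF dec_family_tableau[OF RS1_props(1,2)]] obtain c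
    where c: "sorted_wrt (colour_less c {..<m}) (rev (map w (sorted_list_of_set S)))"
      "card {v \<in> set (rev (map w (sorted_list_of_set S))). c v \<in> {..<m}} = boxes_upto (shape (RS1 S w)) m"
    unfolding inc_family_def by blast
  have "colour_less c {..<m} (w s') (w s)" if "s \<in> S" "s' \<in> S" "s < s'" for s s'
    by (rule sorted_wrt_sorted_list[of "\<lambda>a b. colour_less c {..<m} (w b) (w a)" "sorted_list_of_set S"])
      (use c(1) that fin in \<open>auto simp: sorted_wrt_map sorted_wrt_rev\<close>)
  then show ?thesis using c(2) fin
    by (intro exI[of _ "c \<circ> w"]) (auto simp: colour_less_def card_colour)
qed

end

section \<open>Rank bounds\<close>

lemma scalar_prod_sum: "v \<in> carrier_vec n \<Longrightarrow> u \<bullet> v = (\<Sum>l<n. u $ l * v $ l)"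
  by (simp add: scalar_prod_def lessThan_atLeast0)

lemma mult_mat_vec_sum:
  "A \<in> carrier_mat n m \<Longrightarrow> v \<in> carrier_vec m \<Longrightarrow> i < n \<Longrightarrow> (A *\<^sub>v v) $ i = (\<Sum>l<m. A $$ (i, l) * v $ l)"
  by (auto simp: scalar_prod_def lessThan_atLeast0 intro!: sum.cong)

lemma mult_mat_sum:
  "A \<in> carrier_mat n m \<Longrightarrow> B \<in> carrier_mat m k \<Longrightarrow> i < n \<Longrightarrow> j < k \<Longrightarrow>
    (A * B) $$ (i, j) = (\<Sum>l<m. A $$ (i, l) * B $$ (l, j))"
  by (auto simp: scalar_prod_def lessThan_atLeast0 intro!: sum.cong)

text \<open>Rank bounds are stated through certificates: a factorisation through dimension
  \<open>c\<close> here, a compression to an identity matrix in \<open>rank_ge\<close>. These are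
  the forms in which the bounds arise, as sums of rank-one matrices and as dual systems of vectors,
  and the second one is visibly an open condition.\<close>

definition rank_le :: "complex mat \<Rightarrow> nat \<Rightarrow> bool" where
  "rank_le A c \<longleftrightarrow> (\<exists>B C. B \<in> carrier_mat (dim_row A) c \<and> C \<in> carrier_mat c (dim_col A) \<and> A = B * C)"

definition rank_ge :: "complex mat \<Rightarrow> nat \<Rightarrow> bool" where
  "rank_ge A r \<longleftrightarrow> (\<exists>P Q. P \<in> carrier_mat r (dim_row A) \<and> Q \<in> carrier_mat (dim_col A) r \<and> P * A * Q = 1\<^sub>m r)"

text \<open>If \<open>c < r\<close>, padding \<open>U\<close> with zero columns and \<open>V\<close>
  with zero rows gives square matrices whose product is 1 in one order and hence in the other. But
  row \<open>c\<close> of the padded \<open>V\<close> is zero.\<close>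

lemma mult_eq_one_imp_le:
  fixes U V :: "complex mat"
  assumes U: "U \<in> carrier_mat r c" and V: "V \<in> carrier_mat c r" and UV: "U * V = 1\<^sub>m r"
  shows "r \<le> c"
proof (rule ccontr)
  assume "\<not> r \<le> c"
  then have cr: "c < r" by simp
  define U' where "U' = mat r r (\<lambda>(i, j). if j < c then U $$ (i, j) else 0)"
  define V' where "V' = mat r r (\<lambda>(i, j). if i < c then V $$ (i, j) else 0)"
  have "U' * V' = 1\<^sub>m r"
  proof (rule eq_matI)
    fix i j assume ij: "i < dim_row (1\<^sub>m r :: complex mat)" "j < dim_col (1\<^sub>m r :: complex mat)"
    have "(U' * V') $$ (i, j) = (\<Sum>k = 0..<r. if k < c then U $$ (i, k) * V $$ (k, j) else 0)"
      using ij by (auto simp: U'_def V'_def scalar_prod_def intro!: sum.cong)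
    also have "\<dots> = (\<Sum>k = 0..<c. U $$ (i, k) * V $$ (k, j))"
      using cr by (intro sum.mono_neutral_cong_right) auto
    also have "\<dots> = (U * V) $$ (i, j)"
      using ij U V by (auto simp: scalar_prod_def)
    finally show "(U' * V') $$ (i, j) = 1\<^sub>m r $$ (i, j)" using UV by simp
  qed (auto simp: U'_def V'_def)
  then have "V' * U' = 1\<^sub>m r"
    by (rule mat_mult_left_right_inverse[rotated 2]) (auto simp: U'_def V'_def)
  then have "(V' * U') $$ (c, c) = 1" using cr by simp
  moreover have "(V' * U') $$ (c, c) = 0"
    using cr by (simp add: V'_def U'_def scalar_prod_def)
  ultimately show False by simp
qed

lemma rank_ge_le:
  assumes "rank_ge A r" "rank_le A c"
  shows "r \<le> c"
proof -
  from assms obtain P Q B C where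
    P: "P \<in> carrier_mat r (dim_row A)" and Q: "Q \<in> carrier_mat (dim_col A) r" and PQ: "P * A * Q = 1\<^sub>m r"
    and B: "B \<in> carrier_mat (dim_row A) c" and C: "C \<in> carrier_mat c (dim_col A)" and A: "A = B * C"
    unfolding rank_ge_def rank_le_def by blast
  have "(P * B) * (C * Q) = P * B * C * Q"
    by (rule assoc_mult_mat[of _ r c _ "dim_col A" _ r, symmetric]) (use P Q B C in auto)
  also have "P * B * C = P * A"
    unfolding A by (rule assoc_mult_mat[OF P B C])
  finally have "(P * B) * (C * Q) = 1\<^sub>m r" using PQ by simp
  then show ?thesis using P Q B C by (intro mult_eq_one_imp_le) auto
qed

lemma rank_leI:
  assumes "finite T" "A \<in> carrier_mat n m"
    "\<And>i j. i < n \<Longrightarrow> j < m \<Longrightarrow> A $$ (i, j) = (\<Sum>t\<in>T. f t i * g t j)"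
  shows "rank_le A (card T)"
proof -
  obtain e where e: "bij_betw e {0..<card T} T"
    using assms(1) ex_bij_betw_nat_finite by blast
  let ?B = "mat n (card T) (\<lambda>(i, t). f (e t) i)" and ?C = "mat (card T) m (\<lambda>(t, j). g (e t) j)"
  have "A = ?B * ?C"
  proof (rule eq_matI)
    fix i j assume "i < dim_row (?B * ?C)" "j < dim_col (?B * ?C)"
    then have ij: "i < n" "j < m" by auto
    have "(\<Sum>t\<in>T. f t i * g t j) = (\<Sum>t = 0..<card T. f (e t) i * g (e t) j)"
      by (rule sum.reindex_bij_betw[OF e, symmetric])
    then show "A $$ (i, j) = (?B * ?C) $$ (i, j)"
      using ij assms(3) by (simp add: scalar_prod_def)
  qed (use assms in auto)
  then show ?thesis unfolding rank_le_def using assms(2) by (intro exI[of _ ?B] exI[of _ ?C]) auto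
qed

lemma rank_leE:
  assumes "rank_le A c" "A \<in> carrier_mat n m"
  obtains f g where "\<And>i j. i < n \<Longrightarrow> j < m \<Longrightarrow> A $$ (i, j) = (\<Sum>t<c. f t i * g t j)"
proof -
  from assms obtain B C where BC: "B \<in> carrier_mat n c" "C \<in> carrier_mat c m" "A = B * C"
    unfolding rank_le_def by auto
  show ?thesis
    by (rule that[of "\<lambda>t i. B $$ (i, t)" "\<lambda>t j. C $$ (t, j)"])
      (use BC in \<open>auto simp: scalar_prod_def lessThan_atLeast0\<close>)
qed

lemma rank_le_add:
  assumes "rank_le A c" "rank_le B d" "A \<in> carrier_mat n m" "B \<in> carrier_mat n m"
  shows "rank_le (A + B) (c + d)"
proof -
  obtain f g where fg: "\<And>i j. i < n \<Longrightarrow> j < m \<Longrightarrow> A $$ (i, j) = (\<Sum>t<c. f t i * g t j)"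
    using rank_leE[OF assms(1,3)] by blast
  obtain f' g' where fg': "\<And>i j. i < n \<Longrightarrow> j < m \<Longrightarrow> B $$ (i, j) = (\<Sum>t<d. f' t i * g' t j)"
    using rank_leE[OF assms(2,4)] by blast
  have "rank_le (A + B) (card ({..<c} <+> {..<d}))"
    by (rule rank_leI[where f = "case_sum f f'" and g = "case_sum g g'" and n = n and m = m])
      (use assms fg fg' in \<open>auto simp: sum.Plus\<close>)
  then show ?thesis by (simp add: card_Plus)
qed

lemma rank_le_mono:
  assumes "rank_le A c" "c \<le> d"
  shows "rank_le A d"
proof -
  obtain f g where fg: "\<And>i j. i < dim_row A \<Longrightarrow> j < dim_col A \<Longrightarrow> A $$ (i, j) = (\<Sum>t<c. f t i * g t j)"
    using rank_leE[OF assms(1)] by blast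
  have "rank_le A (card {..<d})"
  proof (rule rank_leI[where n = "dim_row A" and m = "dim_col A"
        and f = "\<lambda>t i. if t < c then f t i else 0" and g = g])
    fix i j assume ij: "i < dim_row A" "j < dim_col A"
    have "(\<Sum>t<d. (if t < c then f t i else 0) * g t j) = (\<Sum>t<c. f t i * g t j)"
      using assms(2) by (intro sum.mono_neutral_cong_right) auto
    then show "A $$ (i, j) = (\<Sum>t<d. (if t < c then f t i else 0) * g t j)" using fg ij by simp
  qed auto
  then show ?thesis by simp
qed

lemma rank_le_mult:
  assumes "rank_le A c" "A \<in> carrier_mat n m" "M \<in> carrier_mat m k"
  shows "rank_le (A * M) c"
proof -
  obtain B C where "B \<in> carrier_mat n c" "C \<in> carrier_mat c m" "A = B * C"
    using assms unfolding rank_le_def by auto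
  then have "B \<in> carrier_mat n c" "C * M \<in> carrier_mat c k" "A * M = B * (C * M)"
    using assms by (auto simp: assoc_mult_mat)
  then show ?thesis unfolding rank_le_def using assms by (metis carrier_matD index_mult_mat(2,3))
qed

lemma rank_geI:
  assumes "finite T" "A \<in> carrier_mat n m"
    "\<And>t. t \<in> T \<Longrightarrow> \<phi> t \<in> carrier_vec n" "\<And>t. t \<in> T \<Longrightarrow> \<psi> t \<in> carrier_vec m"
    "\<And>t t'. t \<in> T \<Longrightarrow> t' \<in> T \<Longrightarrow> \<phi> t \<bullet> (A *\<^sub>v \<psi> t') = (if t = t' then 1 else 0)"
  shows "rank_ge A (card T)"
proof -
  let ?r = "card T"
  obtain e where e: "bij_betw e {0..<?r} T"
    using assms(1) ex_bij_betw_nat_finite by blast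
  then have eT: "e i \<in> T" if "i < ?r" for i using that by (auto simp: bij_betw_def)
  have einj: "e i = e j \<longleftrightarrow> i = j" if "i < ?r" "j < ?r" for i j
    using e that by (auto simp: bij_betw_def inj_on_def)
  let ?P = "mat_of_rows n (map (\<lambda>i. \<phi> (e i)) [0..<?r])"
  let ?Q = "mat_of_cols m (map (\<lambda>i. \<psi> (e i)) [0..<?r])"
  have P: "?P \<in> carrier_mat ?r n" and Q: "?Q \<in> carrier_mat m ?r" by auto
  have "?P * A * ?Q = 1\<^sub>m ?r"
  proof (rule eq_matI)
    fix i j assume "i < dim_row (1\<^sub>m ?r :: complex mat)" "j < dim_col (1\<^sub>m ?r :: complex mat)"
    then have ij: "i < ?r" "j < ?r" by auto
    have "?P * A * ?Q = ?P * (A * ?Q)" using P Q assms(2) by (simp add: assoc_mult_mat)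
    also have "(?P * (A * ?Q)) $$ (i, j) = row ?P i \<bullet> col (A * ?Q) j"
      using ij P Q by simp
    also have "col (A * ?Q) j = A *\<^sub>v \<psi> (e j)"
    proof -
      have "col ?Q j = \<psi> (e j)" using ij assms(4) eT by (simp add: col_mat_of_cols)
      then show ?thesis using col_mult2[OF assms(2) Q] ij by simp
    qed
    also have "row ?P i = \<phi> (e i)"
      using ij assms(3) eT by simp
    finally show "(?P * A * ?Q) $$ (i, j) = 1\<^sub>m ?r $$ (i, j)"
      using ij assms(5) eT einj by simp
  qed (use P Q in auto)
  then show ?thesis unfolding rank_ge_def using P Q assms(2) by (intro exI[of _ ?P] exI[of _ ?Q]) auto
qed

lemma rank_ge_entries:
  assumes "finite T" "A \<in> carrier_mat n m"
    "\<And>t. t \<in> T \<Longrightarrow> f t < n" "\<And>t. t \<in> T \<Longrightarrow> g t < m"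
    "\<And>t t'. t \<in> T \<Longrightarrow> t' \<in> T \<Longrightarrow> A $$ (f t, g t') = (if t = t' then 1 else 0)"
  shows "rank_ge A (card T)"
proof (rule rank_geI[where \<phi> = "\<lambda>t. unit_vec n (f t)" and \<psi> = "\<lambda>t. unit_vec m (g t)"])
  fix t t' assume t: "t \<in> T" "t' \<in> T"
  have "A *\<^sub>v unit_vec m (g t') \<in> carrier_vec n" using assms(2) by simp
  then have "unit_vec n (f t) \<bullet> (A *\<^sub>v unit_vec m (g t')) = (A *\<^sub>v unit_vec m (g t')) $ f t"
    using assms(3) t by (intro scalar_prod_left_unit) auto
  also have "\<dots> = row A (f t) \<bullet> unit_vec m (g t')" using assms(2,3) t by simp
  also have "\<dots> = row A (f t) $ g t'" using assms(2,4) t by (intro scalar_prod_right_unit) auto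
  finally show "unit_vec n (f t) \<bullet> (A *\<^sub>v unit_vec m (g t')) = (if t = t' then 1 else 0)"
    using assms t by simp
qed (use assms in auto)

lemma rank_ge_smult:
  assumes "rank_ge A r" "c \<noteq> 0"
  shows "rank_ge (c \<cdot>\<^sub>m A) r"
proof -
  obtain P Q where PQ: "P \<in> carrier_mat r (dim_row A)" "Q \<in> carrier_mat (dim_col A) r" "P * A * Q = 1\<^sub>m r"
    using assms unfolding rank_ge_def by blast
  have "((1 / c) \<cdot>\<^sub>m P) * (c \<cdot>\<^sub>m A) = c \<cdot>\<^sub>m ((1 / c) \<cdot>\<^sub>m P * A)"
    by (rule mult_smult_distrib) (use PQ in auto)
  also have "(1 / c) \<cdot>\<^sub>m P * A = (1 / c) \<cdot>\<^sub>m (P * A)"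
    by (rule mult_smult_assoc_mat) (use PQ in auto)
  also have "c \<cdot>\<^sub>m ((1 / c) \<cdot>\<^sub>m M) = M" for M
    by (rule eq_matI) (use assms(2) in auto)
  finally have "((1 / c) \<cdot>\<^sub>m P) * (c \<cdot>\<^sub>m A) = P * A" .
  then show ?thesis unfolding rank_ge_def using PQ
    by (intro exI[of _ "(1 / c) \<cdot>\<^sub>m P"] exI[of _ Q]) auto
qed

lemma rank_le_smult:
  assumes "rank_le A r"
  shows "rank_le (c \<cdot>\<^sub>m A) r"
proof -
  obtain B C where "B \<in> carrier_mat (dim_row A) r" "C \<in> carrier_mat r (dim_col A)" "A = B * C"
    using assms unfolding rank_le_def by blast
  then have "c \<cdot>\<^sub>m A = (c \<cdot>\<^sub>m B) * C" "c \<cdot>\<^sub>m B \<in> carrier_mat (dim_row A) r"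
    using mult_smult_assoc_mat[of B "dim_row A" r C "dim_col A" c] by (metis, metis smult_carrier_mat)
  then show ?thesis unfolding rank_le_def using \<open>C \<in> _\<close>
    by (intro exI[of _ "c \<cdot>\<^sub>m B"] exI[of _ C]) auto
qed

lemma rank_le_zero: "rank_le (0\<^sub>m n m) 0"
  by (rule rank_leI[of "{}", simplified]) auto

section \<open>Homogeneous Jordan frames\<close>

text \<open>The parity of \<open>x ^\<^sub>m a *\<^sub>v v\<close> for \<open>v\<close> of parity
  \<open>s\<close>: an even matrix keeps the parity, an odd one flips it at each
  application.\<close>

definition shift :: "bool \<Rightarrow> nat \<Rightarrow> bool \<Rightarrow> bool" where
  "shift e a s = (if e \<or> even a then s else \<not> s)"

lemma shift_0[simp]: "shift e 0 s = s" by (simp add: shift_def)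

text \<open>The parity of an index \<open>i\<close> is the truth value of \<open>i < p\<close>, so that \<open>True\<close> stands for
  $V^+$; a homogeneous matrix is even (\<open>e = True\<close>, in $\mathfrak{k}$) or odd (in $\mathfrak{s}$).\<close>

definition hom_vec :: "nat \<Rightarrow> bool \<Rightarrow> complex vec \<Rightarrow> bool" where
  "hom_vec p s v \<longleftrightarrow> (\<forall>i<dim_vec v. v $ i \<noteq> 0 \<longrightarrow> (i < p) = s)"

definition hom_mat :: "nat \<Rightarrow> bool \<Rightarrow> complex mat \<Rightarrow> bool" where
  "hom_mat p e x \<longleftrightarrow> (\<forall>i<dim_row x. \<forall>j<dim_col x. x $$ (i, j) \<noteq> 0 \<longrightarrow> ((i < p) = (j < p)) = e)"

lemma hom_mat_mult:
  assumes "hom_mat p e x" "hom_mat p f y" "x \<in> carrier_mat n m" "y \<in> carrier_mat m k"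
  shows "hom_mat p (e = f) (x * y)"
  unfolding hom_mat_def
proof (intro allI impI)
  fix i j assume ij: "i < dim_row (x * y)" "j < dim_col (x * y)" "(x * y) $$ (i, j) \<noteq> 0"
  then have "(\<Sum>l = 0..<m. x $$ (i, l) * y $$ (l, j)) \<noteq> 0"
    using assms by (auto simp: scalar_prod_def)
  then obtain l where "l < m" "x $$ (i, l) \<noteq> 0" "y $$ (l, j) \<noteq> 0"
    by (metis (no_types, lifting) atLeastLessThan_iff mult_eq_0_iff sum.neutral)
  then show "((i < p) = (j < p)) = (e = f)"
    using assms ij unfolding hom_mat_def by (metis carrier_matD index_mult_mat(2,3))
qed

lemma hom_mat_one: "hom_mat p True (1\<^sub>m n)"
  by (simp add: hom_mat_def)

lemma hom_mat_pow:
  assumes "hom_mat p e x" "x \<in> carrier_mat n n"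
  shows "hom_mat p (e \<or> even a) (x ^\<^sub>m a)"
proof (induction a)
  case 0
  then show ?case using assms by (simp add: hom_mat_one)
next
  case (Suc a)
  have "hom_mat p ((e \<or> even a) = e) (x ^\<^sub>m a * x)"
    using Suc assms by (intro hom_mat_mult) auto
  then show ?case by (cases e) auto
qed

lemma hom_vec_mult:
  assumes "hom_mat p e x" "hom_vec p s v" "x \<in> carrier_mat n m" "v \<in> carrier_vec m"
  shows "hom_vec p (s = e) (x *\<^sub>v v)"
  unfolding hom_vec_def
proof (intro allI impI)
  fix i assume i: "i < dim_vec (x *\<^sub>v v)" "(x *\<^sub>v v) $ i \<noteq> 0"
  then have "(\<Sum>l = 0..<m. x $$ (i, l) * v $ l) \<noteq> 0"
    using assms by (auto simp: scalar_prod_def)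
  then obtain l where "l < m" "x $$ (i, l) \<noteq> 0" "v $ l \<noteq> 0"
    by (metis (no_types, lifting) atLeastLessThan_iff mult_eq_0_iff sum.neutral)
  then show "(i < p) = (s = e)"
    using assms i unfolding hom_mat_def hom_vec_def by (metis carrier_matD carrier_vecD dim_mult_mat_vec)
qed

lemma hom_vec_pow_mult:
  assumes "hom_mat p e x" "hom_vec p s v" "x \<in> carrier_mat n n" "v \<in> carrier_vec n"
  shows "hom_vec p (shift e a s) (x ^\<^sub>m a *\<^sub>v v)"
  using hom_vec_mult[OF hom_mat_pow[OF assms(1,3), of a] assms(2) pow_carrier_mat[OF assms(3)] assms(4)]
  by (auto simp: shift_def split: if_splits)

lemma hom_mat_transpose: "hom_mat p e x \<Longrightarrow> hom_mat p e (transpose_mat x)"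
  unfolding hom_mat_def by auto

lemma hom_vec_scalar_prod:
  assumes "hom_vec p s u" "hom_vec p t v" "u \<in> carrier_vec n" "v \<in> carrier_vec n" "u \<bullet> v \<noteq> 0"
  shows "s = t"
proof -
  have "(\<Sum>l = 0..<n. u $ l * v $ l) \<noteq> 0" using assms by (auto simp: scalar_prod_def)
  then obtain l where "l < n" "u $ l \<noteq> 0" "v $ l \<noteq> 0"
    by (metis (no_types, lifting) atLeastLessThan_iff mult_eq_0_iff sum.neutral)
  then show ?thesis using assms unfolding hom_vec_def by (metis carrier_vecD)
qed

text \<open>The matrix of the map that sends \<open>u\<close> to the sum of the vectors
  \<open>b \<kappa>\<close> with coefficients \<open>\<beta> \<kappa> \<bullet> u\<close>.
  Projections onto frames and intertwiners between two frames are both of this form.\<close>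

definition outer_sum :: "nat \<Rightarrow> 'k set \<Rightarrow> ('k \<Rightarrow> complex vec) \<Rightarrow> ('k \<Rightarrow> complex vec) \<Rightarrow> complex mat" where
  "outer_sum n T b \<beta> = mat n n (\<lambda>(i, j). \<Sum>\<kappa>\<in>T. b \<kappa> $ i * \<beta> \<kappa> $ j)"

lemma outer_sum_carrier[simp]: "outer_sum n T b \<beta> \<in> carrier_mat n n"
  by (simp add: outer_sum_def)

lemma outer_sum_cong:
  "(\<And>\<kappa>. \<kappa> \<in> T \<Longrightarrow> b \<kappa> = b' \<kappa>) \<Longrightarrow> outer_sum n T b \<beta> = outer_sum n T b' \<beta>"
  unfolding outer_sum_def by (intro arg_cong[of _ _ "mat n n"] ext) (auto intro!: sum.cong)

lemma mult_outer_sum: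
  assumes "y \<in> carrier_mat n n" "\<And>\<kappa>. \<kappa> \<in> T \<Longrightarrow> b \<kappa> \<in> carrier_vec n"
  shows "y * outer_sum n T b \<beta> = outer_sum n T (\<lambda>\<kappa>. y *\<^sub>v b \<kappa>) \<beta>"
proof (rule eq_matI)
  fix i j assume "i < dim_row (outer_sum n T (\<lambda>\<kappa>. y *\<^sub>v b \<kappa>) \<beta>)" "j < dim_col (outer_sum n T (\<lambda>\<kappa>. y *\<^sub>v b \<kappa>) \<beta>)"
  then have ij: "i < n" "j < n" by (auto simp: outer_sum_def)
  have "(y * outer_sum n T b \<beta>) $$ (i, j) = (\<Sum>l<n. \<Sum>\<kappa>\<in>T. y $$ (i, l) * b \<kappa> $ l * \<beta> \<kappa> $ j)"
    unfolding mult_mat_sum[OF assms(1) outer_sum_carrier ij]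
    by (intro sum.cong refl) (use ij in \<open>simp add: outer_sum_def sum_distrib_left mult.assoc\<close>)
  also have "\<dots> = (\<Sum>\<kappa>\<in>T. (\<Sum>l<n. y $$ (i, l) * b \<kappa> $ l) * \<beta> \<kappa> $ j)"
    by (subst sum.swap) (simp add: sum_distrib_right)
  also have "\<dots> = (\<Sum>\<kappa>\<in>T. (y *\<^sub>v b \<kappa>) $ i * \<beta> \<kappa> $ j)"
    by (intro sum.cong refl) (simp only: mult_mat_vec_sum[OF assms(1) assms(2) ij(1)])
  finally show "(y * outer_sum n T b \<beta>) $$ (i, j) = outer_sum n T (\<lambda>\<kappa>. y *\<^sub>v b \<kappa>) \<beta> $$ (i, j)"
    using ij by (simp add: outer_sum_def)
qed (use assms in \<open>auto simp: outer_sum_def\<close>)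

lemma outer_sum_mult_vec_index:
  assumes "u \<in> carrier_vec n" "i < n"
  shows "(outer_sum n T b \<beta> *\<^sub>v u) $ i = (\<Sum>\<kappa>\<in>T. (\<beta> \<kappa> \<bullet> u) * b \<kappa> $ i)"
proof -
  have "(outer_sum n T b \<beta> *\<^sub>v u) $ i = (\<Sum>l<n. \<Sum>\<kappa>\<in>T. \<beta> \<kappa> $ l * u $ l * b \<kappa> $ i)"
    unfolding mult_mat_vec_sum[OF outer_sum_carrier assms]
    by (intro sum.cong refl) (use assms in \<open>simp add: outer_sum_def sum_distrib_left mult_ac\<close>)
  also have "\<dots> = (\<Sum>\<kappa>\<in>T. (\<Sum>l<n. \<beta> \<kappa> $ l * u $ l) * b \<kappa> $ i)"
    by (subst sum.swap) (simp add: sum_distrib_right)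
  finally show ?thesis by (simp add: scalar_prod_sum[OF assms(1)])
qed

lemma transpose_outer_sum: "transpose_mat (outer_sum n T b \<beta>) = outer_sum n T \<beta> b"
  by (rule eq_matI) (auto simp: outer_sum_def mult.commute)

lemma outer_sum_mult:
  assumes "y \<in> carrier_mat n n" "\<And>\<kappa>. \<kappa> \<in> T \<Longrightarrow> \<beta> \<kappa> \<in> carrier_vec n"
  shows "outer_sum n T b \<beta> * y = outer_sum n T b (\<lambda>\<kappa>. transpose_mat y *\<^sub>v \<beta> \<kappa>)"
proof -
  have "outer_sum n T b \<beta> * y = transpose_mat (transpose_mat y * outer_sum n T \<beta> b)"
    using assms(1) by (subst transpose_mult[of _ n n _ n]) (auto simp: transpose_outer_sum)
  also have "\<dots> = outer_sum n T b (\<lambda>\<kappa>. transpose_mat y *\<^sub>v \<beta> \<kappa>)"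
    by (subst mult_outer_sum) (use assms in \<open>auto simp: transpose_outer_sum\<close>)
  finally show ?thesis .
qed

lemma outer_sum_mult_dual:
  assumes "finite T" "\<And>\<kappa>. \<kappa> \<in> T \<Longrightarrow> b' \<kappa> \<in> carrier_vec n" "\<And>\<kappa>. \<kappa> \<in> T \<Longrightarrow> b \<kappa> \<in> carrier_vec n"
    "\<And>\<kappa> \<kappa>'. \<kappa> \<in> T \<Longrightarrow> \<kappa>' \<in> T \<Longrightarrow> \<beta> \<kappa> \<bullet> b \<kappa>' = (if \<kappa> = \<kappa>' then 1 else 0)" "\<kappa> \<in> T"
  shows "outer_sum n T b' \<beta> *\<^sub>v b \<kappa> = b' \<kappa>"
proof (rule eq_vecI)
  fix i assume "i < dim_vec (b' \<kappa>)"
  then have i: "i < n" using assms(2)[OF assms(5)] by simp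
  have "(outer_sum n T b' \<beta> *\<^sub>v b \<kappa>) $ i = (\<Sum>\<kappa>'\<in>T. if \<kappa>' = \<kappa> then b' \<kappa>' $ i else 0)"
    unfolding outer_sum_mult_vec_index[OF assms(3)[OF assms(5)] i]
    by (intro sum.cong refl) (use assms(4,5) in auto)
  then show "(outer_sum n T b' \<beta> *\<^sub>v b \<kappa>) $ i = b' \<kappa> $ i" using assms(1,5) by simp
qed (use assms(2)[OF assms(5)] in \<open>simp add: outer_sum_def\<close>)

lemma hom_outer_sum:
  assumes "\<And>\<kappa>. \<kappa> \<in> T \<Longrightarrow> b \<kappa> \<in> carrier_vec n \<and> \<beta> \<kappa> \<in> carrier_vec n"
    "\<And>\<kappa>. \<kappa> \<in> T \<Longrightarrow> hom_vec p (s \<kappa>) (b \<kappa>) \<and> hom_vec p (s \<kappa>) (\<beta> \<kappa>)"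
  shows "hom_mat p True (outer_sum n T b \<beta>)"
  unfolding hom_mat_def
proof (intro allI impI)
  fix i j assume "i < dim_row (outer_sum n T b \<beta>)" "j < dim_col (outer_sum n T b \<beta>)"
    and nz: "outer_sum n T b \<beta> $$ (i, j) \<noteq> 0"
  then have ij: "i < n" "j < n" by (auto simp: outer_sum_def)
  with nz have "(\<Sum>\<kappa>\<in>T. b \<kappa> $ i * \<beta> \<kappa> $ j) \<noteq> 0" by (simp add: outer_sum_def)
  then obtain \<kappa> where k: "\<kappa> \<in> T" and "b \<kappa> $ i * \<beta> \<kappa> $ j \<noteq> 0"
    by (meson sum.neutral)
  then have "b \<kappa> $ i \<noteq> 0" "\<beta> \<kappa> $ j \<noteq> 0" by auto
  then have "(i < p) = s \<kappa>" "(j < p) = s \<kappa>"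
    using assms[OF k] ij unfolding hom_vec_def by auto
  then show "((i < p) = (j < p)) = True" by simp
qed

text \<open>A row \<open>(s, N)\<close> stands for a Jordan block of size \<open>N\<close> whose
  kernel vector has parity \<open>s\<close>. The box \<open>(k, a)\<close> stands for the vector of
  block \<open>k\<close> that is killed by exactly \<open>a + 1\<close> applications of
  \<open>x\<close>.\<close>

type_synonym jordan_type = "(bool \<times> nat) list"

definition boxes :: "jordan_type \<Rightarrow> (nat \<times> nat) set" where
  "boxes \<tau> = Sigma {..<length \<tau>} (\<lambda>k. {..<snd (\<tau> ! k)})"

definition box_parity :: "bool \<Rightarrow> jordan_type \<Rightarrow> nat \<times> nat \<Rightarrow> bool" where
  "box_parity e \<tau> \<kappa> = shift e (snd \<kappa>) (fst (\<tau> ! fst \<kappa>))"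

lemma finite_boxes[simp]: "finite (boxes \<tau>)" by (simp add: boxes_def)

text \<open>In a frame, \<open>x\<close> maps box \<open>(k, a + 1)\<close> to box \<open>(k, a)\<close> and kills the boxes \<open>(k, 0)\<close>;
  the covectors \<open>\<beta>\<close> are dual to the vectors \<open>b\<close>.\<close>

locale jordan_frame =
  fixes p n :: nat and e :: bool and x :: "complex mat" and \<tau> :: jordan_type
    and b \<beta> :: "nat \<times> nat \<Rightarrow> complex vec"
  assumes x: "x \<in> carrier_mat n n" and hom_x: "hom_mat p e x"
    and b_carrier: "\<kappa> \<in> boxes \<tau> \<Longrightarrow> b \<kappa> \<in> carrier_vec n"
    and \<beta>_carrier: "\<kappa> \<in> boxes \<tau> \<Longrightarrow> \<beta> \<kappa> \<in> carrier_vec n"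
    and dual: "\<kappa> \<in> boxes \<tau> \<Longrightarrow> \<kappa>' \<in> boxes \<tau> \<Longrightarrow> \<beta> \<kappa> \<bullet> b \<kappa>' = (if \<kappa> = \<kappa>' then 1 else 0)"
    and x_b_0: "(k, 0) \<in> boxes \<tau> \<Longrightarrow> x *\<^sub>v b (k, 0) = 0\<^sub>v n"
    and x_b_Suc: "(k, Suc a) \<in> boxes \<tau> \<Longrightarrow> x *\<^sub>v b (k, Suc a) = b (k, a)"
    and \<beta>_x: "(k, a) \<in> boxes \<tau> \<Longrightarrow>
      transpose_mat x *\<^sub>v \<beta> (k, a) = (if (k, Suc a) \<in> boxes \<tau> then \<beta> (k, Suc a) else 0\<^sub>v n)"
    and hom_b: "\<kappa> \<in> boxes \<tau> \<Longrightarrow> hom_vec p (box_parity e \<tau> \<kappa>) (b \<kappa>)"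
    and hom_\<beta>: "\<kappa> \<in> boxes \<tau> \<Longrightarrow> hom_vec p (box_parity e \<tau> \<kappa>) (\<beta> \<kappa>)"

begin

text \<open>The projection onto the span of the frame along the common kernel of its covectors. It
  commutes with \<open>x\<close>, so the complementary space is stable and can be searched for a
  further Jordan chain.\<close>

definition proj :: "complex mat" where
  "proj = outer_sum n (boxes \<tau>) b \<beta>"

lemma proj_carrier[simp]: "proj \<in> carrier_mat n n"
  by (simp add: proj_def)

lemma proj_index: "i < n \<Longrightarrow> j < n \<Longrightarrow> proj $$ (i, j) = (\<Sum>\<kappa>\<in>boxes \<tau>. b \<kappa> $ i * \<beta> \<kappa> $ j)"
  by (simp add: proj_def outer_sum_def)

lemma mult_proj_index:
  assumes "y \<in> carrier_mat n n" "i < n" "j < n"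
  shows "(y * proj) $$ (i, j) = (\<Sum>\<kappa>\<in>boxes \<tau>. (y *\<^sub>v b \<kappa>) $ i * \<beta> \<kappa> $ j)"
proof -
  have "y * proj = outer_sum n (boxes \<tau>) (\<lambda>\<kappa>. y *\<^sub>v b \<kappa>) \<beta>"
    unfolding proj_def by (rule mult_outer_sum[OF assms(1) b_carrier])
  then show ?thesis using assms(2,3) by (simp add: outer_sum_def)
qed

lemma proj_mult_index:
  assumes "y \<in> carrier_mat n n" "i < n" "j < n"
  shows "(proj * y) $$ (i, j) = (\<Sum>\<kappa>\<in>boxes \<tau>. b \<kappa> $ i * (transpose_mat y *\<^sub>v \<beta> \<kappa>) $ j)"
proof -
  have "proj * y = outer_sum n (boxes \<tau>) b (\<lambda>\<kappa>. transpose_mat y *\<^sub>v \<beta> \<kappa>)"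
    unfolding proj_def by (rule outer_sum_mult[OF assms(1) \<beta>_carrier])
  then show ?thesis using assms(2,3) by (simp add: outer_sum_def)
qed

lemma proj_mult_vec_index:
  "u \<in> carrier_vec n \<Longrightarrow> i < n \<Longrightarrow> (proj *\<^sub>v u) $ i = (\<Sum>\<kappa>\<in>boxes \<tau>. (\<beta> \<kappa> \<bullet> u) * b \<kappa> $ i)"
  unfolding proj_def by (rule outer_sum_mult_vec_index)

lemma proj_b: "\<kappa> \<in> boxes \<tau> \<Longrightarrow> proj *\<^sub>v b \<kappa> = b \<kappa>"
  unfolding proj_def by (rule outer_sum_mult_dual[OF finite_boxes b_carrier b_carrier dual])

lemma proj_\<beta>: "\<kappa> \<in> boxes \<tau> \<Longrightarrow> transpose_mat proj *\<^sub>v \<beta> \<kappa> = \<beta> \<kappa>"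
  unfolding proj_def transpose_outer_sum
proof (rule outer_sum_mult_dual[OF finite_boxes \<beta>_carrier \<beta>_carrier])
  fix \<kappa> \<kappa>' assume "\<kappa> \<in> boxes \<tau>" "\<kappa>' \<in> boxes \<tau>"
  then show "b \<kappa> \<bullet> \<beta> \<kappa>' = (if \<kappa> = \<kappa>' then 1 else 0)"
    using comm_scalar_prod[OF b_carrier \<beta>_carrier] dual[of \<kappa>' \<kappa>] by simp
qed

lemma proj_idem: "proj * proj = proj"
proof (rule eq_matI)
  fix i j assume "i < dim_row proj" "j < dim_col proj"
  then have ij: "i < n" "j < n" using carrier_matD[OF proj_carrier] by auto
  show "(proj * proj) $$ (i, j) = proj $$ (i, j)"
    unfolding mult_proj_index[OF proj_carrier ij] proj_index[OF ij]
    by (intro sum.cong refl) (simp only: proj_b)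
qed (use carrier_matD[OF proj_carrier] in auto)

text \<open>The box \<open>(k, a + 1)\<close> contributes to \<open>x * proj\<close> the product of
  \<open>b (k, a)\<close> and \<open>\<beta> (k, a + 1)\<close>, which is what the box
  \<open>(k, a)\<close> contributes to \<open>proj * x\<close>. The two sums differ by a shift of
  the index, and the boxes without a partner contribute zero.\<close>

lemma x_proj: "x * proj = proj * x"
proof (rule eq_matI)
  fix i j assume "i < dim_row (proj * x)" "j < dim_col (proj * x)"
  then have ij: "i < n" "j < n" using x carrier_matD[OF proj_carrier] by auto
  let ?S = "{\<kappa> \<in> boxes \<tau>. snd \<kappa> \<noteq> 0}" and ?T = "{\<kappa> \<in> boxes \<tau>. (fst \<kappa>, Suc (snd \<kappa>)) \<in> boxes \<tau>}"
  have x0: "(x *\<^sub>v b \<kappa>) $ i = 0" if "\<kappa> \<in> boxes \<tau>" "snd \<kappa> = 0" for \<kappa>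
    using x_b_0[of "fst \<kappa>"] that ij by (metis index_zero_vec(1) prod.collapse)
  have xS: "x *\<^sub>v b \<kappa> = b (fst \<kappa>, snd \<kappa> - 1)" if "\<kappa> \<in> boxes \<tau>" "snd \<kappa> \<noteq> 0" for \<kappa>
    using x_b_Suc[of "fst \<kappa>" "snd \<kappa> - 1"] that by auto
  have \<beta>T: "transpose_mat x *\<^sub>v \<beta> \<kappa> = \<beta> (fst \<kappa>, Suc (snd \<kappa>))" if "\<kappa> \<in> ?T" for \<kappa>
    using \<beta>_x[of "fst \<kappa>" "snd \<kappa>"] that by auto
  have \<beta>0: "(transpose_mat x *\<^sub>v \<beta> \<kappa>) $ j = 0" if "\<kappa> \<in> boxes \<tau> - ?T" for \<kappa>
    using \<beta>_x[of "fst \<kappa>" "snd \<kappa>"] that ij by auto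
  have "(x * proj) $$ (i, j) = (\<Sum>\<kappa>\<in>boxes \<tau>. (x *\<^sub>v b \<kappa>) $ i * \<beta> \<kappa> $ j)"
    using x ij by (rule mult_proj_index)
  also have "\<dots> = (\<Sum>\<kappa>\<in>?S. (x *\<^sub>v b \<kappa>) $ i * \<beta> \<kappa> $ j)"
    by (rule sum.mono_neutral_right) (use x0 in auto)
  also have "\<dots> = (\<Sum>\<kappa>\<in>?T. b \<kappa> $ i * (transpose_mat x *\<^sub>v \<beta> \<kappa>) $ j)"
  proof (rule sum.reindex_bij_witness[of _ "\<lambda>\<kappa>. (fst \<kappa>, Suc (snd \<kappa>))" "\<lambda>\<kappa>. (fst \<kappa>, snd \<kappa> - 1)"])
    fix \<kappa> assume k: "\<kappa> \<in> ?S"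
    then show T: "(fst \<kappa>, snd \<kappa> - 1) \<in> ?T" by (auto simp: boxes_def)
    show "b (fst \<kappa>, snd \<kappa> - 1) $ i * (transpose_mat x *\<^sub>v \<beta> (fst \<kappa>, snd \<kappa> - 1)) $ j = (x *\<^sub>v b \<kappa>) $ i * \<beta> \<kappa> $ j"
      unfolding \<beta>T[OF T] using k xS[of \<kappa>] by simp
  qed (auto simp: boxes_def)
  also have "\<dots> = (\<Sum>\<kappa>\<in>boxes \<tau>. b \<kappa> $ i * (transpose_mat x *\<^sub>v \<beta> \<kappa>) $ j)"
    by (rule sum.mono_neutral_left) (use \<beta>0 in auto)
  also have "\<dots> = (proj * x) $$ (i, j)"
    using x ij by (rule proj_mult_index[symmetric])
  finally show "(x * proj) $$ (i, j) = (proj * x) $$ (i, j)" .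
qed (use x carrier_matD[OF proj_carrier] in auto)

lemma hom_proj: "hom_mat p True proj"
  unfolding proj_def
  by (rule hom_outer_sum[where s = "box_parity e \<tau>"]) (use b_carrier \<beta>_carrier hom_b hom_\<beta> in auto)

text \<open>This bound is what makes a frame of maximal size exist.\<close>

lemma card_boxes_le: "card (boxes \<tau>) \<le> n"
proof (rule rank_ge_le)
  show "rank_ge (1\<^sub>m n) (card (boxes \<tau>))"
    by (rule rank_geI[where n = n and m = n and \<phi> = \<beta> and \<psi> = b])
      (use b_carrier \<beta>_carrier dual in auto)
  show "rank_le (1\<^sub>m n) n"
    unfolding rank_le_def by (intro exI[of _ "1\<^sub>m n"]) auto
qed

end

lemma pow_mat_add:
  assumes "x \<in> carrier_mat n n"
  shows "x ^\<^sub>m (a + b) = x ^\<^sub>m a * x ^\<^sub>m b"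
proof (induction b)
  case 0
  then show ?case using assms pow_carrier_mat[OF assms, of a] by simp
next
  case (Suc b)
  have "x ^\<^sub>m (a + Suc b) = x ^\<^sub>m a * x ^\<^sub>m b * x" using Suc by simp
  also have "\<dots> = x ^\<^sub>m a * (x ^\<^sub>m b * x)"
    by (rule assoc_mult_mat[of _ n n _ n _ n]) (use assms in auto)
  finally show ?case by simp
qed

lemma pow_mult_vec_add:
  assumes "x \<in> carrier_mat n n" "v \<in> carrier_vec n"
  shows "x ^\<^sub>m a *\<^sub>v (x ^\<^sub>m b *\<^sub>v v) = x ^\<^sub>m (a + b) *\<^sub>v v"
  unfolding pow_mat_add[OF assms(1)]
  by (rule assoc_mult_mat_vec[symmetric, of _ n n _ n]) (use assms in auto)

lemma mult_pow_mult_vec: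
  assumes "x \<in> carrier_mat n n" "v \<in> carrier_vec n"
  shows "x *\<^sub>v (x ^\<^sub>m b *\<^sub>v v) = x ^\<^sub>m (Suc b) *\<^sub>v v"
  using pow_mult_vec_add[OF assms, of 1 b] assms(1) by simp

lemma scalar_prod_mult_mat_vec:
  assumes "A \<in> carrier_mat n m" "v \<in> carrier_vec m" "u \<in> carrier_vec n"
  shows "(transpose_mat A *\<^sub>v u) \<bullet> v = (u :: complex vec) \<bullet> (A *\<^sub>v v)"
  by (rule transpose_vec_mult_scalar[OF assms])

lemma mult_mat_zero_vec: "A \<in> carrier_mat n m \<Longrightarrow> A *\<^sub>v 0\<^sub>v m = (0\<^sub>v n :: complex vec)"
  by (intro eq_vecI) auto

lemma zero_mat_mult_vec: "v \<in> carrier_vec m \<Longrightarrow> 0\<^sub>m n m *\<^sub>v v = (0\<^sub>v n :: complex vec)"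
  by (intro eq_vecI) (auto simp: scalar_prod_def)

lemma hom_vec_smult: "hom_vec p s v \<Longrightarrow> hom_vec p s (c \<cdot>\<^sub>v v)"
  by (auto simp: hom_vec_def)

lemma hom_vec_minus:
  "hom_vec p s u \<Longrightarrow> hom_vec p s v \<Longrightarrow> u \<in> carrier_vec n \<Longrightarrow> v \<in> carrier_vec n \<Longrightarrow> hom_vec p s (u - v)"
  by (auto simp: hom_vec_def)

lemma boxes_append:
  "boxes (\<tau> @ [(s, N)]) = boxes \<tau> \<union> {length \<tau>} \<times> {..<N}"
  by (auto simp: boxes_def nth_append split: if_splits)

context jordan_frame
begin

text \<open>The new chain consists of the vectors \<open>x^c v\<close>, numbered from its kernel
  end, and its covectors are \<open>\<phi>\<close> composed with powers of \<open>x\<close>. Duality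
  inside the chain is \<open>pair\<close>, since \<open>a + (N - a')\<close> equals \<open>N\<close>
  exactly for \<open>a = a'\<close>; duality with the old chains is \<open>ortho1\<close> and
  \<open>ortho2\<close>.\<close>

lemma extend:
  assumes v: "v \<in> carrier_vec n" and \<phi>: "\<phi> \<in> carrier_vec n"
    and ortho1: "\<And>\<kappa> c. \<kappa> \<in> boxes \<tau> \<Longrightarrow> \<beta> \<kappa> \<bullet> (x ^\<^sub>m c *\<^sub>v v) = 0"
    and ortho2: "\<And>\<kappa> c. \<kappa> \<in> boxes \<tau> \<Longrightarrow> \<phi> \<bullet> (x ^\<^sub>m c *\<^sub>v b \<kappa>) = 0"
    and pair: "\<And>c. \<phi> \<bullet> (x ^\<^sub>m c *\<^sub>v v) = (if c = N then 1 else 0)"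
    and zero: "x ^\<^sub>m Suc N *\<^sub>v v = 0\<^sub>v n" "transpose_mat (x ^\<^sub>m Suc N) *\<^sub>v \<phi> = 0\<^sub>v n"
    and hom: "hom_vec p s \<phi>" "hom_vec p (shift e N s) v"
  shows "jordan_frame p n e x (\<tau> @ [(s, Suc N)])
    (\<lambda>\<kappa>. if fst \<kappa> = length \<tau> then x ^\<^sub>m (N - snd \<kappa>) *\<^sub>v v else b \<kappa>)
    (\<lambda>\<kappa>. if fst \<kappa> = length \<tau> then transpose_mat (x ^\<^sub>m snd \<kappa>) *\<^sub>v \<phi> else \<beta> \<kappa>)"
    (is "jordan_frame p n e x ?\<tau> ?b ?\<beta>")
proof -
  have old: "fst \<kappa> < length \<tau>" if "\<kappa> \<in> boxes \<tau>" for \<kappa> using that by (auto simp: boxes_def)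
  have xp: "x ^\<^sub>m c \<in> carrier_mat n n" "transpose_mat (x ^\<^sub>m c) \<in> carrier_mat n n" for c
    using x by auto
  have xpv: "x ^\<^sub>m c *\<^sub>v u \<in> carrier_vec n" "transpose_mat (x ^\<^sub>m c) *\<^sub>v u \<in> carrier_vec n"
    if "u \<in> carrier_vec n" for c u
    using mult_mat_vec_carrier[OF xp(1) that] mult_mat_vec_carrier[OF xp(2) that] by auto
  note pow_mat.simps(2)[simp del]
  have mem: "\<kappa> \<in> boxes ?\<tau> \<longleftrightarrow> (fst \<kappa> \<noteq> length \<tau> \<and> \<kappa> \<in> boxes \<tau>) \<or> (fst \<kappa> = length \<tau> \<and> snd \<kappa> \<le> N)" for \<kappa>
    using old[of \<kappa>] by (cases \<kappa>) (auto simp: boxes_append)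
  have par: "box_parity e ?\<tau> \<kappa> = (if fst \<kappa> = length \<tau> then shift e (snd \<kappa>) s else box_parity e \<tau> \<kappa>)"
    if "\<kappa> \<in> boxes ?\<tau>" for \<kappa>
    using that old[of \<kappa>] by (auto simp: box_parity_def nth_append mem)
  have sp: "(transpose_mat (x ^\<^sub>m a) *\<^sub>v \<phi>) \<bullet> u = \<phi> \<bullet> (x ^\<^sub>m a *\<^sub>v u)" if "u \<in> carrier_vec n" for a u
    using scalar_prod_mult_mat_vec[OF xp(1) that \<phi>] .
  show ?thesis
  proof
    show "x \<in> carrier_mat n n" "hom_mat p e x" by (rule x hom_x)+
  next
    fix \<kappa> assume k: "\<kappa> \<in> boxes ?\<tau>"
    show "?b \<kappa> \<in> carrier_vec n" using k b_carrier[of \<kappa>] xpv[OF v] by (auto simp only: mem split: if_split)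
    show "?\<beta> \<kappa> \<in> carrier_vec n" using k \<beta>_carrier[of \<kappa>] xpv[OF \<phi>] by (auto simp only: mem split: if_split)
    show "hom_vec p (box_parity e ?\<tau> \<kappa>) (?b \<kappa>)"
    proof (cases "fst \<kappa> = length \<tau>")
      case True
      then have "shift e (N - snd \<kappa>) (shift e N s) = shift e (snd \<kappa>) s"
        using k by (auto simp: mem shift_def)
      then show ?thesis
        using hom_vec_pow_mult[OF hom_x hom(2) x v, of "N - snd \<kappa>"] True by (simp add: par[OF k])
    qed (use hom_b[of \<kappa>] k in \<open>simp add: par mem\<close>)
    show "hom_vec p (box_parity e ?\<tau> \<kappa>) (?\<beta> \<kappa>)"
    proof (cases "fst \<kappa> = length \<tau>")
      case True
      have "hom_vec p (s = (e \<or> even (snd \<kappa>))) (transpose_mat (x ^\<^sub>m snd \<kappa>) *\<^sub>v \<phi>)"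
        by (rule hom_vec_mult[OF hom_mat_transpose[OF hom_mat_pow[OF hom_x x]] hom(1) xp(2) \<phi>])
      moreover have "(s = (e \<or> even (snd \<kappa>))) = shift e (snd \<kappa>) s" by (auto simp: shift_def)
      ultimately show ?thesis using True by (simp add: par[OF k])
    qed (use hom_\<beta>[of \<kappa>] k in \<open>simp add: par mem\<close>)
  next
    fix \<kappa> \<kappa>' assume k: "\<kappa> \<in> boxes ?\<tau>" and k': "\<kappa>' \<in> boxes ?\<tau>"
    show "?\<beta> \<kappa> \<bullet> ?b \<kappa>' = (if \<kappa> = \<kappa>' then 1 else 0)"
    proof (cases "fst \<kappa> = length \<tau>"; cases "fst \<kappa>' = length \<tau>")
      assume kk: "fst \<kappa> = length \<tau>" "fst \<kappa>' = length \<tau>"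
      have "(transpose_mat (x ^\<^sub>m snd \<kappa>) *\<^sub>v \<phi>) \<bullet> (x ^\<^sub>m (N - snd \<kappa>') *\<^sub>v v)
          = \<phi> \<bullet> (x ^\<^sub>m (snd \<kappa> + (N - snd \<kappa>')) *\<^sub>v v)"
        using sp[OF xpv(1)[OF v]] pow_mult_vec_add[OF x v] by simp
      also have "\<dots> = (if snd \<kappa> = snd \<kappa>' then 1 else 0)"
        using k k' kk by (auto simp: pair mem)
      finally show ?thesis using kk by (simp add: prod_eq_iff)
    next
      assume kk: "fst \<kappa> = length \<tau>" "fst \<kappa>' \<noteq> length \<tau>"
      then show ?thesis using sp b_carrier[of \<kappa>'] ortho2[of \<kappa>'] k' by (auto simp: mem)
    next
      assume kk: "fst \<kappa> \<noteq> length \<tau>" "fst \<kappa>' = length \<tau>"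
      then show ?thesis using ortho1[of \<kappa>] k by (auto simp: mem)
    next
      assume kk: "fst \<kappa> \<noteq> length \<tau>" "fst \<kappa>' \<noteq> length \<tau>"
      then show ?thesis using dual[of \<kappa> \<kappa>'] k k' by (simp add: mem)
    qed
  next
    fix k assume "(k, 0) \<in> boxes ?\<tau>"
    then show "x *\<^sub>v ?b (k, 0) = 0\<^sub>v n"
      using x_b_0[of k] zero(1) mult_pow_mult_vec[OF x v, of N] by (auto simp: mem)
  next
    fix k a assume k: "(k, Suc a) \<in> boxes ?\<tau>"
    show "x *\<^sub>v ?b (k, Suc a) = ?b (k, a)"
    proof (cases "k = length \<tau>")
      case True
      then have "N - a = Suc (N - Suc a)" using k by (auto simp: mem)
      then show ?thesis using True mult_pow_mult_vec[OF x v, of "N - Suc a"] by simp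
    qed (use k x_b_Suc[of k a] in \<open>auto simp: mem\<close>)
  next
    fix k a assume k: "(k, a) \<in> boxes ?\<tau>"
    show "transpose_mat x *\<^sub>v ?\<beta> (k, a) = (if (k, Suc a) \<in> boxes ?\<tau> then ?\<beta> (k, Suc a) else 0\<^sub>v n)"
    proof (cases "k = length \<tau>")
      case True
      have "transpose_mat x *\<^sub>v (transpose_mat (x ^\<^sub>m a) *\<^sub>v \<phi>) = transpose_mat (x ^\<^sub>m a * x) *\<^sub>v \<phi>"
        unfolding transpose_mult[OF xp(1) x]
        by (rule assoc_mult_mat_vec[symmetric]) (use x xp \<phi> in auto)
      moreover have "\<not> Suc a \<le> N \<Longrightarrow> a = N" using k True by (auto simp: mem)
      ultimately show ?thesis using True zero(2) by (auto simp: mem pow_mat.simps(2))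
    qed (use k \<beta>_x[of k a] in \<open>simp add: mem\<close>)
  qed
qed

text \<open>The search takes place in the image of \<open>E = 1 - proj\<close>. A vector
  \<open>v\<close> there whose chain has the maximal length \<open>N + 1\<close> splits off: some
  covector is nonzero on \<open>x^N v\<close>, and it can be corrected until its pairing with the
  whole chain is a delta. Since \<open>E\<close> is even, starting from unit vectors keeps
  \<open>v\<close> and the covector homogeneous.\<close>

lemma exists_extension:
  assumes nil: "x ^\<^sub>m m = 0\<^sub>m n n" and ne: "proj \<noteq> 1\<^sub>m n"
  shows "\<exists>s N b' \<beta>'. jordan_frame p n e x (\<tau> @ [(s, Suc N)]) b' \<beta>'"
proof -
  define E where "E = 1\<^sub>m n - proj"
  have E: "E \<in> carrier_mat n n" unfolding E_def by (rule minus_carrier_mat[OF proj_carrier])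
  have xp: "x ^\<^sub>m c \<in> carrier_mat n n" "transpose_mat (x ^\<^sub>m c) \<in> carrier_mat n n" for c
    using x by auto
  have xpv: "x ^\<^sub>m c *\<^sub>v u \<in> carrier_vec n" "transpose_mat (x ^\<^sub>m c) *\<^sub>v u \<in> carrier_vec n"
    if "u \<in> carrier_vec n" for c u
    using mult_mat_vec_carrier[OF xp(1) that] mult_mat_vec_carrier[OF xp(2) that] by auto
  note pow_mat.simps(2)[simp del]
  have Ev: "E *\<^sub>v u = u - proj *\<^sub>v u" if "u \<in> carrier_vec n" for u
    using that by (simp add: E_def minus_mult_distrib_mat_vec[of _ n n])
  have TE: "transpose_mat E = 1\<^sub>m n - transpose_mat proj"
    by (rule eq_matI) (auto simp: E_def carrier_matD[OF proj_carrier])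
  have TEv: "transpose_mat E *\<^sub>v u = u - transpose_mat proj *\<^sub>v u" if "u \<in> carrier_vec n" for u
    using that by (simp add: TE minus_mult_distrib_mat_vec[of _ n n])
  have Eb: "E *\<^sub>v b \<kappa> = 0\<^sub>v n" if "\<kappa> \<in> boxes \<tau>" for \<kappa>
    using that b_carrier by (simp add: Ev proj_b)
  have E\<beta>: "transpose_mat E *\<^sub>v \<beta> \<kappa> = 0\<^sub>v n" if "\<kappa> \<in> boxes \<tau>" for \<kappa>
    using that \<beta>_carrier by (simp add: TEv proj_\<beta>)
  have xE: "x * E = E * x"
    unfolding E_def using x x_proj
    by (simp add: mult_minus_distrib_mat[of _ n n _ n] minus_mult_distrib_mat[of _ n n _ _ n])
  have xpE: "x ^\<^sub>m c * E = E * x ^\<^sub>m c" for c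
  proof (induction c)
    case (Suc c)
    have "x ^\<^sub>m c * x * E = x ^\<^sub>m c * E * x"
      using xE x xp E by (simp add: assoc_mult_mat[of _ n n _ n _ n])
    then show ?case using Suc x xp E by (simp add: pow_mat.simps(2) assoc_mult_mat[of _ n n _ n _ n])
  qed (use x E in simp)
  have EE: "E * E = E"
  proof -
    have "E * proj = 0\<^sub>m n n"
      unfolding E_def by (subst minus_mult_distrib_mat[of _ n n _ _ n])
        (simp_all add: proj_idem left_mult_one_mat[OF proj_carrier] minus_r_inv_mat[OF proj_carrier])
    moreover have "E * E = E - E * proj"
      using E by (subst (2) E_def) (simp add: mult_minus_distrib_mat[of _ n n _ n])
    ultimately show ?thesis using E by (auto intro!: eq_matI)
  qed
  have homE: "hom_mat p True E"
    using hom_proj unfolding hom_mat_def E_def by (auto simp: carrier_matD[OF proj_carrier])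
  have "E \<noteq> 0\<^sub>m n n"
  proof
    assume 0: "E = 0\<^sub>m n n"
    have "proj = 1\<^sub>m n"
    proof (rule eq_matI)
      fix i j assume "i < dim_row (1\<^sub>m n :: complex mat)" "j < dim_col (1\<^sub>m n :: complex mat)"
      then have "E $$ (i, j) = 0" "i < n" "j < n" using 0 by auto
      then show "proj $$ (i, j) = 1\<^sub>m n $$ (i, j)"
        unfolding E_def using carrier_matD[OF proj_carrier] by auto
    qed (use carrier_matD[OF proj_carrier] in auto)
    with ne show False by simp
  qed
  define N where "N = (LEAST N. x ^\<^sub>m Suc N * E = 0\<^sub>m n n)"
  have "x ^\<^sub>m Suc m * E = 0\<^sub>m n n"
    using x E pow_mat_add[OF x, of m 1] nil by simp
  then have N: "x ^\<^sub>m Suc N * E = 0\<^sub>m n n"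
    unfolding N_def by (rule LeastI)
  have N0: "x ^\<^sub>m N * E \<noteq> 0\<^sub>m n n"
  proof (cases N)
    case 0
    then show ?thesis using \<open>E \<noteq> 0\<^sub>m n n\<close> x E by simp
  next
    case (Suc N')
    then have "N' < (LEAST N. x ^\<^sub>m Suc N * E = 0\<^sub>m n n)" by (simp add: N_def)
    from not_less_Least[OF this] show ?thesis using Suc by simp
  qed
  have Nc: "x ^\<^sub>m c * E = 0\<^sub>m n n" if "c > N" for c
  proof -
    obtain d where "c = d + Suc N" using \<open>c > N\<close> by (metis Suc_leI add.commute le_Suc_ex)
    then have "x ^\<^sub>m c * E = x ^\<^sub>m d * (x ^\<^sub>m Suc N * E)"
      using assoc_mult_mat[OF xp(1) xp(1) E, of d "Suc N"] pow_mat_add[OF x, of d "Suc N"] by simp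
    then show ?thesis using N right_mult_zero_mat[OF xp(1)] by simp
  qed
  \<comment> \<open>A nonzero entry of \<open>x^N E\<close> names a homogeneous vector,
    \<open>E\<close> applied to the unit vector \<open>j0\<close>, and a homogeneous covector, row
    \<open>i0\<close> of \<open>E\<close>, which pair nontrivially through
    \<open>x^N\<close>.\<close>
  obtain i0 j0 where ij: "i0 < n" "j0 < n" "(x ^\<^sub>m N * E) $$ (i0, j0) \<noteq> 0"
  proof -
    have "\<exists>i<n. \<exists>j<n. (x ^\<^sub>m N * E) $$ (i, j) \<noteq> 0"
    proof (rule ccontr)
      assume "\<not> ?thesis"
      then have "x ^\<^sub>m N * E = 0\<^sub>m n n" using E xp[of N] by (intro eq_matI) auto
      then show False using N0 by simp
    qed
    then show ?thesis using that by blast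
  qed
  define v where "v = E *\<^sub>v unit_vec n j0"
  have v: "v \<in> carrier_vec n" using E by (simp add: v_def)
  have homu: "hom_vec p (i < p) (unit_vec n i)" if "i < n" for i
    using that by (auto simp: hom_vec_def unit_vec_def)
  have Ev_v: "E *\<^sub>v v = v"
    unfolding v_def using E EE assoc_mult_mat_vec[of E n n E n "unit_vec n j0"] by simp
  have xv: "x ^\<^sub>m c *\<^sub>v v = (x ^\<^sub>m c * E) *\<^sub>v unit_vec n j0" for c
    unfolding v_def using E xp assoc_mult_mat_vec[of "x ^\<^sub>m c" n n E n "unit_vec n j0"] by simp
  have xv0: "x ^\<^sub>m c *\<^sub>v v = 0\<^sub>v n" if "c > N" for c
    unfolding xv Nc[OF that] by (intro eq_vecI) auto
  have homv: "hom_vec p (j0 < p) v"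
    using hom_vec_mult[OF homE homu[OF ij(2)] E] unfolding v_def by simp
  define \<phi>0 where "\<phi>0 = transpose_mat E *\<^sub>v unit_vec n i0"
  have \<phi>0: "\<phi>0 \<in> carrier_vec n" using E by (simp add: \<phi>0_def)
  have E\<phi>0: "transpose_mat E *\<^sub>v \<phi>0 = \<phi>0"
    unfolding \<phi>0_def using E EE transpose_mult[OF E E]
      assoc_mult_mat_vec[of "transpose_mat E" n n "transpose_mat E" n "unit_vec n i0"] by simp
  have \<phi>0v: "\<phi>0 \<bullet> (x ^\<^sub>m c *\<^sub>v v) = (x ^\<^sub>m c * E) $$ (i0, j0)" for c
  proof -
    have xvc: "x ^\<^sub>m c *\<^sub>v v \<in> carrier_vec n" by (rule xpv[OF v])
    have "\<phi>0 \<bullet> (x ^\<^sub>m c *\<^sub>v v) = unit_vec n i0 \<bullet> (E *\<^sub>v (x ^\<^sub>m c *\<^sub>v v))"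
      unfolding \<phi>0_def by (rule scalar_prod_mult_mat_vec[OF E xvc]) simp
    also have "E *\<^sub>v (x ^\<^sub>m c *\<^sub>v v) = x ^\<^sub>m c *\<^sub>v (E *\<^sub>v v)"
      using assoc_mult_mat_vec[of E n n "x ^\<^sub>m c" n v] assoc_mult_mat_vec[of "x ^\<^sub>m c" n n E n v] E xp v xpE
      by simp
    also have "unit_vec n i0 \<bullet> (x ^\<^sub>m c *\<^sub>v (E *\<^sub>v v)) = (x ^\<^sub>m c *\<^sub>v v) $ i0"
      unfolding Ev_v using ij xvc by (intro scalar_prod_left_unit)
    also have "\<dots> = (x ^\<^sub>m c * E) $$ (i0, j0)"
    proof -
      have M: "x ^\<^sub>m c * E \<in> carrier_mat n n" by (rule mult_carrier_mat[OF xp(1) E])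
      have "(x ^\<^sub>m c *\<^sub>v v) $ i0 = row (x ^\<^sub>m c * E) i0 \<bullet> unit_vec n j0"
        unfolding xv using carrier_matD[OF M] ij by (intro index_mult_mat_vec) simp
      also have "\<dots> = row (x ^\<^sub>m c * E) i0 $ j0"
        using M ij by (intro scalar_prod_right_unit) auto
      also have "\<dots> = (x ^\<^sub>m c * E) $$ (i0, j0)"
        using carrier_matD[OF M] ij by (intro index_row) auto
      finally show ?thesis .
    qed
    finally show ?thesis .
  qed
  have hom\<phi>0: "hom_vec p (i0 < p) \<phi>0"
    using hom_vec_mult[OF hom_mat_transpose[OF homE] homu[OF ij(1)] transpose_carrier_mat[THEN iffD2, OF E]]
    unfolding \<phi>0_def by simp
  have homxv: "hom_vec p (shift e c (j0 < p)) (x ^\<^sub>m c *\<^sub>v v)" for c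
    by (rule hom_vec_pow_mult[OF hom_x homv x v])
  have par: "(i0 < p) = shift e N (j0 < p)"
    by (rule hom_vec_scalar_prod[OF hom\<phi>0 homxv \<phi>0]) (use xpv[OF v] \<phi>0v ij in auto)
  text \<open>Subtracting multiples of shifted covectors makes the pairing a delta function.\<close>
  have "\<exists>\<phi>. \<phi> \<in> carrier_vec n \<and> transpose_mat E *\<^sub>v \<phi> = \<phi> \<and> hom_vec p (i0 < p) \<phi> \<and>
      (\<forall>c. c + d \<ge> N \<longrightarrow> \<phi> \<bullet> (x ^\<^sub>m c *\<^sub>v v) = (if c = N then 1 else 0))" for d
  proof (induction d)
    case 0
    define r where "r = (x ^\<^sub>m N * E) $$ (i0, j0)"
    have "((1 / r) \<cdot>\<^sub>v \<phi>0) \<bullet> (x ^\<^sub>m c *\<^sub>v v) = (if c = N then 1 else 0)" if "c + 0 \<ge> N" for c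
    proof (cases "c = N")
      case True
      then show ?thesis using \<phi>0v[of N] \<phi>0 xpv(1)[OF v, of N] ij by (simp add: r_def)
    next
      case False
      then show ?thesis using that xv0[of c] \<phi>0 by simp
    qed
    then show ?case
      using \<phi>0 hom\<phi>0 E\<phi>0 E mult_mat_vec[of "transpose_mat E" n n \<phi>0 "1 / r"]
      by (intro exI[of _ "(1 / r) \<cdot>\<^sub>v \<phi>0"]) (auto simp: hom_vec_smult)
  next
    case (Suc d)
    then obtain \<phi> where \<phi>: "\<phi> \<in> carrier_vec n" "transpose_mat E *\<^sub>v \<phi> = \<phi>" "hom_vec p (i0 < p) \<phi>"
      and \<phi>p: "\<And>c. c + d \<ge> N \<Longrightarrow> \<phi> \<bullet> (x ^\<^sub>m c *\<^sub>v v) = (if c = N then 1 else 0)" by blast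
    show ?case
    proof (cases "d \<ge> N")
      case True
      then show ?thesis using \<phi> \<phi>p by (intro exI[of _ \<phi>]) auto
    next
      case False
      define c0 where "c0 = N - Suc d"
      have c0: "c0 + Suc d = N" using False by (simp add: c0_def)
      define r where "r = \<phi> \<bullet> (x ^\<^sub>m c0 *\<^sub>v v)"
      define \<psi> where "\<psi> = transpose_mat (x ^\<^sub>m Suc d) *\<^sub>v \<phi>"
      have \<psi>: "\<psi> \<in> carrier_vec n" unfolding \<psi>_def by (rule xpv[OF \<phi>(1)])
      have \<psi>v: "\<psi> \<bullet> (x ^\<^sub>m c *\<^sub>v v) = \<phi> \<bullet> (x ^\<^sub>m (Suc d + c) *\<^sub>v v)" for c
      proof -
        have "\<psi> \<bullet> (x ^\<^sub>m c *\<^sub>v v) = \<phi> \<bullet> (x ^\<^sub>m Suc d *\<^sub>v (x ^\<^sub>m c *\<^sub>v v))"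
          unfolding \<psi>_def by (rule scalar_prod_mult_mat_vec[of _ n n]) (use xp xpv[OF v] \<phi> in auto)
        then show ?thesis unfolding pow_mult_vec_add[OF x v] .
      qed
      have E\<psi>: "transpose_mat E *\<^sub>v \<psi> = \<psi>"
      proof -
        have "transpose_mat E *\<^sub>v \<psi> = transpose_mat (x ^\<^sub>m Suc d * E) *\<^sub>v \<phi>"
          unfolding \<psi>_def transpose_mult[OF xp(1) E]
          by (rule assoc_mult_mat_vec[symmetric, of _ n n _ n]) (use xp E \<phi> in auto)
        also have "\<dots> = transpose_mat (x ^\<^sub>m Suc d) *\<^sub>v (transpose_mat E *\<^sub>v \<phi>)"
          unfolding xpE transpose_mult[OF E xp(1)]
          by (rule assoc_mult_mat_vec[of _ n n _ n]) (use xp E \<phi> in auto)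
        finally show ?thesis using \<phi> by (simp add: \<psi>_def)
      qed
      \<comment> \<open>A correction takes place only if \<open>r\<close> is nonzero. Then
        \<open>x^c0 v\<close> has the parity of the covector, which is also that of
        \<open>x^N v\<close>, so the power \<open>Suc d = N - c0\<close> of \<open>x\<close> keeps
        parities.\<close>
      have hom\<psi>: "r = 0 \<or> hom_vec p (i0 < p) \<psi>"
      proof (cases "r = 0")
        case False
        have "(i0 < p) = shift e c0 (j0 < p)"
          by (rule hom_vec_scalar_prod[OF \<phi>(3) homxv \<phi>(1)]) (use xpv[OF v] False in \<open>auto simp: r_def\<close>)
        then have "e \<or> even (Suc d)"
          using par c0 by (auto simp: shift_def split: if_splits)
        then show ?thesis
          using hom_vec_mult[OF hom_mat_transpose[OF hom_mat_pow[OF hom_x x, of "Suc d"]] \<phi>(3) xp(2) \<phi>(1)]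
          unfolding \<psi>_def by auto
      qed simp
      \<comment> \<open>The value at \<open>c0\<close> is cancelled because \<open>\<psi>\<close>
        sees it at the exponent \<open>N\<close>, where the pairing is 1; the values at larger
        exponents stay, because \<open>\<psi>\<close> sees them beyond \<open>N\<close>, where the
        chain is zero.\<close>
      define \<phi>' where "\<phi>' = \<phi> - r \<cdot>\<^sub>v \<psi>"
      have "\<phi>' \<in> carrier_vec n" using \<phi> \<psi> by (simp add: \<phi>'_def)
      moreover have "transpose_mat E *\<^sub>v \<phi>' = \<phi>'"
        unfolding \<phi>'_def using \<phi> \<psi> E E\<psi> mult_mat_vec[of "transpose_mat E" n n \<psi> r]
        by (subst mult_minus_distrib_mat_vec[of _ n n]) auto
      moreover have "hom_vec p (i0 < p) \<phi>'"
      proof (cases "r = 0")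
        case True
        then have "\<phi>' = \<phi>" unfolding \<phi>'_def using \<phi>(1) \<psi> by (intro eq_vecI) auto
        then show ?thesis using \<phi> by simp
      next
        case False
        then show ?thesis unfolding \<phi>'_def using hom\<psi> \<phi> \<psi>
          by (intro hom_vec_minus[of _ _ _ _ n] hom_vec_smult) auto
      qed
      moreover have "\<phi>' \<bullet> (x ^\<^sub>m c *\<^sub>v v) = (if c = N then 1 else 0)" if c: "c + Suc d \<ge> N" for c
      proof -
        have "x ^\<^sub>m c *\<^sub>v v \<in> carrier_vec n" by (rule xpv[OF v])
        then have eq: "\<phi>' \<bullet> (x ^\<^sub>m c *\<^sub>v v) = \<phi> \<bullet> (x ^\<^sub>m c *\<^sub>v v) - r * (\<phi> \<bullet> (x ^\<^sub>m (Suc d + c) *\<^sub>v v))"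
          unfolding \<phi>'_def \<psi>v[symmetric] using \<phi> \<psi> by (simp add: minus_scalar_prod_distrib[of _ n])
        show ?thesis
        proof (cases "c = c0")
          case True
          then show ?thesis using eq c0 \<phi>p[of N] by (simp add: r_def add.commute)
        next
          case False
          then have "c + d \<ge> N" "Suc d + c > N" using c c0 by auto
          then show ?thesis using eq \<phi>p[of c] xv0[of "Suc d + c"] \<phi>(1) by simp
        qed
      qed
      ultimately show ?thesis by blast
    qed
  qed
  from this[of N] obtain \<phi> where \<phi>: "\<phi> \<in> carrier_vec n" "transpose_mat E *\<^sub>v \<phi> = \<phi>" "hom_vec p (i0 < p) \<phi>"
    and \<phi>p: "\<And>c. \<phi> \<bullet> (x ^\<^sub>m c *\<^sub>v v) = (if c = N then 1 else 0)" by auto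
  have Exv: "E *\<^sub>v (x ^\<^sub>m c *\<^sub>v u) = x ^\<^sub>m c *\<^sub>v (E *\<^sub>v u)" if "u \<in> carrier_vec n" for c u
    using assoc_mult_mat_vec[of E n n "x ^\<^sub>m c" n u] assoc_mult_mat_vec[of "x ^\<^sub>m c" n n E n u] E xp that xpE
    by simp
  have "jordan_frame p n e x (\<tau> @ [(i0 < p, Suc N)])
    (\<lambda>\<kappa>. if fst \<kappa> = length \<tau> then x ^\<^sub>m (N - snd \<kappa>) *\<^sub>v v else b \<kappa>)
    (\<lambda>\<kappa>. if fst \<kappa> = length \<tau> then transpose_mat (x ^\<^sub>m snd \<kappa>) *\<^sub>v \<phi> else \<beta> \<kappa>)"
  proof (rule extend[OF v \<phi>(1) _ _ \<phi>p _ _ \<phi>(3)])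
    fix \<kappa> c assume k: "\<kappa> \<in> boxes \<tau>"
    have xvc: "x ^\<^sub>m c *\<^sub>v v \<in> carrier_vec n" "x ^\<^sub>m c *\<^sub>v b \<kappa> \<in> carrier_vec n"
      using xpv[OF v] xpv[OF b_carrier[OF k]] by auto
    have "\<beta> \<kappa> \<bullet> (x ^\<^sub>m c *\<^sub>v v) = \<beta> \<kappa> \<bullet> (E *\<^sub>v (x ^\<^sub>m c *\<^sub>v v))"
      using Exv[OF v] Ev_v by simp
    also have "\<dots> = 0"
      using scalar_prod_mult_mat_vec[OF E xvc(1) \<beta>_carrier[OF k]] E\<beta>[OF k] xvc by simp
    finally show "\<beta> \<kappa> \<bullet> (x ^\<^sub>m c *\<^sub>v v) = 0" .
    have "\<phi> \<bullet> (x ^\<^sub>m c *\<^sub>v b \<kappa>) = \<phi> \<bullet> (E *\<^sub>v (x ^\<^sub>m c *\<^sub>v b \<kappa>))"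
      using scalar_prod_mult_mat_vec[OF E xvc(2) \<phi>(1)] \<phi>(2) by simp
    also have "\<dots> = 0"
      using Exv[OF b_carrier[OF k]] Eb[OF k] \<phi>(1) mult_mat_zero_vec[OF xp(1)] by simp
    finally show "\<phi> \<bullet> (x ^\<^sub>m c *\<^sub>v b \<kappa>) = 0" .
  next
    show "x ^\<^sub>m Suc N *\<^sub>v v = 0\<^sub>v n" by (rule xv0) simp
    have "transpose_mat (x ^\<^sub>m Suc N) *\<^sub>v \<phi> = transpose_mat (x ^\<^sub>m Suc N) *\<^sub>v (transpose_mat E *\<^sub>v \<phi>)"
      using \<phi> by simp
    also have "\<dots> = transpose_mat (E * x ^\<^sub>m Suc N) *\<^sub>v \<phi>"
      unfolding transpose_mult[OF E xp(1)]
      by (rule assoc_mult_mat_vec[symmetric, of _ n n _ n]) (use xp E \<phi> in auto)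
    also have "\<dots> = 0\<^sub>v n" unfolding xpE[symmetric] N using \<phi>(1) by (simp add: zero_mat_mult_vec)
    finally show "transpose_mat (x ^\<^sub>m Suc N) *\<^sub>v \<phi> = 0\<^sub>v n" .
    show "hom_vec p (shift e N (i0 < p)) v"
      using homv par by (auto simp: shift_def split: if_splits)
  qed
  then show ?thesis by blast
qed

end

text \<open>A frame with the largest number of boxes has \<open>proj\<close> equal to the identity,
  since otherwise it could be extended. Empty rows are excluded because they would be invisible to
  all kernel dimensions, from which the type is later recovered.\<close>

theorem exists_jordan_frame:
  assumes x: "x \<in> carrier_mat n n" and hom: "hom_mat p e x" and nil: "x ^\<^sub>m m = 0\<^sub>m n n"
  shows "\<exists>\<tau> b \<beta>. jordan_frame p n e x \<tau> b \<beta> \<and> jordan_frame.proj n \<tau> b \<beta> = 1\<^sub>m n \<and> (\<forall>t\<in>set \<tau>. snd t > 0)"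
proof -
  define P where "P = (\<lambda>\<tau>. (\<exists>b \<beta>. jordan_frame p n e x \<tau> b \<beta>) \<and> (\<forall>t\<in>set \<tau>. snd t > 0))"
  have "P []"
  proof -
    have "jordan_frame p n e x [] (\<lambda>_. 0\<^sub>v n) (\<lambda>_. 0\<^sub>v n)"
      by unfold_locales (auto simp: boxes_def x hom)
    then show ?thesis unfolding P_def by auto
  qed
  moreover have "card (boxes \<tau>) \<le> n" if "P \<tau>" for \<tau>
    using that jordan_frame.card_boxes_le unfolding P_def by blast
  ultimately obtain \<tau> where \<tau>: "P \<tau>" and max: "\<And>\<tau>'. P \<tau>' \<Longrightarrow> card (boxes \<tau>') \<le> card (boxes \<tau>)"
    using ex_has_greatest_nat[of P "[]" "\<lambda>\<tau>. card (boxes \<tau>)" "Suc n"] by (metis le_imp_less_Suc)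
  then obtain b \<beta> where fr: "jordan_frame p n e x \<tau> b \<beta>" unfolding P_def by blast
  interpret jordan_frame p n e x \<tau> b \<beta> by (rule fr)
  have "proj = 1\<^sub>m n"
  proof (rule ccontr)
    assume "proj \<noteq> 1\<^sub>m n"
    from exists_extension[OF nil this] obtain s N where "P (\<tau> @ [(s, Suc N)])"
      using \<tau> unfolding P_def by fastforce
    moreover have "card (boxes (\<tau> @ [(s, Suc N)])) = card (boxes \<tau>) + Suc N"
      unfolding boxes_append by (subst card_Un_disjoint) (auto simp: boxes_def)
    ultimately show False using max by force
  qed
  then show ?thesis using fr \<tau> unfolding P_def by blast
qed

section \<open>Dimensions of subspaces\<close>

lemma is_subspaceI:
  assumes "W \<subseteq> carrier_vec n" "0\<^sub>v n \<in> W" "\<And>u v. u \<in> W \<Longrightarrow> v \<in> W \<Longrightarrow> u + v \<in> W"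
    "\<And>c v. v \<in> W \<Longrightarrow> c \<cdot>\<^sub>v v \<in> W"
  shows "is_subspace n W"
  unfolding is_subspace_def
  by (intro subspace.intro submodule.intro vec_vs vec_module) (use assms in \<open>auto simp: module_vec_simps\<close>)

text \<open>A basis of \<open>W\<close> together with covectors on the whole space. Independence and
  spanning become one duality relation and one expansion formula, and this form is carried along
  easily by conjugation (\<open>dual_frame_image\<close>) and by restriction to a block of
  coordinates (\<open>dual_frame_restrict\<close>).\<close>

definition dual_frame :: "nat \<Rightarrow> complex vec set \<Rightarrow> 't set \<Rightarrow> ('t \<Rightarrow> complex vec) \<Rightarrow> ('t \<Rightarrow> complex vec) \<Rightarrow> bool" where
  "dual_frame n W T b \<beta> \<longleftrightarrow> W \<subseteq> carrier_vec n \<and> 0\<^sub>v n \<in> W \<and>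
    (\<forall>u\<in>W. \<forall>v\<in>W. u + v \<in> W) \<and> (\<forall>c. \<forall>v\<in>W. c \<cdot>\<^sub>v v \<in> W) \<and> finite T \<and>
    (\<forall>t\<in>T. b t \<in> W \<and> \<beta> t \<in> carrier_vec n) \<and>
    (\<forall>t\<in>T. \<forall>t'\<in>T. \<beta> t \<bullet> b t' = (if t = t' then 1 else 0)) \<and>
    (\<forall>u\<in>W. \<forall>i<n. u $ i = (\<Sum>t\<in>T. (\<beta> t \<bullet> u) * b t $ i))"

lemma dual_frameI:
  assumes "W \<subseteq> carrier_vec n" "0\<^sub>v n \<in> W" "\<And>u v. u \<in> W \<Longrightarrow> v \<in> W \<Longrightarrow> u + v \<in> W"
    "\<And>c v. v \<in> W \<Longrightarrow> c \<cdot>\<^sub>v v \<in> W" "finite T"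
    "\<And>t. t \<in> T \<Longrightarrow> b t \<in> W" "\<And>t. t \<in> T \<Longrightarrow> \<beta> t \<in> carrier_vec n"
    "\<And>t t'. t \<in> T \<Longrightarrow> t' \<in> T \<Longrightarrow> \<beta> t \<bullet> b t' = (if t = t' then 1 else 0)"
    "\<And>u i. u \<in> W \<Longrightarrow> i < n \<Longrightarrow> u $ i = (\<Sum>t\<in>T. (\<beta> t \<bullet> u) * b t $ i)"
  shows "dual_frame n W T b \<beta>"
  unfolding dual_frame_def by (intro conjI ballI allI impI) (rule assms; assumption)+

lemma dual_frame_dim:
  assumes "dual_frame n W T b \<beta>"
  shows "is_subspace n W" "subspace_dim n W = card T"
proof -
  note f = assms[unfolded dual_frame_def]
  show W: "is_subspace n W" by (rule is_subspaceI) (use f in blast)+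
  have finT: "finite T" and bW: "\<And>t. t \<in> T \<Longrightarrow> b t \<in> W" and \<beta>: "\<And>t. t \<in> T \<Longrightarrow> \<beta> t \<in> carrier_vec n"
    using f by blast+
  have dual: "\<beta> t \<bullet> b t' = (if t = t' then 1 else 0)" if "t \<in> T" "t' \<in> T" for t t' using f that by blast
  have span: "u $ i = (\<Sum>t\<in>T. (\<beta> t \<bullet> u) * b t $ i)" if "u \<in> W" "i < n" for u i using f that by blast
  interpret vec_space "TYPE(complex)" n .
  have sub: "submodule class_ring W V" and vs: "vectorspace class_ring (V\<lparr>carrier := W\<rparr>)"
    using W subspace_is_vs unfolding is_subspace_def subspace_def by auto
  have Wc: "W \<subseteq> carrier_vec n" using submodule.subset[OF sub] by simp
  have inj: "inj_on b T"
    by (rule inj_onI) (metis dual zero_neq_one)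
  let ?B = "b ` T"
  have BW: "?B \<subseteq> W" and B: "?B \<subseteq> carrier_vec n" and finB: "finite ?B"
    using bW Wc finT by auto
  have idx: "lincomb a ?B $ i = (\<Sum>t\<in>T. a (b t) * b t $ i)" if "i < n" for a i
    using lincomb_index[OF that B, of a] inj by (simp add: sum.reindex)
  have li: "lin_indpt ?B"
  proof (rule finite_lin_indpt2[OF finB])
    show "?B \<subseteq> carrier_vec n" by (rule B)
    fix a assume 0: "lincomb a ?B = 0\<^sub>v n"
    have lc: "lincomb a ?B \<in> carrier_vec n" using B by (simp add: lincomb_closed)
    \<comment> \<open>Pairing the vanishing combination with \<open>\<beta> t\<close> isolates the
      coefficient of \<open>b t\<close>.\<close>
    have "a (b t) = 0" if t: "t \<in> T" for t
    proof -
      have "\<beta> t \<bullet> lincomb a ?B = (\<Sum>l<n. \<Sum>t'\<in>T. a (b t') * (\<beta> t $ l * b t' $ l))"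
        unfolding scalar_prod_sum[OF lc] by (simp add: idx sum_distrib_left mult_ac)
      also have "\<dots> = (\<Sum>t'\<in>T. a (b t') * (\<beta> t \<bullet> b t'))"
        by (subst sum.swap, intro sum.cong refl)
          (use B in \<open>auto simp: scalar_prod_sum[of _ n] sum_distrib_left\<close>)
      also have "\<dots> = (\<Sum>t'\<in>T. if t' = t then a (b t') else 0)"
        by (intro sum.cong refl) (use dual t in auto)
      also have "\<dots> = a (b t)" using t finT by simp
      finally show ?thesis using 0 \<beta>[OF t] by simp
    qed
    then show "\<forall>v\<in>?B. a v = 0" by auto
  qed
  have "span ?B = W"
  proof
    show "span ?B \<subseteq> W"
      using span_is_subset[OF BW sub] .
    show "W \<subseteq> span ?B"
    proof
      fix u assume u: "u \<in> W"
      define a where "a = (\<lambda>v. \<beta> (the_inv_into T b v) \<bullet> u)"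
      have "u = lincomb a ?B"
      proof (rule eq_vecI)
        fix i assume "i < dim_vec (lincomb a ?B)"
        then have i: "i < n" using lincomb_closed[of ?B a] B by (auto simp: lincomb_dim finB)
        have "a (b t) = \<beta> t \<bullet> u" if "t \<in> T" for t
          using that inj by (simp add: a_def the_inv_into_f_f)
        then show "u $ i = lincomb a ?B $ i" using idx[OF i, of a] span[OF u i] by simp
      qed (use u Wc B finB in \<open>auto simp: lincomb_dim\<close>)
      then show "u \<in> span ?B"
        using finB by (rule in_spanI) auto
    qed
  qed
  moreover note span_li_not_depend[OF BW sub]
  ultimately have "vectorspace.basis class_ring (V\<lparr>carrier := W\<rparr>) ?B"
    using li BW by (subst vectorspace.basis_def[OF vs]) auto
  then have "vectorspace.dim class_ring (V\<lparr>carrier := W\<rparr>) = card ?B"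
    using vectorspace.dim_basis[OF vs finB] by simp
  then show "subspace_dim n W = card T" using inj unfolding subspace_dim_def by (simp add: card_image)
qed

section \<open>Graded kernels and ranks of powers\<close>

definition graded_part :: "nat \<Rightarrow> nat \<Rightarrow> bool \<Rightarrow> complex vec set" where
  "graded_part p n \<epsilon> = {v \<in> carrier_vec n. hom_vec p \<epsilon> v}"

definition graded_proj :: "nat \<Rightarrow> nat \<Rightarrow> bool \<Rightarrow> complex mat" where
  "graded_proj p n \<epsilon> = mat n n (\<lambda>(i, j). if i = j \<and> (i < p) = \<epsilon> then 1 else 0)"

lemma graded_proj_carrier[simp]: "graded_proj p n \<epsilon> \<in> carrier_mat n n"
  by (simp add: graded_proj_def)

lemma mult_graded_proj_index:
  assumes "A \<in> carrier_mat m n" "i < m" "j < n"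
  shows "(A * graded_proj p n \<epsilon>) $$ (i, j) = (if (j < p) = \<epsilon> then A $$ (i, j) else 0)"
proof -
  have "(A * graded_proj p n \<epsilon>) $$ (i, j) =
      (\<Sum>l<n. if l = j then A $$ (i, j) * (if (j < p) = \<epsilon> then 1 else 0) else 0)"
    unfolding mult_mat_sum[OF assms(1) graded_proj_carrier assms(2,3)]
    by (intro sum.cong refl) (use assms in \<open>auto simp: graded_proj_def\<close>)
  then show ?thesis using assms by simp
qed

lemma graded_proj_mult_vec:
  assumes "u \<in> carrier_vec n" "hom_vec p s u"
  shows "graded_proj p n \<epsilon> *\<^sub>v u = (if s = \<epsilon> then u else 0\<^sub>v n)"
proof (rule eq_vecI)
  fix i assume "i < dim_vec (if s = \<epsilon> then u else 0\<^sub>v n)"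
  then have i: "i < n" using assms by (auto split: if_splits)
  have "(graded_proj p n \<epsilon> *\<^sub>v u) $ i = (\<Sum>l<n. if l = i then (if (i < p) = \<epsilon> then u $ i else 0) else 0)"
    unfolding mult_mat_vec_sum[OF graded_proj_carrier assms(1) i]
    by (intro sum.cong refl) (use i in \<open>auto simp: graded_proj_def\<close>)
  then show "(graded_proj p n \<epsilon> *\<^sub>v u) $ i = (if s = \<epsilon> then u else 0\<^sub>v n) $ i"
    using i assms by (auto simp: hom_vec_def)
qed (use assms in \<open>auto simp: graded_proj_def\<close>)

context jordan_frame
begin

lemma pow_b: "(k, a) \<in> boxes \<tau> \<Longrightarrow> x ^\<^sub>m m *\<^sub>v b (k, a) = (if m \<le> a then b (k, a - m) else 0\<^sub>v n)"
proof (induction m)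
  case 0
  then show ?case using x b_carrier[of "(k, a)"] by simp
next
  case (Suc m)
  have "x ^\<^sub>m Suc m *\<^sub>v b (k, a) = x *\<^sub>v (x ^\<^sub>m m *\<^sub>v b (k, a))"
    using mult_pow_mult_vec[OF x b_carrier[OF Suc.prems]] by simp
  also have "\<dots> = (if Suc m \<le> a then b (k, a - Suc m) else 0\<^sub>v n)"
  proof (cases "m < a")
    case True
    then have "(k, Suc (a - Suc m)) \<in> boxes \<tau>" "a - m = Suc (a - Suc m)"
      using Suc.prems by (auto simp: boxes_def)
    then show ?thesis using Suc x_b_Suc[of k "a - Suc m"] True by simp
  next
    case False
    have "(k, 0) \<in> boxes \<tau>" using Suc.prems by (auto simp: boxes_def)
    then show ?thesis using Suc False x_b_0[of k] mult_mat_zero_vec[OF x] by (cases "m = a") auto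
  qed
  finally show ?case .
qed

lemma pow_\<beta>:
  "(k, a) \<in> boxes \<tau> \<Longrightarrow> transpose_mat (x ^\<^sub>m m) *\<^sub>v \<beta> (k, a) = (if (k, a + m) \<in> boxes \<tau> then \<beta> (k, a + m) else 0\<^sub>v n)"
proof (induction m)
  case 0
  then show ?case using x \<beta>_carrier[of "(k, a)"] by simp
next
  case (Suc m)
  have xm: "x ^\<^sub>m m \<in> carrier_mat n n" using x by simp
  have "transpose_mat (x ^\<^sub>m Suc m) *\<^sub>v \<beta> (k, a) = transpose_mat x *\<^sub>v (transpose_mat (x ^\<^sub>m m) *\<^sub>v \<beta> (k, a))"
    unfolding pow_mat.simps transpose_mult[OF xm x]
    by (rule assoc_mult_mat_vec[of _ n n _ n]) (use x xm \<beta>_carrier[OF Suc.prems] in auto)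
  also have "\<dots> = (if (k, a + Suc m) \<in> boxes \<tau> then \<beta> (k, a + Suc m) else 0\<^sub>v n)"
  proof (cases "(k, a + m) \<in> boxes \<tau>")
    case True
    then show ?thesis using Suc \<beta>_x[OF True] by simp
  next
    case False
    then have "(k, a + Suc m) \<notin> boxes \<tau>" by (auto simp: boxes_def)
    then show ?thesis using Suc False mult_mat_zero_vec[OF transpose_carrier_mat[THEN iffD2, OF x]] by simp
  qed
  finally show ?case .
qed

end

text \<open>The boxes of parity \<epsilon> in the first \<open>m\<close> columns index a basis of
  the kernel of \<open>x^m\<close> on the graded part; the remaining ones, the
  \<open>image_boxes\<close>, count the rank of \<open>x^m\<close> there.\<close>

definition kernel_boxes :: "bool \<Rightarrow> jordan_type \<Rightarrow> nat \<Rightarrow> bool \<Rightarrow> (nat \<times> nat) set" where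
  "kernel_boxes e \<tau> m \<epsilon> = {\<kappa> \<in> boxes \<tau>. snd \<kappa> < m \<and> box_parity e \<tau> \<kappa> = \<epsilon>}"

definition image_boxes :: "bool \<Rightarrow> jordan_type \<Rightarrow> nat \<Rightarrow> bool \<Rightarrow> (nat \<times> nat) set" where
  "image_boxes e \<tau> m \<epsilon> = {\<kappa> \<in> boxes \<tau>. m \<le> snd \<kappa> \<and> box_parity e \<tau> \<kappa> = \<epsilon>}"

lemma finite_kernel_boxes[simp]: "finite (kernel_boxes e \<tau> m \<epsilon>)"
  by (simp add: kernel_boxes_def)

lemma finite_image_boxes[simp]: "finite (image_boxes e \<tau> m \<epsilon>)"
  by (simp add: image_boxes_def)

locale full_jordan_frame = jordan_frame +
  assumes proj_one: "proj = 1\<^sub>m n"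
begin

lemma expand_vec:
  assumes "u \<in> carrier_vec n" "i < n"
  shows "u $ i = (\<Sum>\<kappa>\<in>boxes \<tau>. (\<beta> \<kappa> \<bullet> u) * b \<kappa> $ i)"
  using proj_mult_vec_index[OF assms] assms by (simp add: proj_one)

lemma pow_carrier: "x ^\<^sub>m m \<in> carrier_mat n n"
  using x by simp

text \<open>A covector in a column \<open>a\<close> with \<open>m \<le> a\<close> is the covector in
  column \<open>a - m\<close> composed with \<open>x^m\<close>, so it vanishes on the kernel of
  \<open>x^m\<close>. A covector of the other parity vanishes on \<open>u\<close> by
  homogeneity.\<close>

lemma kernel_scalar_prod:
  assumes "u \<in> carrier_vec n" "hom_vec p \<epsilon> u" "x ^\<^sub>m m *\<^sub>v u = 0\<^sub>v n" "\<kappa> \<in> boxes \<tau> - kernel_boxes e \<tau> m \<epsilon>"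
  shows "\<beta> \<kappa> \<bullet> u = 0"
proof (cases "box_parity e \<tau> \<kappa> = \<epsilon>")
  case False
  then show ?thesis
    using hom_vec_scalar_prod[OF hom_\<beta>[of \<kappa>] assms(2) \<beta>_carrier[of \<kappa>] assms(1)] assms(4) by blast
next
  case True
  obtain k a where ka: "\<kappa> = (k, a)" by (cases \<kappa>)
  then have am: "m \<le> a" "(k, a - m) \<in> boxes \<tau>" using True assms(4) by (auto simp: kernel_boxes_def boxes_def)
  then have "\<beta> \<kappa> = transpose_mat (x ^\<^sub>m m) *\<^sub>v \<beta> (k, a - m)"
    using pow_\<beta>[of k "a - m" m] assms(4) ka by simp
  then have "\<beta> \<kappa> \<bullet> u = \<beta> (k, a - m) \<bullet> (x ^\<^sub>m m *\<^sub>v u)"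
    using scalar_prod_mult_mat_vec[OF pow_carrier assms(1) \<beta>_carrier[OF am(2)]] by simp
  then show ?thesis using assms(3) \<beta>_carrier[OF am(2)] by simp
qed

lemma kernel_box_vec:
  assumes "\<kappa> \<in> kernel_boxes e \<tau> m \<epsilon>"
  shows "b \<kappa> \<in> carrier_vec n" "hom_vec p \<epsilon> (b \<kappa>)" "x ^\<^sub>m m *\<^sub>v b \<kappa> = 0\<^sub>v n"
  using assms b_carrier[of \<kappa>] hom_b[of \<kappa>] pow_b[of "fst \<kappa>" "snd \<kappa>" m] by (auto simp: kernel_boxes_def)

lemma expand_kernel_vec:
  assumes "u \<in> carrier_vec n" "hom_vec p \<epsilon> u" "x ^\<^sub>m m *\<^sub>v u = 0\<^sub>v n" "i < n"
  shows "u $ i = (\<Sum>\<kappa>\<in>kernel_boxes e \<tau> m \<epsilon>. (\<beta> \<kappa> \<bullet> u) * b \<kappa> $ i)"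
  unfolding expand_vec[OF assms(1,4)]
  by (rule sum.mono_neutral_right) (use kernel_scalar_prod[OF assms(1-3)] in \<open>auto simp: kernel_boxes_def\<close>)

lemma mem_kernel: "v \<in> graded_part p n \<epsilon> \<inter> mat_kernel (x ^\<^sub>m m) \<longleftrightarrow>
    v \<in> carrier_vec n \<and> hom_vec p \<epsilon> v \<and> x ^\<^sub>m m *\<^sub>v v = 0\<^sub>v n"
  unfolding graded_part_def mat_kernel[OF pow_carrier] by blast

lemma dual_frame_kernel:
  "dual_frame n (graded_part p n \<epsilon> \<inter> mat_kernel (x ^\<^sub>m m)) (kernel_boxes e \<tau> m \<epsilon>) b \<beta>" (is "dual_frame n ?W ?T b \<beta>")
proof (rule dual_frameI)
  show "?W \<subseteq> carrier_vec n" "0\<^sub>v n \<in> ?W" using mult_mat_zero_vec[OF pow_carrier] mem_kernel by (auto simp: hom_vec_def)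
next
  fix u v assume "u \<in> ?W" "v \<in> ?W"
  then show "u + v \<in> ?W" unfolding mem_kernel by (auto simp: hom_vec_def mult_add_distrib_mat_vec[OF pow_carrier])
next
  fix c v assume "v \<in> ?W"
  then show "c \<cdot>\<^sub>v v \<in> ?W" unfolding mem_kernel by (auto simp: hom_vec_def mult_mat_vec[OF pow_carrier])
next
  fix t assume t: "t \<in> ?T"
  then have "t \<in> boxes \<tau>" unfolding kernel_boxes_def by blast
  then show "\<beta> t \<in> carrier_vec n" by (rule \<beta>_carrier)
  show "b t \<in> ?W" unfolding mem_kernel using kernel_box_vec[OF t] by blast
  fix t' assume "t' \<in> ?T"
  then have "t' \<in> boxes \<tau>" unfolding kernel_boxes_def by blast
  then show "\<beta> t \<bullet> b t' = (if t = t' then 1 else 0)" by (rule dual[OF \<open>t \<in> boxes \<tau>\<close>])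
next
  fix u i assume "u \<in> ?W" "i < n"
  then show "u $ i = (\<Sum>t\<in>?T. (\<beta> t \<bullet> u) * b t $ i)"
    using expand_kernel_vec unfolding mem_kernel by blast
qed simp

text \<open>The power \<open>x^m\<close> moves an image box by \<open>m\<close> columns towards the
  kernel end, where the covector of the shifted box detects it.\<close>

lemma rank_ge_pow: "rank_ge (x ^\<^sub>m m * graded_proj p n \<epsilon>) (card (image_boxes e \<tau> m \<epsilon>))"
proof (rule rank_geI[where \<phi> = "\<lambda>\<kappa>. \<beta> (fst \<kappa>, snd \<kappa> - m)" and \<psi> = b])
  fix t assume t: "t \<in> image_boxes e \<tau> m \<epsilon>"
  then have t': "(fst t, snd t - m) \<in> boxes \<tau>" "t \<in> boxes \<tau>" by (auto simp: image_boxes_def boxes_def)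
  then show "\<beta> (fst t, snd t - m) \<in> carrier_vec n" "b t \<in> carrier_vec n"
    using b_carrier \<beta>_carrier by auto
  fix u assume u: "u \<in> image_boxes e \<tau> m \<epsilon>"
  then have u': "(fst u, snd u - m) \<in> boxes \<tau>" "u \<in> boxes \<tau>" by (auto simp: image_boxes_def boxes_def)
  have "(x ^\<^sub>m m * graded_proj p n \<epsilon>) *\<^sub>v b u = x ^\<^sub>m m *\<^sub>v (graded_proj p n \<epsilon> *\<^sub>v b u)"
    by (rule assoc_mult_mat_vec[OF pow_carrier graded_proj_carrier]) (rule b_carrier[OF u'(2)])
  also have "\<dots> = b (fst u, snd u - m)"
    using graded_proj_mult_vec[OF b_carrier hom_b, OF u'(2,2), of \<epsilon>] u pow_b[of "fst u" "snd u" m]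
    by (simp add: image_boxes_def)
  finally show "\<beta> (fst t, snd t - m) \<bullet> ((x ^\<^sub>m m * graded_proj p n \<epsilon>) *\<^sub>v b u) = (if t = u then 1 else 0)"
    using dual[OF t'(1) u'(1)] t u by (auto simp: image_boxes_def prod_eq_iff)
qed (use pow_carrier in \<open>auto intro: mult_carrier_mat[OF pow_carrier]\<close>)

text \<open>Insert the identity in the form of \<open>proj\<close>: a box outside
  \<open>image_boxes\<close> contributes zero, either because \<open>x^m\<close> kills its vector or
  because the graded projection kills its covector.\<close>

lemma rank_le_pow: "rank_le (x ^\<^sub>m m * graded_proj p n \<epsilon>) (card (image_boxes e \<tau> m \<epsilon>))"
proof (rule rank_leI[where f = "\<lambda>\<kappa> i. (x ^\<^sub>m m *\<^sub>v b \<kappa>) $ i" and g = "\<lambda>\<kappa> j. if (j < p) = \<epsilon> then \<beta> \<kappa> $ j else 0"])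
  fix i j assume ij: "i < n" "j < n"
  have "(x ^\<^sub>m m * graded_proj p n \<epsilon>) $$ (i, j) = (if (j < p) = \<epsilon> then (x ^\<^sub>m m * proj) $$ (i, j) else 0)"
    unfolding mult_graded_proj_index[OF pow_carrier ij] proj_one right_mult_one_mat[OF pow_carrier] by simp
  also have "\<dots> = (\<Sum>\<kappa>\<in>boxes \<tau>. (x ^\<^sub>m m *\<^sub>v b \<kappa>) $ i * (if (j < p) = \<epsilon> then \<beta> \<kappa> $ j else 0))"
    unfolding mult_proj_index[OF pow_carrier ij] by (simp add: if_distrib sum.neutral)
  also have "\<dots> = (\<Sum>\<kappa>\<in>image_boxes e \<tau> m \<epsilon>. (x ^\<^sub>m m *\<^sub>v b \<kappa>) $ i * (if (j < p) = \<epsilon> then \<beta> \<kappa> $ j else 0))"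
  proof (rule sum.mono_neutral_right)
    show "\<forall>\<kappa>\<in>boxes \<tau> - image_boxes e \<tau> m \<epsilon>. (x ^\<^sub>m m *\<^sub>v b \<kappa>) $ i * (if (j < p) = \<epsilon> then \<beta> \<kappa> $ j else 0) = 0"
    proof
      fix \<kappa> assume k: "\<kappa> \<in> boxes \<tau> - image_boxes e \<tau> m \<epsilon>"
      then have "snd \<kappa> < m \<or> box_parity e \<tau> \<kappa> \<noteq> \<epsilon>" by (auto simp: image_boxes_def)
      then show "(x ^\<^sub>m m *\<^sub>v b \<kappa>) $ i * (if (j < p) = \<epsilon> then \<beta> \<kappa> $ j else 0) = 0"
      proof
        assume "snd \<kappa> < m"
        then show ?thesis using pow_b[of "fst \<kappa>" "snd \<kappa>" m] k ij by simp
      next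
        assume "box_parity e \<tau> \<kappa> \<noteq> \<epsilon>"
        then show ?thesis using hom_\<beta>[of \<kappa>] \<beta>_carrier[of \<kappa>] k ij unfolding hom_vec_def by auto
      qed
    qed
  qed (auto simp: image_boxes_def)
  finally show "(x ^\<^sub>m m * graded_proj p n \<epsilon>) $$ (i, j) =
      (\<Sum>\<kappa>\<in>image_boxes e \<tau> m \<epsilon>. (x ^\<^sub>m m *\<^sub>v b \<kappa>) $ i * (if (j < p) = \<epsilon> then \<beta> \<kappa> $ j else 0))" .
qed (use pow_carrier in \<open>auto intro: mult_carrier_mat[OF pow_carrier]\<close>)

text \<open>The sum does not depend on \<open>m\<close>. For \<open>m = 0\<close> it is the rank of
  the graded projection, computed once from the frame and once from the standard basis.\<close>

lemma card_kernel_image_boxes: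
  "card (kernel_boxes e \<tau> m \<epsilon>) + card (image_boxes e \<tau> m \<epsilon>) = card {i. i < n \<and> (i < p) = \<epsilon>}"
proof -
  have "card (kernel_boxes e \<tau> m \<epsilon>) + card (image_boxes e \<tau> m \<epsilon>) = card (image_boxes e \<tau> 0 \<epsilon>)"
    by (subst card_Un_disjoint[symmetric])
      (auto simp: kernel_boxes_def image_boxes_def intro!: arg_cong[of _ _ card])
  also have "\<dots> = card {i. i < n \<and> (i < p) = \<epsilon>}"
  proof (rule antisym)
    have 1: "x ^\<^sub>m 0 * graded_proj p n \<epsilon> = graded_proj p n \<epsilon>"
      using x left_mult_one_mat[OF graded_proj_carrier] by simp
    show "card (image_boxes e \<tau> 0 \<epsilon>) \<le> card {i. i < n \<and> (i < p) = \<epsilon>}"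
    proof (rule rank_ge_le[OF rank_ge_pow[of 0 \<epsilon>, unfolded 1]])
      show "rank_le (graded_proj p n \<epsilon>) (card {i. i < n \<and> (i < p) = \<epsilon>})"
      proof (rule rank_leI[where f = "\<lambda>t i. if i = t then 1 else 0" and g = "\<lambda>t i. if i = t then 1 else 0"])
        fix i j assume "i < n" "j < n"
        have "(\<Sum>t | t < n \<and> (t < p) = \<epsilon>. (if i = t then 1 else 0) * (if j = t then 1 else 0)) =
            (\<Sum>t | t < n \<and> (t < p) = \<epsilon>. if t = i then if j = i then 1 else 0 else (0 :: complex))"
          by (intro sum.cong) auto
        then show "graded_proj p n \<epsilon> $$ (i, j) =
            (\<Sum>t | t < n \<and> (t < p) = \<epsilon>. (if i = t then 1 else 0) * (if j = t then 1 else 0))"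
          using \<open>i < n\<close> \<open>j < n\<close> by (auto simp: graded_proj_def)
      qed auto
    qed
    show "card {i. i < n \<and> (i < p) = \<epsilon>} \<le> card (image_boxes e \<tau> 0 \<epsilon>)"
    proof (rule rank_ge_le[OF _ rank_le_pow[of 0 \<epsilon>, unfolded 1]])
      show "rank_ge (graded_proj p n \<epsilon>) (card {i. i < n \<and> (i < p) = \<epsilon>})"
        by (rule rank_ge_entries[where f = id and g = id]) (auto simp: graded_proj_def)
    qed
  qed
  finally show ?thesis .
qed

end

section \<open>Conjugacy of homogeneous nilpotents\<close>

text \<open>A group element together with its inverse. Even matrices are the block diagonal ones, so
  \<open>hom_mat p True\<close> for both says that the element lies in $K$; see
  \<open>K_group_iff\<close>.\<close>

definition K_pair :: "nat \<Rightarrow> nat \<Rightarrow> complex mat \<Rightarrow> complex mat \<Rightarrow> bool" where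
  "K_pair p n g h \<longleftrightarrow> g \<in> carrier_mat n n \<and> h \<in> carrier_mat n n \<and> hom_mat p True g \<and> hom_mat p True h \<and>
     g * h = 1\<^sub>m n \<and> h * g = 1\<^sub>m n"

context full_jordan_frame
begin

lemma outer_sum_frame: "outer_sum n (boxes \<tau>) b \<beta> = 1\<^sub>m n"
  using proj_one unfolding proj_def .

lemma eq_mat_on_frame:
  assumes "A \<in> carrier_mat n n" "B \<in> carrier_mat n n" "\<And>\<kappa>. \<kappa> \<in> boxes \<tau> \<Longrightarrow> A *\<^sub>v b \<kappa> = B *\<^sub>v b \<kappa>"
  shows "A = B"
proof -
  have "A * outer_sum n (boxes \<tau>) b \<beta> = outer_sum n (boxes \<tau>) (\<lambda>\<kappa>. A *\<^sub>v b \<kappa>) \<beta>"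
    by (rule mult_outer_sum[OF assms(1) b_carrier])
  also have "\<dots> = outer_sum n (boxes \<tau>) (\<lambda>\<kappa>. B *\<^sub>v b \<kappa>) \<beta>"
    by (rule outer_sum_cong[OF assms(3)])
  also have "\<dots> = B * outer_sum n (boxes \<tau>) b \<beta>"
    by (rule mult_outer_sum[OF assms(2) b_carrier, symmetric])
  finally have "A * outer_sum n (boxes \<tau>) b \<beta> = B * outer_sum n (boxes \<tau>) b \<beta>" .
  then show ?thesis using assms by (simp add: outer_sum_frame)
qed

text \<open>Two frames of one type are matched box by box: \<open>g\<close> sends \<open>b\<close>
  to \<open>b'\<close> and \<open>h\<close> sends it back. Equal box parities make both even, and
  the intertwining relation is checked on each box.\<close>

lemma conjugate:
  assumes "full_jordan_frame p n e x' \<tau> b' \<beta>'"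
  shows "\<exists>g h. K_pair p n g h \<and> x' = g * x * h"
proof -
  interpret F': full_jordan_frame p n e x' \<tau> b' \<beta>' by (rule assms)
  define g where "g = outer_sum n (boxes \<tau>) b' \<beta>"
  define h where "h = outer_sum n (boxes \<tau>) b \<beta>'"
  have g: "g \<in> carrier_mat n n" and h: "h \<in> carrier_mat n n" by (simp_all add: g_def h_def)
  have gb: "g *\<^sub>v b \<kappa> = b' \<kappa>" if "\<kappa> \<in> boxes \<tau>" for \<kappa>
    unfolding g_def by (rule outer_sum_mult_dual[OF _ F'.b_carrier b_carrier dual that]) simp
  have hb: "h *\<^sub>v b' \<kappa> = b \<kappa>" if "\<kappa> \<in> boxes \<tau>" for \<kappa>
    unfolding h_def by (rule outer_sum_mult_dual[OF _ b_carrier F'.b_carrier F'.dual that]) simp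
  have "h * g = 1\<^sub>m n"
    by (rule eq_mat_on_frame) (use g h gb hb b_carrier in \<open>auto simp: assoc_mult_mat_vec[of _ n n _ n]\<close>)
  moreover have gh: "g * h = 1\<^sub>m n"
    by (rule F'.eq_mat_on_frame) (use g h gb hb F'.b_carrier in \<open>auto simp: assoc_mult_mat_vec[of _ n n _ n]\<close>)
  moreover have "hom_mat p True g" unfolding g_def
    by (rule hom_outer_sum[where s = "box_parity e \<tau>"]) (use b_carrier \<beta>_carrier F'.b_carrier F'.hom_b hom_\<beta> in auto)
  moreover have "hom_mat p True h" unfolding h_def
    by (rule hom_outer_sum[where s = "box_parity e \<tau>"]) (use b_carrier F'.\<beta>_carrier F'.hom_\<beta> hom_b in auto)
  ultimately have "K_pair p n g h" using g h by (simp add: K_pair_def)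
  have "x' * g = g * x"
  proof (rule eq_mat_on_frame)
    fix \<kappa> assume k: "\<kappa> \<in> boxes \<tau>"
    have "(x' * g) *\<^sub>v b \<kappa> = x' *\<^sub>v b' \<kappa>"
      using assoc_mult_mat_vec[OF F'.x g b_carrier[OF k]] gb[OF k] by simp
    also have "\<dots> = g *\<^sub>v (x *\<^sub>v b \<kappa>)"
    proof (cases \<kappa>)
      case (Pair k a)
      show ?thesis
      proof (cases a)
        case 0
        then show ?thesis using Pair k x_b_0[of k] F'.x_b_0[of k] mult_mat_zero_vec[OF g] by simp
      next
        case (Suc a')
        then have "(k, a') \<in> boxes \<tau>" using k Pair by (auto simp: boxes_def)
        then show ?thesis using Pair k Suc x_b_Suc[of k a'] F'.x_b_Suc[of k a'] gb by simp
      qed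
    qed
    also have "\<dots> = (g * x) *\<^sub>v b \<kappa>"
      using assoc_mult_mat_vec[OF g x b_carrier[OF k]] by simp
    finally show "(x' * g) *\<^sub>v b \<kappa> = (g * x) *\<^sub>v b \<kappa>" .
  qed (use g x F'.x in auto)
  then have "g * x * h = x' * (g * h)"
    using g h F'.x by (metis assoc_mult_mat)
  then have "x' = g * x * h" using F'.x by (simp add: gh)
  with \<open>K_pair p n g h\<close> show ?thesis by blast
qed

lemma permute_type:
  assumes "mset \<tau>' = mset \<tau>"
  shows "\<exists>b' \<beta>'. full_jordan_frame p n e x \<tau>' b' \<beta>'"
proof -
  obtain f where f: "f permutes {..<length \<tau>}" "permute_list f \<tau> = \<tau>'"
    using mset_eq_permutation[OF assms] by blast
  have len: "length \<tau>' = length \<tau>" using f by auto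
  have nth: "\<tau>' ! k = \<tau> ! f k" if "k < length \<tau>" for k
    using f that permute_list_nth by blast
  have fl: "f k < length \<tau> \<longleftrightarrow> k < length \<tau>" for k
    using permutes_in_image[OF f(1), of k] by simp
  have mem: "\<kappa> \<in> boxes \<tau>' \<longleftrightarrow> (f (fst \<kappa>), snd \<kappa>) \<in> boxes \<tau>" for \<kappa>
    by (cases \<kappa>) (auto simp: boxes_def len fl nth)
  have par: "box_parity e \<tau>' \<kappa> = box_parity e \<tau> (f (fst \<kappa>), snd \<kappa>)" if "\<kappa> \<in> boxes \<tau>'" for \<kappa>
    using that by (auto simp: box_parity_def boxes_def len nth)
  have finj: "f a = f c \<longleftrightarrow> a = c" for a c using permutes_inj[OF f(1)] by (auto simp: inj_def)
  let ?b = "\<lambda>\<kappa>. b (f (fst \<kappa>), snd \<kappa>)" and ?\<beta> = "\<lambda>\<kappa>. \<beta> (f (fst \<kappa>), snd \<kappa>)"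
  have fr: "jordan_frame p n e x \<tau>' ?b ?\<beta>"
    by unfold_locales
      (use x hom_x b_carrier \<beta>_carrier dual x_b_0 x_b_Suc \<beta>_x hom_b hom_\<beta> in \<open>auto simp: mem par finj prod_eq_iff\<close>)
  have bij: "bij_betw (\<lambda>\<kappa>. (f (fst \<kappa>), snd \<kappa>)) (boxes \<tau>') (boxes \<tau>)"
  proof (rule bij_betwI[where g = "\<lambda>\<kappa>. (inv_into UNIV f (fst \<kappa>), snd \<kappa>)"])
    show "(\<lambda>\<kappa>. (inv_into UNIV f (fst \<kappa>), snd \<kappa>)) \<in> boxes \<tau> \<rightarrow> boxes \<tau>'"
      by (auto simp: mem permutes_inverses[OF f(1)])
  qed (auto simp: mem permutes_inverses[OF f(1)])
  have "outer_sum n (boxes \<tau>') ?b ?\<beta> = outer_sum n (boxes \<tau>) b \<beta>"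
    unfolding outer_sum_def using sum.reindex_bij_betw[OF bij, of "\<lambda>\<kappa>. b \<kappa> $ _ * \<beta> \<kappa> $ _"] by simp
  then have "full_jordan_frame p n e x \<tau>' ?b ?\<beta>"
    unfolding full_jordan_frame_def full_jordan_frame_axioms_def jordan_frame.proj_def[OF fr]
    using fr outer_sum_frame by simp
  then show ?thesis by blast
qed

end

lemma card_kernel_boxes_Suc:
  "card (kernel_boxes e \<tau> (Suc c) \<epsilon>) =
    card (kernel_boxes e \<tau> c \<epsilon>) + length (filter (\<lambda>t. c < snd t \<and> shift e c (fst t) = \<epsilon>) \<tau>)"
proof -
  let ?S = "{k. k < length \<tau> \<and> c < snd (\<tau> ! k) \<and> shift e c (fst (\<tau> ! k)) = \<epsilon>}"
  have "kernel_boxes e \<tau> (Suc c) \<epsilon> = kernel_boxes e \<tau> c \<epsilon> \<union> (\<lambda>k. (k, c)) ` ?S"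
    by (auto simp: kernel_boxes_def boxes_def box_parity_def less_Suc_eq)
  moreover have "kernel_boxes e \<tau> c \<epsilon> \<inter> (\<lambda>k. (k, c)) ` ?S = {}"
    by (auto simp: kernel_boxes_def)
  moreover have "card ((\<lambda>k. (k, c)) ` ?S) = card ?S"
    by (rule card_image) (auto simp: inj_on_def)
  ultimately show ?thesis
    by (simp add: card_Un_disjoint length_filter_conv_card)
qed

text \<open>First differences of the kernel counts give, for each parity of the kernel vector, the
  number of rows longer than \<open>c\<close>; second differences give the number of rows of each
  length. Rows of length zero would go unseen, hence \<open>pos\<close>.\<close>

lemma type_eqI:
  assumes eq: "\<And>c \<epsilon>. card (kernel_boxes e \<tau> (Suc c) \<epsilon>) = card (kernel_boxes e \<tau>' (Suc c) \<epsilon>)"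
    and pos: "\<And>t. t \<in> set \<tau> \<union> set \<tau>' \<Longrightarrow> snd t > 0"
  shows "mset \<tau> = mset \<tau>'"
proof -
  have eq': "card (kernel_boxes e \<tau> c \<epsilon>) = card (kernel_boxes e \<tau>' c \<epsilon>)" for c \<epsilon>
    using eq by (cases c) (simp_all add: kernel_boxes_def)
  have A: "length (filter (\<lambda>t. c < snd t \<and> fst t = s) \<tau>) = length (filter (\<lambda>t. c < snd t \<and> fst t = s) \<tau>')" for c s
  proof -
    have "shift e c a = shift e c s \<longleftrightarrow> a = s" for a by (auto simp: shift_def)
    then show ?thesis
      using card_kernel_boxes_Suc[of e \<tau> c "shift e c s"] card_kernel_boxes_Suc[of e \<tau>' c "shift e c s"] eq'
      by simp
  qed
  have cnt: "count (mset \<sigma>) (s, Suc c) + length (filter (\<lambda>t. Suc c < snd t \<and> fst t = s) \<sigma>)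
      = length (filter (\<lambda>t. c < snd t \<and> fst t = s) \<sigma>)" for \<sigma> :: jordan_type and s c
    by (induction \<sigma>) (auto simp: less_Suc_eq_le le_less)
  show ?thesis
  proof (rule multiset_eqI)
    fix t :: "bool \<times> nat"
    obtain s l where t: "t = (s, l)" by (cases t)
    show "count (mset \<tau>) t = count (mset \<tau>') t"
    proof (cases l)
      case 0
      then have "t \<notin> set \<tau>" "t \<notin> set \<tau>'" using pos[of t] t by auto
      then show ?thesis by (metis count_mset_0_iff)
    next
      case (Suc c)
      then show ?thesis using cnt[of \<tau> s c] cnt[of \<tau>' s c] A t by simp
    qed
  qed
qed

definition hom_nilpotents :: "nat \<Rightarrow> nat \<Rightarrow> bool \<Rightarrow> complex mat set" where
  "hom_nilpotents p n e = {x \<in> carrier_mat n n. hom_mat p e x \<and> (\<exists>m. x ^\<^sub>m m = 0\<^sub>m n n)}"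

definition kdim :: "nat \<Rightarrow> nat \<Rightarrow> complex mat \<Rightarrow> nat \<Rightarrow> bool \<Rightarrow> nat" where
  "kdim p n x m \<epsilon> = subspace_dim n (graded_part p n \<epsilon> \<inter> mat_kernel (x ^\<^sub>m m))"

lemma hom_nilpotent_frame:
  assumes "x \<in> hom_nilpotents p n e"
  obtains \<tau> b \<beta> where "full_jordan_frame p n e x \<tau> b \<beta>" "\<forall>t\<in>set \<tau>. snd t > 0"
proof -
  from assms obtain \<tau> b \<beta> where "jordan_frame p n e x \<tau> b \<beta>" "jordan_frame.proj n \<tau> b \<beta> = 1\<^sub>m n"
    "\<forall>t\<in>set \<tau>. snd t > 0"
    unfolding hom_nilpotents_def using exists_jordan_frame by blast
  then show ?thesis
    by (intro that) (auto simp: full_jordan_frame_def full_jordan_frame_axioms_def)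
qed

lemma kdim_frame: "full_jordan_frame p n e x \<tau> b \<beta> \<Longrightarrow> kdim p n x m \<epsilon> = card (kernel_boxes e \<tau> m \<epsilon>)"
  unfolding kdim_def by (rule dual_frame_dim(2)[OF full_jordan_frame.dual_frame_kernel])

section \<open>The generic orbit in the saturation of a linear slice\<close>

text \<open>The functions met below, such as determinants of products that contain \<open>x\<close>,
  have arbitrary values at matrices of other sizes. Agreement with a member of
  \<open>poly_funs\<close> is therefore asked for on the carrier only.\<close>

definition poly_on :: "nat \<Rightarrow> (complex mat \<Rightarrow> complex) \<Rightarrow> bool" where
  "poly_on n f \<longleftrightarrow> (\<exists>f'\<in>poly_funs n. \<forall>x\<in>carrier_mat n n. f x = f' x)"

lemma poly_on_funs: "f \<in> poly_funs n \<Longrightarrow> poly_on n f"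
  unfolding poly_on_def by blast

lemma poly_on_const: "poly_on n (\<lambda>x. c)"
  by (rule poly_on_funs[OF poly_funs.const])

lemma poly_on_coord: "i < n \<Longrightarrow> j < n \<Longrightarrow> poly_on n (\<lambda>x. x $$ (i, j))"
  by (rule poly_on_funs[OF poly_funs.coord])

lemma poly_on_cong: "poly_on n f \<Longrightarrow> (\<And>x. x \<in> carrier_mat n n \<Longrightarrow> f x = g x) \<Longrightarrow> poly_on n g"
  unfolding poly_on_def by metis

lemma
  assumes "poly_on n f" "poly_on n g"
  shows poly_on_add: "poly_on n (\<lambda>x. f x + g x)" and poly_on_mult: "poly_on n (\<lambda>x. f x * g x)"
proof -
  obtain f' g' where fg: "f' \<in> poly_funs n" "\<forall>x\<in>carrier_mat n n. f x = f' x"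
    "g' \<in> poly_funs n" "\<forall>x\<in>carrier_mat n n. g x = g' x"
    using assms unfolding poly_on_def by blast
  show "poly_on n (\<lambda>x. f x + g x)"
    by (rule poly_on_cong[OF poly_on_funs[OF poly_funs.add[OF fg(1,3)]]]) (use fg in simp)
  show "poly_on n (\<lambda>x. f x * g x)"
    by (rule poly_on_cong[OF poly_on_funs[OF poly_funs.mult[OF fg(1,3)]]]) (use fg in simp)
qed

lemma poly_on_sum: "(\<And>s. s \<in> S \<Longrightarrow> poly_on n (f s)) \<Longrightarrow> poly_on n (\<lambda>x. \<Sum>s\<in>S. f s x)"
  by (induction S rule: infinite_finite_induct) (auto intro!: poly_on_const poly_on_add)

lemma poly_on_prod: "(\<And>s. s \<in> S \<Longrightarrow> poly_on n (f s)) \<Longrightarrow> poly_on n (\<lambda>x. \<Prod>s\<in>S. f s x)"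
  by (induction S rule: infinite_finite_induct) (auto intro!: poly_on_const poly_on_mult)

lemma poly_on_mat_mult:
  assumes "\<And>x. x \<in> carrier_mat n n \<Longrightarrow> A x \<in> carrier_mat k l" "\<And>x. x \<in> carrier_mat n n \<Longrightarrow> B x \<in> carrier_mat l m"
    "\<And>i j. i < k \<Longrightarrow> j < l \<Longrightarrow> poly_on n (\<lambda>x. A x $$ (i, j))"
    "\<And>i j. i < l \<Longrightarrow> j < m \<Longrightarrow> poly_on n (\<lambda>x. B x $$ (i, j))" "i < k" "j < m"
  shows "poly_on n (\<lambda>x. (A x * B x) $$ (i, j))"
  by (rule poly_on_cong[of n "\<lambda>x. \<Sum>a<l. A x $$ (i, a) * B x $$ (a, j)"])
    (use assms mult_mat_sum[OF assms(1,2) assms(5,6)] in \<open>auto intro!: poly_on_sum poly_on_mult\<close>)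

lemma poly_on_pow: "i < n \<Longrightarrow> j < n \<Longrightarrow> poly_on n (\<lambda>x. (x ^\<^sub>m m) $$ (i, j))"
proof (induction m arbitrary: i j)
  case 0
  show ?case
    by (rule poly_on_cong[OF poly_on_const[of n "if i = j then 1 else 0"]]) (use 0 in auto)
next
  case (Suc m)
  have "poly_on n (\<lambda>x. (x ^\<^sub>m m * x) $$ (i, j))"
    by (rule poly_on_mat_mult[of n _ n n _ n]) (use Suc in \<open>auto intro: poly_on_coord\<close>)
  then show ?case by simp
qed

lemma poly_on_det:
  assumes "\<And>x. x \<in> carrier_mat n n \<Longrightarrow> A x \<in> carrier_mat r r"
    "\<And>i j. i < r \<Longrightarrow> j < r \<Longrightarrow> poly_on n (\<lambda>x. A x $$ (i, j))"
  shows "poly_on n (\<lambda>x. det (A x))"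
proof (rule poly_on_cong[of n "\<lambda>x. \<Sum>p | p permutes {0..<r}. signof p * (\<Prod>i = 0..<r. A x $$ (i, p i))"])
  show "poly_on n (\<lambda>x. \<Sum>p | p permutes {0..<r}. signof p * (\<Prod>i = 0..<r. A x $$ (i, p i)))"
    by (intro poly_on_sum poly_on_mult poly_on_const poly_on_prod assms(2))
      (auto dest: permutes_in_image)
qed (simp only: det_def'[OF assms(1)])

lemma poly_on_conj:
  assumes f: "f \<in> poly_funs n" and g: "g \<in> carrier_mat n n" and h: "h \<in> carrier_mat n n"
  shows "poly_on n (\<lambda>x. f (g * x * h))"
  using f
proof induction
  case (coord i j)
  have "poly_on n (\<lambda>x. (g * x) $$ (i, j))" if "i < n" "j < n" for i j
    by (rule poly_on_mat_mult[of n "\<lambda>_. g" n n "\<lambda>x. x" n]) (use g that in \<open>auto intro: poly_on_coord poly_on_const\<close>)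
  then show ?case
    by (intro poly_on_mat_mult[of n "\<lambda>x. g * x" n n "\<lambda>_. h" n])
      (use g h coord in \<open>auto intro: poly_on_const mult_carrier_mat\<close>)
qed (auto intro: poly_on_const poly_on_add poly_on_mult)

lemma poly_on_line:
  assumes "poly_on n f" "u \<in> carrier_mat n n" "v \<in> carrier_mat n n"
  shows "\<exists>q. \<forall>t. f ((1 - t) \<cdot>\<^sub>m u + t \<cdot>\<^sub>m v) = poly q t"
proof -
  obtain f' where f': "f' \<in> poly_funs n" "\<forall>x\<in>carrier_mat n n. f x = f' x"
    using assms(1) unfolding poly_on_def by blast
  have "\<exists>q. \<forall>t. f' ((1 - t) \<cdot>\<^sub>m u + t \<cdot>\<^sub>m v) = poly q t"
    using f'(1)
  proof induction
    case (const c)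
    show ?case by (intro exI[of _ "[:c:]"]) simp
  next
    case (coord i j)
    then show ?case using assms(2,3)
      by (intro exI[of _ "[:u $$ (i, j), v $$ (i, j) - u $$ (i, j):]"]) (auto simp: algebra_simps)
  next
    case (add f g)
    then show ?case by (metis poly_add)
  next
    case (mult f g)
    then show ?case by (metis poly_mult)
  qed
  then show ?thesis using f'(2) assms by simp
qed

text \<open>On the line through a point \<open>u\<close> that suits the earlier polynomials and a
  point \<open>v\<close> that suits the new one, each of them restricts to a nonzero polynomial in
  \<open>t\<close>, and their product has finitely many roots. Closure under lines plays the part of
  irreducibility.\<close>

lemma common_nonzero:
  assumes D: "D \<subseteq> carrier_mat n n" "D \<noteq> {}"
    and line: "\<And>u v t. u \<in> D \<Longrightarrow> v \<in> D \<Longrightarrow> (1 - t) \<cdot>\<^sub>m u + t \<cdot>\<^sub>m v \<in> D"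
    and "finite I" "\<And>i. i \<in> I \<Longrightarrow> poly_on n (f i)" "\<And>i. i \<in> I \<Longrightarrow> \<exists>u\<in>D. f i u \<noteq> 0"
  shows "\<exists>u\<in>D. \<forall>i\<in>I. f i u \<noteq> 0"
  using assms(4-6)
proof (induction I rule: finite_induct)
  case empty
  then show ?case using D by auto
next
  case (insert i I)
  then obtain u where u: "u \<in> D" "\<forall>j\<in>I. f j u \<noteq> 0" by auto
  obtain v where v: "v \<in> D" "f i v \<noteq> 0" using insert.prems(2)[of i] by auto
  have uv: "u \<in> carrier_mat n n" "v \<in> carrier_mat n n" using u v D by auto
  have u0: "(1 - 0) \<cdot>\<^sub>m u + 0 \<cdot>\<^sub>m v = u" "(1 - 1) \<cdot>\<^sub>m u + 1 \<cdot>\<^sub>m v = v"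
    using uv by (auto intro!: eq_matI)
  have "\<forall>j. j \<in> insert i I \<longrightarrow> (\<exists>q. \<forall>t. f j ((1 - t) \<cdot>\<^sub>m u + t \<cdot>\<^sub>m v) = poly q t)"
    using poly_on_line insert.prems(1) u v D by blast
  then obtain q where q: "\<And>j t. j \<in> insert i I \<Longrightarrow> f j ((1 - t) \<cdot>\<^sub>m u + t \<cdot>\<^sub>m v) = poly (q j) t"
    by metis
  have "q j \<noteq> 0" if j: "j \<in> insert i I" for j
  proof
    assume "q j = 0"
    then have "f j ((1 - t) \<cdot>\<^sub>m u + t \<cdot>\<^sub>m v) = 0" for t using q[OF j] by simp
    from this[of 0] this[of 1] show False using u0 u(2) v(2) j by auto
  qed
  then have "(\<Prod>j\<in>insert i I. q j) \<noteq> 0" using insert.hyps by simp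
  then have "finite {t. poly (\<Prod>j\<in>insert i I. q j) t = 0}" by (rule poly_roots_finite)
  then obtain t where "poly (\<Prod>j\<in>insert i I. q j) t \<noteq> 0"
    using ex_new_if_finite[OF infinite_UNIV_char_0] by blast
  then have "\<forall>j\<in>insert i I. poly (q j) t \<noteq> 0"
    using insert.hyps by (auto simp: poly_prod)
  then show ?case using q line[OF u(1) v(1), of t] by (metis (no_types, lifting))
qed

lemma topspace_zariski: "topspace (zariski n) = carrier_mat n n"
proof
  show "topspace (zariski n) \<subseteq> carrier_mat n n"
    using openin_topspace[of "zariski n"] unfolding openin_zariski by auto
  have "openin (zariski n) (carrier_mat n n)"
    unfolding openin_zariski
    by (intro exI[of _ "{\<lambda>x. 1}"]) (auto simp: zero_locus_def intro: poly_funs.const)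
  then show "carrier_mat n n \<subseteq> topspace (zariski n)" by (rule openin_subset)
qed

lemma openin_poly_nonzero:
  assumes "poly_on n f"
  shows "openin (zariski n) {x \<in> carrier_mat n n. f x \<noteq> 0}"
proof -
  obtain f' where "f' \<in> poly_funs n" "\<forall>x\<in>carrier_mat n n. f x = f' x"
    using assms unfolding poly_on_def by blast
  then show ?thesis unfolding openin_zariski
    by (intro exI[of _ "{f'}"]) (auto simp: zero_locus_def)
qed

section \<open>Conjugation by K and its invariants\<close>

definition K_orbit :: "nat \<Rightarrow> nat \<Rightarrow> complex mat \<Rightarrow> complex mat set" where
  "K_orbit p n x = {g * x * h | g h. K_pair p n g h}"

lemma K_pair_one: "K_pair p n (1\<^sub>m n) (1\<^sub>m n)"
  by (simp add: K_pair_def hom_mat_one)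

lemma K_pair_inverse: "K_pair p n g h \<Longrightarrow> K_pair p n h g"
  by (simp add: K_pair_def)

lemma square_mult_closed: "A \<in> carrier_mat n n \<Longrightarrow> B \<in> carrier_mat n n \<Longrightarrow> A * B \<in> carrier_mat n n"
  by simp

lemma square_mult_assoc:
  fixes A B C :: "complex mat"
  shows "A \<in> carrier_mat n n \<Longrightarrow> B \<in> carrier_mat n n \<Longrightarrow> C \<in> carrier_mat n n \<Longrightarrow> A * B * C = A * (B * C)"
  by (rule assoc_mult_mat)

lemma K_pairD:
  assumes "K_pair p n g h"
  shows "g \<in> carrier_mat n n" "h \<in> carrier_mat n n" "hom_mat p True g" "hom_mat p True h"
    "g * h = 1\<^sub>m n" "h * g = 1\<^sub>m n"
  using assms by (auto simp: K_pair_def)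

lemma K_pair_cancel:
  assumes "K_pair p n g h" "x \<in> carrier_mat n n"
  shows "g * (h * x) = x" "h * (g * x) = x"
  using square_mult_assoc[of g n h x] square_mult_assoc[of h n g x] K_pairD[OF assms(1)] assms(2) by auto

lemma K_pair_mult:
  assumes "K_pair p n g h" "K_pair p n g' h'"
  shows "K_pair p n (g * g') (h' * h)"
proof -
  note c = K_pairD[OF assms(1)] K_pairD[OF assms(2)]
  have "(g * g') * (h' * h) = 1\<^sub>m n" "(h' * h) * (g * g') = 1\<^sub>m n"
    using c by (simp_all add: square_mult_assoc square_mult_closed K_pair_cancel[OF assms(1)] K_pair_cancel[OF assms(2)])
  moreover have "hom_mat p (True = True) (g * g')" "hom_mat p (True = True) (h' * h)"
    using hom_mat_mult[OF c(3,9,1,7)] hom_mat_mult[OF c(10,4,8,2)] by auto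
  ultimately show ?thesis using c unfolding K_pair_def by (auto simp: square_mult_closed)
qed

lemma K_orbit_subset:
  assumes x: "x \<in> carrier_mat n n" and y: "y \<in> K_orbit p n x"
  shows "K_orbit p n y \<subseteq> K_orbit p n x"
proof
  fix z assume "z \<in> K_orbit p n y"
  then obtain g h g' h' where gh: "K_pair p n g h" "y = g * x * h" "K_pair p n g' h'" "z = g' * y * h'"
    using y unfolding K_orbit_def by blast
  have "z = (g' * g) * x * (h * h')"
    unfolding gh(2,4) using K_pairD[OF gh(1)] K_pairD[OF gh(3)] x
    by (simp add: square_mult_assoc square_mult_closed)
  then show "z \<in> K_orbit p n x" using K_pair_mult[OF gh(3,1)] unfolding K_orbit_def by blast
qed

lemma K_orbit_sym:
  assumes x: "x \<in> carrier_mat n n" and y: "y \<in> K_orbit p n x"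
  shows "x \<in> K_orbit p n y"
proof -
  obtain g h where gh: "K_pair p n g h" "y = g * x * h" using y unfolding K_orbit_def by blast
  have "x = h * y * g"
    unfolding gh(2) using K_pairD[OF gh(1)] x
    by (simp add: square_mult_assoc square_mult_closed K_pair_cancel[OF gh(1)])
  then show ?thesis using K_pair_inverse[OF gh(1)] unfolding K_orbit_def by blast
qed

lemma K_orbit_eq:
  assumes "x \<in> carrier_mat n n" "y \<in> K_orbit p n x"
  shows "K_orbit p n y = K_orbit p n x"
proof -
  have "y \<in> carrier_mat n n" using assms by (auto simp: K_orbit_def K_pair_def)
  then show ?thesis using assms K_orbit_subset K_orbit_sym by blast
qed

lemma conj_pow:
  assumes "K_pair p n g h" "x \<in> carrier_mat n n"
  shows "(g * x * h) ^\<^sub>m m = g * x ^\<^sub>m m * h"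
proof (induction m)
  case 0
  then show ?case using K_pairD[OF assms(1)] assms(2) by simp
next
  case (Suc m)
  have "x ^\<^sub>m m \<in> carrier_mat n n" using assms(2) by simp
  then show ?case using Suc K_pairD[OF assms(1)] assms(2)
    by (simp add: square_mult_assoc[of _ n] square_mult_closed[of _ n] K_pair_cancel[OF assms(1)])
qed

lemma hom_nilpotents_conj:
  assumes "K_pair p n g h" "x \<in> hom_nilpotents p n e"
  shows "g * x * h \<in> hom_nilpotents p n e"
proof -
  have c: "g \<in> carrier_mat n n" "h \<in> carrier_mat n n" "x \<in> carrier_mat n n" "hom_mat p True g" "hom_mat p True h" "hom_mat p e x"
    using assms by (auto simp: K_pair_def hom_nilpotents_def)
  have "hom_mat p ((True = e) = True) (g * x * h)"
    using c by (intro hom_mat_mult[of _ _ _ _ _ n n n]) auto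
  moreover obtain m where "x ^\<^sub>m m = 0\<^sub>m n n" using assms by (auto simp: hom_nilpotents_def)
  then have "(g * x * h) ^\<^sub>m m = 0\<^sub>m n n"
    using conj_pow[OF assms(1) c(3), of m] c by simp
  ultimately show ?thesis using c by (auto simp: hom_nilpotents_def)
qed

text \<open>Covectors are moved by the transpose of the inverse, which preserves all
  pairings.\<close>

lemma dual_frame_image:
  assumes fr: "dual_frame n W T b \<beta>" and gh: "K_pair p n g h"
  shows "dual_frame n ((\<lambda>v. g *\<^sub>v v) ` W) T (\<lambda>t. g *\<^sub>v b t) (\<lambda>t. transpose_mat h *\<^sub>v \<beta> t)"
proof -
  note f = fr[unfolded dual_frame_def] and c = K_pairD[OF gh]
  have W: "w \<in> carrier_vec n" if "w \<in> W" for w using f that by blast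
  have hg: "h *\<^sub>v (g *\<^sub>v w) = w" if "w \<in> W" for w
    using assoc_mult_mat_vec[OF c(2,1) W[OF that]] c(6) W[OF that] by simp
  have pair: "(transpose_mat h *\<^sub>v \<beta> t) \<bullet> (g *\<^sub>v w) = \<beta> t \<bullet> w" if "t \<in> T" "w \<in> W" for t w
    using transpose_vec_mult_scalar[OF c(2), of "g *\<^sub>v w" "\<beta> t"] hg[OF that(2)] f that c W[OF that(2)] by simp
  have span: "(g *\<^sub>v w) $ i = (\<Sum>t\<in>T. ((transpose_mat h *\<^sub>v \<beta> t) \<bullet> (g *\<^sub>v w)) * (g *\<^sub>v b t) $ i)"
    if w: "w \<in> W" and i: "i < n" for w i
  proof -
    have "(g *\<^sub>v w) $ i = (\<Sum>l<n. \<Sum>t\<in>T. (\<beta> t \<bullet> w) * (g $$ (i, l) * b t $ l))"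
      unfolding mult_mat_vec_sum[OF c(1) W[OF w] i]
    proof (rule sum.cong[OF refl])
      fix l assume "l \<in> {..<n}"
      then have "w $ l = (\<Sum>t\<in>T. (\<beta> t \<bullet> w) * b t $ l)" using f w by blast
      then show "g $$ (i, l) * w $ l = (\<Sum>t\<in>T. (\<beta> t \<bullet> w) * (g $$ (i, l) * b t $ l))"
        by (simp add: sum_distrib_left mult_ac)
    qed
    also have "\<dots> = (\<Sum>t\<in>T. (\<beta> t \<bullet> w) * (g *\<^sub>v b t) $ i)"
    proof (subst sum.swap, rule sum.cong[OF refl])
      fix t assume "t \<in> T"
      then have "b t \<in> carrier_vec n" using f by blast
      then show "(\<Sum>l<n. (\<beta> t \<bullet> w) * (g $$ (i, l) * b t $ l)) = (\<beta> t \<bullet> w) * (g *\<^sub>v b t) $ i"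
        using mult_mat_vec_sum[OF c(1) _ i] by (simp add: sum_distrib_left)
    qed
    finally show ?thesis using pair[OF _ w] by simp
  qed
  show ?thesis unfolding dual_frame_def
  proof (intro conjI)
    show "(\<lambda>v. g *\<^sub>v v) ` W \<subseteq> carrier_vec n" using c W by auto
    show "0\<^sub>v n \<in> (\<lambda>v. g *\<^sub>v v) ` W" using f mult_mat_zero_vec[OF c(1)] by (metis image_eqI)
    show "\<forall>u\<in>(\<lambda>v. g *\<^sub>v v) ` W. \<forall>v\<in>(\<lambda>v. g *\<^sub>v v) ` W. u + v \<in> (\<lambda>v. g *\<^sub>v v) ` W"
    proof (intro ballI)
      fix u v assume "u \<in> (\<lambda>v. g *\<^sub>v v) ` W" "v \<in> (\<lambda>v. g *\<^sub>v v) ` W"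
      then obtain u' v' where uv: "u' \<in> W" "v' \<in> W" "u = g *\<^sub>v u'" "v = g *\<^sub>v v'" by blast
      have "u + v = g *\<^sub>v (u' + v')"
        using mult_add_distrib_mat_vec[OF c(1) W[OF uv(1)] W[OF uv(2)]] uv by simp
      then show "u + v \<in> (\<lambda>v. g *\<^sub>v v) ` W" using f uv by blast
    qed
    show "\<forall>a. \<forall>v\<in>(\<lambda>v. g *\<^sub>v v) ` W. a \<cdot>\<^sub>v v \<in> (\<lambda>v. g *\<^sub>v v) ` W"
    proof (intro allI ballI)
      fix a v assume "v \<in> (\<lambda>v. g *\<^sub>v v) ` W"
      then obtain v' where v: "v' \<in> W" "v = g *\<^sub>v v'" by blast
      then have "a \<cdot>\<^sub>v v = g *\<^sub>v (a \<cdot>\<^sub>v v')" using mult_mat_vec[OF c(1) W[OF v(1)]] by simp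
      then show "a \<cdot>\<^sub>v v \<in> (\<lambda>v. g *\<^sub>v v) ` W" using f v by blast
    qed
    show "finite T" using f by blast
    show "\<forall>t\<in>T. g *\<^sub>v b t \<in> (\<lambda>v. g *\<^sub>v v) ` W \<and> transpose_mat h *\<^sub>v \<beta> t \<in> carrier_vec n"
      using f c by auto
    show "\<forall>t\<in>T. \<forall>t'\<in>T. (transpose_mat h *\<^sub>v \<beta> t) \<bullet> (g *\<^sub>v b t') = (if t = t' then 1 else 0)"
      using pair f by simp
    show "\<forall>u\<in>(\<lambda>v. g *\<^sub>v v) ` W. \<forall>i<n. u $ i = (\<Sum>t\<in>T. ((transpose_mat h *\<^sub>v \<beta> t) \<bullet> u) * (g *\<^sub>v b t) $ i)"
      using span by blast
  qed
qed

text \<open>As \<open>g\<close> is even, it maps the graded kernel of \<open>x^m\<close> onto the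
  graded kernel of the conjugate, and the image of a dual frame has the same index set.\<close>

lemma kdim_conj:
  assumes gh: "K_pair p n g h" and x: "x \<in> hom_nilpotents p n e"
  shows "kdim p n (g * x * h) m \<epsilon> = kdim p n x m \<epsilon>"
proof -
  note c = K_pairD[OF gh]
  obtain \<tau> b \<beta> where fr: "full_jordan_frame p n e x \<tau> b \<beta>" by (rule hom_nilpotent_frame[OF x])
  interpret full_jordan_frame p n e x \<tau> b \<beta> by (rule fr)
  have xc: "x \<in> carrier_mat n n" using assms(2) by (simp add: hom_nilpotents_def)
  let ?W = "graded_part p n \<epsilon> \<inter> mat_kernel (x ^\<^sub>m m)" and ?W' = "graded_part p n \<epsilon> \<inter> mat_kernel ((g * x * h) ^\<^sub>m m)"
  have y: "(g * x * h) ^\<^sub>m m \<in> carrier_mat n n" "g * x ^\<^sub>m m \<in> carrier_mat n n" using c xc by auto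
  have mem': "v \<in> ?W' \<longleftrightarrow> v \<in> carrier_vec n \<and> hom_vec p \<epsilon> v \<and> g *\<^sub>v (x ^\<^sub>m m *\<^sub>v (h *\<^sub>v v)) = 0\<^sub>v n" for v
  proof -
    have "(g * x * h) ^\<^sub>m m *\<^sub>v v = g *\<^sub>v (x ^\<^sub>m m *\<^sub>v (h *\<^sub>v v))" if v: "v \<in> carrier_vec n"
      unfolding conj_pow[OF gh xc] assoc_mult_mat_vec[OF y(2) c(2) v]
      by (rule assoc_mult_mat_vec[OF c(1) pow_carrier]) (use c v in simp)
    then show ?thesis unfolding graded_part_def mat_kernel[OF y(1)] by auto
  qed
  have inv: "h *\<^sub>v (g *\<^sub>v v) = v" "g *\<^sub>v (h *\<^sub>v v) = v" if v: "v \<in> carrier_vec n" for v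
    using assoc_mult_mat_vec[OF c(2,1) v] assoc_mult_mat_vec[OF c(1,2) v] c(5,6) v by simp_all
  have "(\<lambda>v. g *\<^sub>v v) ` ?W = ?W'"
  proof (intro equalityI subsetI)
    fix v assume "v \<in> (\<lambda>v. g *\<^sub>v v) ` ?W"
    then obtain w where w: "v = g *\<^sub>v w" "w \<in> carrier_vec n" "hom_vec p \<epsilon> w" "x ^\<^sub>m m *\<^sub>v w = 0\<^sub>v n"
      using mem_kernel by blast
    then show "v \<in> ?W'" unfolding mem' using c inv(1)[OF w(2)] hom_vec_mult[OF c(3) w(3) c(1) w(2)]
      mult_mat_zero_vec[OF c(1)] by simp
  next
    fix v assume "v \<in> ?W'"
    then have v: "v \<in> carrier_vec n" "hom_vec p \<epsilon> v" "g *\<^sub>v (x ^\<^sub>m m *\<^sub>v (h *\<^sub>v v)) = 0\<^sub>v n" unfolding mem' by blast+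
    have hv: "h *\<^sub>v v \<in> carrier_vec n" using c(2) v(1) by simp
    have "x ^\<^sub>m m *\<^sub>v (h *\<^sub>v v) = 0\<^sub>v n"
      using inv(1)[OF mult_mat_vec_carrier[OF pow_carrier[of m] hv]] v(3) mult_mat_zero_vec[OF c(2)] by simp
    then have "h *\<^sub>v v \<in> ?W" unfolding mem_kernel using hv hom_vec_mult[OF c(4) v(2) c(2) v(1)] by simp
    then show "v \<in> (\<lambda>v. g *\<^sub>v v) ` ?W" using inv(2)[OF v(1)] by (metis image_eqI)
  qed
  then show ?thesis
    using dual_frame_dim(2)[OF dual_frame_image[OF dual_frame_kernel[of \<epsilon> m] gh]] dual_frame_dim(2)[OF dual_frame_kernel[of \<epsilon> m]]
    unfolding kdim_def by simp
qed

text \<open>For the converse direction the kernel dimensions determine the multiset of rows of the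
  Jordan type; after a permutation of rows both matrices have frames of the same type, and
  \<open>full_jordan_frame.conjugate\<close> applies.\<close>

theorem conjugate_iff_kdim:
  assumes x: "x \<in> hom_nilpotents p n e" and y: "y \<in> hom_nilpotents p n e"
  shows "(\<exists>g h. K_pair p n g h \<and> y = g * x * h) \<longleftrightarrow> (\<forall>m\<ge>1. \<forall>\<epsilon>. kdim p n y m \<epsilon> = kdim p n x m \<epsilon>)"
proof
  assume "\<exists>g h. K_pair p n g h \<and> y = g * x * h"
  then obtain g h where gh: "K_pair p n g h" "y = g * x * h" by blast
  show "\<forall>m\<ge>1. \<forall>\<epsilon>. kdim p n y m \<epsilon> = kdim p n x m \<epsilon>"
    unfolding gh(2) kdim_conj[OF gh(1) x] by simp
next
  assume eq: "\<forall>m\<ge>1. \<forall>\<epsilon>. kdim p n y m \<epsilon> = kdim p n x m \<epsilon>"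
  obtain \<tau> b \<beta> where fr: "full_jordan_frame p n e x \<tau> b \<beta>" "\<forall>t\<in>set \<tau>. snd t > 0"
    by (rule hom_nilpotent_frame[OF x])
  obtain \<tau>' b' \<beta>' where fr': "full_jordan_frame p n e y \<tau>' b' \<beta>'" "\<forall>t\<in>set \<tau>'. snd t > 0"
    by (rule hom_nilpotent_frame[OF y])
  have "mset \<tau> = mset \<tau>'"
  proof (rule type_eqI[of e])
    fix c \<epsilon>
    have "kdim p n y (Suc c) \<epsilon> = kdim p n x (Suc c) \<epsilon>" using eq by simp
    then show "card (kernel_boxes e \<tau> (Suc c) \<epsilon>) = card (kernel_boxes e \<tau>' (Suc c) \<epsilon>)"
      by (simp only: kdim_frame[OF fr(1)] kdim_frame[OF fr'(1)])
  qed (use fr(2) fr'(2) in blast)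
  then obtain b'' \<beta>'' where "full_jordan_frame p n e y \<tau> b'' \<beta>''"
    using full_jordan_frame.permute_type[OF fr'(1), of \<tau>] by auto
  then show "\<exists>g h. K_pair p n g h \<and> y = g * x * h"
    by (rule full_jordan_frame.conjugate[OF fr(1)])
qed

abbreviation graded_dim :: "nat \<Rightarrow> nat \<Rightarrow> bool \<Rightarrow> nat" where
  "graded_dim p n \<epsilon> \<equiv> card {i. i < n \<and> (i < p) = \<epsilon>}"

lemma kdim_rank:
  assumes x: "x \<in> hom_nilpotents p n e"
  shows rank_le_imp_kdim: "rank_le (x ^\<^sub>m m * graded_proj p n \<epsilon>) r \<Longrightarrow> graded_dim p n \<epsilon> \<le> kdim p n x m \<epsilon> + r"
    and rank_ge_imp_kdim: "rank_ge (x ^\<^sub>m m * graded_proj p n \<epsilon>) r \<Longrightarrow> kdim p n x m \<epsilon> + r \<le> graded_dim p n \<epsilon>"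
    and rank_ge_kdim: "rank_ge (x ^\<^sub>m m * graded_proj p n \<epsilon>) (graded_dim p n \<epsilon> - kdim p n x m \<epsilon>)"
proof -
  obtain \<tau> b \<beta> where fr: "full_jordan_frame p n e x \<tau> b \<beta>" by (rule hom_nilpotent_frame[OF x])
  interpret full_jordan_frame p n e x \<tau> b \<beta> by (rule fr)
  have eq: "kdim p n x m \<epsilon> + card (image_boxes e \<tau> m \<epsilon>) = graded_dim p n \<epsilon>"
    using card_kernel_image_boxes[of m \<epsilon>] kdim_frame[OF fr] by simp
  show "graded_dim p n \<epsilon> \<le> kdim p n x m \<epsilon> + r" if "rank_le (x ^\<^sub>m m * graded_proj p n \<epsilon>) r"
    using rank_ge_le[OF rank_ge_pow that] eq by simp
  show "kdim p n x m \<epsilon> + r \<le> graded_dim p n \<epsilon>" if "rank_ge (x ^\<^sub>m m * graded_proj p n \<epsilon>) r"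
    using rank_ge_le[OF that rank_le_pow] eq by simp
  show "rank_ge (x ^\<^sub>m m * graded_proj p n \<epsilon>) (graded_dim p n \<epsilon> - kdim p n x m \<epsilon>)"
    using rank_ge_pow[of m \<epsilon>] eq by (metis add_diff_cancel_left')
qed

text \<open>A certificate with \<open>P\<close> and \<open>Q\<close> at \<open>y\<close> gives the
  polynomial \<open>det (P * A x * Q)\<close>, where \<open>A x\<close> is the matrix in question;
  it equals 1 at \<open>y\<close>. Wherever it is nonzero, multiplying \<open>Q\<close> by the
  inverse of that product gives a certificate at \<open>x\<close>.\<close>

lemma rank_ge_open:
  assumes y: "y \<in> carrier_mat n n" and r: "rank_ge (y ^\<^sub>m m * graded_proj p n \<epsilon>) r"
  shows "\<exists>f. poly_on n f \<and> f y \<noteq> 0 \<and>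
    (\<forall>x\<in>carrier_mat n n. f x \<noteq> 0 \<longrightarrow> rank_ge (x ^\<^sub>m m * graded_proj p n \<epsilon>) r)"
proof -
  let ?A = "\<lambda>x. x ^\<^sub>m m * graded_proj p n \<epsilon>"
  have A: "?A x \<in> carrier_mat n n" if "x \<in> carrier_mat n n" for x
    using that by (intro mult_carrier_mat[OF pow_carrier_mat graded_proj_carrier])
  obtain P Q where PQ: "P \<in> carrier_mat r n" "Q \<in> carrier_mat n r" "P * ?A y * Q = 1\<^sub>m r"
    using r A[OF y] unfolding rank_ge_def carrier_matD[OF A[OF y]] by blast
  define f where "f = (\<lambda>x. det (P * ?A x * Q))"
  have "poly_on n (\<lambda>x. ?A x $$ (i, j))" if "i < n" "j < n" for i j
    by (rule poly_on_mat_mult[of n _ n n _ n]) (use that in \<open>auto intro: poly_on_pow poly_on_const\<close>)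
  then have "poly_on n (\<lambda>x. (P * ?A x) $$ (i, j))" if "i < r" "j < n" for i j
    by (rule poly_on_mat_mult[of n _ r n _ n, rotated 3]) (use that PQ A in \<open>auto intro: poly_on_const\<close>)
  then have "poly_on n (\<lambda>x. (P * ?A x * Q) $$ (i, j))" if "i < r" "j < r" for i j
    by (rule poly_on_mat_mult[of n _ r n _ r, rotated 2])
      (use that PQ A in \<open>auto intro: poly_on_const intro!: mult_carrier_mat[OF _ A]\<close>)
  then have "poly_on n f"
    unfolding f_def by (rule poly_on_det[rotated]) (use PQ A in \<open>auto intro!: mult_carrier_mat[OF mult_carrier_mat[OF _ A]]\<close>)
  moreover have "f y \<noteq> 0" unfolding f_def PQ(3) by simp
  moreover have "rank_ge (?A x) r" if x: "x \<in> carrier_mat n n" and fx: "f x \<noteq> 0" for x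
  proof -
    have PA: "P * ?A x \<in> carrier_mat r n" by (rule mult_carrier_mat[OF PQ(1) A[OF x]])
    have M: "P * ?A x * Q \<in> carrier_mat r r" by (rule mult_carrier_mat[OF PA PQ(2)])
    obtain Z where Z: "Z \<in> carrier_mat r r" "P * ?A x * Q * Z = 1\<^sub>m r"
      using det_non_zero_imp_unit[OF M, of "()"] fx M
      unfolding f_def Units_def by (auto simp: ring_mat_def)
    have "P * ?A x * (Q * Z) = 1\<^sub>m r" using Z assoc_mult_mat[OF PA PQ(2) Z(1)] by simp
    then show ?thesis unfolding rank_ge_def using PQ Z A[OF x]
      by (intro exI[of _ P] exI[of _ "Q * Z"]) auto
  qed
  ultimately show ?thesis by (intro exI[of _ f]) simp
qed

lemma rank_ge_0: "rank_ge A 0"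
  unfolding rank_ge_def by (intro exI[of _ "0\<^sub>m 0 (dim_row A)"] exI[of _ "0\<^sub>m (dim_col A) 0"]) auto

text \<open>\<open>R m \<epsilon>\<close> is the generic rank of the m-th power on a graded part. In
  \<open>lower\<close> each \<open>m\<close> and \<epsilon> may have its own witness; a simultaneous
  one is produced in \<open>generic_element\<close>. Beyond \<open>B\<close> the bounds are zero, so
  finitely many rank conditions remain.\<close>

locale linear_slice =
  fixes p n :: nat and e :: bool and D :: "complex mat set" and R :: "nat \<Rightarrow> bool \<Rightarrow> nat" and B :: nat
  assumes D_nilpotent: "D \<subseteq> hom_nilpotents p n e"
    and line: "\<And>u v t. u \<in> D \<Longrightarrow> v \<in> D \<Longrightarrow> (1 - t) \<cdot>\<^sub>m u + t \<cdot>\<^sub>m v \<in> D"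
    and upper: "\<And>u m \<epsilon>. u \<in> D \<Longrightarrow> m \<ge> 1 \<Longrightarrow> rank_le (u ^\<^sub>m m * graded_proj p n \<epsilon>) (R m \<epsilon>)"
    and lower: "\<And>m \<epsilon>. m \<ge> 1 \<Longrightarrow> \<exists>u\<in>D. rank_ge (u ^\<^sub>m m * graded_proj p n \<epsilon>) (R m \<epsilon>)"
    and R_0: "\<And>m \<epsilon>. m > B \<Longrightarrow> R m \<epsilon> = 0"
begin

definition saturation :: "complex mat set" where
  "saturation = {g * u * h | g u h. K_pair p n g h \<and> u \<in> D}"

definition generic_orbit :: "complex mat set" where
  "generic_orbit = {y \<in> hom_nilpotents p n e. \<forall>m\<ge>1. \<forall>\<epsilon>. kdim p n y m \<epsilon> + R m \<epsilon> = graded_dim p n \<epsilon>}"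

lemma D_carrier: "D \<subseteq> carrier_mat n n"
  using D_nilpotent by (auto simp: hom_nilpotents_def)

lemma D_nonempty: "D \<noteq> {}"
  using lower[of 1] by auto

lemma saturation_nilpotent: "y \<in> saturation \<Longrightarrow> y \<in> hom_nilpotents p n e"
  using hom_nilpotents_conj D_nilpotent unfolding saturation_def by blast

lemma saturation_kdim:
  assumes "y \<in> saturation" "m \<ge> 1"
  shows "graded_dim p n \<epsilon> \<le> kdim p n y m \<epsilon> + R m \<epsilon>"
proof -
  obtain g u h where y: "y = g * u * h" "K_pair p n g h" "u \<in> D" using assms unfolding saturation_def by blast
  then have u: "u \<in> hom_nilpotents p n e" using D_nilpotent by auto
  have "kdim p n y m \<epsilon> = kdim p n u m \<epsilon>"
    using conjugate_iff_kdim[OF u hom_nilpotents_conj[OF y(2) u]] y assms(2) by blast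
  then show ?thesis using rank_le_imp_kdim[OF u upper[OF y(3) assms(2)]] by simp
qed

text \<open>On the saturation the upper bounds hold everywhere, so equality of all ranks amounts to
  finitely many lower bounds, each of which is an open condition.\<close>

lemma mem_generic_orbit_iff:
  assumes "y \<in> saturation"
  shows "y \<in> generic_orbit \<longleftrightarrow> (\<forall>m\<in>{1..B}. \<forall>\<epsilon>. rank_ge (y ^\<^sub>m m * graded_proj p n \<epsilon>) (R m \<epsilon>))"
proof
  assume y: "y \<in> generic_orbit"
  show "\<forall>m\<in>{1..B}. \<forall>\<epsilon>. rank_ge (y ^\<^sub>m m * graded_proj p n \<epsilon>) (R m \<epsilon>)"
  proof (intro ballI allI)
    fix m \<epsilon> assume m: "m \<in> {1..B}"
    then have "kdim p n y m \<epsilon> + R m \<epsilon> = graded_dim p n \<epsilon>" using y by (simp add: generic_orbit_def)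
    then have "R m \<epsilon> = graded_dim p n \<epsilon> - kdim p n y m \<epsilon>" by simp
    then show "rank_ge (y ^\<^sub>m m * graded_proj p n \<epsilon>) (R m \<epsilon>)"
      using rank_ge_kdim[OF saturation_nilpotent[OF assms]] by metis
  qed
next
  assume r: "\<forall>m\<in>{1..B}. \<forall>\<epsilon>. rank_ge (y ^\<^sub>m m * graded_proj p n \<epsilon>) (R m \<epsilon>)"
  have "kdim p n y m \<epsilon> + R m \<epsilon> = graded_dim p n \<epsilon>" if m: "m \<ge> 1" for m \<epsilon>
  proof -
    have "rank_ge (y ^\<^sub>m m * graded_proj p n \<epsilon>) (R m \<epsilon>)"
      using r m R_0[of m \<epsilon>] rank_ge_0 by (cases "m \<le> B") auto
    then show ?thesis
      using rank_ge_imp_kdim[OF saturation_nilpotent[OF assms]] saturation_kdim[OF assms m, of \<epsilon>]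
      by (meson le_antisym)
  qed
  then show "y \<in> generic_orbit" using saturation_nilpotent[OF assms] by (simp add: generic_orbit_def)
qed

definition conditions :: "(nat \<times> bool) set" where
  "conditions = {1..B} \<times> UNIV"

lemma mem_conditions: "i \<in> conditions \<longleftrightarrow> fst i \<in> {1..B}"
  by (cases i) (simp add: conditions_def)

lemma finite_conditions: "finite conditions"
  by (simp add: conditions_def)

text \<open>The point \<open>y i\<close> may depend on the condition. With separate witnesses this
  yields generic elements of the slice, with a constant \<open>y\<close> it yields openness of the
  generic orbit.\<close>

lemma generic_neighbourhood:
  assumes "\<forall>i\<in>conditions. y i \<in> carrier_mat n n \<and>
    rank_ge (y i ^\<^sub>m fst i * graded_proj p n (snd i)) (R (fst i) (snd i))"
  shows "\<exists>f. (\<forall>i\<in>conditions. poly_on n (f i) \<and> f i (y i) \<noteq> 0) \<and>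
    (\<forall>z\<in>saturation. (\<forall>i\<in>conditions. f i z \<noteq> 0) \<longrightarrow> z \<in> generic_orbit)"
proof -
  let ?P = "\<lambda>i f. poly_on n f \<and> f (y i) \<noteq> 0 \<and>
      (\<forall>x\<in>carrier_mat n n. f x \<noteq> 0 \<longrightarrow> rank_ge (x ^\<^sub>m fst i * graded_proj p n (snd i)) (R (fst i) (snd i)))"
  have "\<forall>i\<in>conditions. \<exists>f. ?P i f"
  proof
    fix i assume "i \<in> conditions"
    then have "y i \<in> carrier_mat n n" "rank_ge (y i ^\<^sub>m fst i * graded_proj p n (snd i)) (R (fst i) (snd i))"
      using assms by simp_all
    then show "\<exists>f. ?P i f" by (rule rank_ge_open)
  qed
  then have "\<exists>f. \<forall>i\<in>conditions. ?P i (f i)" by (rule bchoice)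
  then obtain f where f: "\<forall>i\<in>conditions. ?P i (f i)" ..
  have "z \<in> generic_orbit" if z: "z \<in> saturation" and nz: "\<forall>i\<in>conditions. f i z \<noteq> 0" for z
  proof -
    have zc: "z \<in> carrier_mat n n" using saturation_nilpotent[OF z] by (simp add: hom_nilpotents_def)
    show ?thesis unfolding mem_generic_orbit_iff[OF z]
    proof (intro ballI allI)
      fix m \<epsilon> assume "m \<in> {1..B}"
      then have i: "(m, \<epsilon>) \<in> conditions" by (simp add: mem_conditions)
      then have "?P (m, \<epsilon>) (f (m, \<epsilon>))" using f by blast
      then show "rank_ge (z ^\<^sub>m m * graded_proj p n \<epsilon>) (R m \<epsilon>)" using bspec[OF nz i] zc by simp
    qed
  qed
  moreover have "\<forall>i\<in>conditions. poly_on n (f i) \<and> f i (y i) \<noteq> 0" using f by simp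
  ultimately show ?thesis by (intro exI[of _ f]) simp
qed

lemma D_saturation: "D \<subseteq> saturation"
proof
  fix u assume u: "u \<in> D"
  then have "u = 1\<^sub>m n * u * 1\<^sub>m n" using D_carrier by auto
  then show "u \<in> saturation" using u K_pair_one[of p n] unfolding saturation_def by blast
qed

text \<open>The extra polynomial \<open>f0\<close> serves density: it will be the pullback of a
  function that is nonzero at a prescribed point of the saturation.\<close>

lemma generic_element:
  assumes "poly_on n f0" "\<exists>u\<in>D. f0 u \<noteq> 0"
  shows "\<exists>u\<in>D. u \<in> generic_orbit \<and> f0 u \<noteq> 0"
proof -
  have "\<forall>i\<in>conditions. \<exists>u. u \<in> D \<and> rank_ge (u ^\<^sub>m fst i * graded_proj p n (snd i)) (R (fst i) (snd i))"
    using lower by (metis atLeastAtMost_iff mem_conditions)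
  then have "\<exists>y. \<forall>i\<in>conditions. y i \<in> D \<and> rank_ge (y i ^\<^sub>m fst i * graded_proj p n (snd i)) (R (fst i) (snd i))"
    by (rule bchoice)
  then obtain y where y: "\<forall>i\<in>conditions. y i \<in> D \<and>
    rank_ge (y i ^\<^sub>m fst i * graded_proj p n (snd i)) (R (fst i) (snd i))" ..
  then have "\<forall>i\<in>conditions. y i \<in> carrier_mat n n \<and>
    rank_ge (y i ^\<^sub>m fst i * graded_proj p n (snd i)) (R (fst i) (snd i))"
    using D_carrier by (simp add: subset_iff)
  from generic_neighbourhood[OF this] obtain f
    where f: "(\<forall>i\<in>conditions. poly_on n (f i) \<and> f i (y i) \<noteq> 0) \<and>
      (\<forall>z\<in>saturation. (\<forall>i\<in>conditions. f i z \<noteq> 0) \<longrightarrow> z \<in> generic_orbit)" ..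
  let ?I = "insert None (Some ` conditions)"
  define f' where "f' = (\<lambda>i. case i of None \<Rightarrow> f0 | Some j \<Rightarrow> f j)"
  have "\<exists>u\<in>D. \<forall>i\<in>?I. f' i u \<noteq> 0"
  proof (rule common_nonzero[OF D_carrier D_nonempty line])
    fix i assume "i \<in> ?I"
    then consider "i = None" | j where "i = Some j" "j \<in> conditions" by blast
    then show "poly_on n (f' i)"
      by cases (use assms(1) f in \<open>simp_all add: f'_def\<close>)
  next
    fix i assume "i \<in> ?I"
    then consider "i = None" | j where "i = Some j" "j \<in> conditions" by blast
    then show "\<exists>u\<in>D. f' i u \<noteq> 0"
    proof cases
      case 1
      then show ?thesis using assms(2) by (simp add: f'_def)
    next
      case (2 j)
      then show ?thesis using f y by (intro bexI[of _ "y j"]) (simp_all add: f'_def)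
    qed
  qed (simp_all add: finite_conditions)
  then obtain u where u: "u \<in> D" "\<forall>i\<in>?I. f' i u \<noteq> 0" by (elim bexE)
  then have "f0 u \<noteq> 0" "\<forall>i\<in>conditions. f i u \<noteq> 0" by (simp_all add: f'_def)
  moreover from this have "u \<in> generic_orbit" using f D_saturation u(1) by (simp add: subset_iff)
  ultimately show ?thesis using u(1) by (intro bexI[of _ u]) simp_all
qed

lemma generic_orbit_eq:
  assumes "y \<in> generic_orbit"
  shows "generic_orbit = K_orbit p n y"
proof -
  have y: "y \<in> hom_nilpotents p n e" using assms by (simp add: generic_orbit_def)
  have "z \<in> generic_orbit \<longleftrightarrow> z \<in> K_orbit p n y" if z: "z \<in> hom_nilpotents p n e" for z
  proof -
    have "z \<in> K_orbit p n y \<longleftrightarrow> (\<forall>m\<ge>1. \<forall>\<epsilon>. kdim p n z m \<epsilon> = kdim p n y m \<epsilon>)"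
      unfolding conjugate_iff_kdim[OF y z, symmetric] K_orbit_def by blast
    also have "\<dots> \<longleftrightarrow> (\<forall>m\<ge>1. \<forall>\<epsilon>. kdim p n z m \<epsilon> + R m \<epsilon> = graded_dim p n \<epsilon>)"
    proof -
      have "kdim p n y m \<epsilon> + R m \<epsilon> = graded_dim p n \<epsilon>" if "m \<ge> 1" for m \<epsilon>
        using assms that by (simp add: generic_orbit_def)
      then have "kdim p n z m \<epsilon> = kdim p n y m \<epsilon> \<longleftrightarrow> kdim p n z m \<epsilon> + R m \<epsilon> = graded_dim p n \<epsilon>"
        if "m \<ge> 1" for m \<epsilon>
        using that by (metis add_right_cancel)
      then show ?thesis by simp
    qed
    also have "\<dots> \<longleftrightarrow> z \<in> generic_orbit"
      using z by (simp add: generic_orbit_def)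
    finally show ?thesis by simp
  qed
  moreover have "K_orbit p n y \<subseteq> hom_nilpotents p n e"
    using hom_nilpotents_conj[OF _ y] unfolding K_orbit_def by blast
  ultimately show ?thesis by (auto simp: generic_orbit_def)
qed

text \<open>The slice contains one generic element, the generic elements form a single orbit, and
  the saturation contains the orbit of every element of the slice.\<close>

lemma generic_orbit_saturation: "generic_orbit \<subseteq> saturation"
proof -
  obtain u where "u \<in> D" "u \<in> generic_orbit" using generic_element[OF poly_on_const[of n 1]] D_nonempty by auto
  then show ?thesis using generic_orbit_eq unfolding K_orbit_def saturation_def by blast
qed

lemma open_dense_generic_orbit: "open_dense_in (zariski n) generic_orbit saturation"
proof -
  have sat: "saturation \<subseteq> carrier_mat n n"
    using saturation_nilpotent by (auto simp: hom_nilpotents_def)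
  have "openin (subtopology (zariski n) saturation) generic_orbit"
  proof (subst openin_subopen, intro ballI)
    fix y assume y: "y \<in> generic_orbit"
    then have ys: "y \<in> saturation" using generic_orbit_saturation by blast
    have "y \<in> carrier_mat n n" using sat ys by blast
    have "\<forall>i\<in>conditions. y \<in> carrier_mat n n \<and>
      rank_ge (y ^\<^sub>m fst i * graded_proj p n (snd i)) (R (fst i) (snd i))"
      using y \<open>y \<in> carrier_mat n n\<close> unfolding mem_generic_orbit_iff[OF ys] by (simp add: mem_conditions)
    from generic_neighbourhood[of "\<lambda>_. y", OF this] obtain f
      where f: "(\<forall>i\<in>conditions. poly_on n (f i) \<and> f i y \<noteq> 0) \<and>
        (\<forall>z\<in>saturation. (\<forall>i\<in>conditions. f i z \<noteq> 0) \<longrightarrow> z \<in> generic_orbit)" ..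
    let ?F = "\<lambda>x. \<Prod>i\<in>conditions. f i x"
    have "poly_on n ?F" by (rule poly_on_prod) (use f in simp)
    then have "openin (zariski n) {x \<in> carrier_mat n n. ?F x \<noteq> 0}" by (rule openin_poly_nonzero)
    then have "openin (subtopology (zariski n) saturation) ({x \<in> carrier_mat n n. ?F x \<noteq> 0} \<inter> saturation)"
      unfolding openin_subtopology by blast
    moreover have "y \<in> {x \<in> carrier_mat n n. ?F x \<noteq> 0} \<inter> saturation"
      using ys f \<open>y \<in> carrier_mat n n\<close> by (simp add: prod_zero_iff finite_conditions)
    moreover have "{x \<in> carrier_mat n n. ?F x \<noteq> 0} \<inter> saturation \<subseteq> generic_orbit"
    proof
      fix x assume "x \<in> {x \<in> carrier_mat n n. ?F x \<noteq> 0} \<inter> saturation"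
      then have "x \<in> saturation" "?F x \<noteq> 0" by auto
      then show "x \<in> generic_orbit" using f by (simp add: prod_zero_iff finite_conditions)
    qed
    ultimately show "\<exists>T. openin (subtopology (zariski n) saturation) T \<and> y \<in> T \<and> T \<subseteq> generic_orbit"
      by blast
  qed
  moreover have "(subtopology (zariski n) saturation) closure_of generic_orbit = saturation"
  proof
    show "(subtopology (zariski n) saturation) closure_of generic_orbit \<subseteq> saturation"
      using closure_of_subset_topspace[of "subtopology (zariski n) saturation" generic_orbit] by auto
    show "saturation \<subseteq> (subtopology (zariski n) saturation) closure_of generic_orbit"
    proof
      fix y assume y: "y \<in> saturation"
      then obtain g u h where gh: "y = g * u * h" "K_pair p n g h" "u \<in> D" unfolding saturation_def by blast
      have c: "g \<in> carrier_mat n n" "h \<in> carrier_mat n n" using gh(2) by (auto simp: K_pair_def)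
      have "\<exists>z. z \<in> generic_orbit \<and> z \<in> T"
        if yT: "y \<in> T" and T: "openin (subtopology (zariski n) saturation) T" for T
      proof -
        obtain P where P: "P \<subseteq> poly_funs n" "T = (carrier_mat n n - zero_locus n P) \<inter> saturation"
          using T unfolding openin_subtopology openin_zariski by blast
        then obtain f where f: "f \<in> P" "f y \<noteq> 0" using yT by (auto simp: zero_locus_def)
        \<comment> \<open>A basic neighbourhood of \<open>y = g * u * h\<close> is pulled back to
          the slice: the conjugated polynomial is nonzero at \<open>u\<close>, hence at some generic
          \<open>v\<close> in \<open>D\<close>, and \<open>g * v * h\<close> is a generic point of
          the neighbourhood.\<close>
        have "poly_on n (\<lambda>x. f (g * x * h))" using f P c by (intro poly_on_conj) auto
        moreover have "\<exists>u\<in>D. f (g * u * h) \<noteq> 0" using gh f by blast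
        ultimately obtain v where v: "v \<in> D" "v \<in> generic_orbit" "f (g * v * h) \<noteq> 0"
          using generic_element by blast
        have "g * v * h \<in> K_orbit p n v" using gh(2) unfolding K_orbit_def by blast
        then have "g * v * h \<in> generic_orbit" using generic_orbit_eq[OF v(2)] by simp
        moreover have "g * v * h \<in> saturation" using v gh(2) unfolding saturation_def by blast
        moreover have "g * v * h \<in> carrier_mat n n" using sat calculation(2) by blast
        ultimately show ?thesis using P f v by (auto simp: zero_locus_def)
      qed
      then show "y \<in> (subtopology (zariski n) saturation) closure_of generic_orbit"
        unfolding in_closure_of using y sat by (auto simp: topspace_zariski)
    qed
  qed
  ultimately show ?thesis by (simp add: open_dense_in_def)
qed

text \<open>Any other candidate is dense, so it meets the open generic orbit, and orbits that meet
  coincide.\<close>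

theorem the_open_dense_orbit:
  "(THE N. N \<in> K_orbit p n ` hom_nilpotents p n e \<and> open_dense_in (zariski n) N saturation) = generic_orbit"
proof (rule the_equality)
  obtain u where u: "u \<in> D" "u \<in> generic_orbit" using generic_element[OF poly_on_const[of n 1]] D_nonempty by auto
  then have "generic_orbit \<in> K_orbit p n ` hom_nilpotents p n e"
    using generic_orbit_eq[OF u(2)] D_nilpotent by blast
  then show "generic_orbit \<in> K_orbit p n ` hom_nilpotents p n e \<and> open_dense_in (zariski n) generic_orbit saturation"
    using open_dense_generic_orbit by simp
  fix N assume N: "N \<in> K_orbit p n ` hom_nilpotents p n e \<and> open_dense_in (zariski n) N saturation"
  then obtain y where y: "y \<in> hom_nilpotents p n e" "N = K_orbit p n y" by blast
  have "u \<in> (subtopology (zariski n) saturation) closure_of N"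
    using N u D_saturation by (auto simp: open_dense_in_def)
  then obtain z where z: "z \<in> N" "z \<in> generic_orbit"
    using u open_dense_generic_orbit unfolding in_closure_of open_dense_in_def by blast
  have "y \<in> carrier_mat n n" using y by (simp add: hom_nilpotents_def)
  then have "N = K_orbit p n z" using K_orbit_eq z(1) y(2) by blast
  then show "N = generic_orbit" using generic_orbit_eq[OF z(2)] by simp
qed

end

section \<open>Generic ranks in incidence algebras\<close>

text \<open>Families are encoded by colourings: the classes of the colours in \<open>C\<close> are chains, those of
  the colours below \<open>m\<close> are antichains.\<close>

definition greene_poset :: "'y set \<Rightarrow> ('y \<Rightarrow> 'y \<Rightarrow> bool) \<Rightarrow> nat list \<Rightarrow> bool" where
  "greene_poset Y pr lam \<longleftrightarrow> finite Y \<and>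
    (\<forall>a\<in>Y. \<not> pr a a) \<and> (\<forall>a\<in>Y. \<forall>b\<in>Y. \<forall>c\<in>Y. pr a b \<longrightarrow> pr b c \<longrightarrow> pr a c) \<and> sum_list lam = card Y \<and>
    (\<forall>m. \<exists>c :: 'y \<Rightarrow> nat. \<exists>C. finite C \<and>
      (\<forall>a\<in>Y. \<forall>b\<in>Y. c a = c b \<longrightarrow> c a \<in> C \<longrightarrow> a \<noteq> b \<longrightarrow> pr a b \<or> pr b a) \<and>
      m * card C + (\<Sum>l\<leftarrow>lam. l - m) \<le> card {a \<in> Y. c a \<in> C}) \<and>
    (\<forall>m. \<exists>c :: 'y \<Rightarrow> nat. (\<forall>a\<in>Y. \<forall>b\<in>Y. c a = c b \<longrightarrow> c a < m \<longrightarrow> \<not> pr a b) \<and>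
      boxes_upto lam m \<le> card {a \<in> Y. c a < m})"

text \<open>Under the product order on the points of an array, chains are increasing subsequences
  and antichains are decreasing ones.\<close>

lemma greene_poset_RS:
  assumes bij: "bij_betw lab Y S" and fin: "finite S" and inj: "inj_on w S"
    and pr: "\<And>a b. a \<in> Y \<Longrightarrow> b \<in> Y \<Longrightarrow> pr a b \<longleftrightarrow> lab a < lab b \<and> w (lab a) < w (lab b)"
  shows "greene_poset Y pr (shape (RS1 S w))"
  unfolding greene_poset_def
proof (intro conjI allI)
  have lab: "lab a \<in> S" if "a \<in> Y" for a using bij that by (auto simp: bij_betw_def)
  have labinj: "lab a = lab b \<longleftrightarrow> a = b" if "a \<in> Y" "b \<in> Y" for a b
    using bij that by (auto simp: bij_betw_def inj_on_def)
  have card_lab: "card {a \<in> Y. P (lab a)} = card {s \<in> S. P s}" for P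
  proof -
    have "{s \<in> S. P s} = lab ` {a \<in> Y. P (lab a)}" using bij by (auto simp: bij_betw_def)
    moreover have "inj_on lab {a \<in> Y. P (lab a)}" using bij by (auto simp: bij_betw_def inj_on_def)
    ultimately show ?thesis by (simp add: card_image)
  qed
  show "finite Y" using bij fin bij_betw_finite by blast
  show "\<forall>a\<in>Y. \<not> pr a a" using pr by auto
  show "\<forall>a\<in>Y. \<forall>b\<in>Y. \<forall>c\<in>Y. pr a b \<longrightarrow> pr b c \<longrightarrow> pr a c" using pr by fastforce
  show "sum_list (shape (RS1 S w)) = card Y"
    using sum_list_shape_RS1[OF fin inj] bij by (simp add: bij_betw_same_card)
  fix m
  from greene_increasing[OF fin inj, of m] obtain c :: "int \<Rightarrow> nat" and C where c: "finite C"
    "\<forall>s\<in>S. \<forall>s'\<in>S. s < s' \<longrightarrow> c s = c s' \<longrightarrow> c s \<in> C \<longrightarrow> w s < w s'"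
    "card {s \<in> S. c s \<in> C} = m * card C + (\<Sum>l\<leftarrow>shape (RS1 S w). l - m)"
    by (elim exE conjE)
  have "pr a b \<or> pr b a" if "a \<in> Y" "b \<in> Y" "c (lab a) = c (lab b)" "c (lab a) \<in> C" "a \<noteq> b" for a b
    using c(2)[rule_format, of "lab a" "lab b"] c(2)[rule_format, of "lab b" "lab a"] pr[of a b] pr[of b a] lab[of a] lab[of b] labinj[of a b] that
    by (cases "lab a" "lab b" rule: linorder_cases) auto
  then show "\<exists>c :: _ \<Rightarrow> nat. \<exists>C. finite C \<and>
      (\<forall>a\<in>Y. \<forall>b\<in>Y. c a = c b \<longrightarrow> c a \<in> C \<longrightarrow> a \<noteq> b \<longrightarrow> pr a b \<or> pr b a) \<and>
      m * card C + (\<Sum>l\<leftarrow>shape (RS1 S w). l - m) \<le> card {a \<in> Y. c a \<in> C}"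
    using c(1,3) card_lab[of "\<lambda>s. c s \<in> C"] by (intro exI[of _ "\<lambda>a. c (lab a)"] exI[of _ C]) simp
  from greene_decreasing[OF fin inj, of m] obtain c :: "int \<Rightarrow> nat"
    where c: "\<forall>s\<in>S. \<forall>s'\<in>S. s < s' \<longrightarrow> c s = c s' \<longrightarrow> c s < m \<longrightarrow> w s' < w s"
      "card {s \<in> S. c s < m} = boxes_upto (shape (RS1 S w)) m"
    by (elim exE conjE)
  have "\<not> pr a b" if "a \<in> Y" "b \<in> Y" "c (lab a) = c (lab b)" "c (lab a) < m" for a b
    using c(1)[rule_format, of "lab a" "lab b"] pr[of a b] lab[of a] lab[of b] that by fastforce
  then show "\<exists>c :: _ \<Rightarrow> nat. (\<forall>a\<in>Y. \<forall>b\<in>Y. c a = c b \<longrightarrow> c a < m \<longrightarrow> \<not> pr a b) \<and>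
      boxes_upto (shape (RS1 S w)) m \<le> card {a \<in> Y. c a < m}"
    using c(2) card_lab[of "\<lambda>s. c s < m"] by (intro exI[of _ "\<lambda>a. c (lab a)"]) simp
qed

lemma boxes_upto_add: "boxes_upto lam m + (\<Sum>l\<leftarrow>lam. l - m) = sum_list lam"
  unfolding boxes_upto_def by (induction lam) auto

text \<open>\<open>u v\<close> is the length of a longest chain of elements of \<open>F\<close> at
  or below \<open>v\<close>. It is at most \<open>m\<close>, because a chain meets each of the
  \<open>m\<close> antichains at most once. It grows along \<open>pr\<close>, strictly if the larger
  element lies in \<open>F\<close>, since that element can be appended. The colouring
  \<open>c\<close> itself has no reason to be monotone, hence the passage to
  \<open>u\<close>.\<close>

lemma antichain_levels:
  assumes fin: "finite Y" and trans: "\<And>a b c. a \<in> Y \<Longrightarrow> b \<in> Y \<Longrightarrow> c \<in> Y \<Longrightarrow> pr a b \<Longrightarrow> pr b c \<Longrightarrow> pr a c"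
    and irr: "\<And>a. a \<in> Y \<Longrightarrow> \<not> pr a a"
    and FY: "F \<subseteq> Y" and c: "\<And>a b. a \<in> F \<Longrightarrow> b \<in> F \<Longrightarrow> c a = c b \<Longrightarrow> \<not> pr a b"
    and cm: "\<And>a. a \<in> F \<Longrightarrow> c a < (m :: nat)"
  shows "\<exists>u. (\<forall>a\<in>Y. u a \<le> m) \<and> (\<forall>a\<in>F. 1 \<le> u a) \<and>
    (\<forall>a\<in>Y. \<forall>b\<in>Y. pr a b \<longrightarrow> u a \<le> u b \<and> (b \<in> F \<longrightarrow> u a < u b))"
proof -
  define chains where "chains v = {S. S \<subseteq> F \<and> (\<forall>a\<in>S. a = v \<or> pr a v) \<and> (\<forall>a\<in>S. \<forall>b\<in>S. a \<noteq> b \<longrightarrow> pr a b \<or> pr b a)}" for v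
  define u where "u v = Max (card ` chains v)" for v
  have finF: "finite F" using FY fin finite_subset by blast
  have finS: "finite (chains v)" for v
    by (rule finite_subset[of _ "Pow F"]) (auto simp: chains_def finF)
  have ne: "{} \<in> chains v" for v by (simp add: chains_def)
  have u_ge: "card S \<le> u v" if "S \<in> chains v" for S v
    unfolding u_def using that finS by (intro Max_ge) auto
  have u_ex: "\<exists>S\<in>chains v. card S = u v" for v
  proof -
    have "u v \<in> card ` chains v" unfolding u_def using finS[of v] ne[of v] by (intro Max_in) auto
    then show ?thesis by auto
  qed
  have "u v \<le> m" for v
  proof -
    obtain S where S: "S \<in> chains v" "card S = u v" using u_ex by blast
    have "inj_on c S"
    proof (rule inj_onI, rule ccontr)
      fix a b assume ab: "a \<in> S" "b \<in> S" "c a = c b" "a \<noteq> b"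
      have "a \<in> F" "b \<in> F" "pr a b \<or> pr b a" using S(1) ab unfolding chains_def by blast+
      then show False using c[of a b] c[of b a] ab by auto
    qed
    moreover have "c ` S \<subseteq> {..<m}" using S cm by (auto simp: chains_def)
    ultimately show ?thesis using S(2) card_inj_on_le[of c S "{..<m}"] by simp
  qed
  moreover have "1 \<le> u a" if "a \<in> F" for a
  proof -
    have "{a} \<in> chains a" using that by (simp add: chains_def)
    from u_ge[OF this] show ?thesis by simp
  qed
  moreover have "u a \<le> u b \<and> (b \<in> F \<longrightarrow> u a < u b)" if ab: "a \<in> Y" "b \<in> Y" "pr a b" for a b
  proof -
    obtain S where S: "S \<in> chains a" "card S = u a" using u_ex by blast
    have Sb: "pr s b" if s: "s \<in> S" for s
    proof -
      have "s = a \<or> pr s a" "s \<in> Y" using S s FY by (auto simp: chains_def)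
      then show ?thesis using trans[of s a b] ab by blast
    qed
    then have "S \<in> chains b" using S by (auto simp: chains_def)
    moreover have "u a < u b" if b: "b \<in> F"
    proof -
      have "b \<notin> S" using Sb irr ab by blast
      have "insert b S \<in> chains b" using S Sb b by (auto simp: chains_def)
      moreover have "finite S" using S finF finite_subset by (auto simp: chains_def)
      ultimately show ?thesis using u_ge[of "insert b S" b] S(2) \<open>b \<notin> S\<close> by simp
    qed
    ultimately show ?thesis using u_ge S(2) by metis
  qed
  ultimately show ?thesis by blast
qed

lemma greene_poset_levels:
  assumes "greene_poset Y pr lam"
  obtains F u where "F \<subseteq> Y" "card (Y - F) \<le> card Y - boxes_upto lam m" "\<And>a. a \<in> Y \<Longrightarrow> u a \<le> m" "\<And>a. a \<in> F \<Longrightarrow> 1 \<le> u a"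
    "\<And>a b. a \<in> Y \<Longrightarrow> b \<in> Y \<Longrightarrow> pr a b \<Longrightarrow> u a \<le> u b \<and> (b \<in> F \<longrightarrow> u a < (u b :: nat))"
proof -
  from assms obtain c :: "'a \<Rightarrow> nat" where c: "\<forall>a\<in>Y. \<forall>b\<in>Y. c a = c b \<longrightarrow> c a < m \<longrightarrow> \<not> pr a b"
      "boxes_upto lam m \<le> card {a \<in> Y. c a < m}"
    unfolding greene_poset_def by blast
  have fin: "finite Y" and irr: "\<And>a. a \<in> Y \<Longrightarrow> \<not> pr a a"
    and trans: "\<And>a b c. a \<in> Y \<Longrightarrow> b \<in> Y \<Longrightarrow> c \<in> Y \<Longrightarrow> pr a b \<Longrightarrow> pr b c \<Longrightarrow> pr a c"
    using assms unfolding greene_poset_def by blast+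
  let ?F = "{a \<in> Y. c a < m}"
  have "\<exists>u. (\<forall>a\<in>Y. u a \<le> m) \<and> (\<forall>a\<in>?F. 1 \<le> u a) \<and>
    (\<forall>a\<in>Y. \<forall>b\<in>Y. pr a b \<longrightarrow> u a \<le> u b \<and> (b \<in> ?F \<longrightarrow> u a < u b))"
    by (rule antichain_levels[where c = c, OF fin trans irr]) (use c in auto)
  then obtain u where u: "\<forall>a\<in>Y. u a \<le> m" "\<forall>a\<in>?F. 1 \<le> u a"
    "\<forall>a\<in>Y. \<forall>b\<in>Y. pr a b \<longrightarrow> u a \<le> u b \<and> (b \<in> ?F \<longrightarrow> u a < u b)" by blast
  have "card (Y - ?F) \<le> card Y - boxes_upto lam m"
    using c(2) fin by (subst card_Diff_subset) auto
  then show ?thesis by (intro that[of ?F u]) (use u in auto)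
qed

text \<open>In a finite total order the number of predecessors of an element is its
  position.\<close>

lemma card_class_positions:
  assumes fin: "finite Z" and irr: "\<And>a. a \<in> Z \<Longrightarrow> \<not> pr a a"
    and trans: "\<And>a b c. a \<in> Z \<Longrightarrow> b \<in> Z \<Longrightarrow> c \<in> Z \<Longrightarrow> pr a b \<Longrightarrow> pr b c \<Longrightarrow> pr a c"
    and tot: "\<And>a b. a \<in> Z \<Longrightarrow> b \<in> Z \<Longrightarrow> a \<noteq> b \<Longrightarrow> pr a b \<or> pr b a"
  shows "bij_betw (\<lambda>a. card {b \<in> Z. pr b a}) Z {..<card Z}"
proof -
  have less: "card {b \<in> Z. pr b a} < card {b \<in> Z. pr b a'}" if "a \<in> Z" "a' \<in> Z" "pr a a'" for a a'
  proof (rule psubset_card_mono)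
    have "{b \<in> Z. pr b a} \<subseteq> {b \<in> Z. pr b a'}" using trans that by blast
    moreover have "a \<in> {b \<in> Z. pr b a'}" "a \<notin> {b \<in> Z. pr b a}" using that irr by auto
    ultimately show "{b \<in> Z. pr b a} \<subset> {b \<in> Z. pr b a'}" by blast
  qed (use fin in simp)
  have inj: "inj_on (\<lambda>a. card {b \<in> Z. pr b a}) Z"
  proof (rule inj_onI)
    fix a a' assume a: "a \<in> Z" "a' \<in> Z" "card {b \<in> Z. pr b a} = card {b \<in> Z. pr b a'}"
    then show "a = a'" using less[of a a'] less[of a' a] tot[of a a'] by auto
  qed
  have "(\<lambda>a. card {b \<in> Z. pr b a}) ` Z \<subseteq> {..<card Z}"
  proof safe
    fix a assume a: "a \<in> Z"
    show "card {b \<in> Z. pr b a} < card Z"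
      by (rule psubset_card_mono) (use fin a irr in auto)
  qed
  then have "(\<lambda>a. card {b \<in> Z. pr b a}) ` Z = {..<card Z}"
    by (rule card_subset_eq[rotated]) (simp_all add: card_image[OF inj])
  then show ?thesis using inj by (simp add: bij_betw_def)
qed

text \<open>\<open>\<Theta>\<close> joins each element of a chain of the family to its successor, so
  \<open>m\<close> steps are possible from all but the last \<open>m\<close> elements of each chain.
  At most \<open>m * card C\<close> elements are lost, which leaves at least the sum of
  \<open>l - m\<close>; a subset of that exact size is chosen.\<close>

lemma greene_poset_chains:
  assumes "greene_poset Y pr lam"
  obtains \<Theta> T where "\<Theta> \<subseteq> Y \<times> Y" "\<And>a b. (a, b) \<in> \<Theta> \<Longrightarrow> pr a b" "single_valued \<Theta>" "single_valued (\<Theta>\<inverse>)"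
    "T \<subseteq> Y" "T \<subseteq> Domain (\<Theta> ^^ m)" "card T = (\<Sum>l\<leftarrow>lam. l - m)"
proof -
  from assms obtain c :: "'a \<Rightarrow> nat" and C where C: "finite C"
      "\<forall>a\<in>Y. \<forall>b\<in>Y. c a = c b \<longrightarrow> c a \<in> C \<longrightarrow> a \<noteq> b \<longrightarrow> pr a b \<or> pr b a"
      "m * card C + (\<Sum>l\<leftarrow>lam. l - m) \<le> card {a \<in> Y. c a \<in> C}"
    unfolding greene_poset_def by blast
  have fin: "finite Y" and irr: "\<And>a. a \<in> Y \<Longrightarrow> \<not> pr a a"
    and trans: "\<And>a b c. a \<in> Y \<Longrightarrow> b \<in> Y \<Longrightarrow> c \<in> Y \<Longrightarrow> pr a b \<Longrightarrow> pr b c \<Longrightarrow> pr a c"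
    using assms unfolding greene_poset_def by blast+
  define Z where "Z j = {a \<in> Y. c a = j}" for j
  define pos where "pos a = card {b \<in> Z (c a). pr b a}" for a
  have bij: "bij_betw pos (Z j) {..<card (Z j)}" if "j \<in> C" for j
  proof -
    have "bij_betw (\<lambda>a. card {b \<in> Z j. pr b a}) (Z j) {..<card (Z j)}"
    proof (rule card_class_positions)
      show "pr a b \<or> pr b a" if "a \<in> Z j" "b \<in> Z j" "a \<noteq> b" for a b
        using C(2) that \<open>j \<in> C\<close> unfolding Z_def by auto
      show "pr a d" if "a \<in> Z j" "b \<in> Z j" "d \<in> Z j" "pr a b" "pr b d" for a b d
        using trans[of a b d] that by (simp add: Z_def)
    qed (use fin irr in \<open>auto simp: Z_def\<close>)
    then show ?thesis by (rule bij_betw_cong[THEN iffD1, rotated]) (simp add: pos_def Z_def)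
  qed
  have finZ: "finite (Z j)" for j using fin by (simp add: Z_def)
  have pos_inj: "a = b" if "a \<in> Y" "b \<in> Y" "c a = c b" "c a \<in> C" "pos a = pos b" for a b
    using bij[of "c a"] that unfolding bij_betw_def inj_on_def Z_def by auto
  have pos_less: "pos a < card (Z (c a))" if "a \<in> Y" "c a \<in> C" for a
    using bij[OF that(2)] that(1) unfolding bij_betw_def Z_def by auto
  have pos_ex: "\<exists>a\<in>Y. c a = j \<and> pos a = k" if "j \<in> C" "k < card (Z j)" for j k
  proof -
    have "k \<in> pos ` Z j" using bij[OF that(1)] that(2) by (simp add: bij_betw_def)
    then show ?thesis by (auto simp: Z_def)
  qed
  have pos_pr: "pr a b" if ab: "a \<in> Y" "b \<in> Y" "c a = c b" "c a \<in> C" "pos a < pos b" for a b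
  proof (rule ccontr)
    assume "\<not> pr a b"
    then have "pr b a" using C(2) ab by auto
    then have "{z \<in> Z (c b). pr z b} \<subseteq> {z \<in> Z (c a). pr z a}"
      using trans[of _ b a] ab(1-3) by (auto simp: Z_def)
    then have "pos b \<le> pos a" unfolding pos_def using finZ by (intro card_mono) auto
    then show False using ab by simp
  qed
  define \<Theta> where "\<Theta> = {(a, b). a \<in> Y \<and> b \<in> Y \<and> c a = c b \<and> c a \<in> C \<and> pos b = Suc (pos a)}"
  have pow: "(a, b) \<in> \<Theta> ^^ k" if "a \<in> Y" "b \<in> Y" "c a = c b" "c a \<in> C" "pos b = pos a + k" for a b k
    using that
  proof (induction k arbitrary: b)
    case 0
    then show ?case using pos_inj[of a b] by simp
  next
    case (Suc k)
    have "pos a + k < card (Z (c a))" using pos_less[of b] Suc.prems by simp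
    then obtain d where d: "d \<in> Y" "c d = c a" "pos d = pos a + k" using pos_ex Suc.prems(4) by blast
    then have "(a, d) \<in> \<Theta> ^^ k" using Suc by auto
    moreover have "(d, b) \<in> \<Theta>" using d Suc.prems by (simp add: \<Theta>_def)
    ultimately show ?case by auto
  qed
  have dom: "{a \<in> Y. c a \<in> C \<and> pos a + m < card (Z (c a))} \<subseteq> Domain (\<Theta> ^^ m)"
  proof
    fix a assume a: "a \<in> {a \<in> Y. c a \<in> C \<and> pos a + m < card (Z (c a))}"
    then obtain b where "b \<in> Y" "c b = c a" "pos b = pos a + m" using pos_ex[of "c a" "pos a + m"] by auto
    then have "(a, b) \<in> \<Theta> ^^ m" using pow[of a b m] a by simp
    then show "a \<in> Domain (\<Theta> ^^ m)" by blast
  qed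
  let ?S1 = "{a \<in> Y. c a \<in> C \<and> pos a + m < card (Z (c a))}"
  let ?S2 = "{a \<in> Y. c a \<in> C \<and> card (Z (c a)) \<le> pos a + m}"
  have "{a \<in> Y. c a \<in> C} = ?S1 \<union> ?S2" by auto
  then have "card {a \<in> Y. c a \<in> C} \<le> card ?S1 + card ?S2" by (simp only: card_Un_le)
  \<comment> \<open>The elements with fewer than \<open>m\<close> successors are told apart by their
    chain and their distance from its end, which is less than \<open>m\<close>.\<close>
  moreover have "card ?S2 \<le> card (C \<times> {..<m})"
  proof (rule card_inj_on_le[where f = "\<lambda>a. (c a, card (Z (c a)) - Suc (pos a))"])
    show "inj_on (\<lambda>a. (c a, card (Z (c a)) - Suc (pos a))) ?S2"
    proof (rule inj_onI)
      fix a b assume a: "a \<in> ?S2" and b: "b \<in> ?S2"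
        and eq: "(c a, card (Z (c a)) - Suc (pos a)) = (c b, card (Z (c b)) - Suc (pos b))"
      have "pos a < card (Z (c a))" "pos b < card (Z (c a))"
        using pos_less[of a] pos_less[of b] a b eq by auto
      then have "pos a = pos b" using eq by auto
      then show "a = b" using pos_inj[of a b] a b eq by auto
    qed
    show "(\<lambda>a. (c a, card (Z (c a)) - Suc (pos a))) ` ?S2 \<subseteq> C \<times> {..<m}"
    proof safe
      fix a assume "a \<in> Y" "c a \<in> C" "card (Z (c a)) \<le> pos a + m"
      then show "card (Z (c a)) - Suc (pos a) < m" using pos_less[of a] by simp
    qed
    show "finite (C \<times> {..<m})" using C(1) by simp
  qed
  moreover have "card (C \<times> {..<m}) = m * card C" by (simp add: card_cartesian_product)
  ultimately have le: "(\<Sum>l\<leftarrow>lam. l - m) \<le> card ?S1"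
    using C(3) by simp
  obtain T where T: "T \<subseteq> ?S1" "card T = (\<Sum>l\<leftarrow>lam. l - m)"
    by (rule obtain_subset_with_card_n[OF le])
  show ?thesis
  proof (rule that[of \<Theta> T])
    show "single_valued \<Theta>" using pos_inj by (auto simp: single_valued_def \<Theta>_def)
    show "single_valued (\<Theta>\<inverse>)" using pos_inj by (auto simp: single_valued_def \<Theta>_def)
    show "T \<subseteq> Domain (\<Theta> ^^ m)" using T(1) dom by blast
    show "pr a b" if "(a, b) \<in> \<Theta>" for a b using that pos_pr by (auto simp: \<Theta>_def)
  qed (use T in \<open>auto simp: \<Theta>_def\<close>)
qed

section \<open>Rank bounds from cuts and from chains\<close>

lemma rank_le_cols:
  assumes M: "M \<in> carrier_mat n n" and fin: "finite C"
    and supp: "\<And>a b. a < n \<Longrightarrow> b < n \<Longrightarrow> M $$ (a, b) \<noteq> 0 \<Longrightarrow> b \<in> C"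
  shows "rank_le M (card C)"
proof (rule rank_leI[OF fin M, where f = "\<lambda>t a. M $$ (a, t)" and g = "\<lambda>t b. if b = t then 1 else 0"])
  fix a b assume ab: "a < n" "b < n"
  have "(\<Sum>t\<in>C. M $$ (a, t) * (if b = t then 1 else 0)) = (\<Sum>t\<in>C. if t = b then M $$ (a, b) else 0)"
    by (intro sum.cong) auto
  also have "\<dots> = M $$ (a, b)"
    using supp[OF ab] fin by (cases "b \<in> C") auto
  finally show "M $$ (a, b) = (\<Sum>t\<in>C. M $$ (a, t) * (if b = t then 1 else 0))" by simp
qed

lemma rank_le_rows:
  assumes M: "M \<in> carrier_mat n n" and fin: "finite C"
    and supp: "\<And>a b. a < n \<Longrightarrow> b < n \<Longrightarrow> M $$ (a, b) \<noteq> 0 \<Longrightarrow> a \<in> C"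
  shows "rank_le M (card C)"
proof (rule rank_leI[OF fin M, where g = "\<lambda>t b. M $$ (t, b)" and f = "\<lambda>t a. if a = t then 1 else 0"])
  fix a b assume ab: "a < n" "b < n"
  have "(\<Sum>t\<in>C. (if a = t then 1 else 0) * M $$ (t, b)) = (\<Sum>t\<in>C. if t = a then M $$ (a, b) else 0)"
    by (intro sum.cong) auto
  also have "\<dots> = M $$ (a, b)"
    using supp[OF ab] fin by (cases "a \<in> C") auto
  finally show "M $$ (a, b) = (\<Sum>t\<in>C. (if a = t then 1 else 0) * M $$ (t, b))" by simp
qed

text \<open>Entries of the product are sums over paths. A step raises the level \<open>u\<close>
  unless it ends outside \<open>F\<close>, and levels run from \<open>k\<close> to below
  \<open>k + m\<close>, so every path of \<open>m\<close> steps must stall. After each factor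
  \<open>X\<close>, the columns outside \<open>F\<close> at the current minimal level are split off,
  at the cost of their number; what remains has level at least \<open>k + 1\<close>. Each point
  outside \<open>F\<close> is charged once, at the step that belongs to its level.\<close>

lemma rank_le_cut:
  assumes "B \<in> carrier_mat n n" and X: "X \<in> carrier_mat n n"
    and step: "\<And>a b. a < n \<Longrightarrow> b < n \<Longrightarrow> X $$ (a, b) \<noteq> 0 \<Longrightarrow> a \<in> G \<Longrightarrow> b \<in> G \<and> u a \<le> u b \<and> (b \<in> F \<longrightarrow> u a < (u b :: nat))"
    and "\<And>a b. a < n \<Longrightarrow> b < n \<Longrightarrow> B $$ (a, b) \<noteq> 0 \<Longrightarrow> b \<in> G \<and> k \<le> u b"
    and "\<And>b. b < n \<Longrightarrow> b \<in> G \<Longrightarrow> u b < k + m"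
  shows "rank_le (B * X ^\<^sub>m m) (card {b. b < n \<and> b \<in> G \<and> b \<notin> F \<and> k \<le> u b})"
  using assms(1,4,5)
proof (induction m arbitrary: B k)
  case 0
  have "B = 0\<^sub>m n n"
  proof (rule eq_matI)
    fix i j assume "i < dim_row (0\<^sub>m n n :: complex mat)" "j < dim_col (0\<^sub>m n n :: complex mat)"
    then have ij: "i < n" "j < n" by auto
    then show "B $$ (i, j) = 0\<^sub>m n n $$ (i, j)"
      using 0(2)[OF ij] 0(3)[OF ij(2)] by (cases "B $$ (i, j) = 0") auto
  qed (use 0(1) in auto)
  then have "B * X ^\<^sub>m 0 = 0\<^sub>m n n" using X by simp
  then show ?case using rank_le_mono[OF rank_le_zero] by simp
next
  case (Suc m)
  let ?C = "{b. b < n \<and> b \<in> G \<and> b \<notin> F \<and> u b = k}"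
  define B1 where "B1 = mat n n (\<lambda>(a, b). if b \<in> ?C then 0 else (B * X) $$ (a, b))"
  define B2 where "B2 = mat n n (\<lambda>(a, b). if b \<in> ?C then (B * X) $$ (a, b) else 0)"
  have c: "B1 \<in> carrier_mat n n" "B2 \<in> carrier_mat n n" "B * X \<in> carrier_mat n n" "X ^\<^sub>m m \<in> carrier_mat n n"
    using Suc.prems(1) X by (auto simp: B1_def B2_def)
  have BX: "B * X = B1 + B2"
    by (rule eq_matI) (use Suc.prems(1) X in \<open>auto simp: B1_def B2_def\<close>)
  have nz: "b \<in> G \<and> k \<le> u b \<and> (b \<in> F \<longrightarrow> k < u b)" if ab: "a < n" "b < n" and BXnz: "(B * X) $$ (a, b) \<noteq> 0" for a b
  proof -
    obtain l where "l < n" "B $$ (a, l) * X $$ (l, b) \<noteq> 0"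
      using BXnz unfolding mult_mat_sum[OF Suc.prems(1) X ab] by (meson lessThan_iff sum.neutral)
    then show ?thesis using Suc.prems(2)[of a l] step[of l b] ab by fastforce
  qed
  have "rank_le (B1 * X ^\<^sub>m m) (card {b. b < n \<and> b \<in> G \<and> b \<notin> F \<and> Suc k \<le> u b})"
  proof (rule Suc.IH[OF c(1)])
    fix a b assume ab: "a < n" "b < n" "B1 $$ (a, b) \<noteq> 0"
    then have "b \<notin> ?C" "(B * X) $$ (a, b) \<noteq> 0" by (auto simp: B1_def split: if_splits)
    then show "b \<in> G \<and> Suc k \<le> u b" using nz[OF ab(1,2)] ab by auto
  qed (use Suc.prems(3) in auto)
  moreover have "rank_le B2 (card ?C)"
    by (rule rank_le_cols[OF c(2)]) (auto simp: B2_def split: if_splits)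
  then have "rank_le (B2 * X ^\<^sub>m m) (card ?C)" using c by (intro rank_le_mult[of _ _ n n _ n])
  ultimately have "rank_le (B1 * X ^\<^sub>m m + B2 * X ^\<^sub>m m)
      (card {b. b < n \<and> b \<in> G \<and> b \<notin> F \<and> Suc k \<le> u b} + card ?C)"
    by (rule rank_le_add[of _ _ _ _ n n]) (use c in auto)
  moreover have "card {b. b < n \<and> b \<in> G \<and> b \<notin> F \<and> Suc k \<le> u b} + card ?C = card {b. b < n \<and> b \<in> G \<and> b \<notin> F \<and> k \<le> u b}"
    by (subst card_Un_disjoint[symmetric]) (auto intro!: arg_cong[of _ _ card])
  moreover have "B * X ^\<^sub>m Suc m = B1 * X ^\<^sub>m m + B2 * X ^\<^sub>m m"
  proof -
    have "B * X ^\<^sub>m Suc m = B * (X * X ^\<^sub>m m)" using pow_mat_add[OF X, of 1 m] X by simp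
    also have "\<dots> = B * X * X ^\<^sub>m m" using assoc_mult_mat[OF Suc.prems(1) X c(4)] by simp
    finally show ?thesis unfolding BX using c by (simp add: add_mult_distrib_mat[of _ n n])
  qed
  ultimately show ?case by simp
qed

text \<open>A path has a starting row in \<open>A'\<close> followed by \<open>m + 1\<close> columns
  in \<open>A\<close>, with levels from 0 to \<open>m + 1\<close>. Rows at level 0 and columns
  outside \<open>F\<close> at level 1 are split off by hand; the remaining columns have level at
  least 2, where \<open>rank_le_cut\<close> takes over. Seen through \<rho>, the rows and columns
  charged are different points of \<open>Y - F\<close> because their levels differ.\<close>

lemma rank_le_incidence:
  assumes P: "greene_poset Y pr lam" and X: "X \<in> carrier_mat n n" and X0: "X0 \<in> carrier_mat n n"
    and A: "A \<subseteq> {..<n}" "A' \<subseteq> {..<n}" and inj: "inj_on \<rho> A" "inj_on \<rho> A'" and \<rho>: "\<rho> ` A \<subseteq> Y" "\<rho> ` A' \<subseteq> Y"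
    and step0: "\<And>a b. a < n \<Longrightarrow> b < n \<Longrightarrow> X0 $$ (a, b) \<noteq> 0 \<Longrightarrow> a \<in> A' \<and> b \<in> A \<and> pr (\<rho> a) (\<rho> b)"
    and step: "\<And>a b. a < n \<Longrightarrow> b < n \<Longrightarrow> X $$ (a, b) \<noteq> 0 \<Longrightarrow> a \<in> A \<Longrightarrow> b \<in> A \<and> pr (\<rho> a) (\<rho> b)"
  shows "rank_le (X0 * X ^\<^sub>m m) (card Y - boxes_upto lam (Suc m))"
proof -
  obtain F u where F: "F \<subseteq> Y" "card (Y - F) \<le> card Y - boxes_upto lam (Suc m)" "\<And>a. a \<in> Y \<Longrightarrow> u a \<le> Suc m"
    "\<And>a. a \<in> F \<Longrightarrow> 1 \<le> u a"
    "\<And>a b. a \<in> Y \<Longrightarrow> b \<in> Y \<Longrightarrow> pr a b \<Longrightarrow> u a \<le> u b \<and> (b \<in> F \<longrightarrow> u a < (u b :: nat))"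
    using greene_poset_levels[OF P, of "Suc m"] by metis
  let ?v = "\<lambda>a. u (\<rho> a)" and ?F = "{a. \<rho> a \<in> F}"
  let ?C0 = "{a \<in> A'. ?v a = 0}" and ?C1 = "{b \<in> A. b \<notin> ?F \<and> ?v b = 1}"
  let ?C2 = "{b. b < n \<and> b \<in> A \<and> b \<notin> ?F \<and> 2 \<le> ?v b}"
  define M0 where "M0 = mat n n (\<lambda>(a, b). if a \<in> ?C0 then X0 $$ (a, b) else 0)"
  define M1 where "M1 = mat n n (\<lambda>(a, b). if a \<notin> ?C0 \<and> b \<in> ?C1 then X0 $$ (a, b) else 0)"
  define M2 where "M2 = mat n n (\<lambda>(a, b). if a \<notin> ?C0 \<and> b \<notin> ?C1 then X0 $$ (a, b) else 0)"
  have c: "M0 \<in> carrier_mat n n" "M1 \<in> carrier_mat n n" "M2 \<in> carrier_mat n n" "X ^\<^sub>m m \<in> carrier_mat n n"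
    using X by (auto simp: M0_def M1_def M2_def)
  have XM: "X0 = M0 + M1 + M2" by (rule eq_matI) (use X0 in \<open>auto simp: M0_def M1_def M2_def\<close>)
  have fin: "finite A" "finite A'" using A finite_subset by blast+
  have "rank_le (M2 * X ^\<^sub>m m) (card ?C2)"
  proof (rule rank_le_cut[OF c(3) X])
    fix a b assume ab: "a < n" "b < n" "X $$ (a, b) \<noteq> 0" "a \<in> A"
    from step[OF this] F(5)[of "\<rho> a" "\<rho> b"] \<rho> ab(4)
    show "b \<in> A \<and> ?v a \<le> ?v b \<and> (b \<in> ?F \<longrightarrow> ?v a < ?v b)" by auto
  next
    fix a b assume ab: "a < n" "b < n" "M2 $$ (a, b) \<noteq> 0"
    then have nz: "X0 $$ (a, b) \<noteq> 0" "a \<notin> ?C0" "b \<notin> ?C1" by (auto simp: M2_def split: if_splits)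
    from step0[OF ab(1,2) nz(1)] have s: "a \<in> A'" "b \<in> A" "pr (\<rho> a) (\<rho> b)" by auto
    then have "?v a \<le> ?v b \<and> (b \<in> ?F \<longrightarrow> ?v a < ?v b)" using F(5)[of "\<rho> a" "\<rho> b"] \<rho> by auto
    then show "b \<in> A \<and> 2 \<le> ?v b" using s nz by auto
  next
    fix b assume "b < n" "b \<in> A"
    then show "?v b < 2 + m" using F(3)[of "\<rho> b"] \<rho> by fastforce
  qed
  moreover have "rank_le M0 (card ?C0)"
    by (rule rank_le_rows[OF c(1)]) (use fin in \<open>auto simp: M0_def split: if_splits\<close>)
  moreover have "rank_le M1 (card ?C1)"
    by (rule rank_le_cols[OF c(2)]) (use fin in \<open>auto simp: M1_def split: if_splits\<close>)
  ultimately have r: "rank_le (M0 * X ^\<^sub>m m + M1 * X ^\<^sub>m m + M2 * X ^\<^sub>m m) (card ?C0 + card ?C1 + card ?C2)"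
  proof -
    assume r2: "rank_le (M2 * X ^\<^sub>m m) (card ?C2)" and r0: "rank_le M0 (card ?C0)" and r1: "rank_le M1 (card ?C1)"
    have "rank_le (M0 * X ^\<^sub>m m + M1 * X ^\<^sub>m m) (card ?C0 + card ?C1)"
      by (rule rank_le_add[OF rank_le_mult[OF r0 c(1,4)] rank_le_mult[OF r1 c(2,4)]]) (use c in auto)
    then show ?thesis by (rule rank_le_add[OF _ r2, of _ _ n n]) (use c in auto)
  qed
  have eq: "M0 * X ^\<^sub>m m + M1 * X ^\<^sub>m m + M2 * X ^\<^sub>m m = X0 * X ^\<^sub>m m"
    unfolding XM by (subst add_mult_distrib_mat[of _ n n], (use c in simp)+, subst add_mult_distrib_mat[of _ n n], (use c in simp)+)
  have "card ?C0 + card ?C1 + card ?C2 \<le> card (Y - F)"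
  proof -
    have "card ?C1 + card ?C2 = card (?C1 \<union> ?C2)" using fin by (subst card_Un_disjoint) auto
    also have "\<dots> = card (\<rho> ` (?C1 \<union> ?C2))"
      by (rule card_image[symmetric], rule inj_on_subset[OF inj(1)]) auto
    finally have 1: "card ?C1 + card ?C2 = card (\<rho> ` (?C1 \<union> ?C2))" .
    have 2: "card ?C0 = card (\<rho> ` ?C0)"
      by (rule card_image[symmetric], rule inj_on_subset[OF inj(2)]) auto
    have "card (\<rho> ` ?C0) + card (\<rho> ` (?C1 \<union> ?C2)) = card (\<rho> ` ?C0 \<union> \<rho> ` (?C1 \<union> ?C2))"
    proof (rule card_Un_disjoint[symmetric])
      have "u y = 0" if "y \<in> \<rho> ` ?C0" for y using that by auto
      moreover have "u y \<noteq> 0" if "y \<in> \<rho> ` (?C1 \<union> ?C2)" for y using that by auto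
      ultimately show "\<rho> ` ?C0 \<inter> \<rho> ` (?C1 \<union> ?C2) = {}" by blast
    qed (use fin in auto)
    also have "\<dots> \<le> card (Y - F)"
    proof (rule card_mono)
      have "\<rho> a \<notin> F" if "?v a = 0" for a using F(4)[of "\<rho> a"] that by auto
      then show "\<rho> ` ?C0 \<union> \<rho> ` (?C1 \<union> ?C2) \<subseteq> Y - F" using \<rho> by blast
    qed (use P in \<open>simp add: greene_poset_def\<close>)
    finally show ?thesis using 1 2 by simp
  qed
  then have "card ?C0 + card ?C1 + card ?C2 \<le> card Y - boxes_upto lam (Suc m)" using F(2) by (rule order_trans)
  then show ?thesis by (rule rank_le_mono[OF r[unfolded eq]])
qed

text \<open>For a single-valued relation at most one path of a given length joins two points, so no
  entry exceeds 1 and the products keep the 0/1 pattern of the relation powers. The first factor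
  \<open>Z\<close> is kept apart so that it can start in another index set.\<close>

lemma pow_mat_relpow:
  assumes X: "X \<in> carrier_mat n n" and inj: "inj_on \<rho> G"
    and sv: "single_valued \<Theta>" and ran: "Range \<Theta> \<subseteq> \<rho> ` G" and G: "G \<subseteq> {..<n}"
    and ent: "\<And>a z. a \<in> G \<Longrightarrow> z < n \<Longrightarrow> X $$ (a, z) = (if z \<in> G \<and> (\<rho> a, \<rho> z) \<in> \<Theta> then 1 else 0)"
    and Z: "Z \<in> carrier_mat n n" and i: "i < n"
    and Zent: "\<And>z. z < n \<Longrightarrow> Z $$ (i, z) = (if z \<in> G \<and> (v, \<rho> z) \<in> \<Theta> then 1 else 0)"
    and "b < n"
  shows "(Z * X ^\<^sub>m m) $$ (i, b) = (if b \<in> G \<and> (v, \<rho> b) \<in> \<Theta> ^^ Suc m then 1 else 0)"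
  using assms(10)
proof (induction m arbitrary: b)
  case 0
  have "Z * X ^\<^sub>m 0 = Z" using X Z by simp
  then show ?case using Zent[OF 0] by simp
next
  case (Suc m)
  note bn = Suc.prems
  have ZX: "Z * X ^\<^sub>m m \<in> carrier_mat n n" using X Z by simp
  have "Z * X ^\<^sub>m Suc m = (Z * X ^\<^sub>m m) * X"
    using assoc_mult_mat[OF Z pow_carrier_mat[OF X] X] by simp
  then have eq: "(Z * X ^\<^sub>m Suc m) $$ (i, b) = (\<Sum>z<n. (Z * X ^\<^sub>m m) $$ (i, z) * X $$ (z, b))"
    using mult_mat_sum[OF ZX X i bn] by simp
  let ?P = "\<lambda>z. z \<in> G \<and> (v, \<rho> z) \<in> \<Theta> ^^ Suc m"
  have terms: "(Z * X ^\<^sub>m m) $$ (i, z) * X $$ (z, b) = (if ?P z \<and> b \<in> G \<and> (\<rho> z, \<rho> b) \<in> \<Theta> then 1 else 0)"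
    if "z < n" for z
    using Suc.IH[OF that] ent[of z b] bn by auto
  show ?case
  proof (cases "b \<in> G \<and> (v, \<rho> b) \<in> \<Theta> ^^ Suc (Suc m)")
    case True
    then obtain y where y: "(v, y) \<in> \<Theta> ^^ Suc m" "(y, \<rho> b) \<in> \<Theta>" by auto
    then have "y \<in> \<rho> ` G" using ran by auto
    then obtain z where z: "z \<in> G" "y = \<rho> z" by blast
    have uniq: "z' = z" if "?P z'" for z'
    proof -
      have "\<rho> z' = \<rho> z"
        using single_valuedD[OF single_valued_relpow[OF sv, of "Suc m"]] that y(1) unfolding z(2) by blast
      then show ?thesis using inj that z(1) by (simp add: inj_on_eq_iff)
    qed
    have "(Z * X ^\<^sub>m Suc m) $$ (i, b) = (\<Sum>z'<n. if z' = z then 1 else 0)"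
      unfolding eq
    proof (rule sum.cong)
      fix z' assume "z' \<in> {..<n}"
      then have z': "z' < n" by simp
      show "(Z * X ^\<^sub>m m) $$ (i, z') * X $$ (z', b) = (if z' = z then 1 else 0)"
      proof (cases "z' = z")
        case True
        then show ?thesis unfolding terms[OF z'] using y z \<open>b \<in> G \<and> _\<close> by simp
      next
        case False
        then have "\<not> ?P z'" using uniq by blast
        then show ?thesis unfolding terms[OF z'] using False by auto
      qed
    qed simp
    also have "\<dots> = 1" using z(1) G by auto
    finally show ?thesis using True by simp
  next
    case False
    then have "\<not> (?P z \<and> b \<in> G \<and> (\<rho> z, \<rho> b) \<in> \<Theta>)" for z by auto
    then have "(Z * X ^\<^sub>m Suc m) $$ (i, b) = 0" unfolding eq using terms by (simp add: sum.neutral)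
    then show ?thesis using False by simp
  qed
qed

text \<open>Rows over the points of \<open>T\<close> and columns over their endpoints form an
  identity submatrix; that the converse is single-valued keeps the endpoints apart.\<close>

lemma rank_ge_relpow:
  assumes M: "M \<in> carrier_mat n n" and A: "A \<subseteq> {..<n}" "A' \<subseteq> {..<n}"
    and sv: "single_valued (\<Theta>\<inverse>)" and fin: "finite T" and T: "T \<subseteq> Domain (\<Theta> ^^ m)"
    and TA: "T \<subseteq> \<rho> ` A'" and ran: "Range (\<Theta> ^^ m) \<subseteq> \<rho> ` A"
    and ent: "\<And>a b. a \<in> A' \<Longrightarrow> b \<in> A \<Longrightarrow> M $$ (a, b) = (if (\<rho> a, \<rho> b) \<in> \<Theta> ^^ m then 1 else 0)"
  shows "rank_ge M (card T)"
proof -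
  have "\<forall>t\<in>T. \<exists>a. a \<in> A' \<and> \<rho> a = t" using TA by auto
  then have "\<exists>f. \<forall>t\<in>T. f t \<in> A' \<and> \<rho> (f t) = t" by (rule bchoice)
  then obtain f where f: "\<And>t. t \<in> T \<Longrightarrow> f t \<in> A' \<and> \<rho> (f t) = t" by blast
  have "\<forall>t\<in>T. \<exists>b. b \<in> A \<and> (t, \<rho> b) \<in> \<Theta> ^^ m"
  proof
    fix t assume "t \<in> T"
    then obtain y where y: "(t, y) \<in> \<Theta> ^^ m" using T by auto
    then have "y \<in> \<rho> ` A" using ran by auto
    then show "\<exists>b. b \<in> A \<and> (t, \<rho> b) \<in> \<Theta> ^^ m" using y by auto
  qed
  then have "\<exists>g. \<forall>t\<in>T. g t \<in> A \<and> (t, \<rho> (g t)) \<in> \<Theta> ^^ m" by (rule bchoice)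
  then obtain g where g: "\<And>t. t \<in> T \<Longrightarrow> g t \<in> A \<and> (t, \<rho> (g t)) \<in> \<Theta> ^^ m" by blast
  have sv': "single_valued ((\<Theta> ^^ m)\<inverse>)"
  proof (induction m)
    case (Suc m)
    then show ?case using single_valued_relcomp[OF sv] by (simp add: converse_relcomp)
  qed simp
  show ?thesis
  proof (rule rank_ge_entries[OF fin M, where f = f and g = g])
    fix t t' assume t: "t \<in> T" "t' \<in> T"
    have "(t, \<rho> (g t')) \<in> \<Theta> ^^ m \<longleftrightarrow> t = t'"
      using g[OF t(2)] sv' unfolding single_valued_def by blast
    then show "M $$ (f t, g t') = (if t = t' then 1 else 0)"
      using ent[of "f t" "g t'"] f[OF t(1)] g[OF t(2)] by simp
  qed (use f g A in auto)
qed

section \<open>The conormal slice\<close>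

definition kpart :: "nat \<Rightarrow> nat \<Rightarrow> complex mat \<Rightarrow> complex mat" where
  "kpart p n x = mat n n (\<lambda>(a, b). if (a < p) = (b < p) then x $$ (a, b) else 0)"

definition spart :: "nat \<Rightarrow> nat \<Rightarrow> complex mat \<Rightarrow> complex mat" where
  "spart p n x = mat n n (\<lambda>(a, b). if (a < p) = (b < p) then 0 else x $$ (a, b))"

lemma kpart_carrier[simp]: "kpart p n x \<in> carrier_mat n n"
  and spart_carrier[simp]: "spart p n x \<in> carrier_mat n n"
  by (simp_all add: kpart_def spart_def)

lemma hom_kpart: "hom_mat p True (kpart p n x)" and hom_spart: "hom_mat p False (spart p n x)"
  by (auto simp: hom_mat_def kpart_def spart_def split: if_splits)

lemma hom_kpart_pow: "hom_mat p True (kpart p n x ^\<^sub>m m)"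
  using hom_mat_pow[OF hom_kpart kpart_carrier, where a = m] by simp

lemma graded_proj_commute:
  assumes "hom_mat p True X" "X \<in> carrier_mat n n"
  shows "graded_proj p n \<epsilon> * X = X * graded_proj p n \<epsilon>"
proof (rule eq_matI)
  fix i j assume "i < dim_row (X * graded_proj p n \<epsilon>)" "j < dim_col (X * graded_proj p n \<epsilon>)"
  then have ij: "i < n" "j < n" using assms by (auto simp: graded_proj_def)
  have "(graded_proj p n \<epsilon> * X) $$ (i, j) = (\<Sum>l<n. if l = i then if (i < p) = \<epsilon> then X $$ (i, j) else 0 else 0)"
    unfolding mult_mat_sum[OF graded_proj_carrier assms(2) ij]
    by (intro sum.cong refl) (use ij in \<open>auto simp: graded_proj_def\<close>)
  then show "(graded_proj p n \<epsilon> * X) $$ (i, j) = (X * graded_proj p n \<epsilon>) $$ (i, j)"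
    unfolding mult_graded_proj_index[OF assms(2) ij]
    using assms ij unfolding hom_mat_def by auto
qed (use assms in \<open>auto simp: graded_proj_def\<close>)

text \<open>The slice is described in coordinates: $A$ and $B$ are the indices of the two graded parts,
  which are split as $L \sqcup I \sqcup L'$ and $M \sqcup J \sqcup M'$, and \<open>mate\<close> is the matching
  of $I$ and $J$. The data are symmetric in the two parts.\<close>

locale matching_data =
  fixes p n :: nat and \<epsilon> :: bool and A B L I L' M J M' :: "nat set" and mate :: "nat \<Rightarrow> nat"
  assumes A: "A = {i. i < n \<and> (i < p) = \<epsilon>}" and B: "B = {i. i < n \<and> (i < p) \<noteq> \<epsilon>}"
    and A_split: "A = L \<union> I \<union> L'" "L \<inter> I = {}" "L \<inter> L' = {}" "I \<inter> L' = {}"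
    and B_split: "B = M \<union> J \<union> M'" "M \<inter> J = {}" "M \<inter> M' = {}" "J \<inter> M' = {}"
    and mate: "\<And>i. i \<in> I \<Longrightarrow> mate i \<in> J \<and> mate (mate i) = i" "\<And>j. j \<in> J \<Longrightarrow> mate j \<in> I \<and> mate (mate j) = j"
begin

text \<open>The conditions on rows say that the image of \<open>x\<close> lies in the base subspace
  \<open>W0\<close>, spanned by the unit vectors of \<open>L\<close> and \<open>M\<close> and the
  sums of matched ones; the conditions on columns say that \<open>x\<close> kills it. The last
  clause is strict triangularity of the even part. The translation is made in
  \<open>slice_iff\<close> and \<open>slice_conormal\<close>.\<close>

definition slice :: "complex mat set" where
  "slice = {x \<in> carrier_mat n n.
    (\<forall>a<n. \<forall>b<n. x $$ (a, b) \<noteq> 0 \<longrightarrow> a \<notin> L' \<union> M' \<and> b \<notin> L \<union> M) \<and>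
    (\<forall>i\<in>I. \<forall>y<n. x $$ (i, y) = x $$ (mate i, y) \<and> x $$ (y, i) = - x $$ (y, mate i)) \<and>
    (\<forall>a<n. \<forall>b<n. x $$ (a, b) \<noteq> 0 \<longrightarrow> (a < p) = (b < p) \<longrightarrow> a < b)}"

text \<open>The positions in \<open>A\<close> where the even part can be nonzero. For two matched
  indices, an entry at \<open>(a, b)\<close> forces the opposite entry at the position of their
  mates, which has to lie above the diagonal as well.\<close>

definition pr_k :: "nat \<Rightarrow> nat \<Rightarrow> bool" where
  "pr_k a b \<longleftrightarrow> a \<in> L \<union> I \<and> b \<in> I \<union> L' \<and> a < b \<and> (a \<in> I \<longrightarrow> b \<in> I \<longrightarrow> mate a < mate b)"

text \<open>A matched index of \<open>A\<close> is represented by its mate in \<open>J\<close>, as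
  \<rho> records. This turns odd and even steps into relations on one and the same set.\<close>

definition Y_s :: "nat set" where "Y_s = J \<union> M \<union> L'"

text \<open>A point of \<open>J\<close> has a coordinate in each graded part, itself and its mate; a
  point of \<open>M\<close> or \<open>L'\<close> has only one. Each clause compares the coordinates
  that two points have in the same part, so every point of \<open>M\<close> precedes every point of
  \<open>L'\<close>.\<close>

definition pr_s :: "nat \<Rightarrow> nat \<Rightarrow> bool" where
  "pr_s a b \<longleftrightarrow> a \<in> J \<union> M \<and> b \<in> J \<union> L' \<and> (a \<in> J \<longrightarrow> b \<in> J \<longrightarrow> a < b \<and> mate a < mate b) \<and>
    (a \<in> M \<longrightarrow> b \<in> J \<longrightarrow> a < b) \<and> (a \<in> J \<longrightarrow> b \<in> L' \<longrightarrow> mate a < b)"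

definition \<rho> :: "nat \<Rightarrow> nat" where "\<rho> y = (if y \<in> I then mate y else y)"

lemma sliceD:
  assumes "x \<in> slice"
  shows "x \<in> carrier_mat n n"
    "\<And>a b. a < n \<Longrightarrow> b < n \<Longrightarrow> x $$ (a, b) \<noteq> 0 \<Longrightarrow> a \<notin> L' \<and> a \<notin> M' \<and> b \<notin> L \<and> b \<notin> M"
    "\<And>i y. i \<in> I \<Longrightarrow> y < n \<Longrightarrow> x $$ (i, y) = x $$ (mate i, y)"
    "\<And>i y. i \<in> I \<Longrightarrow> y < n \<Longrightarrow> x $$ (y, i) = - x $$ (y, mate i)"
    "\<And>a b. a < n \<Longrightarrow> b < n \<Longrightarrow> x $$ (a, b) \<noteq> 0 \<Longrightarrow> (a < p) = (b < p) \<Longrightarrow> a < b"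
  using assms unfolding slice_def by auto

lemma index_less: "i \<in> I \<Longrightarrow> i < n" "j \<in> J \<Longrightarrow> j < n" "i \<in> I \<Longrightarrow> mate i < n" "j \<in> J \<Longrightarrow> mate j < n"
proof -
  have "I \<subseteq> {..<n}" "J \<subseteq> {..<n}" using A A_split(1) B B_split(1) by auto
  then show "i \<in> I \<Longrightarrow> i < n" "j \<in> J \<Longrightarrow> j < n" "i \<in> I \<Longrightarrow> mate i < n" "j \<in> J \<Longrightarrow> mate j < n"
    using mate by blast+
qed

lemma parity: "a \<in> A \<Longrightarrow> (a < p) = \<epsilon>" "b \<in> B \<Longrightarrow> (b < p) = (\<not> \<epsilon>)" "a < n \<Longrightarrow> (a < p) = \<epsilon> \<longleftrightarrow> a \<in> A"
  "a < n \<Longrightarrow> a \<in> A \<or> a \<in> B" "a \<in> A \<Longrightarrow> a < n" "b \<in> B \<Longrightarrow> b < n" "A \<inter> B = {}"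
  using A B by auto

lemma subsets: "L \<subseteq> A" "I \<subseteq> A" "L' \<subseteq> A" "M \<subseteq> B" "J \<subseteq> B" "M' \<subseteq> B"
  using A_split B_split by auto

lemma disjoint_parts: "I \<inter> J = {}" "I \<inter> M = {}" "L' \<inter> J = {}" "L' \<inter> M = {}" "L \<inter> J = {}" "L \<inter> M = {}" "I \<inter> M' = {}"
  using subsets parity(7) by auto

lemma slice_pr_k:
  assumes x: "x \<in> slice" and ab: "a < n" "b < n" "x $$ (a, b) \<noteq> 0" "a \<in> A" "b \<in> A"
  shows "pr_k a b"
proof -
  note D = sliceD[OF x]
  have ab': "a \<in> L \<union> I" "b \<in> I \<union> L'" using D(2)[OF ab(1-3)] ab(4,5) A_split by auto
  moreover have "a < b" using D(5)[OF ab(1-3)] ab(4,5) parity by auto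
  moreover have "mate a < mate b" if i: "a \<in> I" "b \<in> I"
  proof -
    have "x $$ (mate a, mate b) \<noteq> 0"
      using D(3)[OF i(1) ab(2)] D(4)[OF i(2), of "mate a"] index_less(3)[OF i(1)] ab(3) by simp
    moreover have "mate a \<in> B" "mate b \<in> B" using i mate B_split by auto
    ultimately show ?thesis using D(5)[of "mate a" "mate b"] index_less i parity by auto
  qed
  ultimately show ?thesis by (auto simp: pr_k_def)
qed

text \<open>An odd entry is not restricted by triangularity directly. Equality of matched rows and
  opposition of matched columns copy it into a diagonal block, where triangularity applies.\<close>

lemma slice_pr_s:
  assumes x: "x \<in> slice" and ab: "a < n" "b < n" "x $$ (a, b) \<noteq> 0" "a \<in> B" "b \<in> A"
  shows "a \<in> J \<union> M" "b \<in> I \<union> L'" "pr_s a (\<rho> b)"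
proof -
  note D = sliceD[OF x]
  show ab': "a \<in> J \<union> M" "b \<in> I \<union> L'" using D(2)[OF ab(1-3)] ab(4,5) A_split B_split by auto
  have 1: "a < mate b" if b: "b \<in> I"
  proof -
    have "x $$ (a, mate b) \<noteq> 0" using D(4)[OF b ab(1)] ab(3) by simp
    moreover have "mate b \<in> B" using b mate B_split by auto
    ultimately show ?thesis using D(5)[of a "mate b"] index_less b ab parity by auto
  qed
  have 2: "mate a < b" if a: "a \<in> J"
  proof -
    have "x $$ (mate a, b) \<noteq> 0" using D(3)[of "mate a" b] mate(2)[OF a] ab(2,3) by simp
    moreover have "mate a \<in> A" using a mate A_split by auto
    ultimately show ?thesis using D(5)[of "mate a" b] index_less a ab parity by auto
  qed
  show "pr_s a (\<rho> b)"
  proof (cases "b \<in> I")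
    case True
    then show ?thesis using 1 2 ab' mate(1)[of b] disjoint_parts B_split unfolding pr_s_def \<rho>_def by auto
  next
    case False
    then show ?thesis using 2 ab' disjoint_parts unfolding pr_s_def \<rho>_def by auto
  qed
qed

lemma \<rho>_props: "inj_on \<rho> (I \<union> L')" "inj_on \<rho> (J \<union> M)" "\<rho> ` (I \<union> L') = J \<union> L'" "\<And>a. a \<in> J \<union> M \<Longrightarrow> \<rho> a = a"
proof -
  show id: "\<And>a. a \<in> J \<union> M \<Longrightarrow> \<rho> a = a" using disjoint_parts by (auto simp: \<rho>_def)
  then show "inj_on \<rho> (J \<union> M)" by (auto simp: inj_on_def)
  show "inj_on \<rho> (I \<union> L')"
  proof (rule inj_onI)
    fix a b assume ab: "a \<in> I \<union> L'" "b \<in> I \<union> L'" "\<rho> a = \<rho> b"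
    have \<rho>L: "\<rho> l \<in> L'" if "l \<in> L'" for l using that A_split(4) by (auto simp: \<rho>_def)
    have \<rho>I: "\<rho> i = mate i \<and> mate i \<in> J \<and> mate (mate i) = i \<and> \<rho> i \<notin> L'" if "i \<in> I" for i
      using that mate(1)[OF that] disjoint_parts(3) by (auto simp: \<rho>_def)
    show "a = b"
    proof (cases "a \<in> I")
      case True
      then have "b \<in> I" using \<rho>I[of a] \<rho>L[of b] ab by auto
      then show ?thesis using \<rho>I[of a] \<rho>I[of b] True ab(3) by metis
    next
      case False
      then have "a \<in> L'" using ab by auto
      then have "b \<notin> I" using \<rho>L[of a] \<rho>I[of b] ab by auto
      then show ?thesis using False ab(3) by (simp add: \<rho>_def)
    qed
  qed
  have "\<rho> ` I = J" using mate by (force simp: \<rho>_def image_def)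
  moreover have "\<rho> ` L' = L'" using A_split by (force simp: \<rho>_def image_def)
  ultimately show "\<rho> ` (I \<union> L') = J \<union> L'" by (simp add: image_Un)
qed

text \<open>Moving the graded projection next to the first factor confines that factor to indices of
  \<open>A\<close>; the later even steps cannot leave \<open>A\<close>.\<close>

lemma rank_le_slice_k:
  assumes P: "greene_poset A pr_k lam" and x: "x \<in> slice" and m: "m \<ge> 1"
  shows "rank_le (kpart p n x ^\<^sub>m m * graded_proj p n \<epsilon>) (card A - boxes_upto lam m)"
proof -
  let ?k = "kpart p n x" and ?E = "graded_proj p n \<epsilon>"
  obtain l where l: "m = Suc l" using m by (cases m) auto
  have c: "?k ^\<^sub>m l \<in> carrier_mat n n" by simp
  have "?k ^\<^sub>m m * ?E = ?k * (?k ^\<^sub>m l * ?E)"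
    using pow_mat_add[OF kpart_carrier, of p n x 1 l] assoc_mult_mat[OF kpart_carrier c graded_proj_carrier] l by simp
  also have "?k ^\<^sub>m l * ?E = ?E * ?k ^\<^sub>m l" by (rule graded_proj_commute[OF hom_kpart_pow c, symmetric])
  also have "?k * (?E * ?k ^\<^sub>m l) = ?k * ?E * ?k ^\<^sub>m l"
    by (rule assoc_mult_mat[OF kpart_carrier graded_proj_carrier c, symmetric])
  also have "rank_le \<dots> (card A - boxes_upto lam m)" unfolding l
  proof (rule rank_le_incidence[OF P kpart_carrier, where \<rho> = id and A = A and A' = A])
    show "?k * ?E \<in> carrier_mat n n" by (rule mult_carrier_mat[OF kpart_carrier graded_proj_carrier])
    fix a b assume ab: "a < n" "b < n"
    have nz: "b \<in> A \<and> pr_k (id a) (id b)" if "a \<in> A" "?k $$ (a, b) \<noteq> 0"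
      using that slice_pr_k[OF x ab] parity(3)[OF ab(1)] parity(3)[OF ab(2)] ab
      by (simp add: kpart_def split: if_splits)
    show "b \<in> A \<and> pr_k (id a) (id b)" if "?k $$ (a, b) \<noteq> 0" "a \<in> A" by (rule nz[OF that(2,1)])
    show "a \<in> A \<and> b \<in> A \<and> pr_k (id a) (id b)" if "(?k * ?E) $$ (a, b) \<noteq> 0"
    proof -
      have k: "(b < p) = \<epsilon>" "?k $$ (a, b) \<noteq> 0"
        using that unfolding mult_graded_proj_index[OF kpart_carrier ab] by (auto split: if_splits)
      then have "a \<in> A" using parity(3)[OF ab(1)] ab by (simp add: kpart_def split: if_splits)
      then show ?thesis using nz k(2) by blast
    qed
  qed (auto simp: A)
  finally show ?thesis .
qed

lemma spart_kpart_proj: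
  "spart p n x * kpart p n x ^\<^sub>m m * graded_proj p n \<epsilon> = spart p n x * graded_proj p n \<epsilon> * kpart p n x ^\<^sub>m m"
proof -
  have k: "kpart p n x ^\<^sub>m m \<in> carrier_mat n n" by simp
  have "hom_mat p True (kpart p n x ^\<^sub>m m)" by (rule hom_kpart_pow)
  then have "kpart p n x ^\<^sub>m m * graded_proj p n \<epsilon> = graded_proj p n \<epsilon> * kpart p n x ^\<^sub>m m"
    using k by (intro graded_proj_commute[symmetric])
  then show ?thesis
    using assoc_mult_mat[OF spart_carrier k graded_proj_carrier] assoc_mult_mat[OF spart_carrier graded_proj_carrier k] by simp
qed

text \<open>The first factor crosses from \<open>J\<close> or \<open>M\<close> to \<open>I\<close>
  or \<open>L'\<close>. Later even steps obey \<open>pr_s\<close> as well: the row of an index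
  \<open>a\<close> in \<open>I\<close> equals that of its mate, so the even entry is at the same
  time an odd entry in row \<open>mate a\<close>.\<close>

lemma rank_le_slice_s:
  assumes "greene_poset Y_s pr_s lam" "x \<in> slice"
  shows "rank_le (spart p n x * kpart p n x ^\<^sub>m m * graded_proj p n \<epsilon>) (card Y_s - boxes_upto lam (Suc m))"
  unfolding spart_kpart_proj
proof (rule rank_le_incidence[OF assms(1) kpart_carrier, where \<rho> = \<rho> and A = "I \<union> L'" and A' = "J \<union> M"])
  show "spart p n x * graded_proj p n \<epsilon> \<in> carrier_mat n n"
    by (rule mult_carrier_mat[OF spart_carrier graded_proj_carrier])
  show "I \<union> L' \<subseteq> {..<n}" "J \<union> M \<subseteq> {..<n}" using subsets parity by auto
  show "inj_on \<rho> (I \<union> L')" "inj_on \<rho> (J \<union> M)" by (rule \<rho>_props)+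
  show "\<rho> ` (I \<union> L') \<subseteq> Y_s" "\<rho> ` (J \<union> M) \<subseteq> Y_s" using \<rho>_props by (auto simp: Y_s_def)
next
  fix a b assume ab: "a < n" "b < n" "(spart p n x * graded_proj p n \<epsilon>) $$ (a, b) \<noteq> 0"
  then have nz: "x $$ (a, b) \<noteq> 0" "(b < p) = \<epsilon>" "(a < p) \<noteq> (b < p)"
    unfolding mult_graded_proj_index[OF spart_carrier ab(1,2)] by (auto simp: spart_def split: if_splits)
  then have "a \<in> B" "b \<in> A" using ab by (auto simp: A B)
  from slice_pr_s[OF assms(2) ab(1,2) nz(1) this] show "a \<in> J \<union> M \<and> b \<in> I \<union> L' \<and> pr_s (\<rho> a) (\<rho> b)"
    using \<rho>_props(4) by auto
next
  fix a b assume ab: "a < n" "b < n" "kpart p n x $$ (a, b) \<noteq> 0" "a \<in> I \<union> L'"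
  then have nz: "x $$ (a, b) \<noteq> 0" "(a < p) = (b < p)" by (auto simp: kpart_def split: if_splits)
  have aI: "a \<in> I" using sliceD(2)[OF assms(2) ab(1,2) nz(1)] ab(4) by simp
  then have "a \<in> A" using subsets by auto
  then have bA: "b \<in> A" using nz(2) ab(2) A by auto
  have "x $$ (mate a, b) \<noteq> 0" using sliceD(3)[OF assms(2) aI ab(2)] nz by simp
  moreover have "mate a \<in> B" using mate(1)[OF aI] subsets by auto
  ultimately have "b \<in> I \<union> L'" "pr_s (mate a) (\<rho> b)"
    using slice_pr_s[OF assms(2), of "mate a" b] index_less(3)[OF aI] ab(2) bA by auto
  then show "b \<in> I \<union> L' \<and> pr_s (\<rho> a) (\<rho> b)" using aI by (simp add: \<rho>_def)
qed

text \<open>The function \<open>r\<close> gives matched indices the same point, which makes their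
  rows equal; the sign depends on the graded part of the column, which makes matched columns
  opposite. In this way a relation on the poset is lifted to an element of the slice.\<close>

definition chain_mat :: "nat set \<Rightarrow> (nat \<Rightarrow> nat) \<Rightarrow> (nat \<times> nat) set \<Rightarrow> complex mat" where
  "chain_mat Dm r \<Theta> = mat n n (\<lambda>(a, b). if a \<in> Dm \<and> b \<in> Dm \<and> (r a, r b) \<in> \<Theta> then if b \<in> A then 1 else - 1 else 0)"

lemma chain_mat_slice:
  assumes I: "I \<union> J \<subseteq> Dm" "\<And>i. i \<in> I \<Longrightarrow> r (mate i) = r i"
    and E1: "\<And>a b. a \<in> Dm \<Longrightarrow> b \<in> Dm \<Longrightarrow> (r a, r b) \<in> \<Theta> \<Longrightarrow> a \<notin> L' \<union> M' \<and> b \<notin> L \<union> M"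
    and E3: "\<And>a b. a \<in> Dm \<Longrightarrow> b \<in> Dm \<Longrightarrow> (r a, r b) \<in> \<Theta> \<Longrightarrow> (a \<in> A) = (b \<in> A) \<Longrightarrow> a < b"
  shows "chain_mat Dm r \<Theta> \<in> slice"
  unfolding slice_def
proof (intro CollectI conjI ballI allI impI)
  fix i y assume i: "i \<in> I" and y: "y < n"
  have i': "mate i \<in> J" "i < n" "mate i < n" "i \<in> A" "mate i \<notin> A"
    using mate(1)[OF i] index_less i subsets parity(7) by auto
  then have "i \<in> Dm" "mate i \<in> Dm" using i I by auto
  then show "chain_mat Dm r \<Theta> $$ (i, y) = chain_mat Dm r \<Theta> $$ (mate i, y)"
    "chain_mat Dm r \<Theta> $$ (y, i) = - chain_mat Dm r \<Theta> $$ (y, mate i)"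
    using i' y I(2)[OF i] by (auto simp: chain_mat_def)
next
  fix a b assume ab: "a < n" "b < n" "chain_mat Dm r \<Theta> $$ (a, b) \<noteq> 0"
  then have c: "a \<in> Dm" "b \<in> Dm" "(r a, r b) \<in> \<Theta>" by (auto simp: chain_mat_def split: if_splits)
  then show "a \<notin> L' \<union> M'" "b \<notin> L \<union> M" using E1 by blast+
  show "a < b" if "(a < p) = (b < p)" using E3[OF c] that ab parity by auto
qed (simp add: chain_mat_def)

lemma rank_ge_slice_k:
  assumes P: "greene_poset A pr_k lam" and m: "m \<ge> 1"
  shows "\<exists>x\<in>slice. rank_ge (kpart p n x ^\<^sub>m m * graded_proj p n \<epsilon>) (card A - boxes_upto lam m)"
proof -
  obtain \<Theta> T where \<Theta>: "\<Theta> \<subseteq> A \<times> A" "\<And>a b. (a, b) \<in> \<Theta> \<Longrightarrow> pr_k a b" "single_valued \<Theta>" "single_valued (\<Theta>\<inverse>)"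
    and T: "T \<subseteq> A" "T \<subseteq> Domain (\<Theta> ^^ m)" "card T = (\<Sum>l\<leftarrow>lam. l - m)"
    using greene_poset_chains[OF P, of m] by metis
  have cT: "card T = card A - boxes_upto lam m"
    using T(3) boxes_upto_add[of lam m] P by (simp add: greene_poset_def)
  \<comment> \<open>Points live in \<open>A\<close>, so \<open>J\<close> is folded onto
    \<open>I\<close>. Indices of \<open>M\<close> and \<open>M'\<close> are left out of the domain
    \<open>A \<union> J\<close>, which makes their rows and columns zero.\<close>
  define r where "r = (\<lambda>y. if y \<in> J then mate y else y)"
  define x where "x = chain_mat (A \<union> J) r \<Theta>"
  have rA: "r a = a" if "a \<in> A" for a using that subsets parity(7) by (auto simp: r_def)
  have rJ: "r j = mate j" "mate j \<in> I" "mate (mate j) = j" if "j \<in> J" for j using that mate by (auto simp: r_def)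
  have xs: "x \<in> slice" unfolding x_def
  proof (rule chain_mat_slice)
    show "I \<union> J \<subseteq> A \<union> J" using subsets by auto
    show "r (mate i) = r i" if "i \<in> I" for i using that mate(1)[OF that] rA[of i] rJ[of "mate i"] subsets by auto
  next
    fix a b assume ab: "a \<in> A \<union> J" "b \<in> A \<union> J" "(r a, r b) \<in> \<Theta>"
    from \<Theta>(2)[OF ab(3)] have pr: "r a \<in> L \<union> I" "r b \<in> I \<union> L'" "r a < r b" "r a \<in> I \<Longrightarrow> r b \<in> I \<Longrightarrow> mate (r a) < mate (r b)"
      by (auto simp: pr_k_def)
    have "a \<notin> L'" using pr(1) rA[of a] A_split by auto
    moreover have "b \<notin> L" using pr(2) rA[of b] A_split by auto
    moreover have "a \<notin> M'" using ab(1) subsets(6) parity(7) B_split(4) by auto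
    moreover have "b \<notin> M" using ab(2) subsets(4) parity(7) B_split(2) by auto
    ultimately show "a \<notin> L' \<union> M' \<and> b \<notin> L \<union> M" by simp
    show "a < b" if "(a \<in> A) = (b \<in> A)"
    proof (cases "a \<in> A")
      case True
      then show ?thesis using pr(3) rA that by auto
    next
      case False
      then have "a \<in> J" "b \<in> J" using that ab by auto
      then show ?thesis using pr(4) rJ by auto
    qed
  qed
  let ?X = "kpart p n x"
  have ent: "?X $$ (a, z) = (if z \<in> A \<and> (id a, id z) \<in> \<Theta> then 1 else 0)" if a: "a \<in> A" and z: "z < n" for a z
    using a z parity(1)[OF a] parity(3)[OF z] parity(5)[OF a] rA by (auto simp: kpart_def x_def chain_mat_def)
  have An: "A \<subseteq> {..<n}" by (auto simp: A)
  have pow: "?X ^\<^sub>m m = ?X * ?X ^\<^sub>m (m - 1)"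
    using pow_mat_add[OF kpart_carrier, of p n x 1 "m - 1"] m by simp
  have XX: "(?X * ?X ^\<^sub>m (m - 1)) $$ (a, b) = (if b \<in> A \<and> (id a, id b) \<in> \<Theta> ^^ Suc (m - 1) then 1 else 0)"
    if a: "a \<in> A" and b: "b < n" for a b
  proof (rule pow_mat_relpow[OF kpart_carrier _ \<Theta>(3) _ An ent kpart_carrier _ _ b])
    show "Range \<Theta> \<subseteq> id ` A" using \<Theta>(1) by auto
    show "a < n" using a An by auto
    show "?X $$ (a, z) = (if z \<in> A \<and> (id a, id z) \<in> \<Theta> then 1 else 0)" if "z < n" for z
      by (rule ent[OF a that])
  qed auto
  have ent': "(?X ^\<^sub>m m * graded_proj p n \<epsilon>) $$ (a, b) = (if (id a, id b) \<in> \<Theta> ^^ m then 1 else 0)"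
    if a: "a \<in> A" and b: "b \<in> A" for a b
  proof -
    have ab: "a < n" "b < n" using a b An by auto
    have "(?X ^\<^sub>m m * graded_proj p n \<epsilon>) $$ (a, b) = (?X ^\<^sub>m m) $$ (a, b)"
      using mult_graded_proj_index[OF pow_carrier_mat[OF kpart_carrier] ab] parity(1)[OF b] by simp
    also have "\<dots> = (if (id a, id b) \<in> \<Theta> ^^ Suc (m - 1) then 1 else 0)"
      unfolding pow using XX[OF a ab(2)] b by simp
    finally show ?thesis using m by simp
  qed
  have "rank_ge (?X ^\<^sub>m m * graded_proj p n \<epsilon>) (card T)"
  proof (rule rank_ge_relpow[OF _ An An \<Theta>(4) _ T(2), where \<rho> = id])
    show "?X ^\<^sub>m m * graded_proj p n \<epsilon> \<in> carrier_mat n n"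
      by (rule mult_carrier_mat[OF pow_carrier_mat[OF kpart_carrier] graded_proj_carrier])
    show "finite T" using T(1) An finite_subset[of T "{..<n}"] by auto
    show "T \<subseteq> id ` A" using T(1) by simp
    show "Range (\<Theta> ^^ m) \<subseteq> id ` A" using \<Theta>(1) m by (cases m) auto
  qed (use ent' in auto)
  then show ?thesis using xs cT by auto
qed

text \<open>One relation on \<open>Y_s\<close> supplies both kinds of entries: the first of its
  \<open>m + 1\<close> steps is read from the odd part, all later ones from the even part.\<close>

lemma rank_ge_slice_s:
  assumes P: "greene_poset Y_s pr_s lam"
  shows "\<exists>x\<in>slice. rank_ge (spart p n x * kpart p n x ^\<^sub>m m * graded_proj p n \<epsilon>) (card Y_s - boxes_upto lam (Suc m))"
proof -
  obtain \<Theta> T where \<Theta>: "\<Theta> \<subseteq> Y_s \<times> Y_s" "\<And>a b. (a, b) \<in> \<Theta> \<Longrightarrow> pr_s a b" "single_valued \<Theta>" "single_valued (\<Theta>\<inverse>)"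
    and T: "T \<subseteq> Y_s" "T \<subseteq> Domain (\<Theta> ^^ Suc m)" "card T = (\<Sum>l\<leftarrow>lam. l - Suc m)"
    using greene_poset_chains[OF P, of "Suc m"] by metis
  have cT: "card T = card Y_s - boxes_upto lam (Suc m)"
    using T(3) boxes_upto_add[of lam "Suc m"] P by (simp add: greene_poset_def)
  define x where "x = chain_mat (I \<union> J \<union> M \<union> L') \<rho> \<Theta>"
  have rI: "\<rho> i = mate i" "mate i \<in> J" "mate (mate i) = i" if "i \<in> I" for i using that mate by (auto simp: \<rho>_def)
  have rL: "\<rho> l = l" if "l \<in> L'" for l using that A_split by (auto simp: \<rho>_def)
  note rJM = \<rho>_props(4)
  have xs: "x \<in> slice" unfolding x_def
  proof (rule chain_mat_slice)
    show "I \<union> J \<subseteq> I \<union> J \<union> M \<union> L'" by auto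
    show "\<rho> (mate i) = \<rho> i" if "i \<in> I" for i using that rI[OF that] rJM by auto
  next
    fix a b assume ab: "a \<in> I \<union> J \<union> M \<union> L'" "b \<in> I \<union> J \<union> M \<union> L'" "(\<rho> a, \<rho> b) \<in> \<Theta>"
    from \<Theta>(2)[OF ab(3)] have pr: "\<rho> a \<in> J \<union> M" "\<rho> b \<in> J \<union> L'"
      "\<rho> a \<in> J \<Longrightarrow> \<rho> b \<in> J \<Longrightarrow> \<rho> a < \<rho> b \<and> mate (\<rho> a) < mate (\<rho> b)"
      "\<rho> a \<in> M \<Longrightarrow> \<rho> b \<in> J \<Longrightarrow> \<rho> a < \<rho> b" "\<rho> a \<in> J \<Longrightarrow> \<rho> b \<in> L' \<Longrightarrow> mate (\<rho> a) < \<rho> b"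
      unfolding pr_s_def by blast+
    have aL: "a \<notin> L'" using rL[of a] pr(1) disjoint_parts by auto
    have bM: "b \<notin> M" using rJM[of b] pr(2) disjoint_parts B_split by auto
    show "a \<notin> L' \<union> M' \<and> b \<notin> L \<union> M"
      using aL bM ab(1,2) disjoint_parts A_split B_split subsets by auto
    show "a < b" if same: "(a \<in> A) = (b \<in> A)"
    proof (cases "a \<in> A")
      case True
      then have "a \<in> I" "b \<in> I \<union> L'" using same ab(1,2) aL subsets parity(7) by auto
      then show ?thesis using pr(3,5) rI rL[of b] by auto
    next
      case False
      then have "a \<in> J \<union> M" "b \<in> J" using same ab(1,2) bM subsets by auto
      then show ?thesis using pr(3,4) rJM[of a] rJM[of b] by auto
    qed
  qed
  let ?X = "kpart p n x" and ?S = "spart p n x"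
  have Gn: "I \<union> L' \<subseteq> {..<n}" "J \<union> M \<subseteq> {..<n}" using subsets parity by auto
  have memA: "z \<in> I \<union> J \<union> M \<union> L' \<and> z \<in> A \<longleftrightarrow> z \<in> I \<union> L'" for z using subsets parity(7) by auto
  have ent: "?X $$ (a, z) = (if z \<in> I \<union> L' \<and> (\<rho> a, \<rho> z) \<in> \<Theta> then 1 else 0)" if a: "a \<in> I \<union> L'" and z: "z < n" for a z
  proof -
    have "a \<in> A" "a < n" using a subsets parity by auto
    then have "?X $$ (a, z) = (if z \<in> A then x $$ (a, z) else 0)"
      using z parity(1)[of a] parity(3)[OF z] by (auto simp: kpart_def)
    then show ?thesis using a z memA[of z] \<open>a < n\<close> by (auto simp: x_def chain_mat_def)
  qed
  have ent0: "?S $$ (a, z) = (if z \<in> I \<union> L' \<and> (\<rho> a, \<rho> z) \<in> \<Theta> then 1 else 0)" if a: "a \<in> J \<union> M" and z: "z < n" for a z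
  proof -
    have "a \<in> B" "a < n" using a subsets parity by auto
    then have "?S $$ (a, z) = (if z \<in> A then x $$ (a, z) else 0)"
      using z parity(2)[of a] parity(3)[OF z] by (auto simp: spart_def)
    then show ?thesis using a z memA[of z] \<open>a < n\<close> by (auto simp: x_def chain_mat_def)
  qed
  have ran: "Range \<Theta> \<subseteq> \<rho> ` (I \<union> L')" unfolding \<rho>_props(3) using \<Theta>(2) by (auto simp: pr_s_def)
  have dom: "Domain \<Theta> \<subseteq> J \<union> M" using \<Theta>(2) by (auto simp: pr_s_def)
  have SX: "(?S * ?X ^\<^sub>m m) $$ (a, b) = (if b \<in> I \<union> L' \<and> (\<rho> a, \<rho> b) \<in> \<Theta> ^^ Suc m then 1 else 0)"
    if a: "a \<in> J \<union> M" and b: "b < n" for a b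
    by (rule pow_mat_relpow[OF kpart_carrier \<rho>_props(1) \<Theta>(3) ran Gn(1) ent spart_carrier _ ent0[OF a] b])
      (use a Gn in auto)
  have ent': "(?S * ?X ^\<^sub>m m * graded_proj p n \<epsilon>) $$ (a, b) = (if (\<rho> a, \<rho> b) \<in> \<Theta> ^^ Suc m then 1 else 0)"
    if a: "a \<in> J \<union> M" and b: "b \<in> I \<union> L'" for a b
  proof -
    have ab: "a < n" "b < n" "b \<in> A" using a b Gn subsets by auto
    have "(?S * ?X ^\<^sub>m m * graded_proj p n \<epsilon>) $$ (a, b) = (?S * ?X ^\<^sub>m m) $$ (a, b)"
      using mult_graded_proj_index[OF mult_carrier_mat[OF spart_carrier pow_carrier_mat[OF kpart_carrier]] ab(1,2)]
        parity(1)[OF ab(3)] by simp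
    then show ?thesis using SX[OF a ab(2)] b by simp
  qed
  have "rank_ge (?S * ?X ^\<^sub>m m * graded_proj p n \<epsilon>) (card T)"
  proof (rule rank_ge_relpow[OF _ Gn \<Theta>(4) _ T(2)])
    show "?S * ?X ^\<^sub>m m * graded_proj p n \<epsilon> \<in> carrier_mat n n"
      by (intro mult_carrier_mat[of _ n n] spart_carrier pow_carrier_mat kpart_carrier graded_proj_carrier)
    have "Y_s \<subseteq> {..<n}" unfolding Y_s_def using Gn by auto
    then show "finite T" using T(1) finite_subset[of T "{..<n}"] by auto
    have "Domain (\<Theta> ^^ Suc m) \<subseteq> Domain \<Theta>" by (metis relpow_Suc_D2 Domain.simps subsetI)
    then show "T \<subseteq> \<rho> ` (J \<union> M)" using T(2) dom rJM by force
    show "Range (\<Theta> ^^ Suc m) \<subseteq> \<rho> ` (I \<union> L')" using ran by auto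
  qed (use ent' in blast)
  then show ?thesis using xs cT by auto
qed

end

section \<open>The two parts of the conormal slice are linear slices\<close>

text \<open>The even part of \<open>x * x\<close> is the sum of the squares of the two
  parts.\<close>

lemma
  assumes x: "x \<in> carrier_mat n n" and sq: "x * x = 0\<^sub>m n n"
  shows spart_square: "spart p n x * spart p n x = - 1 \<cdot>\<^sub>m (kpart p n x * kpart p n x)"
proof (rule eq_matI)
  fix i j assume "i < dim_row (- 1 \<cdot>\<^sub>m (kpart p n x * kpart p n x))" "j < dim_col (- 1 \<cdot>\<^sub>m (kpart p n x * kpart p n x))"
  then have ij: "i < n" "j < n" by (auto simp: kpart_def)
  have "(spart p n x * spart p n x) $$ (i, j) + (kpart p n x * kpart p n x) $$ (i, j) =
      (\<Sum>l<n. if (i < p) = (j < p) then x $$ (i, l) * x $$ (l, j) else 0)"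
    unfolding mult_mat_sum[OF spart_carrier spart_carrier ij] mult_mat_sum[OF kpart_carrier kpart_carrier ij] sum.distrib[symmetric]
    by (intro sum.cong refl) (use ij in \<open>auto simp: spart_def kpart_def\<close>)
  also have "\<dots> = (if (i < p) = (j < p) then (x * x) $$ (i, j) else 0)"
    unfolding mult_mat_sum[OF x x ij] by simp
  also have "\<dots> = 0" using sq ij by simp
  finally show "(spart p n x * spart p n x) $$ (i, j) = (- 1 \<cdot>\<^sub>m (kpart p n x * kpart p n x)) $$ (i, j)"
    using ij by (simp add: eq_neg_iff_add_eq_0 kpart_def spart_def)
qed (auto simp: kpart_def spart_def)

lemma pow_mat_double:
  fixes A :: "complex mat"
  assumes "A \<in> carrier_mat n n"
  shows "A ^\<^sub>m (2 * Suc m) = A ^\<^sub>m (2 * m) * (A * A)"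
proof -
  have "A ^\<^sub>m (2 * Suc m) = A ^\<^sub>m (2 * m) * A * A" by simp
  also have "\<dots> = A ^\<^sub>m (2 * m) * (A * A)"
    by (rule assoc_mult_mat[of _ n n _ n _ n]) (use assms in simp_all)
  finally show ?thesis .
qed

lemma spart_pow_even:
  assumes x: "x \<in> carrier_mat n n" and sq: "x * x = 0\<^sub>m n n"
  shows "spart p n x ^\<^sub>m (2 * m) = (- 1) ^ m \<cdot>\<^sub>m kpart p n x ^\<^sub>m (2 * m)"
proof (induction m)
  case 0
  show ?case by (rule eq_matI) (simp_all add: kpart_def spart_def)
next
  case (Suc m)
  let ?k = "kpart p n x"
  have kk: "?k ^\<^sub>m (2 * m) \<in> carrier_mat n n" "?k * ?k \<in> carrier_mat n n"
    by (simp, rule mult_carrier_mat[OF kpart_carrier kpart_carrier])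
  have "spart p n x ^\<^sub>m (2 * Suc m) = ((- 1) ^ m \<cdot>\<^sub>m ?k ^\<^sub>m (2 * m)) * (- 1 \<cdot>\<^sub>m (?k * ?k))"
    unfolding pow_mat_double[OF spart_carrier] Suc spart_square[OF x sq] ..
  also have "\<dots> = (- 1) ^ m \<cdot>\<^sub>m (- 1 \<cdot>\<^sub>m (?k ^\<^sub>m (2 * m) * (?k * ?k)))"
    using mult_smult_assoc_mat[OF kk(1), of "- 1 \<cdot>\<^sub>m (?k * ?k)" n "(- 1) ^ m"] mult_smult_distrib[OF kk] kk by simp
  also have "\<dots> = (- 1) ^ Suc m \<cdot>\<^sub>m (?k ^\<^sub>m (2 * m) * (?k * ?k))"
    by (rule eq_matI) auto
  finally show ?case unfolding pow_mat_double[OF kpart_carrier] .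
qed

lemma spart_pow_odd:
  assumes x: "x \<in> carrier_mat n n" and sq: "x * x = 0\<^sub>m n n"
  shows "spart p n x ^\<^sub>m Suc (2 * m) = (- 1) ^ m \<cdot>\<^sub>m (spart p n x * kpart p n x ^\<^sub>m (2 * m))"
proof -
  have "spart p n x ^\<^sub>m Suc (2 * m) = spart p n x ^\<^sub>m 1 * spart p n x ^\<^sub>m (2 * m)"
    using pow_mat_add[OF spart_carrier, of p n x 1 "2 * m"] by simp
  also have "\<dots> = spart p n x * ((- 1) ^ m \<cdot>\<^sub>m kpart p n x ^\<^sub>m (2 * m))"
    using spart_pow_even[OF x sq] by (simp add: spart_def)
  finally show ?thesis
    using mult_smult_distrib[OF spart_carrier pow_carrier_mat[OF kpart_carrier], of p n x "(- 1) ^ m"] by simp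
qed

lemma smult_mult_right:
  fixes c :: complex
  shows "A \<in> carrier_mat n n \<Longrightarrow> B \<in> carrier_mat n n \<Longrightarrow> (c \<cdot>\<^sub>m A) * B = c \<cdot>\<^sub>m (A * B)"
  by (rule mult_smult_assoc_mat)


lemma strict_upper_pow:
  fixes A :: "complex mat"
  assumes A: "A \<in> carrier_mat n n" and up: "\<And>i j. i < n \<Longrightarrow> j < n \<Longrightarrow> A $$ (i, j) \<noteq> 0 \<Longrightarrow> i < j"
  shows "i < n \<Longrightarrow> j < n \<Longrightarrow> (A ^\<^sub>m m) $$ (i, j) \<noteq> 0 \<Longrightarrow> i + m \<le> j"
proof (induction m arbitrary: j)
  case 0
  then show ?case using A by (auto split: if_splits)
next
  case (Suc m)
  have "(\<Sum>l<n. (A ^\<^sub>m m) $$ (i, l) * A $$ (l, j)) \<noteq> 0"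
    using Suc.prems mult_mat_sum[OF pow_carrier_mat[OF A] A Suc.prems(1,2), of m] by simp
  then obtain l where "l \<in> {..<n}" "(A ^\<^sub>m m) $$ (i, l) * A $$ (l, j) \<noteq> 0" by (rule sum.not_neutral_contains_not_neutral)
  then have l: "l < n" "(A ^\<^sub>m m) $$ (i, l) \<noteq> 0" "A $$ (l, j) \<noteq> 0" by auto
  show ?case using Suc.IH[OF Suc.prems(1) l(1,2)] up[OF l(1) Suc.prems(2) l(3)] by simp
qed

lemma strict_upper_nilpotent:
  fixes A :: "complex mat"
  assumes A: "A \<in> carrier_mat n n" and up: "\<And>i j. i < n \<Longrightarrow> j < n \<Longrightarrow> A $$ (i, j) \<noteq> 0 \<Longrightarrow> i < j" and m: "n \<le> m"
  shows "A ^\<^sub>m m = 0\<^sub>m n n"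
proof (rule eq_matI)
  fix i j assume "i < dim_row (0\<^sub>m n n :: complex mat)" "j < dim_col (0\<^sub>m n n :: complex mat)"
  then have ij: "i < n" "j < n" by auto
  then show "(A ^\<^sub>m m) $$ (i, j) = (0\<^sub>m n n :: complex mat) $$ (i, j)"
    using strict_upper_pow[OF A up ij, of m] m by fastforce
qed (use A in auto)

locale matched_slice = plus: matching_data p n True A B L I L' M J M' mate
  for p n A B L I L' M J M' mate

text \<open>Exchanging the two graded parts turns each statement about \<open>A\<close> into one
  about \<open>B\<close>, so each rank bound needs only one proof.\<close>

sublocale matched_slice \<subseteq> minus: matching_data p n False B A M J M' L I L' mate
  by unfold_locales
    (use plus.A plus.B plus.A_split plus.B_split plus.mate in auto)

context matched_slice
begin

text \<open>Running over \<open>J\<close> instead of \<open>I\<close> gives the same equations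
  between matched rows and columns, read backwards.\<close>

lemma minus_slice: "minus.slice = plus.slice"
proof -
  have "(\<forall>j\<in>J. \<forall>y<n. x $$ (j, y) = x $$ (mate j, y) \<and> x $$ (y, j) = - x $$ (y, mate j)) \<longleftrightarrow>
      (\<forall>i\<in>I. \<forall>y<n. x $$ (i, y) = x $$ (mate i, y) \<and> x $$ (y, i) = - x $$ (y, mate i))"
    (is "(\<forall>j\<in>J. ?P j) \<longleftrightarrow> (\<forall>i\<in>I. ?P i)") for x :: "complex mat"
  proof -
    have sw: "a = b \<and> c = - d \<longleftrightarrow> b = a \<and> d = - c" for a b c d :: complex by auto
    have "J = mate ` I" using plus.mate by (force simp: image_iff)
    then have "(\<forall>j\<in>J. ?P j) \<longleftrightarrow> (\<forall>i\<in>I. ?P (mate i))" by (simp only: ball_simps(9))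
    also have "\<dots> \<longleftrightarrow> (\<forall>i\<in>I. ?P i)"
    proof (rule ball_cong[OF refl])
      fix i assume "i \<in> I"
      show "?P (mate i) \<longleftrightarrow> ?P i"
        unfolding conjunct2[OF plus.mate(1)[OF \<open>i \<in> I\<close>]] by (rule all_cong1, rule imp_cong[OF refl], rule sw)
    qed
    finally show ?thesis .
  qed
  then show ?thesis unfolding minus.slice_def plus.slice_def by (simp add: Un_commute)
qed

lemma slice_line:
  assumes "u \<in> plus.slice" "v \<in> plus.slice"
  shows "(1 - t) \<cdot>\<^sub>m u + t \<cdot>\<^sub>m v \<in> plus.slice"
proof -
  note u = plus.sliceD[OF assms(1)] and v = plus.sliceD[OF assms(2)]
  have ent: "((1 - t) \<cdot>\<^sub>m u + t \<cdot>\<^sub>m v) $$ (a, b) = (1 - t) * u $$ (a, b) + t * v $$ (a, b)" if "a < n" "b < n" for a b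
    using that u(1) v(1) by simp
  have nz: "u $$ (a, b) \<noteq> 0 \<or> v $$ (a, b) \<noteq> 0" if "a < n" "b < n" "((1 - t) \<cdot>\<^sub>m u + t \<cdot>\<^sub>m v) $$ (a, b) \<noteq> 0" for a b
    using that(3) unfolding ent[OF that(1,2)] by auto
  show ?thesis unfolding plus.slice_def
  proof (intro CollectI conjI ballI allI impI)
    show "(1 - t) \<cdot>\<^sub>m u + t \<cdot>\<^sub>m v \<in> carrier_mat n n" using u(1) v(1) by simp
  next
    fix a b assume "a < n" "b < n" "((1 - t) \<cdot>\<^sub>m u + t \<cdot>\<^sub>m v) $$ (a, b) \<noteq> 0"
    then show "a \<notin> L' \<union> M'" "b \<notin> L \<union> M" "(a < p) = (b < p) \<Longrightarrow> a < b"
      using nz[of a b] u(2)[of a b] v(2)[of a b] u(5)[of a b] v(5)[of a b] by blast+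
  next
    fix i y assume i: "i \<in> I" "y < n"
    then have "i < n" "mate i < n" using plus.index_less by auto
    then show "((1 - t) \<cdot>\<^sub>m u + t \<cdot>\<^sub>m v) $$ (i, y) = ((1 - t) \<cdot>\<^sub>m u + t \<cdot>\<^sub>m v) $$ (mate i, y)"
      "((1 - t) \<cdot>\<^sub>m u + t \<cdot>\<^sub>m v) $$ (y, i) = - ((1 - t) \<cdot>\<^sub>m u + t \<cdot>\<^sub>m v) $$ (y, mate i)"
      using i by (simp_all add: ent u(3)[OF i] v(3)[OF i] u(4)[OF i] v(4)[OF i] algebra_simps)
  qed
qed

text \<open>Only a matched index can have both a nonzero column and a nonzero row, and there the
  terms for \<open>l\<close> and \<open>mate l\<close> cancel: the rows agree and the columns are
  opposite.\<close>

lemma slice_square: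
  assumes "x \<in> plus.slice"
  shows "x * x = 0\<^sub>m n n"
proof (rule eq_matI)
  note D = plus.sliceD[OF assms]
  fix a b assume "a < dim_row (0\<^sub>m n n :: complex mat)" "b < dim_col (0\<^sub>m n n :: complex mat)"
  then have ab: "a < n" "b < n" by auto
  have sub: "I \<union> J \<subseteq> {..<n}" using plus.index_less by auto
  then have fin: "finite I" "finite J" using finite_subset[of _ "{..<n}"] by auto
  have "(x * x) $$ (a, b) = (\<Sum>l\<in>I \<union> J. x $$ (a, l) * x $$ (l, b))"
    unfolding mult_mat_sum[OF D(1) D(1) ab]
  proof (rule sum.mono_neutral_right)
    show "\<forall>l\<in>{..<n} - (I \<union> J). x $$ (a, l) * x $$ (l, b) = 0"
    proof
      fix l assume l: "l \<in> {..<n} - (I \<union> J)"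
      then have "l \<in> L \<union> L' \<union> M \<union> M'" using plus.parity(4)[of l] plus.A_split(1) plus.B_split(1) by auto
      then show "x $$ (a, l) * x $$ (l, b) = 0" using D(2)[of a l] D(2)[of l b] ab l by auto
    qed
  qed (use sub in auto)
  also have "\<dots> = (\<Sum>l\<in>I. x $$ (a, l) * x $$ (l, b)) + (\<Sum>l\<in>J. x $$ (a, l) * x $$ (l, b))"
    by (rule sum.union_disjoint[OF fin plus.disjoint_parts(1)])
  also have "(\<Sum>l\<in>J. x $$ (a, l) * x $$ (l, b)) = (\<Sum>l\<in>I. x $$ (a, mate l) * x $$ (mate l, b))"
    by (rule sum.reindex_bij_witness[of _ mate mate]) (use plus.mate in auto)
  also have "(\<Sum>l\<in>I. x $$ (a, l) * x $$ (l, b)) + (\<Sum>l\<in>I. x $$ (a, mate l) * x $$ (mate l, b)) = (\<Sum>l\<in>I. 0)"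
    unfolding sum.distrib[symmetric] by (rule sum.cong) (simp_all add: D(3) D(4) ab)
  finally show "(x * x) $$ (a, b) = 0\<^sub>m n n $$ (a, b)" using ab by simp
qed (use plus.sliceD(1)[OF assms] in auto)

lemma kpart_slice_nilpotent:
  assumes "x \<in> plus.slice" "n \<le> m"
  shows "kpart p n x ^\<^sub>m m = 0\<^sub>m n n"
proof (rule strict_upper_nilpotent[OF kpart_carrier _ assms(2)])
  fix i j assume "i < n" "j < n" "kpart p n x $$ (i, j) \<noteq> 0"
  then show "i < j" using plus.sliceD(5)[OF assms(1), of i j] by (simp add: kpart_def split: if_splits)
qed

end

lemma kpart_line:
  assumes "u \<in> carrier_mat n n" "v \<in> carrier_mat n n"
  shows "(1 - t) \<cdot>\<^sub>m kpart p n u + t \<cdot>\<^sub>m kpart p n v = kpart p n ((1 - t) \<cdot>\<^sub>m u + t \<cdot>\<^sub>m v)"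
    and "(1 - t) \<cdot>\<^sub>m spart p n u + t \<cdot>\<^sub>m spart p n v = spart p n ((1 - t) \<cdot>\<^sub>m u + t \<cdot>\<^sub>m v)"
  by (rule eq_matI; use assms in \<open>auto simp: kpart_def spart_def\<close>)+

lemma boxes_upto_large: "sum_list lam \<le> m \<Longrightarrow> boxes_upto lam m = sum_list lam"
  unfolding boxes_upto_def by (induction lam) auto

locale greene_slice = matched_slice +
  fixes lam mu lam' mu' :: "nat list"
  assumes greene_k: "greene_poset A plus.pr_k lam" "greene_poset B minus.pr_k mu"
    and greene_s: "greene_poset plus.Y_s plus.pr_s lam'" "greene_poset minus.Y_s minus.pr_s mu'"
begin

definition R_k :: "nat \<Rightarrow> bool \<Rightarrow> nat" where
  "R_k m \<epsilon> = (if \<epsilon> then card A - boxes_upto lam m else card B - boxes_upto mu m)"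

text \<open>Up to sign, an even power of the odd part is the same power of the even part, whereas an
  odd power has one odd factor in front. Hence the alternation between the two pairs of
  shapes.\<close>

definition R_s :: "nat \<Rightarrow> bool \<Rightarrow> nat" where
  "R_s m \<epsilon> = (if even m then R_k m \<epsilon> else
    if \<epsilon> then card plus.Y_s - boxes_upto lam' m else card minus.Y_s - boxes_upto mu' m)"

lemma R_0:
  assumes "n < m"
  shows "R_k m \<epsilon> = 0" "R_s m \<epsilon> = 0"
proof -
  have 0: "card Y - boxes_upto l m = 0" if "greene_poset Y pr l" "Y \<subseteq> {..<n}" for Y :: "nat set" and pr l
  proof -
    have "card Y \<le> n" using card_mono[OF _ that(2)] by simp
    moreover have "sum_list l = card Y" using that(1) by (simp add: greene_poset_def)
    ultimately show ?thesis using boxes_upto_large[of l m] assms by simp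
  qed
  have sub: "A \<subseteq> {..<n}" "B \<subseteq> {..<n}" using plus.A plus.B by auto
  then have "plus.Y_s \<subseteq> {..<n}" "minus.Y_s \<subseteq> {..<n}"
    using plus.subsets unfolding plus.Y_s_def minus.Y_s_def by auto
  then show "R_k m \<epsilon> = 0" "R_s m \<epsilon> = 0"
    using 0[OF greene_k(1) sub(1)] 0[OF greene_k(2) sub(2)] 0[OF greene_s(1)] 0[OF greene_s(2)]
    by (auto simp: R_k_def R_s_def)
qed

lemma rank_le_k: "x \<in> plus.slice \<Longrightarrow> m \<ge> 1 \<Longrightarrow> rank_le (kpart p n x ^\<^sub>m m * graded_proj p n \<epsilon>) (R_k m \<epsilon>)"
  using plus.rank_le_slice_k[OF greene_k(1)] minus.rank_le_slice_k[OF greene_k(2)] minus_slice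
  by (cases \<epsilon>) (simp_all add: R_k_def)

lemma rank_ge_k: "m \<ge> 1 \<Longrightarrow> \<exists>x\<in>plus.slice. rank_ge (kpart p n x ^\<^sub>m m * graded_proj p n \<epsilon>) (R_k m \<epsilon>)"
  using plus.rank_ge_slice_k[OF greene_k(1)] minus.rank_ge_slice_k[OF greene_k(2)] minus_slice
  by (cases \<epsilon>) (simp_all add: R_k_def)

lemma rank_le_s: "x \<in> plus.slice \<Longrightarrow>
    rank_le (spart p n x * kpart p n x ^\<^sub>m (2 * m) * graded_proj p n \<epsilon>) (R_s (Suc (2 * m)) \<epsilon>)"
  using plus.rank_le_slice_s[OF greene_s(1)] minus.rank_le_slice_s[OF greene_s(2)] minus_slice
  by (cases \<epsilon>) (simp_all add: R_s_def)

lemma rank_ge_s: "\<exists>x\<in>plus.slice.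
    rank_ge (spart p n x * kpart p n x ^\<^sub>m (2 * m) * graded_proj p n \<epsilon>) (R_s (Suc (2 * m)) \<epsilon>)"
  using plus.rank_ge_slice_s[OF greene_s(1)] minus.rank_ge_slice_s[OF greene_s(2)] minus_slice
  by (cases \<epsilon>) (simp_all add: R_s_def)

lemma linear_slice_k: "linear_slice p n True (kpart p n ` plus.slice) R_k n"
proof
  show "kpart p n ` plus.slice \<subseteq> hom_nilpotents p n True"
    using hom_kpart kpart_slice_nilpotent[OF _ le_refl] unfolding hom_nilpotents_def by (auto intro!: exI[of _ n])
  fix u v :: "complex mat" and t assume "u \<in> kpart p n ` plus.slice" "v \<in> kpart p n ` plus.slice"
  then obtain x y where xy: "x \<in> plus.slice" "y \<in> plus.slice" "u = kpart p n x" "v = kpart p n y" by blast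
  then show "(1 - t) \<cdot>\<^sub>m u + t \<cdot>\<^sub>m v \<in> kpart p n ` plus.slice"
    using kpart_line(1)[OF plus.sliceD(1)[OF xy(1)] plus.sliceD(1)[OF xy(2)], of t p] slice_line[OF xy(1,2), of t] by auto
next
  fix m \<epsilon> assume "1 \<le> (m :: nat)"
  from rank_ge_k[OF this]
  show "\<exists>u\<in>kpart p n ` plus.slice. rank_ge (u ^\<^sub>m m * graded_proj p n \<epsilon>) (R_k m \<epsilon>)" by blast
qed (use rank_le_k R_0 in auto)

lemma spart_pow_proj:
  assumes "x \<in> plus.slice"
  shows "spart p n x ^\<^sub>m (2 * m) * graded_proj p n \<epsilon> = (- 1) ^ m \<cdot>\<^sub>m (kpart p n x ^\<^sub>m (2 * m) * graded_proj p n \<epsilon>)"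
    and "spart p n x ^\<^sub>m Suc (2 * m) * graded_proj p n \<epsilon> =
      (- 1) ^ m \<cdot>\<^sub>m (spart p n x * kpart p n x ^\<^sub>m (2 * m) * graded_proj p n \<epsilon>)"
proof -
  note D = plus.sliceD(1)[OF assms] slice_square[OF assms]
  have c: "kpart p n x ^\<^sub>m (2 * m) \<in> carrier_mat n n" by simp
  then have "spart p n x * kpart p n x ^\<^sub>m (2 * m) \<in> carrier_mat n n" by (rule mult_carrier_mat[OF spart_carrier])
  with c show "spart p n x ^\<^sub>m (2 * m) * graded_proj p n \<epsilon> = (- 1) ^ m \<cdot>\<^sub>m (kpart p n x ^\<^sub>m (2 * m) * graded_proj p n \<epsilon>)"
    "spart p n x ^\<^sub>m Suc (2 * m) * graded_proj p n \<epsilon> =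
      (- 1) ^ m \<cdot>\<^sub>m (spart p n x * kpart p n x ^\<^sub>m (2 * m) * graded_proj p n \<epsilon>)"
    unfolding spart_pow_even[OF D] spart_pow_odd[OF D] by (simp_all only: smult_mult_right[OF _ graded_proj_carrier])
qed

lemma linear_slice_s: "linear_slice p n False (spart p n ` plus.slice) R_s n"
proof
  show "spart p n ` plus.slice \<subseteq> hom_nilpotents p n False"
  proof
    fix u assume "u \<in> spart p n ` plus.slice"
    then obtain x where x: "x \<in> plus.slice" "u = spart p n x" by blast
    have "u ^\<^sub>m (2 * n) = (- 1) ^ n \<cdot>\<^sub>m kpart p n x ^\<^sub>m (2 * n)"
      unfolding x(2) by (rule spart_pow_even[OF plus.sliceD(1)[OF x(1)] slice_square[OF x(1)]])
    then have "u ^\<^sub>m (2 * n) = 0\<^sub>m n n" using kpart_slice_nilpotent[OF x(1), of "2 * n"] by simp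
    then show "u \<in> hom_nilpotents p n False" using hom_spart unfolding hom_nilpotents_def x(2) by auto
  qed
next
  fix u v :: "complex mat" and t assume "u \<in> spart p n ` plus.slice" "v \<in> spart p n ` plus.slice"
  then obtain x y where xy: "x \<in> plus.slice" "y \<in> plus.slice" "u = spart p n x" "v = spart p n y" by blast
  then show "(1 - t) \<cdot>\<^sub>m u + t \<cdot>\<^sub>m v \<in> spart p n ` plus.slice"
    using kpart_line(2)[OF plus.sliceD(1)[OF xy(1)] plus.sliceD(1)[OF xy(2)], of t p] slice_line[OF xy(1,2), of t] by auto
next
  fix u and m :: nat and \<epsilon> assume "u \<in> spart p n ` plus.slice" and m: "m \<ge> 1"
  then obtain x where x: "x \<in> plus.slice" "u = spart p n x" by blast
  consider l where "m = 2 * l" | l where "m = Suc (2 * l)" by (metis evenE oddE Suc_eq_plus1)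
  then show "rank_le (u ^\<^sub>m m * graded_proj p n \<epsilon>) (R_s m \<epsilon>)"
  proof cases
    case 1
    then show ?thesis using rank_le_k[OF x(1) m, of \<epsilon>] spart_pow_proj(1)[OF x(1), of l \<epsilon>]
      by (simp add: x(2) R_s_def rank_le_smult)
  next
    case 2
    then show ?thesis using rank_le_s[OF x(1), of l \<epsilon>] spart_pow_proj(2)[OF x(1), of l \<epsilon>]
      by (simp add: x(2) rank_le_smult del: pow_mat.simps)
  qed
next
  fix m :: nat and \<epsilon> assume m: "1 \<le> m"
  consider l where "m = 2 * l" | l where "m = Suc (2 * l)" by (metis evenE oddE Suc_eq_plus1)
  then show "\<exists>u\<in>spart p n ` plus.slice. rank_ge (u ^\<^sub>m m * graded_proj p n \<epsilon>) (R_s m \<epsilon>)"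
  proof cases
    case 1
    obtain x where x: "x \<in> plus.slice" "rank_ge (kpart p n x ^\<^sub>m m * graded_proj p n \<epsilon>) (R_k m \<epsilon>)"
      using rank_ge_k[OF m] by blast
    then have "rank_ge (spart p n x ^\<^sub>m m * graded_proj p n \<epsilon>) (R_s m \<epsilon>)"
      using 1 spart_pow_proj(1)[OF x(1), of l \<epsilon>] by (simp add: R_s_def rank_ge_smult)
    then show ?thesis using x(1) by blast
  next
    case 2
    obtain x where x: "x \<in> plus.slice"
      "rank_ge (spart p n x * kpart p n x ^\<^sub>m (2 * l) * graded_proj p n \<epsilon>) (R_s (Suc (2 * l)) \<epsilon>)"
      using rank_ge_s by blast
    then have "rank_ge (spart p n x ^\<^sub>m m * graded_proj p n \<epsilon>) (R_s m \<epsilon>)"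
      using 2 spart_pow_proj(2)[OF x(1), of l \<epsilon>] by (simp add: rank_ge_smult del: pow_mat.simps)
    then show ?thesis using x(1) by blast
  qed
qed (use R_0 in auto)

end

section \<open>The image of the conormal bundle\<close>

definition coord_space :: "nat \<Rightarrow> nat set \<Rightarrow> complex vec set" where
  "coord_space n S = {v \<in> carrier_vec n. \<forall>l<n. l \<notin> S \<longrightarrow> v $ l = 0}"

lemma unit_vec_scalar_prod:
  fixes u :: "complex vec"
  shows "u \<in> carrier_vec n \<Longrightarrow> t < n \<Longrightarrow> unit_vec n t \<bullet> u = u $ t"
  by (simp add: scalar_prod_left_unit)

lemma dual_frame_coord:
  assumes "S \<subseteq> {..<n}"
  shows "dual_frame n (coord_space n S) S (unit_vec n) (unit_vec n)"
proof -
  have fin: "finite S" using assms finite_subset by blast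
  have span: "u $ i = (\<Sum>t\<in>S. (unit_vec n t \<bullet> u) * unit_vec n t $ i)" if u: "u \<in> coord_space n S" and i: "i < n" for u i
  proof -
    have "(\<Sum>t\<in>S. (unit_vec n t \<bullet> u) * unit_vec n t $ i) = (\<Sum>t\<in>S. if t = i then u $ i else 0)"
      by (rule sum.cong) (use assms u i unit_vec_scalar_prod[of u n] in \<open>auto simp: coord_space_def\<close>)
    then show ?thesis using fin u i by (simp add: coord_space_def)
  qed
  have dual: "unit_vec n t \<bullet> unit_vec n t' = (if t = t' then 1 else 0 :: complex)" if "t \<in> S" "t' \<in> S" for t t'
  proof -
    have "t < n" "t' < n" using that assms by auto
    then show ?thesis using unit_vec_scalar_prod[of "unit_vec n t'" n t] by simp
  qed
  have mem: "unit_vec n t \<in> coord_space n S" if t: "t \<in> S" for t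
    unfolding coord_space_def
  proof (intro CollectI conjI allI impI)
    fix l assume l: "l < n" "l \<notin> S"
    then have "l \<noteq> t" using t by blast
    then show "unit_vec n t $ l = (0 :: complex)" using l(1) by (simp add: unit_vec_def)
  qed (rule unit_vec_carrier)
  show ?thesis
  proof (rule dual_frameI[OF _ _ _ _ fin mem _ dual span])
    fix u v assume "u \<in> coord_space n S" "v \<in> coord_space n S"
    then have uv: "u \<in> carrier_vec n" "v \<in> carrier_vec n" "\<And>l. l < n \<Longrightarrow> l \<notin> S \<Longrightarrow> u $ l = 0" "\<And>l. l < n \<Longrightarrow> l \<notin> S \<Longrightarrow> v $ l = 0"
      unfolding coord_space_def by blast+
    then show "u + v \<in> coord_space n S" unfolding coord_space_def by simp
  next
    fix c v assume "v \<in> coord_space n S"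
    then have v: "v \<in> carrier_vec n" "\<And>l. l < n \<Longrightarrow> l \<notin> S \<Longrightarrow> v $ l = 0" unfolding coord_space_def by blast+
    then show "c \<cdot>\<^sub>v v \<in> coord_space n S" unfolding coord_space_def by simp
  qed (simp_all add: coord_space_def Collect_mono)
qed

text \<open>Both standard flags have this form, with offset \<open>a = 0\<close> for the plus part
  and \<open>a = p\<close> for the minus part.\<close>

definition coord_flag :: "nat \<Rightarrow> nat \<Rightarrow> nat \<Rightarrow> complex vec set list" where
  "coord_flag n a m = map (\<lambda>i. coord_space n {a..<a + i}) [0..<m + 1]"

lemma std_flag_coord: "std_flag_plus p q = coord_flag (p + q) 0 p" "std_flag_minus p q = coord_flag (p + q) p q"
proof -
  have "{v \<in> carrier_vec (p + q). \<forall>l<p + q. i \<le> l \<longrightarrow> v $ l = 0} = coord_space (p + q) {0..<0 + i}" for i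
    unfolding coord_space_def by (rule Collect_cong) (simp add: not_less)
  then show "std_flag_plus p q = coord_flag (p + q) 0 p" unfolding std_flag_plus_def coord_flag_def by simp
  have "{v \<in> carrier_vec (p + q). \<forall>l<p + q. l < p \<or> p + i \<le> l \<longrightarrow> v $ l = 0} = coord_space (p + q) {p..<p + i}" for i
    unfolding coord_space_def by (rule Collect_cong) (simp add: not_less not_le)
  then show "std_flag_minus p q = coord_flag (p + q) p q" unfolding std_flag_minus_def coord_flag_def by simp
qed

lemma V_coord: "V_plus p q = coord_space (p + q) {0..<p}" "V_minus p q = coord_space (p + q) {p..<p + q}"
  unfolding V_plus_def V_minus_def coord_space_def by auto

lemma hom_preserves_coord:
  assumes g: "g \<in> carrier_mat n n" and hg: "\<And>a b. a < n \<Longrightarrow> b < n \<Longrightarrow> g $$ (a, b) \<noteq> 0 \<Longrightarrow> b \<in> S \<Longrightarrow> a \<in> S"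
    and v: "v \<in> coord_space n S"
  shows "g *\<^sub>v v \<in> coord_space n S"
proof -
  have vc: "v \<in> carrier_vec n" using v by (simp add: coord_space_def)
  have "(g *\<^sub>v v) $ a = 0" if a: "a < n" "a \<notin> S" for a
    unfolding mult_mat_vec_sum[OF g vc a(1)]
  proof (rule sum.neutral, intro ballI)
    fix l assume "l \<in> {..<n}"
    then show "g $$ (a, l) * v $ l = 0" using hg[of a l] a v by (auto simp: coord_space_def)
  qed
  then show ?thesis using g vc by (simp add: coord_space_def)
qed

text \<open>The conormal variety is defined over the product of the Grassmannian and the flag
  varieties, so every translate of the base point has to be shown to lie in it.\<close>

lemma act_coord_flag:
  assumes gh: "K_pair p n g h" and S: "{a..<a + m} \<subseteq> {..<n}"
    and parity: "\<And>i j. i < n \<Longrightarrow> j < n \<Longrightarrow> (i < p) = (j < p) \<Longrightarrow> i \<in> {a..<a + m} \<Longrightarrow> j \<in> {a..<a + m}"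
  shows "map (\<lambda>U. (\<lambda>v. g *\<^sub>v v) ` U) (coord_flag n a m) \<in> complete_flags n (coord_space n {a..<a + m})"
proof -
  note c = K_pairD[OF gh]
  have fr: "dual_frame n (coord_space n {a..<a + i}) {a..<a + i} (unit_vec n) (unit_vec n)" if "i \<le> m" for i
    using S that by (intro dual_frame_coord order_trans[OF _ S]) simp
  have par: "i \<in> {a..<a + m}" if "i < n" "j < n" "g $$ (i, j) \<noteq> 0" "j \<in> {a..<a + m}" for i j
    using c(3) c(1) that parity[of j i] unfolding hom_mat_def by auto
  have mono: "coord_space n {a..<a + i} \<subseteq> coord_space n {a..<a + j}" if "i \<le> j" for i j
    using that by (auto simp: coord_space_def)
  have nth: "map (\<lambda>U. (\<lambda>v. g *\<^sub>v v) ` U) (coord_flag n a m) ! i = (\<lambda>v. g *\<^sub>v v) ` coord_space n {a..<a + i}"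
    if "i \<le> m" for i using that unfolding coord_flag_def by (simp del: upt_Suc)
  show ?thesis unfolding complete_flags_def
  proof (intro CollectI conjI allI impI)
    show "length (map (\<lambda>U. (\<lambda>v. g *\<^sub>v v) ` U) (coord_flag n a m)) = subspace_dim n (coord_space n {a..<a + m}) + 1"
      using dual_frame_dim(2)[OF fr[OF le_refl]] by (simp add: coord_flag_def)
  next
    fix i assume "i < length (map (\<lambda>U. (\<lambda>v. g *\<^sub>v v) ` U) (coord_flag n a m))"
    then have i: "i \<le> m" by (simp add: coord_flag_def)
    note fi = dual_frame_dim[OF dual_frame_image[OF fr[OF i] gh]]
    show "is_subspace n (map (\<lambda>U. (\<lambda>v. g *\<^sub>v v) ` U) (coord_flag n a m) ! i)"
      "subspace_dim n (map (\<lambda>U. (\<lambda>v. g *\<^sub>v v) ` U) (coord_flag n a m) ! i) = i"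
      unfolding nth[OF i] using fi by simp_all
    show "map (\<lambda>U. (\<lambda>v. g *\<^sub>v v) ` U) (coord_flag n a m) ! i \<subseteq> coord_space n {a..<a + m}"
      unfolding nth[OF i] using hom_preserves_coord[of g n "{a..<a + m}", OF c(1)] par mono[OF i] by blast
  next
    fix i assume "i + 1 < length (map (\<lambda>U. (\<lambda>v. g *\<^sub>v v) ` U) (coord_flag n a m))"
    then have i: "i \<le> m" "i + 1 \<le> m" by (auto simp: coord_flag_def)
    show "map (\<lambda>U. (\<lambda>v. g *\<^sub>v v) ` U) (coord_flag n a m) ! i \<subseteq> map (\<lambda>U. (\<lambda>v. g *\<^sub>v v) ` U) (coord_flag n a m) ! (i + 1)"
      unfolding nth[OF i(1)] nth[OF i(2)] by (intro image_mono mono) simp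
  qed
qed

lemma mult_unit_vec:
  fixes y :: "complex mat"
  assumes "y \<in> carrier_mat n n" "a < n" "b < n"
  shows "(y *\<^sub>v unit_vec n b) $ a = y $$ (a, b)"
  using assms scalar_prod_right_unit[OF assms(3), of "row y a"] by simp

lemma nil_coord_flag:
  assumes y: "y \<in> carrier_mat n n" and S: "{a..<a + m} \<subseteq> {..<n}"
    and par: "\<And>i j. i < n \<Longrightarrow> j < n \<Longrightarrow> y $$ (i, j) \<noteq> 0 \<Longrightarrow> j \<in> {a..<a + m} \<Longrightarrow> i \<in> {a..<a + m}"
  shows "nil_flag (coord_flag n a m) y \<longleftrightarrow>
    (\<forall>i\<in>{a..<a + m}. \<forall>j\<in>{a..<a + m}. y $$ (i, j) \<noteq> 0 \<longrightarrow> i < j)"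
proof -
  have nth: "coord_flag n a m ! i = coord_space n {a..<a + i}" if "i \<le> m" for i
    using that unfolding coord_flag_def by (simp del: upt_Suc)
  have len: "i < length (coord_flag n a m) \<longleftrightarrow> i \<le> m" for i by (auto simp: coord_flag_def)
  show ?thesis
  proof
    assume nil: "nil_flag (coord_flag n a m) y"
    show "\<forall>i\<in>{a..<a + m}. \<forall>j\<in>{a..<a + m}. y $$ (i, j) \<noteq> 0 \<longrightarrow> i < j"
    proof (intro ballI impI)
      fix i j assume ij: "i \<in> {a..<a + m}" "j \<in> {a..<a + m}" "y $$ (i, j) \<noteq> 0"
      then have n: "i < n" "j < n" using S by auto
      have jm: "Suc (j - a) \<le> m" "j - a \<le> m" using ij by auto
      \<comment> \<open>The unit vector \<open>j\<close> first appears in member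
        \<open>j - a + 1\<close> of the flag. Its image, column \<open>j\<close> of
        \<open>y\<close>, must lie one member lower, where only coordinates \<open>i\<close> with
        \<open>a \<le> i < j\<close> are nonzero.\<close>
      have "unit_vec n j \<in> coord_space n {a..<a + Suc (j - a)}"
        using ij n by (auto simp: coord_space_def)
      then have "unit_vec n j \<in> coord_flag n a m ! Suc (j - a)" unfolding nth[OF jm(1)] .
      moreover have "(\<lambda>v. y *\<^sub>v v) ` (coord_flag n a m ! Suc (j - a)) \<subseteq> coord_flag n a m ! (Suc (j - a) - 1)"
        using nil jm unfolding nil_flag_def len by (metis le_add1 plus_1_eq_Suc)
      ultimately have "y *\<^sub>v unit_vec n j \<in> coord_flag n a m ! (Suc (j - a) - 1)" by blast
      then have "y *\<^sub>v unit_vec n j \<in> coord_space n {a..<a + (j - a)}" using nth[OF jm(2)] by simp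
      then show "i < j" using mult_unit_vec[OF y n] ij n by (auto simp: coord_space_def)
    qed
  next
    assume up: "\<forall>i\<in>{a..<a + m}. \<forall>j\<in>{a..<a + m}. y $$ (i, j) \<noteq> 0 \<longrightarrow> i < j"
    show "nil_flag (coord_flag n a m) y" unfolding nil_flag_def len
    proof (intro allI impI)
      fix i assume i: "1 \<le> i \<and> i \<le> m"
      have "y *\<^sub>v v \<in> coord_space n {a..<a + (i - 1)}" if v: "v \<in> coord_space n {a..<a + i}" for v
      proof -
        have vc: "v \<in> carrier_vec n" using v by (simp add: coord_space_def)
        have "(y *\<^sub>v v) $ l = 0" if l: "l < n" "l \<notin> {a..<a + (i - 1)}" for l
          unfolding mult_mat_vec_sum[OF y vc l(1)]
        proof (rule sum.neutral, intro ballI, rule ccontr)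
          fix j assume j: "j \<in> {..<n}" "y $$ (l, j) * v $ j \<noteq> 0"
          then have "j \<in> {a..<a + i}" using v by (auto simp: coord_space_def)
          moreover from this have "j \<in> {a..<a + m}" using i by auto
          moreover have "l \<in> {a..<a + m}" using par[of l j] j l(1) \<open>j \<in> {a..<a + m}\<close> by auto
          ultimately show False using up j l(2) by fastforce
        qed
        then show ?thesis using y vc by (simp add: coord_space_def)
      qed
      then show "(\<lambda>v. y *\<^sub>v v) ` (coord_flag n a m ! i) \<subseteq> coord_flag n a m ! (i - 1)"
        using nth[of i] nth[of "i - 1"] i by auto
    qed
  qed
qed

section \<open>Equivariance of the conormal conditions under K\<close>

lemma conj_image_subset:
  assumes gh: "K_pair p n g h" and u: "u \<in> carrier_mat n n" and U: "U \<subseteq> carrier_vec n" "U' \<subseteq> carrier_vec n"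
  shows "(\<lambda>v. (g * u * h) *\<^sub>v v) ` ((\<lambda>v. g *\<^sub>v v) ` U) \<subseteq> (\<lambda>v. g *\<^sub>v v) ` U' \<longleftrightarrow> (\<lambda>v. u *\<^sub>v v) ` U \<subseteq> U'"
proof -
  note c = K_pairD[OF gh]
  have 1: "(g * u * h) *\<^sub>v (g *\<^sub>v v) = g *\<^sub>v (u *\<^sub>v v)" if v: "v \<in> carrier_vec n" for v
  proof -
    have "(g * u * h) *\<^sub>v (g *\<^sub>v v) = (g * u) *\<^sub>v (h *\<^sub>v (g *\<^sub>v v))"
      by (rule assoc_mult_mat_vec) (use c u v in auto)
    also have "h *\<^sub>v (g *\<^sub>v v) = v" using assoc_mult_mat_vec[OF c(2,1) v] c(6) v by simp
    also have "(g * u) *\<^sub>v v = g *\<^sub>v (u *\<^sub>v v)" by (rule assoc_mult_mat_vec[OF c(1) u v])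
    finally show ?thesis .
  qed
  have inj: "g *\<^sub>v v \<in> (\<lambda>v. g *\<^sub>v v) ` U' \<longleftrightarrow> v \<in> U'" if v: "v \<in> carrier_vec n" for v
  proof
    assume "g *\<^sub>v v \<in> (\<lambda>v. g *\<^sub>v v) ` U'"
    then obtain w where w: "w \<in> U'" "g *\<^sub>v v = g *\<^sub>v w" by blast
    have "h *\<^sub>v (g *\<^sub>v z) = z" if "z \<in> carrier_vec n" for z
      using assoc_mult_mat_vec[OF c(2,1) that] c(6) that by simp
    then have "v = w" using w v U(2) by (metis subsetD)
    then show "v \<in> U'" using w by simp
  qed blast
  have uc: "u *\<^sub>v v \<in> carrier_vec n" if "v \<in> U" for v using that U(1) u by auto
  have "(g * u * h) *\<^sub>v (g *\<^sub>v v) \<in> (\<lambda>v. g *\<^sub>v v) ` U' \<longleftrightarrow> u *\<^sub>v v \<in> U'" if "v \<in> U" for v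
    unfolding 1[OF subsetD[OF U(1) that]] by (rule inj[OF uc[OF that]])
  then show ?thesis by (simp add: image_subset_iff)
qed

lemma image_carrier:
  assumes gh: "K_pair p n g h"
  shows "(\<lambda>v. g *\<^sub>v v) ` carrier_vec n = carrier_vec n"
proof
  note c = K_pairD[OF gh]
  show "carrier_vec n \<subseteq> (\<lambda>v. g *\<^sub>v v) ` carrier_vec n"
  proof
    fix v :: "complex vec" assume v: "v \<in> carrier_vec n"
    then have "v = g *\<^sub>v (h *\<^sub>v v)" using assoc_mult_mat_vec[OF c(1,2) v] c(5) by simp
    then show "v \<in> (\<lambda>v. g *\<^sub>v v) ` carrier_vec n" using c(2) v by (intro image_eqI[of _ _ "h *\<^sub>v v"]) simp_all
  qed
qed (use K_pairD[OF gh] in auto)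

text \<open>With the kernel condition rewritten as an inclusion of images,
  \<open>conj_image_subset\<close> covers both halves.\<close>

lemma nil_subspace_alt:
  assumes "W \<subseteq> carrier_vec n"
  shows "nil_subspace n W =
    {x \<in> carrier_mat n n. (\<lambda>v. x *\<^sub>v v) ` carrier_vec n \<subseteq> W \<and> (\<lambda>v. x *\<^sub>v v) ` W \<subseteq> {0\<^sub>v n}}"
proof -
  have "W \<subseteq> mat_kernel x \<longleftrightarrow> (\<lambda>v. x *\<^sub>v v) ` W \<subseteq> {0\<^sub>v n}" if "x \<in> carrier_mat n n" for x
    unfolding mat_kernel[OF that] using assms by blast
  then show ?thesis unfolding nil_subspace_def by blast
qed

lemma nil_subspace_conj:
  assumes gh: "K_pair p n g h" and u: "u \<in> carrier_mat n n" and W: "W \<subseteq> carrier_vec n"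
  shows "g * u * h \<in> nil_subspace n ((\<lambda>v. g *\<^sub>v v) ` W) \<longleftrightarrow> u \<in> nil_subspace n W"
proof -
  note c = K_pairD[OF gh]
  have gW: "(\<lambda>v. g *\<^sub>v v) ` W \<subseteq> carrier_vec n" using c W by auto
  have "(\<lambda>v. g *\<^sub>v v) ` {0\<^sub>v n} = {0\<^sub>v n}" using mult_mat_zero_vec[OF c(1)] by simp
  then show ?thesis
    unfolding nil_subspace_alt[OF gW] nil_subspace_alt[OF W]
    using conj_image_subset[OF gh u subset_refl W] conj_image_subset[OF gh u W, of "{0\<^sub>v n}"] image_carrier[OF gh] c u
    by simp
qed

lemma nil_flag_conj:
  assumes gh: "K_pair p n g h" and u: "u \<in> carrier_mat n n" and F: "\<And>U. U \<in> set F \<Longrightarrow> U \<subseteq> carrier_vec n"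
  shows "nil_flag (map (\<lambda>U. (\<lambda>v. g *\<^sub>v v) ` U) F) (g * u * h) \<longleftrightarrow> nil_flag F u"
  unfolding nil_flag_def length_map
proof (intro all_cong1 imp_cong refl)
  fix i assume "1 \<le> i \<and> i < length F"
  then have i: "i < length F" "i - 1 < length F" by auto
  show "(\<lambda>v. (g * u * h) *\<^sub>v v) ` (map (\<lambda>U. (\<lambda>v. g *\<^sub>v v) ` U) F ! i) \<subseteq> map (\<lambda>U. (\<lambda>v. g *\<^sub>v v) ` U) F ! (i - 1) \<longleftrightarrow>
      (\<lambda>v. u *\<^sub>v v) ` (F ! i) \<subseteq> F ! (i - 1)"
    unfolding nth_map[OF i(1)] nth_map[OF i(2)]
    by (rule conj_image_subset[OF gh u]) (use F i in auto)
qed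

lemma k_part_eq: "x \<in> carrier_mat (p + q) (p + q) \<Longrightarrow> k_part p q x = kpart p (p + q) x"
  and s_part_eq: "x \<in> carrier_mat (p + q) (p + q) \<Longrightarrow> s_part p q x = spart p (p + q) x"
  unfolding k_part_def s_part_def split_block_def kpart_def spart_def by (auto simp: Let_def intro!: eq_matI)

text \<open>Multiplication by an even matrix on either side respects the decomposition into even and
  odd parts.\<close>

lemma kpart_conj:
  assumes gh: "K_pair p n g h" and u: "u \<in> carrier_mat n n"
  shows "kpart p n (g * u * h) = g * kpart p n u * h" "spart p n (g * u * h) = g * spart p n u * h"
proof -
  note c = K_pairD[OF gh]
  have gp: "(i < p) = (j < p)" if "i < n" "j < n" "g $$ (i, j) \<noteq> 0" for i j using c(1,3) that unfolding hom_mat_def by auto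
  have hp: "(i < p) = (j < p)" if "i < n" "j < n" "h $$ (i, j) \<noteq> 0" for i j using c(2,4) that unfolding hom_mat_def by auto
  have gs: "(\<Sum>l<n. g $$ (i, l) * (if Q (l < p) then f l else 0)) = (if Q (i < p) then \<Sum>l<n. g $$ (i, l) * f l else 0)"
    if "i < n" for i f Q
  proof -
    have "(\<Sum>l<n. g $$ (i, l) * (if Q (l < p) then f l else 0)) = (\<Sum>l<n. if Q (i < p) then g $$ (i, l) * f l else 0)"
      by (rule sum.cong[OF refl]) (use gp[OF that] in force)
    then show ?thesis by simp
  qed
  have hs: "(\<Sum>l<n. (if Q (l < p) then f l else 0) * h $$ (l, j)) = (if Q (j < p) then \<Sum>l<n. f l * h $$ (l, j) else 0)"
    if "j < n" for j f Q
  proof -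
    have "(\<Sum>l<n. (if Q (l < p) then f l else 0) * h $$ (l, j)) = (\<Sum>l<n. if Q (j < p) then f l * h $$ (l, j) else 0)"
      by (rule sum.cong[OF refl]) (use hp[OF _ that] in force)
    then show ?thesis by simp
  qed
  have idx: "kpart p n x $$ (i, j) = (if (i < p) = (j < p) then x $$ (i, j) else 0)"
    "spart p n x $$ (i, j) = (if (i < p) \<noteq> (j < p) then x $$ (i, j) else 0)" if "i < n" "j < n" for x i j
    using that by (auto simp: kpart_def spart_def)
  have gl: "kpart p n (g * x) = g * kpart p n x" "spart p n (g * x) = g * spart p n x" if x: "x \<in> carrier_mat n n" for x
  proof -
    have "kpart p n (g * x) $$ (i, j) = (g * kpart p n x) $$ (i, j) \<and> spart p n (g * x) $$ (i, j) = (g * spart p n x) $$ (i, j)"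
      if ij: "i < n" "j < n" for i j
      unfolding mult_mat_sum[OF c(1) kpart_carrier ij] mult_mat_sum[OF c(1) spart_carrier ij] idx[OF ij]
      using gs[OF ij(1), of "\<lambda>b. b = (j < p)" "\<lambda>l. x $$ (l, j)"] gs[OF ij(1), of "\<lambda>b. b \<noteq> (j < p)" "\<lambda>l. x $$ (l, j)"]
        mult_mat_sum[OF c(1) x ij] ij by (simp add: idx)
    then show "kpart p n (g * x) = g * kpart p n x" "spart p n (g * x) = g * spart p n x"
      by (intro eq_matI; use c in \<open>simp add: carrier_matD[OF kpart_carrier] carrier_matD[OF spart_carrier]\<close>)+
  qed
  have hr: "kpart p n (x * h) = kpart p n x * h" "spart p n (x * h) = spart p n x * h" if x: "x \<in> carrier_mat n n" for x
  proof -
    have "kpart p n (x * h) $$ (i, j) = (kpart p n x * h) $$ (i, j) \<and> spart p n (x * h) $$ (i, j) = (spart p n x * h) $$ (i, j)"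
      if ij: "i < n" "j < n" for i j
      unfolding mult_mat_sum[OF kpart_carrier c(2) ij] mult_mat_sum[OF spart_carrier c(2) ij] idx[OF ij]
      using hs[OF ij(2), of "\<lambda>b. (i < p) = b" "\<lambda>l. x $$ (i, l)"] hs[OF ij(2), of "\<lambda>b. (i < p) \<noteq> b" "\<lambda>l. x $$ (i, l)"]
        mult_mat_sum[OF x c(2) ij] ij by (simp add: idx)
    then show "kpart p n (x * h) = kpart p n x * h" "spart p n (x * h) = spart p n x * h"
      by (intro eq_matI; use c in \<open>simp add: carrier_matD[OF kpart_carrier] carrier_matD[OF spart_carrier]\<close>)+
  qed
  have gu: "g * u \<in> carrier_mat n n" using c u by simp
  show "kpart p n (g * u * h) = g * kpart p n u * h" "spart p n (g * u * h) = g * spart p n u * h"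
    using gl[OF u] hr[OF gu] by simp_all
qed

text \<open>An even matrix is block diagonal. If its inverse is even too, the blocks of the two
  matrices are inverse to each other.\<close>

lemma K_group_iff: "g \<in> K_group p q \<longleftrightarrow> (\<exists>h. K_pair p (p + q) g h)"
proof
  assume "g \<in> K_group p q"
  then obtain a d where g: "g = four_block_mat a (0\<^sub>m p q) (0\<^sub>m q p) d" "a \<in> carrier_mat p p" "invertible_mat a"
    "d \<in> carrier_mat q q" "invertible_mat d" unfolding K_group_def by blast
  obtain a' where a': "a * a' = 1\<^sub>m p" "a' * a = 1\<^sub>m (dim_row a')"
    using g(2,3) unfolding invertible_mat_def inverts_mat_def by auto
  obtain d' where d': "d * d' = 1\<^sub>m q" "d' * d = 1\<^sub>m (dim_row d')"
    using g(4,5) unfolding invertible_mat_def inverts_mat_def by auto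
  have c: "a' \<in> carrier_mat p p" "d' \<in> carrier_mat q q"
    using arg_cong[OF a'(1), of dim_col] arg_cong[OF a'(2), of dim_col] arg_cong[OF d'(1), of dim_col] arg_cong[OF d'(2), of dim_col] g(2,4) by auto
  let ?h = "four_block_mat a' (0\<^sub>m p q) (0\<^sub>m q p) d'"
  have "g * ?h = 1\<^sub>m (p + q)" "?h * g = 1\<^sub>m (p + q)"
    using mult_four_block_mat[OF g(2) zero_carrier_mat zero_carrier_mat g(4) c(1) zero_carrier_mat zero_carrier_mat c(2)]
      mult_four_block_mat[OF c(1) zero_carrier_mat zero_carrier_mat c(2) g(2) zero_carrier_mat zero_carrier_mat g(4)]
      a' d' g c by simp_all
  moreover have "hom_mat p True g" "hom_mat p True ?h"
    using g c by (auto simp: hom_mat_def)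
  ultimately show "\<exists>h. K_pair p (p + q) g h"
    unfolding K_pair_def using g c by (intro exI[of _ ?h]) auto
next
  assume "\<exists>h. K_pair p (p + q) g h"
  then obtain h where gh: "K_pair p (p + q) g h" ..
  note c = K_pairD[OF gh]
  define blk :: "complex mat \<Rightarrow> complex mat \<times> complex mat" where
    "blk x = (mat p p (\<lambda>(i, j). x $$ (i, j)), mat q q (\<lambda>(i, j). x $$ (p + i, p + j)))" for x
  have split: "x = four_block_mat (fst (blk x)) (0\<^sub>m p q) (0\<^sub>m q p) (snd (blk x))"
    if "x \<in> carrier_mat (p + q) (p + q)" "hom_mat p True x" for x
    by (rule eq_matI) (use that in \<open>auto simp: blk_def hom_mat_def\<close>)
  have bc: "fst (blk x) \<in> carrier_mat p p" "snd (blk x) \<in> carrier_mat q q" for x by (auto simp: blk_def)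
  have prod: "fst (blk x) * fst (blk y) = 1\<^sub>m p \<and> snd (blk x) * snd (blk y) = 1\<^sub>m q"
    if "x \<in> carrier_mat (p + q) (p + q)" "hom_mat p True x" "y \<in> carrier_mat (p + q) (p + q)" "hom_mat p True y"
      "x * y = 1\<^sub>m (p + q)" for x y
  proof -
    note bx = bc[of x] and yb = bc[of y]
    have P: "fst (blk x) * fst (blk y) \<in> carrier_mat p p" "snd (blk x) * snd (blk y) \<in> carrier_mat q q"
      using mult_carrier_mat[OF bx(1) yb(1)] mult_carrier_mat[OF bx(2) yb(2)] by simp_all
    have "x * y = four_block_mat (fst (blk x)) (0\<^sub>m p q) (0\<^sub>m q p) (snd (blk x)) *
        four_block_mat (fst (blk y)) (0\<^sub>m p q) (0\<^sub>m q p) (snd (blk y))"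
      using split[OF that(1,2)] split[OF that(3,4)] by simp
    also have "\<dots> = four_block_mat (fst (blk x) * fst (blk y)) (0\<^sub>m p q) (0\<^sub>m q p) (snd (blk x) * snd (blk y))"
      unfolding mult_four_block_mat[OF bx(1) zero_carrier_mat zero_carrier_mat bx(2) yb(1) zero_carrier_mat zero_carrier_mat yb(2)]
      using bx yb P by simp
    finally have m: "1\<^sub>m (p + q) = four_block_mat (fst (blk x) * fst (blk y)) (0\<^sub>m p q) (0\<^sub>m q p) (snd (blk x) * snd (blk y))"
      using that(5) by simp
    have ent: "1\<^sub>m (p + q) $$ (i, j) = (if i < p then if j < p then (fst (blk x) * fst (blk y)) $$ (i, j) else 0
        else if j < p then 0 else (snd (blk x) * snd (blk y)) $$ (i - p, j - p))" if "i < p + q" "j < p + q" for i j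
      unfolding m by (subst index_mat_four_block) (use that bx yb in auto)
    have "fst (blk x) * fst (blk y) = 1\<^sub>m p"
      by (rule eq_matI) (use bx yb ent in \<open>simp_all del: index_mult_mat(1)\<close>)
    moreover have "snd (blk x) * snd (blk y) = 1\<^sub>m q"
    proof (rule eq_matI)
      fix i j assume "i < dim_row (1\<^sub>m q :: complex mat)" "j < dim_col (1\<^sub>m q :: complex mat)"
      then show "(snd (blk x) * snd (blk y)) $$ (i, j) = 1\<^sub>m q $$ (i, j)"
        using ent[of "p + i" "p + j"] by (simp del: index_mult_mat(1))
    qed (use bx yb in auto)
    ultimately show ?thesis ..
  qed
  have "invertible_mat (fst (blk g))" "invertible_mat (snd (blk g))"
    using prod[OF c(1,3,2,4,5)] prod[OF c(2,4,1,3,6)] bc[of g] bc[of h]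
    unfolding invertible_mat_def inverts_mat_def by auto
  then show "g \<in> K_group p q" unfolding K_group_def using split[OF c(1,3)] bc[of g] by blast
qed

text \<open>Inverses are unique, so any inverse of a group element is the even one that
  \<open>K_group_iff\<close> provides.\<close>

lemma adjoint_orbit_eq: "x \<in> carrier_mat (p + q) (p + q) \<Longrightarrow> adjoint_orbit p q x = K_orbit p (p + q) x"
proof -
  have "g \<in> K_group p q \<and> h \<in> carrier_mat (p + q) (p + q) \<and> inverts_mat g h \<and> inverts_mat h g \<longleftrightarrow> K_pair p (p + q) g h" for g h
  proof
    assume a: "g \<in> K_group p q \<and> h \<in> carrier_mat (p + q) (p + q) \<and> inverts_mat g h \<and> inverts_mat h g"
    then obtain h' where h': "K_pair p (p + q) g h'" using K_group_iff by blast
    note c = K_pairD[OF h']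
    have "g * h = 1\<^sub>m (p + q)" using a c(1) by (simp add: inverts_mat_def)
    then have "h = h'" using K_pair_cancel(2)[OF h', of h] a c by simp
    then show "K_pair p (p + q) g h" using h' by simp
  next
    assume "K_pair p (p + q) g h"
    then show "g \<in> K_group p q \<and> h \<in> carrier_mat (p + q) (p + q) \<and> inverts_mat g h \<and> inverts_mat h g"
      using K_group_iff K_pairD[of p "p + q" g h] by (auto simp: inverts_mat_def)
  qed
  then show ?thesis unfolding adjoint_orbit_def K_orbit_def by auto
qed

section \<open>The fibre over the base point and the image of the bundle\<close>

context matching_data
begin

text \<open>For the data of \<omega> this is its column space, by
  \<open>col_space_eq_W0\<close>.\<close>

definition W0 :: "complex vec set" where
  "W0 = {v \<in> carrier_vec n. (\<forall>y\<in>L' \<union> M'. v $ y = 0) \<and> (\<forall>i\<in>I. v $ i = v $ mate i)}"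

text \<open>For the data of \<omega> these are its columns, each indexed by its first row with a 1.
  Indices of \<open>J\<close> are thereby avoided, which makes the unit vectors of
  \<open>L \<union> M \<union> I\<close> the dual covectors.\<close>

definition W0_basis :: "nat \<Rightarrow> complex vec" where
  "W0_basis t = vec n (\<lambda>l. if l = t \<or> t \<in> I \<and> l = mate t then 1 else 0)"

lemma W0D:
  assumes "v \<in> W0"
  shows "v \<in> carrier_vec n" "\<And>y. y \<in> L' \<union> M' \<Longrightarrow> v $ y = 0" "\<And>i. i \<in> I \<Longrightarrow> v $ i = v $ mate i"
  using assms unfolding W0_def by blast+

lemma W0I:
  "v \<in> carrier_vec n \<Longrightarrow> (\<And>y. y \<in> L' \<union> M' \<Longrightarrow> v $ y = 0) \<Longrightarrow> (\<And>i. i \<in> I \<Longrightarrow> v $ i = v $ mate i) \<Longrightarrow> v \<in> W0"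
  unfolding W0_def by blast

lemma finite_parts: "finite L" "finite I" "finite L'" "finite M" "finite J" "finite M'"
  using subsets finite_subset[of _ "{..<n}"] parity(5,6) by (auto simp: subset_iff)

lemma dual_frame_W0: "dual_frame n W0 (L \<union> M \<union> I) W0_basis (unit_vec n)"
proof -
  have lt: "t < n" if "t \<in> L \<union> M \<union> I" for t using that subsets parity(5,6) by auto
  have mem: "W0_basis t \<in> W0" if t: "t \<in> L \<union> M \<union> I" for t
  proof -
    have "W0_basis t $ y = 0" if y: "y \<in> L' \<union> M'" for y
    proof -
      have "y < n" "y \<noteq> t" using y t subsets parity(5-7) A_split B_split disjoint_parts by auto
      moreover have "y \<noteq> mate t" if "t \<in> I" using that y mate(1)[OF that] B_split disjoint_parts by auto
      ultimately show ?thesis by (auto simp: W0_basis_def)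
    qed
    moreover have "W0_basis t $ i = W0_basis t $ mate i" if i: "i \<in> I" for i
    proof -
      have "i < n" "mate i < n" "mate i \<in> J" "mate (mate i) = i" using i index_less mate by auto
      moreover have "i \<noteq> mate t" if "t \<in> I" using that i mate(1)[OF that] disjoint_parts by auto
      moreover have "mate i \<noteq> t" using t mate(1)[OF i] disjoint_parts B_split by auto
      moreover have "i = t \<longleftrightarrow> t \<in> I \<and> mate i = mate t" using i mate(1) by metis
      ultimately show ?thesis by (auto simp: W0_basis_def)
    qed
    ultimately show ?thesis by (simp add: W0_def W0_basis_def)
  qed
  have dual: "unit_vec n t \<bullet> W0_basis t' = (if t = t' then 1 else 0)" if "t \<in> L \<union> M \<union> I" "t' \<in> L \<union> M \<union> I" for t t'
  proof -
    have "t \<noteq> mate t'" if "t' \<in> I" using mate(1)[OF that] \<open>t \<in> L \<union> M \<union> I\<close> disjoint_parts B_split by auto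
    then show ?thesis
      using unit_vec_scalar_prod[of "W0_basis t'" n t] lt[OF that(1)] by (auto simp: W0_basis_def)
  qed
  have span: "u $ i = (\<Sum>t\<in>L \<union> M \<union> I. (unit_vec n t \<bullet> u) * W0_basis t $ i)" if u: "u \<in> W0" and i: "i < n" for u i
  proof -
    have uc: "u \<in> carrier_vec n" using u by (simp add: W0_def)
    have "(\<Sum>t\<in>L \<union> M \<union> I. (unit_vec n t \<bullet> u) * W0_basis t $ i) =
        (\<Sum>t\<in>L \<union> M \<union> I. if i = t \<or> t \<in> I \<and> i = mate t then u $ t else 0)"
      by (rule sum.cong[OF refl]) (use lt i unit_vec_scalar_prod[OF uc] in \<open>simp add: W0_basis_def\<close>)
    also have "\<dots> = u $ i"
    proof (cases "i \<in> J")
      case True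
      then have j: "mate i \<in> I" "mate (mate i) = i" "i \<notin> L \<union> M \<union> I" using mate(2) disjoint_parts B_split by auto
      have "(i = t \<or> t \<in> I \<and> i = mate t) \<longleftrightarrow> t = mate i" if "t \<in> L \<union> M \<union> I" for t
        using that j mate(1) by metis
      then have "(\<Sum>t\<in>L \<union> M \<union> I. if i = t \<or> t \<in> I \<and> i = mate t then u $ t else 0) = (\<Sum>t\<in>L \<union> M \<union> I. if t = mate i then u $ mate i else 0)"
        by (intro sum.cong) auto
      also have "\<dots> = u $ mate i" using j finite_parts by simp
      also have "\<dots> = u $ i" using u j unfolding W0_def by auto
      finally show ?thesis .
    next
      case False
      then have "(i = t \<or> t \<in> I \<and> i = mate t) \<longleftrightarrow> t = i" for t using mate(1) by auto
      then have "(\<Sum>t\<in>L \<union> M \<union> I. if i = t \<or> t \<in> I \<and> i = mate t then u $ t else 0) = (\<Sum>t\<in>L \<union> M \<union> I. if t = i then u $ i else 0)"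
        by (intro sum.cong) auto
      also have "\<dots> = u $ i"
      proof (cases "i \<in> L \<union> M \<union> I")
        case True
        then show ?thesis using finite_parts by simp
      next
        case n: False
        then have "i \<in> L' \<union> M'" using False parity(4)[OF i] A_split(1) B_split(1) by auto
        then have "u $ i = 0" using u unfolding W0_def by auto
        then show ?thesis using n finite_parts by simp
      qed
      finally show ?thesis .
    qed
    finally show ?thesis by simp
  qed
  have "y < n" if "y \<in> L' \<union> M'" for y using that subsets parity(5,6) by auto
  then have lt': "y \<in> L' \<union> M' \<Longrightarrow> y < n" "i \<in> I \<Longrightarrow> i < n" "i \<in> I \<Longrightarrow> mate i < n" for y i
    using index_less by blast+
  show ?thesis
  proof (rule dual_frameI[OF _ _ _ _ _ mem _ dual span])
    fix u v assume uv: "u \<in> W0" "v \<in> W0"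
    note D = W0D[OF uv(1)] W0D[OF uv(2)]
    show "u + v \<in> W0" by (rule W0I) (use D lt' in simp_all)
  next
    fix c v assume v: "v \<in> W0"
    show "c \<cdot>\<^sub>v v \<in> W0" by (rule W0I) (use W0D[OF v] lt' in simp_all)
  next
    show "0\<^sub>v n \<in> W0" by (rule W0I) (use lt' in simp_all)
  qed (use W0D finite_parts in auto)
qed

text \<open>The image condition is tested on unit vectors, that is, on the columns of
  \<open>x\<close>; the kernel condition is tested on \<open>W0_basis\<close>, where the sum of two
  matched unit vectors yields opposite columns. In the reverse direction the terms of a matched pair
  cancel.\<close>

lemma slice_iff:
  "x \<in> slice \<longleftrightarrow> x \<in> nil_subspace n W0 \<and> (\<forall>a<n. \<forall>b<n. x $$ (a, b) \<noteq> 0 \<longrightarrow> (a < p) = (b < p) \<longrightarrow> a < b)"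
proof -
  note fr = dual_frame_W0[unfolded dual_frame_def]
  have Wc: "W0 \<subseteq> carrier_vec n" using fr by blast
  have key: "x \<in> nil_subspace n W0 \<longleftrightarrow>
    (\<forall>a<n. \<forall>b<n. x $$ (a, b) \<noteq> 0 \<longrightarrow> a \<notin> L' \<union> M' \<and> b \<notin> L \<union> M) \<and>
    (\<forall>i\<in>I. \<forall>y<n. x $$ (i, y) = x $$ (mate i, y) \<and> x $$ (y, i) = - x $$ (y, mate i))"
    if x: "x \<in> carrier_mat n n" for x
  proof
    assume nil: "x \<in> nil_subspace n W0"
    then have im: "x *\<^sub>v v \<in> W0" if "v \<in> carrier_vec n" for v
      using that unfolding nil_subspace_def by blast
    have ker: "x *\<^sub>v v = 0\<^sub>v n" if "v \<in> W0" for v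
    proof -
      have "W0 \<subseteq> mat_kernel x" using nil unfolding nil_subspace_def by blast
      then show ?thesis using mat_kernelD(2)[OF x] that by blast
    qed
    have col: "x *\<^sub>v unit_vec n b \<in> W0" for b by (rule im) simp
    have E1: "x $$ (a, b) = 0" if "a \<in> L' \<union> M'" "b < n" for a b
    proof -
      have "a < n" using that subsets parity(5,6) by auto
      have "(x *\<^sub>v unit_vec n b) $ a = 0" by (rule W0D(2)[OF col that(1)])
      then show ?thesis using mult_unit_vec[OF x \<open>a < n\<close> that(2)] by simp
    qed
    have E2: "x $$ (i, y) = x $$ (mate i, y)" if "i \<in> I" "y < n" for i y
      using col[of y] mult_unit_vec[OF x index_less(1)[OF that(1)] that(2)]
        mult_unit_vec[OF x index_less(3)[OF that(1)] that(2)] that(1) unfolding W0_def by auto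
    have row: "(\<Sum>l<n. x $$ (a, l) * W0_basis t $ l) = 0" if "t \<in> L \<union> M \<union> I" "a < n" for a t
    proof -
      have t: "W0_basis t \<in> W0" using fr that by blast
      then have "(x *\<^sub>v W0_basis t) $ a = 0" using ker[OF t] that by simp
      then show ?thesis using mult_mat_vec_sum[OF x _ that(2)] t Wc by (metis subsetD)
    qed
    have E1': "x $$ (a, b) = 0" if "b \<in> L \<union> M" "a < n" for a b
    proof -
      have b: "b < n" "b \<notin> I" using that subsets parity(5,6) A_split disjoint_parts by auto
      have "(\<Sum>l<n. x $$ (a, l) * W0_basis b $ l) = (\<Sum>l<n. if l = b then x $$ (a, b) else 0)"
        by (rule sum.cong) (use b in \<open>auto simp: W0_basis_def\<close>)
      then show ?thesis using row[of b a] that b by simp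
    qed
    have E2': "x $$ (y, i) = - x $$ (y, mate i)" if "i \<in> I" "y < n" for i y
    proof -
      have i: "i < n" "mate i < n" "i \<noteq> mate i" using that index_less mate(1)[OF that(1)] disjoint_parts by auto
      have "(\<Sum>l<n. x $$ (y, l) * W0_basis i $ l) = (\<Sum>l<n. (if l = i then x $$ (y, i) else 0) + (if l = mate i then x $$ (y, mate i) else 0))"
        by (rule sum.cong) (use i that in \<open>auto simp: W0_basis_def\<close>)
      then have "x $$ (y, i) + x $$ (y, mate i) = 0" using row[of i y] that i by (simp add: sum.distrib)
      then show ?thesis by (simp add: eq_neg_iff_add_eq_0)
    qed
    show "(\<forall>a<n. \<forall>b<n. x $$ (a, b) \<noteq> 0 \<longrightarrow> a \<notin> L' \<union> M' \<and> b \<notin> L \<union> M) \<and>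
      (\<forall>i\<in>I. \<forall>y<n. x $$ (i, y) = x $$ (mate i, y) \<and> x $$ (y, i) = - x $$ (y, mate i))"
      using E1 E2 E1' E2' by blast
  next
    assume E: "(\<forall>a<n. \<forall>b<n. x $$ (a, b) \<noteq> 0 \<longrightarrow> a \<notin> L' \<union> M' \<and> b \<notin> L \<union> M) \<and>
      (\<forall>i\<in>I. \<forall>y<n. x $$ (i, y) = x $$ (mate i, y) \<and> x $$ (y, i) = - x $$ (y, mate i))"
    have im: "x *\<^sub>v v \<in> W0" if v: "v \<in> carrier_vec n" for v
    proof -
      have "(x *\<^sub>v v) $ y = 0" if y: "y \<in> L' \<union> M'" for y
      proof -
        have "y < n" using y subsets parity(5,6) by auto
        then show ?thesis unfolding mult_mat_vec_sum[OF x v \<open>y < n\<close>]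
          by (intro sum.neutral ballI) (use E y in auto)
      qed
      moreover have "(x *\<^sub>v v) $ i = (x *\<^sub>v v) $ mate i" if i: "i \<in> I" for i
        unfolding mult_mat_vec_sum[OF x v index_less(1)[OF i]] mult_mat_vec_sum[OF x v index_less(3)[OF i]]
        by (rule sum.cong) (use E i in auto)
      ultimately show ?thesis unfolding W0_def using x v by auto
    qed
    have ker: "x *\<^sub>v v = 0\<^sub>v n" if v: "v \<in> W0" for v
    proof (rule eq_vecI)
      have vc: "v \<in> carrier_vec n" using v Wc by blast
      fix a assume "a < dim_vec (0\<^sub>v n :: complex vec)"
      then have a: "a < n" by simp
      have sub: "I \<union> J \<subseteq> {..<n}" using index_less by auto
      have "(x *\<^sub>v v) $ a = (\<Sum>l\<in>I \<union> J. x $$ (a, l) * v $ l)"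
        unfolding mult_mat_vec_sum[OF x vc a]
      proof (rule sum.mono_neutral_right)
        show "\<forall>l\<in>{..<n} - (I \<union> J). x $$ (a, l) * v $ l = 0"
        proof
          fix l assume l: "l \<in> {..<n} - (I \<union> J)"
          then have "l \<in> L \<union> M \<or> l \<in> L' \<union> M'" using parity(4)[of l] A_split(1) B_split(1) by auto
          then show "x $$ (a, l) * v $ l = 0" using E v a l unfolding W0_def by auto
        qed
      qed (use sub in auto)
      also have "\<dots> = (\<Sum>l\<in>I. x $$ (a, l) * v $ l) + (\<Sum>l\<in>J. x $$ (a, l) * v $ l)"
        by (rule sum.union_disjoint[OF finite_parts(2,5) disjoint_parts(1)])
      also have "(\<Sum>l\<in>J. x $$ (a, l) * v $ l) = (\<Sum>l\<in>I. x $$ (a, mate l) * v $ mate l)"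
        by (rule sum.reindex_bij_witness[of _ mate mate]) (use mate in simp_all)
      also have "(\<Sum>l\<in>I. x $$ (a, l) * v $ l) + (\<Sum>l\<in>I. x $$ (a, mate l) * v $ mate l) = (\<Sum>l\<in>I. 0)"
        unfolding sum.distrib[symmetric]
      proof (rule sum.cong[OF refl])
        fix l assume "l \<in> I"
        then have "x $$ (a, l) = - x $$ (a, mate l)" "v $ l = v $ mate l" using E v a unfolding W0_def by blast+
        then show "x $$ (a, l) * v $ l + x $$ (a, mate l) * v $ mate l = 0" by simp
      qed
      finally show "(x *\<^sub>v v) $ a = 0\<^sub>v n $ a" using a by simp
    qed (use x in auto)
    have "(\<lambda>v. x *\<^sub>v v) ` carrier_vec n \<subseteq> W0" by (rule image_subsetI) (rule im)
    moreover have "(\<lambda>v. x *\<^sub>v v) ` W0 \<subseteq> {0\<^sub>v n}" by (rule image_subsetI) (simp only: ker singleton_iff)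
    ultimately show "x \<in> nil_subspace n W0" unfolding nil_subspace_alt[OF Wc] using x by blast
  qed
  show ?thesis
  proof (cases "x \<in> carrier_mat n n")
    case True
    show ?thesis unfolding key[OF True] slice_def mem_Collect_eq using True by (simp only: conj_assoc simp_thms)
  next
    case False
    then show ?thesis by (simp add: slice_def nil_subspace_def)
  qed
qed

lemma slice_conormal:
  assumes n: "n = p + q" and x: "x \<in> carrier_mat n n"
  shows "x \<in> slice \<longleftrightarrow> x \<in> nil_subspace n W0 \<and>
    nil_flag (std_flag_plus p q) (kpart p n x) \<and> nil_flag (std_flag_minus p q) (kpart p n x)"
proof -
  have e: "std_flag_plus p q = coord_flag n 0 p" "std_flag_minus p q = coord_flag n p q"
    using std_flag_coord[of p q] n by simp_all
  have kp: "kpart p n x $$ (a, b) \<noteq> 0 \<longleftrightarrow> x $$ (a, b) \<noteq> 0 \<and> (a < p) = (b < p)" if "a < n" "b < n" for a b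
    using that by (simp add: kpart_def)
  have sub: "{0..<0 + p} \<subseteq> {..<n}" "{p..<p + q} \<subseteq> {..<n}" using n by auto
  have 1: "nil_flag (std_flag_plus p q) (kpart p n x) \<longleftrightarrow>
      (\<forall>i\<in>{0..<0 + p}. \<forall>j\<in>{0..<0 + p}. kpart p n x $$ (i, j) \<noteq> 0 \<longrightarrow> i < j)"
    unfolding e by (rule nil_coord_flag[OF kpart_carrier sub(1)]) (simp add: kp)
  have 2: "nil_flag (std_flag_minus p q) (kpart p n x) \<longleftrightarrow>
      (\<forall>i\<in>{p..<p + q}. \<forall>j\<in>{p..<p + q}. kpart p n x $$ (i, j) \<noteq> 0 \<longrightarrow> i < j)"
    unfolding e by (rule nil_coord_flag[OF kpart_carrier sub(2)]) (use kp n in force)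
  have 3: "(\<forall>a<n. \<forall>b<n. x $$ (a, b) \<noteq> 0 \<longrightarrow> (a < p) = (b < p) \<longrightarrow> a < b) \<longleftrightarrow>
     (\<forall>i\<in>{0..<0 + p}. \<forall>j\<in>{0..<0 + p}. kpart p n x $$ (i, j) \<noteq> 0 \<longrightarrow> i < j) \<and>
     (\<forall>i\<in>{p..<p + q}. \<forall>j\<in>{p..<p + q}. kpart p n x $$ (i, j) \<noteq> 0 \<longrightarrow> i < j)" (is "?l \<longleftrightarrow> ?r1 \<and> ?r2")
  proof (intro iffI conjI ballI impI)
    fix i j assume l: ?l and ij: "i \<in> {0..<0 + p}" "j \<in> {0..<0 + p}" "kpart p n x $$ (i, j) \<noteq> 0"
    then have "i < n" "j < n" using n by simp_all
    then show "i < j" using l ij(3) kp by blast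
  next
    fix i j assume l: ?l and ij: "i \<in> {p..<p + q}" "j \<in> {p..<p + q}" "kpart p n x $$ (i, j) \<noteq> 0"
    then have "i < n" "j < n" using n by simp_all
    then show "i < j" using l ij(3) kp by blast
  next
    assume r: "?r1 \<and> ?r2"
    show ?l
    proof (intro allI impI)
      fix a b assume ab: "a < n" "b < n" "x $$ (a, b) \<noteq> 0" "(a < p) = (b < p)"
      then have k: "kpart p n x $$ (a, b) \<noteq> 0" using kp by blast
      show "a < b"
      proof (cases "a < p")
        case True
        then have "a \<in> {0..<0 + p}" "b \<in> {0..<0 + p}" using ab by simp_all
        then show ?thesis using r k by blast
      next
        case False
        then have "a \<in> {p..<p + q}" "b \<in> {p..<p + q}" using ab n by simp_all
        then show ?thesis using r k by blast
      qed
    qed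
  qed
  show ?thesis unfolding slice_iff 1 2 3 ..
qed

text \<open>Each point of the orbit is carried to the base point by a group element, where the fibre
  is the slice; taking even or odd parts commutes with this conjugation.\<close>

lemma conormal_image:
  assumes n: "n = p + q" and W: "vec_space.col_space n \<omega> = W0" and r: "r = card (L \<union> M \<union> I)"
  shows "phi_k p q ` conormal_bundle p q r (orbit_of p q \<omega>) = {g * u * h | g u h. K_pair p n g h \<and> u \<in> kpart p n ` slice}"
    "phi_s p q ` conormal_bundle p q r (orbit_of p q \<omega>) = {g * u * h | g u h. K_pair p n g h \<and> u \<in> spart p n ` slice}"
proof -
  have Wc: "W0 \<subseteq> carrier_vec n" by (auto simp: W0_def)
  have fl: "U \<subseteq> carrier_vec n" if "U \<in> set (std_flag_plus p q) \<union> set (std_flag_minus p q)" for U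
    using that unfolding std_flag_plus_def std_flag_minus_def n by auto
  have e: "std_flag_plus p q = coord_flag n 0 p" "std_flag_minus p q = coord_flag n p q"
    "V_plus p q = coord_space n {0..<0 + p}" "V_minus p q = coord_space n {p..<p + q}"
    using std_flag_coord[of p q] V_coord[of p q] n by simp_all
  have X: "act g (W0, std_flag_plus p q, std_flag_minus p q) \<in> X_variety p q r" if gh: "K_pair p n g h" for g h
  proof -
    note d = dual_frame_dim[OF dual_frame_image[OF dual_frame_W0 gh]]
    have "(\<lambda>v. g *\<^sub>v v) ` W0 \<in> Grassmannian n r" unfolding Grassmannian_def using d r by simp
    moreover have "map (\<lambda>U. (\<lambda>v. g *\<^sub>v v) ` U) (coord_flag n 0 p) \<in> complete_flags n (coord_space n {0..<0 + p})"
      by (rule act_coord_flag[OF gh]) (use n in auto)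
    moreover have "map (\<lambda>U. (\<lambda>v. g *\<^sub>v v) ` U) (coord_flag n p q) \<in> complete_flags n (coord_space n {p..<p + q})"
      by (rule act_coord_flag[OF gh]) (use n in auto)
    ultimately show ?thesis unfolding act.simps X_variety_def e n[symmetric] by blast
  qed
  have mem: "(act g (W0, std_flag_plus p q, std_flag_minus p q), g * u * h) \<in> conormal_variety p q r \<longleftrightarrow> u \<in> slice"
    if gh: "K_pair p n g h" and u: "u \<in> carrier_mat n n" for g h u
  proof -
    note c = K_pairD[OF gh]
    have guh: "g * u * h \<in> carrier_mat n n" using c u by auto
    have "k_part p q (g * u * h) = g * kpart p n u * h"
      using k_part_eq[of "g * u * h" p q] guh kpart_conj(1)[OF gh u] n by simp
    then show ?thesis
      using X[OF gh] unfolding conormal_variety_def slice_conormal[OF n u] n[symmetric]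
      by (simp add: nil_subspace_conj[OF gh u Wc] nil_flag_conj[OF gh kpart_carrier] fl)
  qed
  have cb: "conormal_bundle p q r (orbit_of p q \<omega>) =
      {(act g (W0, std_flag_plus p q, std_flag_minus p q), g * u * h) | g h u. K_pair p n g h \<and> u \<in> slice}" (is "?l = ?r")
  proof
    show "?r \<subseteq> ?l"
    proof
      fix y assume "y \<in> ?r"
      then obtain g h u where y: "y = (act g (W0, std_flag_plus p q, std_flag_minus p q), g * u * h)" "K_pair p n g h" "u \<in> slice" by blast
      then have "g \<in> K_group p q" using K_group_iff n by blast
      then have "act g (W0, std_flag_plus p q, std_flag_minus p q) \<in> orbit_of p q \<omega>"
        unfolding orbit_of_def n[symmetric] W by blast
      then show "y \<in> ?l" unfolding conormal_bundle_def y(1) using mem[OF y(2) sliceD(1)[OF y(3)]] y(3) by simp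
    qed
    show "?l \<subseteq> ?r"
    proof
      fix y assume y: "y \<in> ?l"
      obtain g where g: "g \<in> K_group p q" "fst y = act g (W0, std_flag_plus p q, std_flag_minus p q)"
        using y unfolding conormal_bundle_def orbit_of_def n[symmetric] W by blast
      obtain h where gh: "K_pair p n g h" using g(1) K_group_iff n by blast
      note c = K_pairD[OF gh]
      define x where "x = snd y"
      have yx: "y = (fst y, x)" by (simp add: x_def)
      have x: "x \<in> carrier_mat n n"
        using y n unfolding conormal_bundle_def conormal_variety_def nil_subspace_def x_def by auto
      define u where "u = h * x * g"
      have u: "u \<in> carrier_mat n n" using c x by (auto simp: u_def)
      have xu: "x = g * u * h" unfolding u_def
        using c x by (simp add: square_mult_assoc[of _ n] square_mult_closed[of _ n] K_pair_cancel[OF gh])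
      have "u \<in> slice" using mem[OF gh u] y yx g(2) xu unfolding conormal_bundle_def by simp
      moreover have "y = (act g (W0, std_flag_plus p q, std_flag_minus p q), g * u * h)"
        using yx unfolding g(2) xu .
      ultimately show "y \<in> ?r" using gh by blast
    qed
  qed
  have part: "k_part p q (g * u * h) = g * kpart p n u * h" "s_part p q (g * u * h) = g * spart p n u * h"
    if "K_pair p n g h" "u \<in> slice" for g u h
  proof -
    have "g * u * h \<in> carrier_mat (p + q) (p + q)"
      using K_pairD[OF that(1)] sliceD(1)[OF that(2)] n by (metis square_mult_closed)
    from k_part_eq[OF this] s_part_eq[OF this]
    show "k_part p q (g * u * h) = g * kpart p n u * h" "s_part p q (g * u * h) = g * spart p n u * h"
      using kpart_conj[OF that(1) sliceD(1)[OF that(2)]] n by simp_all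
  qed
  have "phi_k p q ` conormal_bundle p q r (orbit_of p q \<omega>) = {k_part p q (g * u * h) | g h u. K_pair p n g h \<and> u \<in> slice}"
    "phi_s p q ` conormal_bundle p q r (orbit_of p q \<omega>) = {s_part p q (g * u * h) | g h u. K_pair p n g h \<and> u \<in> slice}"
    unfolding cb phi_k_def phi_s_def by force+
  moreover have "{k_part p q (g * u * h) | g h u. K_pair p n g h \<and> u \<in> slice} = {g * u * h | g u h. K_pair p n g h \<and> u \<in> kpart p n ` slice}"
  proof (intro equalityI subsetI)
    fix z assume "z \<in> {k_part p q (g * u * h) | g h u. K_pair p n g h \<and> u \<in> slice}"
    then obtain g h u where z: "z = k_part p q (g * u * h)" "K_pair p n g h" "u \<in> slice" by blast
    then show "z \<in> {g * u * h | g u h. K_pair p n g h \<and> u \<in> kpart p n ` slice}"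
      using part(1)[OF z(2,3)] by blast
  next
    fix z assume "z \<in> {g * u * h | g u h. K_pair p n g h \<and> u \<in> kpart p n ` slice}"
    then obtain g h u where z: "z = g * kpart p n u * h" "K_pair p n g h" "u \<in> slice" by blast
    then have "z = k_part p q (g * u * h)" using part(1)[OF z(2,3)] by simp
    then show "z \<in> {k_part p q (g * u * h) | g h u. K_pair p n g h \<and> u \<in> slice}" using z(2,3) by blast
  qed
  moreover have "{s_part p q (g * u * h) | g h u. K_pair p n g h \<and> u \<in> slice} = {g * u * h | g u h. K_pair p n g h \<and> u \<in> spart p n ` slice}"
  proof (intro equalityI subsetI)
    fix z assume "z \<in> {s_part p q (g * u * h) | g h u. K_pair p n g h \<and> u \<in> slice}"
    then obtain g h u where z: "z = s_part p q (g * u * h)" "K_pair p n g h" "u \<in> slice" by blast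
    then show "z \<in> {g * u * h | g u h. K_pair p n g h \<and> u \<in> spart p n ` slice}"
      using part(2)[OF z(2,3)] by blast
  next
    fix z assume "z \<in> {g * u * h | g u h. K_pair p n g h \<and> u \<in> spart p n ` slice}"
    then obtain g h u where z: "z = g * spart p n u * h" "K_pair p n g h" "u \<in> slice" by blast
    then have "z = s_part p q (g * u * h)" using part(2)[OF z(2,3)] by simp
    then show "z \<in> {s_part p q (g * u * h) | g h u. K_pair p n g h \<and> u \<in> slice}" using z(2,3) by blast
  qed
  ultimately show "phi_k p q ` conormal_bundle p q r (orbit_of p q \<omega>) = {g * u * h | g u h. K_pair p n g h \<and> u \<in> kpart p n ` slice}"
    "phi_s p q ` conormal_bundle p q r (orbit_of p q \<omega>) = {g * u * h | g u h. K_pair p n g h \<and> u \<in> spart p n ` slice}"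
    by simp_all
qed

end

section \<open>The parametrization of the nilpotent orbits\<close>

lemma graded_part_eq: "V_plus p q = graded_part p (p + q) True" "V_minus p q = graded_part p (p + q) False"
proof -
  show "V_plus p q = graded_part p (p + q) True"
    unfolding V_plus_def graded_part_def hom_vec_def by (rule Collect_cong, rule conj_cong) (auto simp: not_less)
  have "(\<forall>i<p. v $ i = 0) \<longleftrightarrow> (\<forall>i<p + q. v $ i \<noteq> 0 \<longrightarrow> (i < p) = False)" for v :: "complex vec"
    by (metis trans_less_add1)
  then show "V_minus p q = graded_part p (p + q) False"
    unfolding V_minus_def graded_part_def hom_vec_def by (intro Collect_cong conj_cong) auto
qed

lemma
  fixes x :: "complex mat"
  assumes x: "x \<in> carrier_mat (p + q) (p + q)"
  shows even_blocks: "hom_mat p True x \<Longrightarrow>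
      x = four_block_mat (mat p p (\<lambda>(i, j). x $$ (i, j))) (0\<^sub>m p q) (0\<^sub>m q p) (mat q q (\<lambda>(i, j). x $$ (p + i, p + j)))"
    and odd_blocks: "hom_mat p False x \<Longrightarrow>
      x = four_block_mat (0\<^sub>m p p) (mat p q (\<lambda>(i, j). x $$ (i, p + j))) (mat q p (\<lambda>(i, j). x $$ (p + i, j))) (0\<^sub>m q q)"
  by (rule eq_matI; use x in \<open>auto simp: hom_mat_def\<close>)+

lemma N_k_eq: "N_k p q = hom_nilpotents p (p + q) True"
proof -
  have "x \<in> k_alg p q \<longleftrightarrow> x \<in> carrier_mat (p + q) (p + q) \<and> hom_mat p True x" for x
  proof
    assume "x \<in> k_alg p q"
    then obtain a d where "x = four_block_mat a (0\<^sub>m p q) (0\<^sub>m q p) d" "a \<in> carrier_mat p p" "d \<in> carrier_mat q q"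
      unfolding k_alg_def by blast
    moreover from this have "x \<in> carrier_mat (p + q) (p + q)" by simp
    ultimately show "x \<in> carrier_mat (p + q) (p + q) \<and> hom_mat p True x"
      unfolding hom_mat_def by (simp add: carrier_matD[of a p p] carrier_matD[of d q q])
  next
    assume "x \<in> carrier_mat (p + q) (p + q) \<and> hom_mat p True x"
    then have "x = four_block_mat (mat p p (\<lambda>(i, j). x $$ (i, j))) (0\<^sub>m p q) (0\<^sub>m q p) (mat q q (\<lambda>(i, j). x $$ (p + i, p + j)))"
      using even_blocks by blast
    then show "x \<in> k_alg p q" unfolding k_alg_def by (intro CollectI exI conjI) auto
  qed
  then show ?thesis unfolding N_k_def hom_nilpotents_def nilpotents_def by blast
qed

lemma N_s_eq: "N_s p q = hom_nilpotents p (p + q) False"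
proof -
  have "x \<in> s_alg p q \<longleftrightarrow> x \<in> carrier_mat (p + q) (p + q) \<and> hom_mat p False x" for x
  proof
    assume "x \<in> s_alg p q"
    then obtain b c where "x = four_block_mat (0\<^sub>m p p) b c (0\<^sub>m q q)" "b \<in> carrier_mat p q" "c \<in> carrier_mat q p"
      unfolding s_alg_def by blast
    moreover from this have "x \<in> carrier_mat (p + q) (p + q)" by auto
    ultimately show "x \<in> carrier_mat (p + q) (p + q) \<and> hom_mat p False x"
      unfolding hom_mat_def by (simp add: carrier_matD[of b p q] carrier_matD[of c q p])
  next
    assume "x \<in> carrier_mat (p + q) (p + q) \<and> hom_mat p False x"
    then have "x = four_block_mat (0\<^sub>m p p) (mat p q (\<lambda>(i, j). x $$ (i, p + j))) (mat q p (\<lambda>(i, j). x $$ (p + i, j))) (0\<^sub>m q q)"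
      using odd_blocks by blast
    then show "x \<in> s_alg p q" unfolding s_alg_def by (intro CollectI exI conjI) auto
  qed
  then show ?thesis unfolding N_s_def hom_nilpotents_def nilpotents_def by blast
qed

lemma orbit_s_eq: "orbit_s p q \<Lambda> = {x \<in> hom_nilpotents p (p + q) False. \<forall>k\<ge>1.
    signs_upto \<Lambda> k Plus = kdim p (p + q) x k True \<and> signs_upto \<Lambda> k Minus = kdim p (p + q) x k False}"
  unfolding orbit_s_def N_s_eq kdim_def graded_part_eq ..

lemma sum_shift_support:
  fixes f :: "nat \<Rightarrow> complex"
  assumes "a + m \<le> n" "\<And>l. l < n \<Longrightarrow> l \<notin> {a..<a + m} \<Longrightarrow> f l = 0"
  shows "(\<Sum>l<n. f l) = (\<Sum>i<m. f (a + i))"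
proof -
  have "(\<Sum>l<n. f l) = (\<Sum>l\<in>{a..<a + m}. f l)"
    by (rule sum.mono_neutral_right) (use assms in auto)
  also have "\<dots> = (\<Sum>i<m. f (a + i))"
    by (rule sum.reindex_bij_witness[of _ "\<lambda>i. a + i" "\<lambda>l. l - a"]) auto
  finally show ?thesis .
qed

lemma dual_frame_restrict:
  fixes W :: "complex vec set"
  defines "res \<equiv> \<lambda>m a (v :: complex vec). vec m (\<lambda>i. v $ (a + i))"
  assumes fr: "dual_frame n W T b \<beta>" and W: "W \<subseteq> coord_space n {a..<a + m}" and am: "a + m \<le> n"
  shows "dual_frame m (res m a ` W) T (\<lambda>t. res m a (b t)) (\<lambda>t. res m a (\<beta> t))"
proof -
  note f = fr[unfolded dual_frame_def]
  have Wc: "v \<in> carrier_vec n" "\<And>l. l < n \<Longrightarrow> l \<notin> {a..<a + m} \<Longrightarrow> v $ l = 0" if "v \<in> W" for v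
    using that W unfolding coord_space_def by blast+
  have pair: "res m a (\<beta> t) \<bullet> res m a v = \<beta> t \<bullet> v" if "t \<in> T" "v \<in> W" for t v
  proof -
    have "\<beta> t \<bullet> v = (\<Sum>i<m. \<beta> t $ (a + i) * v $ (a + i))"
      unfolding scalar_prod_sum[OF Wc(1)[OF that(2)]] by (rule sum_shift_support[OF am]) (simp add: Wc(2)[OF that(2)])
    then show ?thesis by (simp add: scalar_prod_sum[of _ m] res_def)
  qed
  show ?thesis
  proof (rule dual_frameI)
    show "res m a ` W \<subseteq> carrier_vec m" by (auto simp: res_def)
    have "res m a (0\<^sub>v n) = 0\<^sub>v m" using am by (auto simp: res_def)
    then show "0\<^sub>v m \<in> res m a ` W" using f by (metis image_eqI)
  next
    fix u v assume "u \<in> res m a ` W" "v \<in> res m a ` W"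
    then obtain u' v' where uv: "u' \<in> W" "v' \<in> W" "u = res m a u'" "v = res m a v'" by blast
    have "u + v = res m a (u' + v')"
      by (rule eq_vecI) (use am Wc(1)[OF uv(1)] Wc(1)[OF uv(2)] in \<open>simp_all add: uv(3,4) res_def\<close>)
    moreover have "u' + v' \<in> W" using f uv(1,2) by blast
    ultimately show "u + v \<in> res m a ` W" by blast
  next
    fix c v assume "v \<in> res m a ` W"
    then obtain v' where v: "v' \<in> W" "v = res m a v'" by blast
    have "c \<cdot>\<^sub>v v = res m a (c \<cdot>\<^sub>v v')"
      by (rule eq_vecI) (use am Wc(1)[OF v(1)] in \<open>simp_all add: v(2) res_def\<close>)
    moreover have "c \<cdot>\<^sub>v v' \<in> W" using f v(1) by blast
    ultimately show "c \<cdot>\<^sub>v v \<in> res m a ` W" by blast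
  next
    fix t t' assume t: "t \<in> T" "t' \<in> T"
    then have "b t' \<in> W" "\<beta> t \<bullet> b t' = (if t = t' then 1 else 0)" using f by blast+
    then show "res m a (\<beta> t) \<bullet> res m a (b t') = (if t = t' then 1 else 0)" using pair[OF t(1)] by simp
  next
    fix u i assume "u \<in> res m a ` W" and i: "i < m"
    then obtain v where v: "v \<in> W" "u = res m a v" by blast
    have "a + i < n" using i am by simp
    then have "v $ (a + i) = (\<Sum>t\<in>T. (\<beta> t \<bullet> v) * b t $ (a + i))" using f v(1) by blast
    then show "u $ i = (\<Sum>t\<in>T. (res m a (\<beta> t) \<bullet> u) * res m a (b t) $ i)"
      using i pair[OF _ v(1)] by (simp add: v(2)) (simp add: res_def)
  next
    fix t assume "t \<in> T"
    then have "b t \<in> W" using f by blast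
    then show "res m a (b t) \<in> res m a ` W" by blast
    show "res m a (\<beta> t) \<in> carrier_vec m" by (simp add: res_def)
  next
    show "finite T" using f by blast
  qed
qed

text \<open>\<open>kernel_dim\<close> belongs to a block of size \<open>m\<close>, the graded kernel
  to the full space of dimension \<open>n\<close>. Restricting coordinates to the block identifies
  the two kernels and carries the dual frame along.\<close>

lemma kernel_dim_block:
  assumes x: "x \<in> hom_nilpotents p n True" and y: "y \<in> carrier_mat m m" and am: "a + m \<le> n"
    and par: "\<And>i. i < n \<Longrightarrow> (i < p) = \<epsilon> \<longleftrightarrow> i \<in> {a..<a + m}"
    and blk: "\<And>i j. i < m \<Longrightarrow> j < m \<Longrightarrow> (x ^\<^sub>m k) $$ (a + i, a + j) = y $$ (i, j)"
  shows "kernel_dim y = kdim p n x k \<epsilon>"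
proof -
  obtain \<tau> b \<beta> where fr: "full_jordan_frame p n True x \<tau> b \<beta>" by (rule hom_nilpotent_frame[OF x])
  interpret full_jordan_frame p n True x \<tau> b \<beta> by (rule fr)
  let ?W = "graded_part p n \<epsilon> \<inter> mat_kernel (x ^\<^sub>m k)"
  let ?res = "\<lambda>v :: complex vec. vec m (\<lambda>i. v $ (a + i))"
  have xc: "x ^\<^sub>m k \<in> carrier_mat n n" by (rule pow_carrier)
  have memW: "v \<in> ?W \<longleftrightarrow> v \<in> carrier_vec n \<and> hom_vec p \<epsilon> v \<and> x ^\<^sub>m k *\<^sub>v v = 0\<^sub>v n" for v
    by (rule mem_kernel)
  have coord: "?W \<subseteq> coord_space n {a..<a + m}"
  proof
    fix v assume "v \<in> ?W"
    then have v: "v \<in> carrier_vec n" "hom_vec p \<epsilon> v" unfolding memW by blast+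
    have "v $ l = 0" if "l < n" "l \<notin> {a..<a + m}" for l
      using v par[OF that(1)] that unfolding hom_vec_def carrier_vecD[OF v(1)] by blast
    then show "v \<in> coord_space n {a..<a + m}" using v(1) unfolding coord_space_def by blast
  qed
  from dual_frame_dim(2)[OF dual_frame_restrict[OF dual_frame_kernel coord am]]
  have dim: "subspace_dim m (?res ` ?W) = card (kernel_boxes True \<tau> k \<epsilon>)" .
  have ker: "x ^\<^sub>m k *\<^sub>v v = 0\<^sub>v n \<longleftrightarrow> y *\<^sub>v ?res v = 0\<^sub>v m" if v: "v \<in> coord_space n {a..<a + m}" for v
  proof -
    have vc: "v \<in> carrier_vec n" "\<And>l. l < n \<Longrightarrow> l \<notin> {a..<a + m} \<Longrightarrow> v $ l = 0"
      using v unfolding coord_space_def by blast+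
    have sum: "(x ^\<^sub>m k *\<^sub>v v) $ l = (\<Sum>j<m. (x ^\<^sub>m k) $$ (l, a + j) * v $ (a + j))" if "l < n" for l
      unfolding mult_mat_vec_sum[OF xc vc(1) that] by (rule sum_shift_support[OF am]) (simp add: vc(2))
    have in_blk: "(x ^\<^sub>m k *\<^sub>v v) $ (a + i) = (y *\<^sub>v ?res v) $ i" if "i < m" for i
      using sum[of "a + i"] that am mult_mat_vec_sum[OF y _ that, of "?res v"] blk by simp
    have out_blk: "(x ^\<^sub>m k *\<^sub>v v) $ l = 0" if l: "l < n" "l \<notin> {a..<a + m}" for l
      unfolding sum[OF l(1)]
    proof (rule sum.neutral, intro ballI)
      fix j assume "j \<in> {..<m}"
      then have j: "a + j < n" "a + j \<in> {a..<a + m}" using am by auto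
      have "hom_mat p True (x ^\<^sub>m k)" using hom_mat_pow[OF hom_x local.x, of k] by simp
      then have "(x ^\<^sub>m k) $$ (l, a + j) \<noteq> 0 \<Longrightarrow> (l < p) = (a + j < p)"
        using l(1) j(1) unfolding hom_mat_def carrier_matD[OF xc] by blast
      then have "(x ^\<^sub>m k) $$ (l, a + j) = 0"
        using par[OF l(1)] par[OF j(1)] l(2) j(2) by blast
      then show "(x ^\<^sub>m k) $$ (l, a + j) * v $ (a + j) = 0" by simp
    qed
    show ?thesis
    proof
      assume 0: "x ^\<^sub>m k *\<^sub>v v = 0\<^sub>v n"
      show "y *\<^sub>v ?res v = 0\<^sub>v m"
        by (rule eq_vecI) (use in_blk 0 y am in \<open>auto simp del: index_mult_mat_vec\<close>)
    next
      assume 0: "y *\<^sub>v ?res v = 0\<^sub>v m"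
      show "x ^\<^sub>m k *\<^sub>v v = 0\<^sub>v n"
      proof (rule eq_vecI)
        fix l assume "l < dim_vec (0\<^sub>v n :: complex vec)"
        then have l: "l < n" by simp
        show "(x ^\<^sub>m k *\<^sub>v v) $ l = 0\<^sub>v n $ l"
        proof (cases "l \<in> {a..<a + m}")
          case True
          then have "l = a + (l - a)" "l - a < m" by auto
          then show ?thesis using in_blk[of "l - a"] 0 l by simp
        next
          case False
          then show ?thesis using out_blk[OF l] l by simp
        qed
      qed (simp only: dim_mult_mat_vec index_zero_vec(2) carrier_matD[OF xc])
    qed
  qed
  have "?res ` ?W = mat_kernel y"
  proof
    show "?res ` ?W \<subseteq> mat_kernel y"
    proof (rule image_subsetI)
      fix v assume v: "v \<in> ?W"
      then have "x ^\<^sub>m k *\<^sub>v v = 0\<^sub>v n" unfolding memW by blast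
      then have "y *\<^sub>v ?res v = 0\<^sub>v m" using ker[OF subsetD[OF coord v]] by simp
      then show "?res v \<in> mat_kernel y" unfolding mat_kernel[OF y] by simp
    qed
    show "mat_kernel y \<subseteq> ?res ` ?W"
    proof
      fix w assume "w \<in> mat_kernel y"
      then have w: "w \<in> carrier_vec m" "y *\<^sub>v w = 0\<^sub>v m" unfolding mat_kernel[OF y] by blast+
      define v where "v = vec n (\<lambda>l. if l \<in> {a..<a + m} then w $ (l - a) else 0)"
      have rv: "?res v = w" by (rule eq_vecI) (use w am in \<open>auto simp: v_def\<close>)
      have vc: "v \<in> coord_space n {a..<a + m}" by (auto simp: v_def coord_space_def)
      have "hom_vec p \<epsilon> v" unfolding hom_vec_def by (auto simp: v_def par split: if_splits)
      moreover have "v \<in> carrier_vec n" by (simp add: v_def)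
      ultimately have "v \<in> ?W" using ker[OF vc] w(2) rv unfolding memW by simp
      then show "w \<in> ?res ` ?W" using rv by blast
    qed
  qed
  moreover have "kernel_dim y = subspace_dim m (mat_kernel y)"
    using y unfolding kernel_dim_def subspace_dim_def by simp
  ultimately show ?thesis using dim kdim_frame[OF fr] by simp
qed

lemma four_block_diag_pow:
  fixes a d :: "complex mat"
  assumes "a \<in> carrier_mat p p" "d \<in> carrier_mat q q"
  shows "four_block_mat a (0\<^sub>m p q) (0\<^sub>m q p) d ^\<^sub>m k = four_block_mat (a ^\<^sub>m k) (0\<^sub>m p q) (0\<^sub>m q p) (d ^\<^sub>m k)"
proof (induction k)
  case 0
  then show ?case using assms by simp
next
  case (Suc k)
  have c: "a ^\<^sub>m k \<in> carrier_mat p p" "d ^\<^sub>m k \<in> carrier_mat q q" using assms by simp_all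
  show ?case unfolding pow_mat.simps Suc
      mult_four_block_mat[OF c(1) zero_carrier_mat zero_carrier_mat c(2) assms(1) zero_carrier_mat zero_carrier_mat assms(2)]
    using assms c mult_carrier_mat[OF c(1) assms(1)] mult_carrier_mat[OF c(2) assms(2)] by simp
qed

lemma orbit_k_eq: "orbit_k p q lam mu = {x \<in> hom_nilpotents p (p + q) True. \<forall>k\<ge>1.
    boxes_upto lam k = kdim p (p + q) x k True \<and> boxes_upto mu k = kdim p (p + q) x k False}"
proof -
  have ker: "kernel_dim (a ^\<^sub>m k) = kdim p (p + q) (four_block_mat a (0\<^sub>m p q) (0\<^sub>m q p) d) k True"
    "kernel_dim (d ^\<^sub>m k) = kdim p (p + q) (four_block_mat a (0\<^sub>m p q) (0\<^sub>m q p) d) k False"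
    if c: "a \<in> carrier_mat p p" "d \<in> carrier_mat q q"
      and x: "four_block_mat a (0\<^sub>m p q) (0\<^sub>m q p) d \<in> hom_nilpotents p (p + q) True" for a d k
  proof -
    have ck: "a ^\<^sub>m k \<in> carrier_mat p p" "d ^\<^sub>m k \<in> carrier_mat q q" using c by simp_all
    show "kernel_dim (a ^\<^sub>m k) = kdim p (p + q) (four_block_mat a (0\<^sub>m p q) (0\<^sub>m q p) d) k True"
      by (rule kernel_dim_block[OF x ck(1), of 0]) (use c in \<open>auto simp: four_block_diag_pow\<close>)
    show "kernel_dim (d ^\<^sub>m k) = kdim p (p + q) (four_block_mat a (0\<^sub>m p q) (0\<^sub>m q p) d) k False"
      by (rule kernel_dim_block[OF x ck(2), of p]) (use c in \<open>auto simp: four_block_diag_pow\<close>)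
  qed
  show ?thesis
  proof (intro equalityI subsetI)
    fix x assume "x \<in> orbit_k p q lam mu"
    then obtain a d where ad: "x = four_block_mat a (0\<^sub>m p q) (0\<^sub>m q p) d" "a \<in> carrier_mat p p" "d \<in> carrier_mat q q"
      "four_block_mat a (0\<^sub>m p q) (0\<^sub>m q p) d \<in> hom_nilpotents p (p + q) True"
      "\<forall>k\<ge>1. boxes_upto lam k = kernel_dim (a ^\<^sub>m k) \<and> boxes_upto mu k = kernel_dim (d ^\<^sub>m k)"
      unfolding orbit_k_def N_k_eq by blast
    then show "x \<in> {x \<in> hom_nilpotents p (p + q) True. \<forall>k\<ge>1.
      boxes_upto lam k = kdim p (p + q) x k True \<and> boxes_upto mu k = kdim p (p + q) x k False}"
      using ker[OF ad(2-4)] by simp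
  next
    fix x assume "x \<in> {x \<in> hom_nilpotents p (p + q) True. \<forall>k\<ge>1.
      boxes_upto lam k = kdim p (p + q) x k True \<and> boxes_upto mu k = kdim p (p + q) x k False}"
    then have x: "x \<in> hom_nilpotents p (p + q) True" and
      d: "\<forall>k\<ge>1. boxes_upto lam k = kdim p (p + q) x k True \<and> boxes_upto mu k = kdim p (p + q) x k False" by blast+
    have "x \<in> k_alg p q" using x unfolding N_k_eq[symmetric] N_k_def by blast
    then obtain a e where ad: "x = four_block_mat a (0\<^sub>m p q) (0\<^sub>m q p) e" "a \<in> carrier_mat p p" "e \<in> carrier_mat q q"
      unfolding k_alg_def by blast
    note x' = x[unfolded ad(1)]
    have "\<forall>k\<ge>1. boxes_upto lam k = kernel_dim (a ^\<^sub>m k) \<and> boxes_upto mu k = kernel_dim (e ^\<^sub>m k)"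
      using ker[OF ad(2,3) x'] d unfolding ad(1) by simp
    then show "x \<in> orbit_k p q lam mu" unfolding orbit_k_def N_k_eq using ad x' by blast
  qed
qed

section \<open>Signed Young diagrams\<close>

definition sign_of :: "bool \<Rightarrow> sign" where
  "sign_of b = (if b then Plus else Minus)"

text \<open>For an odd matrix the parities along a Jordan chain alternate, starting with the kernel
  vector in the first column; the row of signs records them.\<close>

definition sign_row :: "bool \<times> nat \<Rightarrow> sign list" where
  "sign_row t = map (\<lambda>a. sign_of (shift False a (fst t))) [0..<snd t]"

definition diagram :: "jordan_type \<Rightarrow> signed_diagram" where
  "diagram \<tau> = mset (map sign_row \<tau>)"

lemma sign_of_eq: "sign_of b = e \<longleftrightarrow> b = (e = Plus)"
  by (cases e) (auto simp: sign_of_def)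

lemma count_sign_row_Suc:
  "count_list (take (Suc c) (sign_row t)) e =
    count_list (take c (sign_row t)) e + (if c < snd t \<and> shift False c (fst t) = (e = Plus) then 1 else 0)"
proof (cases "c < snd t")
  case True
  then have "take (Suc c) (sign_row t) = take c (sign_row t) @ [sign_row t ! c]"
    by (intro take_Suc_conv_app_nth) (simp add: sign_row_def)
  moreover have "sign_row t ! c = sign_of (shift False c (fst t))" using True by (simp add: sign_row_def)
  ultimately show ?thesis using True by (simp add: sign_of_eq)
next
  case False
  then show ?thesis by (simp add: sign_row_def)
qed

text \<open>Consequently the sign counts of a diagram are the graded kernel dimensions of an odd
  nilpotent matrix of that type.\<close>

lemma signs_upto_diagram: "signs_upto (diagram \<tau>) m e = card (kernel_boxes False \<tau> m (e = Plus))"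
proof (induction m)
  case 0
  have "signs_upto (diagram \<tau>) 0 e = 0" by (simp add: signs_upto_def)
  then show ?case by (simp add: kernel_boxes_def)
next
  case (Suc c)
  have "signs_upto (diagram \<tau>) (Suc c) e =
      signs_upto (diagram \<tau>) c e + length (filter (\<lambda>t. c < snd t \<and> shift False c (fst t) = (e = Plus)) \<tau>)"
    unfolding signs_upto_def diagram_def by (induction \<tau>) (simp_all add: count_sign_row_Suc)
  then show ?case using Suc card_kernel_boxes_Suc[of False \<tau> c "e = Plus"] by simp
qed

lemma shift_False_Suc: "shift False (Suc a) s = (\<not> shift False a s)"
  by (simp add: shift_def)

lemma sign_row_alternating: "successively (\<noteq>) (sign_row t)"
  unfolding successively_conv_nth sign_row_def
  by (auto simp: sign_of_def shift_False_Suc)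

lemma alternating_row:
  assumes "successively (\<noteq>) \<rho>" "\<rho> \<noteq> []"
  shows "\<rho> = sign_row (hd \<rho> = Plus, length \<rho>)"
proof (rule nth_equalityI)
  fix a assume "a < length \<rho>"
  then have "\<rho> ! a = sign_of (shift False a (hd \<rho> = Plus))"
  proof (induction a)
    case 0
    then show ?case using assms(2) by (cases "hd \<rho>") (simp_all add: hd_conv_nth sign_of_def)
  next
    case (Suc a)
    have "\<rho> ! a \<noteq> \<rho> ! Suc a" using assms(1) Suc.prems by (simp add: successively_conv_nth)
    then show ?case using Suc shift_False_Suc by (cases "\<rho> ! Suc a") (auto simp: sign_of_def split: if_splits)
  qed
  then show "\<rho> ! a = sign_row (hd \<rho> = Plus, length \<rho>) ! a"
    using \<open>a < length \<rho>\<close> by (simp add: sign_row_def)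
qed (simp add: sign_row_def)

lemma signed_diagram_type:
  assumes "\<forall>\<rho>\<in>#\<Lambda>. \<rho> \<noteq> [] \<and> successively (\<noteq>) \<rho>"
  shows "\<exists>\<tau>. \<Lambda> = diagram \<tau> \<and> (\<forall>t\<in>set \<tau>. snd t > 0)"
proof -
  obtain rs where rs: "\<Lambda> = mset rs" by (metis ex_mset)
  let ?\<tau> = "map (\<lambda>\<rho>. (hd \<rho> = Plus, length \<rho>)) rs"
  have "map sign_row ?\<tau> = map (\<lambda>\<rho>. \<rho>) rs"
    unfolding map_map by (rule map_cong[OF refl]) (use assms alternating_row in \<open>simp add: rs\<close>)
  then show ?thesis using assms by (intro exI[of _ ?\<tau>]) (simp add: diagram_def rs)
qed

lemma signed_diagram_eqI:
  assumes "signed_young_diagram p q \<Lambda>" "signed_young_diagram p q \<Lambda>'"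
    and eq: "\<And>c e. c \<ge> 1 \<Longrightarrow> signs_upto \<Lambda> c e = signs_upto \<Lambda>' c e"
  shows "\<Lambda> = \<Lambda>'"
proof -
  obtain \<tau> \<tau>' where t: "\<Lambda> = diagram \<tau>" "\<forall>t\<in>set \<tau>. snd t > 0" "\<Lambda>' = diagram \<tau>'" "\<forall>t\<in>set \<tau>'. snd t > 0"
    using assms(1,2) signed_diagram_type unfolding signed_young_diagram_def by metis
  have "mset \<tau> = mset \<tau>'"
  proof (rule type_eqI)
    fix c \<epsilon>
    have "(sign_of \<epsilon> = Plus) = \<epsilon>" by (simp add: sign_of_def)
    then show "card (kernel_boxes False \<tau> (Suc c) \<epsilon>) = card (kernel_boxes False \<tau>' (Suc c) \<epsilon>)"
      using eq[of "Suc c" "sign_of \<epsilon>"] unfolding t signs_upto_diagram by simp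
  qed (use t in auto)
  then show ?thesis unfolding t diagram_def mset_map by simp
qed

lemma signed_diagram_of_frame:
  assumes fr: "full_jordan_frame p (p + q) False x \<tau> b \<beta>" and pos: "\<forall>t\<in>set \<tau>. snd t > 0"
  shows "signed_young_diagram p q (diagram \<tau>)"
proof -
  interpret full_jordan_frame p "p + q" False x \<tau> b \<beta> by (rule fr)
  \<comment> \<open>No row is longer than \<open>m\<close>, so the first \<open>m\<close> columns
    contain all boxes and their sign counts are the dimensions of the graded parts.\<close>
  define m where "m = sum_list (map snd \<tau>)"
  have le: "snd t \<le> m" if "t \<in> set \<tau>" for t
    unfolding m_def using that by (intro member_le_sum_list) auto
  have "snd \<kappa> < m" if "\<kappa> \<in> boxes \<tau>" for \<kappa>
  proof -
    have "snd \<kappa> < snd (\<tau> ! fst \<kappa>)" "\<tau> ! fst \<kappa> \<in> set \<tau>" using that by (auto simp: boxes_def)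
    then show ?thesis using le by fastforce
  qed
  then have "image_boxes False \<tau> m \<epsilon> = {}" for \<epsilon> unfolding image_boxes_def by force
  then have A: "signs_upto (diagram \<tau>) m e = card {i. i < p + q \<and> (i < p) = (e = Plus)}" for e
    using card_kernel_image_boxes[of m "e = Plus"] by (simp add: signs_upto_diagram)
  have B: "signs_upto (diagram \<tau>) m e = (\<Sum>\<rho>\<in>#diagram \<tau>. count_list \<rho> e)" for e
  proof -
    have "take m \<rho> = \<rho>" if "\<rho> \<in># diagram \<tau>" for \<rho>
      using that le by (auto simp: diagram_def sign_row_def)
    then show ?thesis unfolding signs_upto_def by (intro arg_cong[of _ _ sum_mset] image_mset_cong) simp
  qed
  have "{i. i < p + q \<and> (i < p) = (Plus = Plus)} = {..<p}" "{i. i < p + q \<and> (i < p) = (Minus = Plus)} = {p..<p + q}"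
    by auto
  then have "(\<Sum>\<rho>\<in>#diagram \<tau>. count_list \<rho> Plus) = p" "(\<Sum>\<rho>\<in>#diagram \<tau>. count_list \<rho> Minus) = q"
    using A[of Plus] A[of Minus] unfolding B by simp_all
  moreover have "\<rho> \<noteq> [] \<and> successively (\<noteq>) \<rho>" if "\<rho> \<in># diagram \<tau>" for \<rho>
    using that pos sign_row_alternating by (auto simp: diagram_def sign_row_def)
  ultimately show ?thesis unfolding signed_young_diagram_def by blast
qed

lemma graded_dim_eq: "graded_dim p (p + q) True = p" "graded_dim p (p + q) False = q"
proof -
  have "{i. i < p + q \<and> (i < p) = True} = {..<p}" "{i. i < p + q \<and> (i < p) = False} = {p..<p + q}" by auto
  then show "graded_dim p (p + q) True = p" "graded_dim p (p + q) False = q" by simp_all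
qed

context linear_slice
begin

lemma generic_orbit_k:
  assumes "n = p + q" "e = True"
    and R: "\<And>m. m \<ge> 1 \<Longrightarrow> boxes_upto lam m + R m True = p" "\<And>m. m \<ge> 1 \<Longrightarrow> boxes_upto mu m + R m False = q"
  shows "generic_orbit = orbit_k p q lam mu"
  unfolding generic_orbit_def unfolding orbit_k_eq assms(1,2)
proof (rule Collect_cong, rule conj_cong[OF refl], rule all_cong1, rule imp_cong[OF refl])
  fix x and m :: nat assume "1 \<le> m"
  then show "(\<forall>\<epsilon>. kdim p (p + q) x m \<epsilon> + R m \<epsilon> = graded_dim p (p + q) \<epsilon>) \<longleftrightarrow>
      boxes_upto lam m = kdim p (p + q) x m True \<and> boxes_upto mu m = kdim p (p + q) x m False"
    using R[of m] graded_dim_eq[of p q] by (auto simp: all_bool_eq)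
qed

text \<open>That a signed diagram with these counts exists is not evident from the combinatorics of
  the shapes; it is the diagram of a Jordan frame of a generic element.\<close>

lemma generic_orbit_s:
  assumes n: "n = p + q" and e: "e = False"
  shows "\<exists>\<Lambda>. signed_young_diagram p q \<Lambda> \<and> generic_orbit = orbit_s p q \<Lambda> \<and>
    (\<forall>m\<ge>1. signs_upto \<Lambda> m Plus + R m True = p \<and> signs_upto \<Lambda> m Minus + R m False = q)"
proof -
  obtain u where u: "u \<in> generic_orbit" using generic_element[OF poly_on_const[of n 1]] D_nonempty by auto
  have un: "u \<in> hom_nilpotents p (p + q) False" using u unfolding generic_orbit_def unfolding n e by blast
  obtain \<tau> b \<beta> where fr: "full_jordan_frame p (p + q) False u \<tau> b \<beta>" "\<forall>t\<in>set \<tau>. snd t > 0"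
    using hom_nilpotent_frame[OF un] by blast
  have kd: "signs_upto (diagram \<tau>) m Plus = kdim p (p + q) u m True" "signs_upto (diagram \<tau>) m Minus = kdim p (p + q) u m False" for m
    unfolding signs_upto_diagram kdim_frame[OF fr(1)] by simp_all
  have R: "signs_upto (diagram \<tau>) m Plus + R m True = p \<and> signs_upto (diagram \<tau>) m Minus + R m False = q" if "m \<ge> 1" for m
  proof -
    have "\<forall>\<epsilon>. kdim p (p + q) u m \<epsilon> + R m \<epsilon> = graded_dim p (p + q) \<epsilon>"
      using u that unfolding generic_orbit_def unfolding n by blast
    from this[rule_format, of True] this[rule_format, of False] show ?thesis unfolding kd graded_dim_eq by simp
  qed
  have "generic_orbit = orbit_s p q (diagram \<tau>)"
    unfolding generic_orbit_def unfolding orbit_s_eq n e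
  proof (rule Collect_cong, rule conj_cong[OF refl], rule all_cong1, rule imp_cong[OF refl])
    fix x and m :: nat assume "1 \<le> m"
    then show "(\<forall>\<epsilon>. kdim p (p + q) x m \<epsilon> + R m \<epsilon> = graded_dim p (p + q) \<epsilon>) \<longleftrightarrow>
        signs_upto (diagram \<tau>) m Plus = kdim p (p + q) x m True \<and> signs_upto (diagram \<tau>) m Minus = kdim p (p + q) x m False"
      using R[of m] graded_dim_eq[of p q] by (auto simp: all_bool_eq)
  qed
  then show ?thesis using signed_diagram_of_frame[OF fr] R by blast
qed

end

section \<open>The posets of the two-line arrays\<close>

lemma the_map_of_zip:
  assumes "distinct xs" "length xs = length ys" "k < length xs"
  shows "the (map_of (zip xs ys) (xs ! k)) = ys ! k"
  using map_of_zip_nth[OF assms(2,1)] assms(2,3) by simp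

text \<open>The entry \<open>ys ! k\<close> is the point of the poset that stands for column
  \<open>k\<close> of the array.\<close>

lemma greene_poset_two_line:
  assumes upper: "distinct upper" "set upper = S" and lower: "distinct lower" "length lower = length upper"
    and ys: "distinct ys" "set ys = Y" "length ys = length upper"
    and pr: "\<And>k k'. k < length ys \<Longrightarrow> k' < length ys \<Longrightarrow>
      pr (ys ! k) (ys ! k') \<longleftrightarrow> upper ! k < upper ! k' \<and> lower ! k < lower ! k'"
  shows "greene_poset Y pr (shape (RS1 S (two_line upper lower)))"
proof -
  define lab where "lab = (\<lambda>y. the (map_of (zip ys upper) y))"
  have lab: "lab (ys ! k) = upper ! k" if "k < length ys" for k
    unfolding lab_def by (rule the_map_of_zip[OF ys(1,3) that])
  have w: "two_line upper lower (upper ! k) = lower ! k" if "k < length ys" for k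
    unfolding two_line_def by (rule the_map_of_zip[OF upper(1) lower(2)[symmetric]]) (use that ys in simp)
  show ?thesis
  proof (rule greene_poset_RS)
    show "bij_betw lab Y S" unfolding bij_betw_def
    proof
      show "inj_on lab Y"
      proof (rule inj_onI)
        fix a b assume ab: "a \<in> Y" "b \<in> Y" "lab a = lab b"
        then obtain k k' where k: "k < length ys" "a = ys ! k" "k' < length ys" "b = ys ! k'"
          using ys(2) by (metis in_set_conv_nth)
        then have "k = k'" using ab(3) lab upper(1) ys(3) by (simp add: nth_eq_iff_index_eq)
        then show "a = b" using k by simp
      qed
      have "lab ` Y = (\<lambda>k. upper ! k) ` {..<length ys}"
        unfolding ys(2)[symmetric] set_conv_nth using lab by force
      also have "\<dots> = S" unfolding upper(2)[symmetric] ys(3) set_conv_nth by auto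
      finally show "lab ` Y = S" .
    qed
    show "finite S" using upper(2) by auto
    show "inj_on (two_line upper lower) S"
    proof (rule inj_onI)
      fix a b assume ab: "a \<in> S" "b \<in> S" "two_line upper lower a = two_line upper lower b"
      then obtain k k' where k: "k < length ys" "a = upper ! k" "k' < length ys" "b = upper ! k'"
        using upper(2) ys(3) by (metis in_set_conv_nth)
      then have "k = k'" using ab(3) w lower ys(3) by (simp add: nth_eq_iff_index_eq)
      then show "a = b" using k by simp
    qed
    fix a b assume "a \<in> Y" "b \<in> Y"
    then obtain k k' where k: "k < length ys" "a = ys ! k" "k' < length ys" "b = ys ! k'"
      using ys(2) by (metis in_set_conv_nth)
    then show "pr a b \<longleftrightarrow> lab a < lab b \<and> two_line upper lower (lab a) < two_line upper lower (lab b)"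
      using pr lab w by simp
  qed
qed

lemma nth_append3:
  "k < length (xs @ ys @ zs) \<Longrightarrow>
    k < length xs \<and> (xs @ ys @ zs) ! k = xs ! k \<or>
    (\<exists>i<length ys. k = length xs + i \<and> (xs @ ys @ zs) ! k = ys ! i) \<or>
    (\<exists>i<length zs. k = length xs + length ys + i \<and> (xs @ ys @ zs) ! k = zs ! i)"
proof -
  assume k: "k < length (xs @ ys @ zs)"
  consider "k < length xs" | "length xs \<le> k" "k - length xs < length ys" | "length xs + length ys \<le> k" by linarith
  then show ?thesis
  proof cases
    case 1
    then show ?thesis by (simp add: nth_append)
  next
    case 2
    then show ?thesis by (intro disjI2 disjI1 exI[of _ "k - length xs"]) (simp add: nth_append)
  next
    case 3
    then show ?thesis using k by (intro disjI2 exI[of _ "k - length xs - length ys"]) (auto simp: nth_append)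
  qed
qed

lemma incr_nth_less:
  assumes "finite A" "i < card A" "j < card A"
  shows "incr A ! i < incr A ! j \<longleftrightarrow> i < j"
proof -
  have s: "sorted_wrt (<) (incr A)" by (rule strict_sorted_list_of_set)
  have len: "length (incr A) = card A" by simp
  show ?thesis
    using sorted_wrt_nth_less[OF s, of i j] sorted_wrt_nth_less[OF s, of j i] assms len
    by (metis linorder_less_linear not_less_iff_gr_or_eq)
qed

lemma rev_incr_nth_less:
  assumes "finite A" "i < card A" "j < card A"
  shows "rev (incr A) ! i < rev (incr A) ! j \<longleftrightarrow> j < i"
proof -
  have "rev (incr A) ! l = incr A ! (card A - Suc l)" if "l < card A" for l
    using that by (simp add: rev_nth)
  then show ?thesis using incr_nth_less[of A "card A - Suc i" "card A - Suc j"] assms by auto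
qed

lemma incr_nth_mem:
  assumes "finite A" "i < card A"
  shows "incr A ! i \<in> A" "rev (incr A) ! i \<in> A"
proof -
  have "incr A ! i \<in> set (incr A)" using assms by (intro nth_mem) simp
  then show "incr A ! i \<in> A" using assms by simp
  have "rev (incr A) ! i \<in> set (rev (incr A))" using assms by (intro nth_mem) simp
  then show "rev (incr A) ! i \<in> A" using assms by simp
qed

context matching_data
begin

text \<open>\<open>z\<close> and \<open>z'\<close> translate labels into indices. The reversed lists
  make \<open>L\<close> and \<open>L'\<close> antichains; their places at the two ends leave
  comparisons with the middle to the lower entries; and in the middle the positions order the
  indices of \<open>J\<close>, while the lower entries order their partners in
  \<open>I\<close>.\<close>

lemma greene_two_line_k:
  assumes z: "strict_mono_on {1..N} z" and zJ: "strict_mono_on Js z'"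
    and sets: "Ls \<union> Is \<union> Ls' = {1..N}" "finite Js"
    and parts: "L = z ` Ls" "I = z ` Is" "L' = z ` Ls'"
    and sg: "bij_betw sg Js Is" "\<And>j. j \<in> Js \<Longrightarrow> mate (z (sg j)) = z' j"
  shows "greene_poset A pr_k (shape (RS1 {1..int N} (two_line (map int [1..<N + 1])
    (map int (rev (incr Ls) @ map sg (incr Js) @ rev (incr Ls'))))))"
proof -
  let ?low = "rev (incr Ls) @ map sg (incr Js) @ rev (incr Ls')"
  let ?ys = "map z ?low"
  have fin: "finite Ls" "finite Is" "finite Ls'" using sets(1) finite_subset[of _ "{1..N}"] by auto
  have zless: "z a < z b \<longleftrightarrow> a < b" if "a \<in> {1..N}" "b \<in> {1..N}" for a b
    using z that by (metis strict_mono_on_def linorder_neqE_nat order_less_asym)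
  have zeq: "z a = z b \<longleftrightarrow> a = b" if "a \<in> {1..N}" "b \<in> {1..N}" for a b
    using zless[OF that] zless[OF that(2,1)] by (metis linorder_neqE_nat order_less_irrefl)
  have z'less: "z' a < z' b \<longleftrightarrow> a < b" if "a \<in> Js" "b \<in> Js" for a b
    using zJ that by (metis strict_mono_on_def linorder_neqE_nat order_less_asym)
  have sgI: "sg ` Js = Is" "inj_on sg Js" using sg(1) by (auto simp: bij_betw_def)
  have setlow: "set ?low = Ls \<union> Is \<union> Ls'" using fin sets sgI by auto
  have injz: "inj_on z {1..N}" using zeq by (auto simp: inj_on_def)
  have disj: "Ls \<inter> Is = {}" "Ls \<inter> Ls' = {}" "Is \<inter> Ls' = {}"
    using A_split(2-4) parts by auto
  have dlow: "distinct ?low" using fin sets disj sgI by (auto simp: distinct_map)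
  have setys: "set ?ys = A" unfolding set_map setlow A_split(1) parts by blast
  have dys: "distinct ?ys" unfolding distinct_map setlow using dlow injz sets(1) by simp
  have len: "length ?low = N"
    using distinct_card[OF dlow] unfolding setlow sets(1) by simp
  have cl: "length (rev (incr Ls)) = card Ls" "length (map sg (incr Js)) = card Js" "length (rev (incr Ls')) = card Ls'"
    by simp_all
  have seg: "(\<exists>i<card Ls. k = i \<and> ?low ! k = rev (incr Ls) ! i) \<or>
      (\<exists>i<card Js. k = card Ls + i \<and> ?low ! k = sg (incr Js ! i)) \<or>
      (\<exists>i<card Ls'. k = card Ls + card Js + i \<and> ?low ! k = rev (incr Ls') ! i)" if "k < N" for k
    using nth_append3[of k "rev (incr Ls)" "map sg (incr Js)" "rev (incr Ls')"] that
    unfolding len cl by (auto simp del: rev_map)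
  note rl = rev_incr_nth_less and nm = incr_nth_mem
  have mL: "z x \<in> L \<and> z x \<notin> I \<and> z x \<notin> L' \<and> x \<in> {1..N}" if "x \<in> Ls" for x
    using that parts A_split sets(1) by blast
  have mL': "z x \<notin> L \<and> z x \<notin> I \<and> z x \<in> L' \<and> x \<in> {1..N}" if "x \<in> Ls'" for x
    using that parts A_split sets(1) by blast
  have mI: "z (sg j) \<notin> L \<and> z (sg j) \<in> I \<and> z (sg j) \<notin> L' \<and> sg j \<in> {1..N}" if "j \<in> Js" for j
  proof -
    have "sg j \<in> Is" using that sgI by blast
    then show ?thesis using parts A_split sets(1) by blast
  qed
  have lowmem: "?low ! k \<in> {1..N}" if "k < N" for k
  proof -
    have "?low ! k \<in> set ?low" by (rule nth_mem) (use that len in simp)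
    then show ?thesis unfolding setlow sets(1) .
  qed
  have prk: "pr_k (z x) (z y) \<longleftrightarrow> (z x \<in> L \<or> z x \<in> I) \<and> (z y \<in> I \<or> z y \<in> L') \<and> x < y \<and>
      (z x \<in> I \<longrightarrow> z y \<in> I \<longrightarrow> mate (z x) < mate (z y))" if "x \<in> {1..N}" "y \<in> {1..N}" for x y
    unfolding pr_k_def zless[OF that] by blast
  have main: "pr_k (z (?low ! k)) (z (?low ! k')) \<longleftrightarrow> k < k' \<and> ?low ! k < ?low ! k'" if kk: "k < N" "k' < N" for k k'
  proof -
    note pk = prk[OF lowmem[OF kk(1)] lowmem[OF kk(2)]]
    from seg[OF kk(1)] show ?thesis
  proof (elim disjE exE conjE)
    fix i assume 1: "i < card Ls" "k = i" "?low ! k = rev (incr Ls) ! i"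
    note m1 = mL[OF nm(2)[OF fin(1) 1(1)]]
    from seg[OF kk(2)] show ?thesis
    proof (elim disjE exE conjE)
      fix i' assume 2: "i' < card Ls" "k' = i'" "?low ! k' = rev (incr Ls) ! i'"
      show ?thesis unfolding pk unfolding 1(3) 2(3) unfolding 1(2) 2(2) using m1 mL[OF nm(2)[OF fin(1) 2(1)]] 1(1) 2(1) rl[OF fin(1) 1(1) 2(1)] by auto
    next
      fix i' assume 2: "i' < card Js" "k' = card Ls + i'" "?low ! k' = sg (incr Js ! i')"
      show ?thesis unfolding pk unfolding 1(3) 2(3) unfolding 1(2) 2(2) using m1 mI[OF nm(1)[OF sets(2) 2(1)]] 1(1) 2(1) by auto
    next
      fix i' assume 2: "i' < card Ls'" "k' = card Ls + card Js + i'" "?low ! k' = rev (incr Ls') ! i'"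
      show ?thesis unfolding pk unfolding 1(3) 2(3) unfolding 1(2) 2(2) using m1 mL'[OF nm(2)[OF fin(3) 2(1)]] 1(1) 2(1) by auto
    qed
  next
    fix i assume 1: "i < card Js" "k = card Ls + i" "?low ! k = sg (incr Js ! i)"
    note m1 = mI[OF nm(1)[OF sets(2) 1(1)]]
    from seg[OF kk(2)] show ?thesis
    proof (elim disjE exE conjE)
      fix i' assume 2: "i' < card Ls" "k' = i'" "?low ! k' = rev (incr Ls) ! i'"
      show ?thesis unfolding pk unfolding 1(3) 2(3) unfolding 1(2) 2(2) using m1 mL[OF nm(2)[OF fin(1) 2(1)]] 1(1) 2(1) by auto
    next
      fix i' assume 2: "i' < card Js" "k' = card Ls + i'" "?low ! k' = sg (incr Js ! i')"
      have jj: "mate (z (sg (incr Js ! i))) < mate (z (sg (incr Js ! i'))) \<longleftrightarrow> i < i'"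
        unfolding sg(2)[OF nm(1)[OF sets(2) 1(1)]] sg(2)[OF nm(1)[OF sets(2) 2(1)]] z'less[OF nm(1)[OF sets(2) 1(1)] nm(1)[OF sets(2) 2(1)]]
        by (rule incr_nth_less[OF sets(2) 1(1) 2(1)])
      show ?thesis unfolding pk unfolding 1(3) 2(3) unfolding 1(2) 2(2) using m1 mI[OF nm(1)[OF sets(2) 2(1)]] 1(1) 2(1) jj by auto
    next
      fix i' assume 2: "i' < card Ls'" "k' = card Ls + card Js + i'" "?low ! k' = rev (incr Ls') ! i'"
      show ?thesis unfolding pk unfolding 1(3) 2(3) unfolding 1(2) 2(2) using m1 mL'[OF nm(2)[OF fin(3) 2(1)]] 1(1) 2(1) by auto
    qed
  next
    fix i assume 1: "i < card Ls'" "k = card Ls + card Js + i" "?low ! k = rev (incr Ls') ! i"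
    note m1 = mL'[OF nm(2)[OF fin(3) 1(1)]]
    from seg[OF kk(2)] show ?thesis
    proof (elim disjE exE conjE)
      fix i' assume 2: "i' < card Ls" "k' = i'" "?low ! k' = rev (incr Ls) ! i'"
      show ?thesis unfolding pk unfolding 1(3) 2(3) unfolding 1(2) 2(2) using m1 mL[OF nm(2)[OF fin(1) 2(1)]] 1(1) 2(1) by auto
    next
      fix i' assume 2: "i' < card Js" "k' = card Ls + i'" "?low ! k' = sg (incr Js ! i')"
      show ?thesis unfolding pk unfolding 1(3) 2(3) unfolding 1(2) 2(2) using m1 mI[OF nm(1)[OF sets(2) 2(1)]] 1(1) 2(1) by auto
    next
      fix i' assume 2: "i' < card Ls'" "k' = card Ls + card Js + i'" "?low ! k' = rev (incr Ls') ! i'"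
      show ?thesis unfolding pk unfolding 1(3) 2(3) unfolding 1(2) 2(2) using m1 mL'[OF nm(2)[OF fin(3) 2(1)]] 1(1) 2(1) rl[OF fin(3) 1(1) 2(1)] by auto
    qed
  qed
  qed
  show ?thesis
  proof (rule greene_poset_two_line)
    show "distinct (map int [1..<N + 1])" by (simp add: distinct_map del: upt_Suc)
    show "set (map int [1..<N + 1]) = {1..int N}"
      by (simp add: image_int_atLeastAtMost atLeastLessThanSuc_atLeastAtMost del: upt_Suc)
    show "distinct (map int ?low)" using dlow unfolding distinct_map by (simp add: inj_on_def)
    show "length (map int ?low) = length (map int [1..<N + 1])" "length ?ys = length (map int [1..<N + 1])"
      using len by (simp_all only: length_map length_upt add_diff_cancel_right')
    fix k k' assume "k < length ?ys" "k' < length ?ys"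
    then have kk: "k < N" "k' < N" using len by (simp_all only: length_map)
    have y: "?ys ! l = z (?low ! l)" "map int ?low ! l = int (?low ! l)" "map int [1..<N + 1] ! l = int (Suc l)" if "l < N" for l
    proof -
      show "?ys ! l = z (?low ! l)" "map int ?low ! l = int (?low ! l)" by (rule nth_map, use that len in simp)+
      show "map int [1..<N + 1] ! l = int (Suc l)" using that by (simp del: upt_Suc)
    qed
    show "pr_k (?ys ! k) (?ys ! k') \<longleftrightarrow> map int [1..<N + 1] ! k < map int [1..<N + 1] ! k' \<and> map int ?low ! k < map int ?low ! k'"
      unfolding y[OF kk(1)] y[OF kk(2)] using main[OF kk] by simp
  qed (rule dys setys)+
qed

text \<open>The upper line carries the coordinates of \<open>J\<close> and \<open>M\<close>, the
  lower line those of \<open>I\<close> and \<open>L'\<close>, and artificial entries fill the gaps.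
  The values \<open>-1, -2, ...\<close> under \<open>M\<close> lie below all others and decrease, so
  \<open>M\<close> is an antichain compared with the rest by the upper line alone. The positions
  above \<open>N\<close> do the same for \<open>L'\<close> from the other side, where the reversed
  list makes it an antichain.\<close>

lemma greene_two_line_s:
  assumes z: "strict_mono_on (Is \<union> Ls') z" and zJ: "strict_mono_on (Js \<union> Ms) z'"
    and sets: "finite Ls'" "Js \<union> Ms \<subseteq> {1..N}"
    and parts: "M = z' ` Ms" "J = z' ` Js" "L' = z ` Ls'"
    and sg: "bij_betw sg Js Is" "\<And>j. j \<in> Js \<Longrightarrow> mate (z' j) = z (sg j)" "Is \<inter> Ls' = {}"
  shows "greene_poset Y_s pr_s (shape (RS1 (int ` (Js \<union> Ms \<union> {N + 1..N + card Ls'})) (two_line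
    (map int (incr Ms @ incr Js @ [N + 1..<N + card Ls' + 1]))
    (map (\<lambda>i. - int i) [1..<card Ms + 1] @ map int (map sg (incr Js) @ rev (incr Ls'))))))"
proof -
  let ?up = "incr Ms @ incr Js @ [N + 1..<N + card Ls' + 1]"
  let ?low = "map (\<lambda>i. - int i) [1..<card Ms + 1] @ map (\<lambda>j. int (sg j)) (incr Js) @ map int (rev (incr Ls'))"
  let ?ys = "map z' (incr Ms) @ map z' (incr Js) @ map z (rev (incr Ls'))"
  have fin: "finite Js" "finite Ms" "finite Ls'" using sets finite_subset[of _ "{1..N}"] by auto
  have zless: "z a < z b \<longleftrightarrow> a < b" if "a \<in> Is \<union> Ls'" "b \<in> Is \<union> Ls'" for a b
    using z that by (metis strict_mono_on_def linorder_neqE_nat order_less_asym)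
  have z'less: "z' a < z' b \<longleftrightarrow> a < b" if "a \<in> Js \<union> Ms" "b \<in> Js \<union> Ms" for a b
    using zJ that by (metis strict_mono_on_def linorder_neqE_nat order_less_asym)
  have inj: "inj_on z Ls'" "inj_on z' (Js \<union> Ms)"
    using strict_mono_on_imp_inj_on[OF z] strict_mono_on_imp_inj_on[OF zJ] by (auto intro: inj_on_subset)
  have sgI: "sg ` Js = Is" "inj_on sg Js" using sg(1) by (auto simp: bij_betw_def)
  have JM: "Js \<inter> Ms = {}" using B_split(2) parts by auto
  have setys: "set ?ys = Y_s" using fin unfolding Y_s_def by (auto simp: parts(1)[symmetric] parts(2)[symmetric] parts(3)[symmetric])
  have dys: "distinct ?ys"
  proof -
    have "inj_on z' Ms" "inj_on z' Js" using inj(2) by (auto intro: inj_on_subset)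
    moreover have "z' ` Ms \<inter> z' ` Js = {}" "z' ` Ms \<inter> z ` Ls' = {}" "z' ` Js \<inter> z ` Ls' = {}"
      using B_split(2) disjoint_parts parts by blast+
    ultimately show ?thesis using fin inj(1) by (simp add: distinct_map) blast
  qed
  have seg: "(\<exists>i<card Ms. ?ys ! k = z' (incr Ms ! i) \<and> ?up ! k = incr Ms ! i \<and> ?low ! k = - int (Suc i)) \<or>
      (\<exists>i<card Js. ?ys ! k = z' (incr Js ! i) \<and> ?up ! k = incr Js ! i \<and> ?low ! k = int (sg (incr Js ! i))) \<or>
      (\<exists>i<card Ls'. ?ys ! k = z (rev (incr Ls') ! i) \<and> ?up ! k = N + Suc i \<and> ?low ! k = int (rev (incr Ls') ! i))"
    if k: "k < length ?ys" for k
  proof -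
    consider "k < card Ms" | "card Ms \<le> k" "k - card Ms < card Js" | "card Ms + card Js \<le> k" by linarith
    then show ?thesis
    proof cases
      case 1
      then show ?thesis by (intro disjI1 exI[of _ k]) (simp add: nth_append del: upt_Suc)
    next
      case 2
      then show ?thesis by (intro disjI2 disjI1 exI[of _ "k - card Ms"]) (simp add: nth_append del: upt_Suc)
    next
      case 3
      then have "k - card Ms - card Js < card Ls'" "\<not> k < card Ms" "\<not> k - card Ms < card Js" using k by auto
      then show ?thesis
        by (intro disjI2 exI[of _ "k - card Ms - card Js"]) (simp add: nth_append del: upt_Suc)
    qed
  qed
  have len: "length ?up = length ?ys" "length ?low = length ?ys" by simp_all
  have dup: "distinct ?up" using JM sets fin by auto
  have upset: "set ?up = Js \<union> Ms \<union> {N + 1..N + card Ls'}" using fin by auto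
  have dlow: "distinct ?low"
  proof -
    have "inj_on (\<lambda>j. int (sg j)) Js" using sgI(2) unfolding inj_on_def by simp
    then have d: "distinct (map (\<lambda>i. - int i) [1..<card Ms + 1])" "distinct (map (\<lambda>j. int (sg j)) (incr Js))"
      "distinct (map int (rev (incr Ls')))"
      using fin by (simp_all add: distinct_map inj_on_def del: upt_Suc)
    have s: "set (map (\<lambda>i. - int i) [1..<card Ms + 1]) \<subseteq> {..<0}"
      "set (map (\<lambda>j. int (sg j)) (incr Js)) = int ` Is" "set (map int (rev (incr Ls'))) = int ` Ls'"
      unfolding sgI(1)[symmetric] using fin by (auto simp: image_image simp del: upt_Suc)
    have neg: "int ` X \<inter> {..<0} = {}" for X by auto
    have "set (map (\<lambda>j. int (sg j)) (incr Js)) \<inter> set (map int (rev (incr Ls'))) = {}"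
      unfolding s(2,3) using sg(3) by auto
    moreover have "set (map (\<lambda>i. - int i) [1..<card Ms + 1]) \<inter>
        (set (map (\<lambda>j. int (sg j)) (incr Js)) \<union> set (map int (rev (incr Ls')))) = {}"
      unfolding s(2,3) using s(1) neg[of Is] neg[of Ls'] by blast
    ultimately show ?thesis unfolding distinct_append set_append using d by (intro conjI)
  qed
  note nm = incr_nth_mem
  have sgm: "sg j \<in> Is" if "j \<in> Js" for j using that sgI by blast
  have mM: "z' x \<in> M \<and> z' x \<notin> J \<and> z' x \<notin> L' \<and> 1 \<le> x \<and> x \<le> N" if "x \<in> Ms" for x
  proof -
    have "z' x \<in> M" "x \<in> {1..N}" using that parts(1) sets(2) by blast+
    then show ?thesis using B_split(2) disjoint_parts(4) by auto
  qed
  have mJ: "z' x \<notin> M \<and> z' x \<in> J \<and> z' x \<notin> L' \<and> 1 \<le> x \<and> x \<le> N \<and> mate (z' x) = z (sg x)" if "x \<in> Js" for x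
  proof -
    have "z' x \<in> J" "x \<in> {1..N}" using that parts(2) sets(2) by blast+
    then show ?thesis using B_split(2) disjoint_parts(3) sg(2)[OF that] by auto
  qed
  have mL: "z x \<notin> M \<and> z x \<notin> J \<and> z x \<in> L'" if "x \<in> Ls'" for x
  proof -
    have "z x \<in> L'" using that parts(3) by blast
    then show ?thesis using disjoint_parts(3,4) by auto
  qed
  have main: "pr_s (?ys ! k) (?ys ! k') \<longleftrightarrow> ?up ! k < ?up ! k' \<and> ?low ! k < ?low ! k'" if kk: "k < length ?ys" "k' < length ?ys" for k k'
    using seg[OF kk(1)]
  proof (elim disjE exE conjE)
    fix i assume 1: "i < card Ms" "?ys ! k = z' (incr Ms ! i)" "?up ! k = incr Ms ! i" "?low ! k = - int (Suc i)"
    note m1 = mM[OF nm(1)[OF fin(2) 1(1)]]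
    note j1 = nm(1)[OF fin(2) 1(1)]
    from seg[OF kk(2)] show ?thesis
    proof (elim disjE exE conjE)
      fix i' assume 2: "i' < card Ms" "?ys ! k' = z' (incr Ms ! i')" "?up ! k' = incr Ms ! i'" "?low ! k' = - int (Suc i')"
      show ?thesis unfolding 1(2-4) 2(2-4) pr_s_def using m1 mM[OF nm(1)[OF fin(2) 2(1)]] incr_nth_less[OF fin(2) 1(1) 2(1)] by auto
      next
      fix i' assume 2: "i' < card Js" "?ys ! k' = z' (incr Js ! i')" "?up ! k' = incr Js ! i'" "?low ! k' = int (sg (incr Js ! i'))"
      show ?thesis unfolding 1(2-4) 2(2-4) pr_s_def using m1 mJ[OF nm(1)[OF fin(1) 2(1)]] z'less[OF UnI2[OF j1] UnI1[OF nm(1)[OF fin(1) 2(1)]]] by auto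
      next
      fix i' assume 2: "i' < card Ls'" "?ys ! k' = z (rev (incr Ls') ! i')" "?up ! k' = N + Suc i'" "?low ! k' = int (rev (incr Ls') ! i')"
      show ?thesis unfolding 1(2-4) 2(2-4) pr_s_def using m1 mL[OF nm(2)[OF fin(3) 2(1)]]  by auto
    qed
  next
    fix i assume 1: "i < card Js" "?ys ! k = z' (incr Js ! i)" "?up ! k = incr Js ! i" "?low ! k = int (sg (incr Js ! i))"
    note m1 = mJ[OF nm(1)[OF fin(1) 1(1)]]
    note j1 = nm(1)[OF fin(1) 1(1)]
    from seg[OF kk(2)] show ?thesis
    proof (elim disjE exE conjE)
      fix i' assume 2: "i' < card Ms" "?ys ! k' = z' (incr Ms ! i')" "?up ! k' = incr Ms ! i'" "?low ! k' = - int (Suc i')"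
      show ?thesis unfolding 1(2-4) 2(2-4) pr_s_def using m1 mM[OF nm(1)[OF fin(2) 2(1)]]  by auto
      next
      fix i' assume 2: "i' < card Js" "?ys ! k' = z' (incr Js ! i')" "?up ! k' = incr Js ! i'" "?low ! k' = int (sg (incr Js ! i'))"
      show ?thesis unfolding 1(2-4) 2(2-4) pr_s_def using m1 mJ[OF nm(1)[OF fin(1) 2(1)]] z'less[OF UnI1[OF j1] UnI1[OF nm(1)[OF fin(1) 2(1)]]] zless[OF UnI1[OF sgm[OF j1]] UnI1[OF sgm[OF nm(1)[OF fin(1) 2(1)]]]] by auto
      next
      fix i' assume 2: "i' < card Ls'" "?ys ! k' = z (rev (incr Ls') ! i')" "?up ! k' = N + Suc i'" "?low ! k' = int (rev (incr Ls') ! i')"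
      show ?thesis unfolding 1(2-4) 2(2-4) pr_s_def using m1 mL[OF nm(2)[OF fin(3) 2(1)]] zless[OF UnI1[OF sgm[OF j1]] UnI2[OF nm(2)[OF fin(3) 2(1)]]] by auto
    qed
  next
    fix i assume 1: "i < card Ls'" "?ys ! k = z (rev (incr Ls') ! i)" "?up ! k = N + Suc i" "?low ! k = int (rev (incr Ls') ! i)"
    note m1 = mL[OF nm(2)[OF fin(3) 1(1)]]
    note j1 = nm(2)[OF fin(3) 1(1)]
    from seg[OF kk(2)] show ?thesis
    proof (elim disjE exE conjE)
      fix i' assume 2: "i' < card Ms" "?ys ! k' = z' (incr Ms ! i')" "?up ! k' = incr Ms ! i'" "?low ! k' = - int (Suc i')"
      show ?thesis unfolding 1(2-4) 2(2-4) pr_s_def using m1 mM[OF nm(1)[OF fin(2) 2(1)]]  by auto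
      next
      fix i' assume 2: "i' < card Js" "?ys ! k' = z' (incr Js ! i')" "?up ! k' = incr Js ! i'" "?low ! k' = int (sg (incr Js ! i'))"
      show ?thesis unfolding 1(2-4) 2(2-4) pr_s_def using m1 mJ[OF nm(1)[OF fin(1) 2(1)]]  by auto
      next
      fix i' assume 2: "i' < card Ls'" "?ys ! k' = z (rev (incr Ls') ! i')" "?up ! k' = N + Suc i'" "?low ! k' = int (rev (incr Ls') ! i')"
      show ?thesis unfolding 1(2-4) 2(2-4) pr_s_def using m1 mL[OF nm(2)[OF fin(3) 2(1)]] rev_incr_nth_less[OF fin(3) 1(1) 2(1)] by auto
    qed
  qed
  have e: "map (\<lambda>i. - int i) [1..<card Ms + 1] @ map int (map sg (incr Js) @ rev (incr Ls')) = ?low"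
    by (simp del: upt_Suc)
  show ?thesis unfolding e
  proof (rule greene_poset_two_line[OF _ _ dlow _ dys setys])
    show "distinct (map int ?up)" unfolding distinct_map using dup by (simp only: inj_on_of_nat simp_thms)
    show "set (map int ?up) = int ` (Js \<union> Ms \<union> {N + 1..N + card Ls'})" unfolding set_map upset ..
    show "length ?low = length (map int ?up)" "length ?ys = length (map int ?up)" using len by simp_all
    fix k k' assume kk: "k < length ?ys" "k' < length ?ys"
    then have "map int ?up ! k = int (?up ! k)" "map int ?up ! k' = int (?up ! k')"
      using len(1) by (metis nth_map)+
    then show "pr_s (?ys ! k) (?ys ! k') \<longleftrightarrow> map int ?up ! k < map int ?up ! k' \<and> ?low ! k < ?low ! k'"
      using main[OF kk] by simp
  qed
qed

end

section \<open>The matching data of a matrix\<close>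

text \<open>A maximal independent set of columns has \<open>nc\<close> elements, so it contains
  every column, and an independent set does not contain zero.\<close>

lemma (in vec_space) full_rank_col_nonzero:
  assumes A: "A \<in> carrier_mat n nc" and rk: "rank A = nc" and c: "c < nc"
  shows "col A c \<noteq> 0\<^sub>v n"
proof -
  obtain S where S: "maximal S (\<lambda>T. T \<subseteq> set (cols A) \<and> lin_indpt T)"
    using maximal_exists[of "(\<lambda>T. T \<subseteq> set (cols A) \<and> lin_indpt T)" "card (set (cols A))" "{}"]
    by (meson List.finite_set card_mono empty_iff empty_subsetI finite_lin_indpt2 rev_finite_subset)
  have sub: "S \<subseteq> set (cols A)" and li: "lin_indpt S" using S by (auto simp: maximal_def)
  have "card S = nc" using rank_card_indpt[OF A S] rk by simp
  then have "card (set (cols A)) \<le> card S" using card_length[of "cols A"] A by simp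
  then have "S = set (cols A)" using sub by (simp add: card_seteq)
  moreover have "0\<^sub>v n \<notin> S"
  proof -
    have "(UNIV :: 'a set) \<noteq> {0}" by (metis UNIV_I singletonD zero_neq_one)
    then show ?thesis using zero_nin_lin_indpt[OF _ li] sub A cols_dim[of A] by auto
  qed
  moreover have "col A c \<in> set (cols A)" using A c by (auto simp: cols_def)
  ultimately show ?thesis by metis
qed

lemma (in matching_data) unmatched_iff:
  assumes "l < n"
  shows "l \<in> L' \<union> M' \<longleftrightarrow> l \<notin> L \<union> I \<union> M \<union> J"
proof (cases "l \<in> A")
  case True
  then have "l \<notin> B" using parity(7) by blast
  then have "l \<notin> M" "l \<notin> J" "l \<notin> M'" using subsets(4-6) by blast+
  moreover have "l \<in> L \<or> l \<in> I \<or> l \<in> L'" using True unfolding A_split(1) by blast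
  ultimately show ?thesis using A_split(3,4) by blast
next
  case False
  then have "l \<notin> L" "l \<notin> I" "l \<notin> L'" using subsets(1-3) by blast+
  moreover have "l \<in> M \<or> l \<in> J \<or> l \<in> M'" using False parity(4)[OF assms] unfolding B_split(1) by blast
  ultimately show ?thesis using B_split(3,4) by blast
qed

lemma (in matching_data) unmatched_less: "l \<in> L' \<union> M' \<Longrightarrow> l < n"
  using subsets(3,6) parity(5,6) by blast

lemma partial_perm_mat_unique:
  assumes "partial_perm_mat t" "t \<in> carrier_mat m k"
  shows "i < m \<Longrightarrow> c < k \<Longrightarrow> t $$ (i, c) \<in> {0, 1}"
    "i < m \<Longrightarrow> c < k \<Longrightarrow> c' < k \<Longrightarrow> t $$ (i, c) = 1 \<Longrightarrow> t $$ (i, c') = 1 \<Longrightarrow> c = c'"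
    "i < m \<Longrightarrow> i' < m \<Longrightarrow> c < k \<Longrightarrow> t $$ (i, c) = 1 \<Longrightarrow> t $$ (i', c) = 1 \<Longrightarrow> i = i'"
proof -
  note p = assms(1)[unfolded partial_perm_mat_def carrier_matD[OF assms(2)]]
  show "i < m \<Longrightarrow> c < k \<Longrightarrow> t $$ (i, c) \<in> {0, 1}" using p by blast
  show "c = c'" if h: "i < m" "c < k" "c' < k" "t $$ (i, c) = 1" "t $$ (i, c') = 1"
  proof -
    have "card {c. c < k \<and> t $$ (i, c) = 1} \<le> Suc 0" using p h(1) by simp
    then show ?thesis using h by (subst (asm) card_le_Suc0_iff_eq) auto
  qed
  show "i = i'" if h: "i < m" "i' < m" "c < k" "t $$ (i, c) = 1" "t $$ (i', c) = 1"
  proof -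
    have "card {i. i < m \<and> t $$ (i, c) = 1} \<le> Suc 0" using p h(3) by simp
    then show ?thesis using h by (subst (asm) card_le_Suc0_iff_eq) auto
  qed
qed

locale orbit_matrix =
  fixes p q r :: nat and \<omega> :: "complex mat"
  assumes T: "\<omega> \<in> T_mats p q r"
begin

abbreviation (input) "Iset \<equiv> I_set p q \<omega>"
abbreviation (input) "Jset \<equiv> J_set p q \<omega>"
abbreviation (input) "Lset \<equiv> L_set p q \<omega>"
abbreviation (input) "Mset \<equiv> M_set p q \<omega>"
abbreviation (input) "Lset' \<equiv> L'_set p q \<omega>"
abbreviation (input) "Mset' \<equiv> M'_set p q \<omega>"

lemma carrier: "\<omega> \<in> carrier_mat (p + q) r"
  using T by (simp add: T_mats_def)

lemma mem_col_ones: "l \<in> col_ones \<omega> c \<longleftrightarrow> l < p + q \<and> \<omega> $$ (l, c) = 1"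
  using carrier by (simp add: col_ones_def)

lemma entry: "l < p + q \<Longrightarrow> c < r \<Longrightarrow> \<omega> $$ (l, c) = (if l \<in> col_ones \<omega> c then 1 else 0)"
  and col_ones_inj: "c < r \<Longrightarrow> c' < r \<Longrightarrow> l \<in> col_ones \<omega> c \<Longrightarrow> l \<in> col_ones \<omega> c' \<Longrightarrow> c = c'"
  and col_ones_same_block:
    "c < r \<Longrightarrow> l \<in> col_ones \<omega> c \<Longrightarrow> l' \<in> col_ones \<omega> c \<Longrightarrow> (l < p) = (l' < p) \<Longrightarrow> l = l'"
proof -
  obtain t1 t2 where t: "t1 \<in> carrier_mat p r" "t2 \<in> carrier_mat q r" "\<omega> = t1 @\<^sub>r t2"
    "partial_perm_mat t1" "partial_perm_mat t2" using T unfolding T_mats_def by blast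
  note u1 = partial_perm_mat_unique[OF t(4,1)] and u2 = partial_perm_mat_unique[OF t(5,2)]
  have ent: "\<omega> $$ (l, c) = (if l < p then t1 $$ (l, c) else t2 $$ (l - p, c))" if "l < p + q" "c < r" for l c
    using that t(1,2) unfolding t(3) append_rows_def by simp
  have mem: "l < p + q \<and> (if l < p then t1 $$ (l, c) = 1 else l - p < q \<and> t2 $$ (l - p, c) = 1)"
    if "l \<in> col_ones \<omega> c" "c < r" for l c
    using that ent[of l c] by (auto simp: mem_col_ones)
  show "\<omega> $$ (l, c) = (if l \<in> col_ones \<omega> c then 1 else 0)" if lc: "l < p + q" "c < r"
  proof -
    have "\<omega> $$ (l, c) \<in> {0, 1}" unfolding ent[OF lc] using u1(1)[of l c] u2(1)[of "l - p" c] lc by auto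
    then show ?thesis using lc by (auto simp: mem_col_ones)
  qed
  show "c = c'" if c: "c < r" "c' < r" "l \<in> col_ones \<omega> c" "l \<in> col_ones \<omega> c'"
    using mem[OF c(3,1)] mem[OF c(4,2)] u1(2)[of l c c'] u2(2)[of "l - p" c c'] c(1,2) by (cases "l < p") auto
  show "l = l'" if c: "c < r" "l \<in> col_ones \<omega> c" "l' \<in> col_ones \<omega> c" "(l < p) = (l' < p)"
    using mem[OF c(2,1)] mem[OF c(3,1)] u1(3)[of l l' c] u2(3)[of "l - p" "l' - p" c] c(1,4)
    by (cases "l < p") auto
qed

text \<open>This is where the rank condition on \<omega> enters; it leaves exactly the three kinds
  of columns listed in \<open>col_ones_cases\<close>.\<close>

lemma col_ones_nonempty: "c < r \<Longrightarrow> col_ones \<omega> c \<noteq> {}"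
proof
  assume c: "c < r" and e: "col_ones \<omega> c = {}"
  have "col \<omega> c = 0\<^sub>v (p + q)"
  proof (rule eq_vecI)
    fix l assume "l < dim_vec (0\<^sub>v (p + q) :: complex vec)"
    then show "col \<omega> c $ l = 0\<^sub>v (p + q) $ l" using carrier c entry[of l c] e by simp
  qed (use carrier in simp)
  moreover have "vec_space.rank (p + q) \<omega> = r" using T by (simp add: T_mats_def)
  ultimately show False using vec_space.full_rank_col_nonzero[OF carrier _ c] by blast
qed

text \<open>The labels of the statement are 1-based; \<open>zp\<close> and \<open>zm\<close> give the 0-based rows of $\omega$.\<close>

abbreviation (input) zp :: "nat \<Rightarrow> nat" where "zp i \<equiv> i - 1"
abbreviation (input) zm :: "nat \<Rightarrow> nat" where "zm j \<equiv> p + j - 1"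

lemma matchedD:
  assumes "matched p q \<omega> i j"
  shows "i \<in> {1..p}" "j \<in> {1..q}" "\<exists>c<r. col_ones \<omega> c = {zp i, zm j}"
  using assms carrier by (auto simp: matched_def)

lemma zp_inj: "i \<in> {1..p} \<Longrightarrow> i' \<in> {1..p} \<Longrightarrow> zp i = zp i' \<Longrightarrow> i = i'"
  and zm_inj: "j \<in> {1..q} \<Longrightarrow> j' \<in> {1..q} \<Longrightarrow> zm j = zm j' \<Longrightarrow> j = j'"
  and zp_less: "i \<in> {1..p} \<Longrightarrow> zp i < p"
  and zm_ge: "j \<in> {1..q} \<Longrightarrow> p \<le> zm j \<and> zm j < p + q"
  by auto

text \<open>A row with a 1 determines the column of that 1, and a column determines its 1 in each of
  the two blocks.\<close>

lemma matched_unique: "matched p q \<omega> i j \<Longrightarrow> matched p q \<omega> i' j' \<Longrightarrow> i = i' \<longleftrightarrow> j = j'"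
proof -
  assume m: "matched p q \<omega> i j" "matched p q \<omega> i' j'"
  obtain c c' where c: "c < r" "col_ones \<omega> c = {zp i, zm j}" "c' < r" "col_ones \<omega> c' = {zp i', zm j'}"
    using matchedD(3)[OF m(1)] matchedD(3)[OF m(2)] by blast
  note b = zp_less[OF matchedD(1)[OF m(1)]] zp_less[OF matchedD(1)[OF m(2)]]
    zm_ge[OF matchedD(2)[OF m(1)]] zm_ge[OF matchedD(2)[OF m(2)]]
  have mem: "zp i \<in> col_ones \<omega> c" "zm j \<in> col_ones \<omega> c" "zp i' \<in> col_ones \<omega> c'" "zm j' \<in> col_ones \<omega> c'"
    unfolding c(2,4) by blast+
  have "zp i = zp i' \<longleftrightarrow> zm j = zm j'"
  proof
    assume e: "zp i = zp i'"
    have "c = c'" using col_ones_inj[OF c(1,3) mem(1)] mem(3) unfolding e by blast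
    then show "zm j = zm j'" using col_ones_same_block[OF c(1) mem(2), of "zm j'"] mem(4) b by (simp add: not_less)
  next
    assume e: "zm j = zm j'"
    have "c = c'" using col_ones_inj[OF c(1,3) mem(2)] mem(4) unfolding e by blast
    then show "zp i = zp i'" using col_ones_same_block[OF c(1) mem(1), of "zp i'"] mem(3) b by simp
  qed
  then show ?thesis
    using zp_inj[OF matchedD(1)[OF m(1)] matchedD(1)[OF m(2)]] zm_inj[OF matchedD(2)[OF m(1)] matchedD(2)[OF m(2)]] by blast
qed

lemma sigma_eq: "matched p q \<omega> i j \<Longrightarrow> sigma p q \<omega> j = i"
  unfolding sigma_def using matched_unique by blast

lemma matched_sigma: "j \<in> Jset \<Longrightarrow> matched p q \<omega> (sigma p q \<omega> j) j"
  unfolding J_set_def using sigma_eq by auto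

lemma bij_sigma: "bij_betw (sigma p q \<omega>) (Jset) (Iset)"
proof (rule bij_betwI')
  fix j j' assume j: "j \<in> Jset" "j' \<in> Jset"
  show "sigma p q \<omega> j = sigma p q \<omega> j' \<longleftrightarrow> j = j'"
    using matched_unique[OF matched_sigma[OF j(1)] matched_sigma[OF j(2)]] .
next
  fix j assume "j \<in> Jset"
  from matched_sigma[OF this] show "sigma p q \<omega> j \<in> Iset" unfolding I_set_def by blast
next
  fix i assume "i \<in> Iset"
  then obtain j where "matched p q \<omega> i j" unfolding I_set_def by blast
  then show "\<exists>j\<in>Jset. i = sigma p q \<omega> j" using sigma_eq unfolding J_set_def by blast
qed

lemma sigma_inv_sigma: "j \<in> Jset \<Longrightarrow> sigma_inv p q \<omega> (sigma p q \<omega> j) = j"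
  unfolding sigma_inv_def by (rule inv_into_f_f[OF bij_betw_imp_inj_on[OF bij_sigma]])

lemma sigma_sigma_inv: "i \<in> Iset \<Longrightarrow> sigma p q \<omega> (sigma_inv p q \<omega> i) = i"
  unfolding sigma_inv_def using bij_betw_inv_into_right[OF bij_sigma] .

lemma bij_sigma_inv: "bij_betw (sigma_inv p q \<omega>) (Iset) (Jset)"
  unfolding sigma_inv_def by (rule bij_betw_inv_into[OF bij_sigma])

lemma sets_subset: "Iset \<subseteq> {1..p}" "Jset \<subseteq> {1..q}" "Lset \<subseteq> {1..p}" "Mset \<subseteq> {1..q}"
  "Lset' \<subseteq> {1..p}" "Mset' \<subseteq> {1..q}"
  unfolding I_set_def J_set_def L_set_def M_set_def L'_set_def M'_set_def using matchedD by auto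

lemma finite_sets: "finite (Iset)" "finite (Jset)" "finite (Lset)" "finite (Mset)"
  "finite (Lset')" "finite (Mset')"
  by (rule finite_subset[OF sets_subset(1)] finite_subset[OF sets_subset(2)] finite_subset[OF sets_subset(3)]
    finite_subset[OF sets_subset(4)] finite_subset[OF sets_subset(5)] finite_subset[OF sets_subset(6)], simp)+

lemma L_D: "i \<in> Lset \<Longrightarrow> i \<in> {1..p} \<and> (\<exists>c<r. col_ones \<omega> c = {zp i})"
  and M_D: "j \<in> Mset \<Longrightarrow> j \<in> {1..q} \<and> (\<exists>c<r. col_ones \<omega> c = {zm j})"
  using carrier unfolding L_set_def M_set_def by auto

lemma I_L_disjoint: "Iset \<inter> Lset = {}" and J_M_disjoint: "Jset \<inter> Mset = {}"
proof -
  show "Iset \<inter> Lset = {}"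
  proof (rule equals0I, elim IntE)
    fix i assume "i \<in> Iset" "i \<in> Lset"
    then obtain j where m: "matched p q \<omega> i j" and L: "i \<in> Lset" unfolding I_set_def by blast
    obtain c c' where c: "c < r" "col_ones \<omega> c = {zp i, zm j}" "c' < r" "col_ones \<omega> c' = {zp i}"
      using matchedD(3)[OF m] L_D[OF L] by blast
    have "c = c'" by (rule col_ones_inj[OF c(1,3), of "zp i"]) (simp_all only: c(2,4), simp_all)
    then show False using c zp_less[OF matchedD(1)[OF m]] zm_ge[OF matchedD(2)[OF m]] by auto
  qed
  show "Jset \<inter> Mset = {}"
  proof (rule equals0I, elim IntE)
    fix j assume "j \<in> Jset" "j \<in> Mset"
    then obtain i where m: "matched p q \<omega> i j" and M: "j \<in> Mset" unfolding J_set_def by blast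
    obtain c c' where c: "c < r" "col_ones \<omega> c = {zp i, zm j}" "c' < r" "col_ones \<omega> c' = {zm j}"
      using matchedD(3)[OF m] M_D[OF M] by blast
    have "c = c'" by (rule col_ones_inj[OF c(1,3), of "zm j"]) (simp_all only: c(2,4), simp_all)
    then show False using c zp_less[OF matchedD(1)[OF m]] zm_ge[OF matchedD(2)[OF m]] by auto
  qed
qed

lemma col_ones_cases:
  assumes c: "c < r"
  shows "(\<exists>i\<in>Lset. col_ones \<omega> c = {zp i}) \<or> (\<exists>j\<in>Mset. col_ones \<omega> c = {zm j}) \<or>
    (\<exists>i j. matched p q \<omega> i j \<and> col_ones \<omega> c = {zp i, zm j})"
proof (cases "\<exists>l\<in>col_ones \<omega> c. l < p")
  case True
  then obtain l where l: "l \<in> col_ones \<omega> c" "l < p" by blast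
  show ?thesis
  proof (cases "\<exists>l'\<in>col_ones \<omega> c. \<not> l' < p")
    case True
    then obtain l' where l': "l' \<in> col_ones \<omega> c" "\<not> l' < p" by blast
    then have "l' < p + q" by (simp add: mem_col_ones)
    have O: "col_ones \<omega> c = {l, l'}" using col_ones_same_block[OF c] l l' by blast
    have e: "zp (Suc l) = l" "zm (Suc (l' - p)) = l'" using l' by auto
    have "matched p q \<omega> (Suc l) (Suc (l' - p))"
      unfolding matched_def e O[symmetric] using c carrier l l' \<open>l' < p + q\<close> by auto
    then show ?thesis using O e by metis
  next
    case False
    then have O: "col_ones \<omega> c = {l}" using col_ones_same_block[OF c] l by blast
    then have "Suc l \<in> Lset" unfolding L_set_def using l c carrier by auto
    then show ?thesis using O by (metis diff_Suc_1)
  qed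
next
  case False
  then obtain l where l: "l \<in> col_ones \<omega> c" "\<not> l < p" using col_ones_nonempty[OF c] by blast
  then have O: "col_ones \<omega> c = {l}" using False col_ones_same_block[OF c] by blast
  have e: "zm (Suc (l - p)) = l" using l by simp
  have "l < p + q" using l by (simp add: mem_col_ones)
  then have "Suc (l - p) \<in> Mset" unfolding M_set_def using l c carrier O e by auto
  then show ?thesis using O e by metis
qed

text \<open>It acts on the 0-based rows of \<omega>, hence the shifts around the 1-based
  \<open>sigma\<close>: row \<open>l\<close> has label \<open>l + 1\<close> in the upper block and
  \<open>l + 1 - p\<close> in the lower one.\<close>

definition mate :: "nat \<Rightarrow> nat" where
  "mate l = (if l < p then zm (sigma_inv p q \<omega> (Suc l)) else zp (sigma p q \<omega> (Suc l - p)))"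

lemma mate_zp: "i \<in> Iset \<Longrightarrow> mate (zp i) = zm (sigma_inv p q \<omega> i)"
  and mate_zm: "j \<in> Jset \<Longrightarrow> mate (zm j) = zp (sigma p q \<omega> j)"
proof -
  assume "i \<in> Iset"
  then have "i \<in> {1..p}" using sets_subset by blast
  then show "mate (zp i) = zm (sigma_inv p q \<omega> i)" by (auto simp: mate_def)
next
  assume "j \<in> Jset"
  then have "j \<in> {1..q}" using sets_subset by blast
  then have "\<not> zm j < p" "Suc (zm j) - p = j" by auto
  then show "mate (zm j) = zp (sigma p q \<omega> j)" by (simp add: mate_def)
qed

lemma zp_image: "zp ` {1..p} = {..<p}" and zm_image: "zm ` {1..q} = {p..<p + q}"
proof -
  show "zp ` {1..p} = {..<p}"
    by (rule Set.set_eqI, rule iffI) (auto intro!: image_eqI[where x = "Suc _"])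
  show "zm ` {1..q} = {p..<p + q}"
  proof (intro equalityI subsetI)
    fix x assume "x \<in> {p..<p + q}"
    then have "x = zm (Suc (x - p))" "Suc (x - p) \<in> {1..q}" by auto
    then show "x \<in> zm ` {1..q}" by blast
  qed auto
qed

lemma zp_inj_on: "inj_on zp {1..p}" and zm_inj_on: "inj_on zm {1..q}"
  by (auto simp: inj_on_def)

lemma image_disjoint: "inj_on f S \<Longrightarrow> X \<subseteq> S \<Longrightarrow> Y \<subseteq> S \<Longrightarrow> X \<inter> Y = {} \<Longrightarrow> f ` X \<inter> f ` Y = {}"
  using inj_on_image_Int[of f S X Y] by simp

lemma matched_slice: "matched_slice p (p + q) {i. i < p + q \<and> (i < p) = True} {i. i < p + q \<and> (i < p) \<noteq> True}
  (zp ` Lset) (zp ` Iset) (zp ` Lset')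
  (zm ` Mset) (zm ` Jset) (zm ` Mset') mate"
  unfolding matched_slice_def
proof
  have u: "Lset \<union> Iset \<union> Lset' = {1..p}" "Mset \<union> Jset \<union> Mset' = {1..q}"
    using sets_subset unfolding L'_set_def M'_set_def by auto
  have "{i. i < p + q \<and> (i < p) = True} = zp ` {1..p}" "{i. i < p + q \<and> (i < p) \<noteq> True} = zm ` {1..q}"
    unfolding zp_image zm_image by auto
  then show "{i. i < p + q \<and> (i < p) = True} = zp ` Lset \<union> zp ` Iset \<union> zp ` Lset'"
    "{i. i < p + q \<and> (i < p) \<noteq> True} = zm ` Mset \<union> zm ` Jset \<union> zm ` Mset'"
    unfolding u[symmetric] image_Un by simp_all
  note dp = image_disjoint[OF zp_inj_on] and dm = image_disjoint[OF zm_inj_on]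
  show "zp ` Lset \<inter> zp ` Iset = {}" by (rule dp) (use sets_subset I_L_disjoint in auto)
  show "zp ` Lset \<inter> zp ` Lset' = {}" by (rule dp) (use sets_subset in \<open>auto simp: L'_set_def\<close>)
  show "zp ` Iset \<inter> zp ` Lset' = {}" by (rule dp) (use sets_subset in \<open>auto simp: L'_set_def\<close>)
  show "zm ` Mset \<inter> zm ` Jset = {}" by (rule dm) (use sets_subset J_M_disjoint in auto)
  show "zm ` Mset \<inter> zm ` Mset' = {}" by (rule dm) (use sets_subset in \<open>auto simp: M'_set_def\<close>)
  show "zm ` Jset \<inter> zm ` Mset' = {}" by (rule dm) (use sets_subset in \<open>auto simp: M'_set_def\<close>)
next
  fix l assume "l \<in> zp ` Iset"
  then obtain i where i: "i \<in> Iset" "l = zp i" by blast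
  have "sigma_inv p q \<omega> i \<in> Jset" using i(1) bij_sigma_inv by (auto simp: bij_betw_def)
  then show "mate l \<in> zm ` Jset \<and> mate (mate l) = l"
    unfolding i(2) mate_zp[OF i(1)] using mate_zm sigma_sigma_inv[OF i(1)] by simp
next
  fix l assume "l \<in> zm ` Jset"
  then obtain j where j: "j \<in> Jset" "l = zm j" by blast
  have "sigma p q \<omega> j \<in> Iset" using j(1) bij_sigma by (auto simp: bij_betw_def)
  then show "mate l \<in> zp ` Iset \<and> mate (mate l) = l"
    unfolding j(2) mate_zm[OF j(1)] using mate_zp sigma_inv_sigma[OF j(1)] by simp
qed simp_all

end

sublocale orbit_matrix \<subseteq> matched_slice p "p + q" "{i. i < p + q \<and> (i < p) = True}" "{i. i < p + q \<and> (i < p) \<noteq> True}"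
  "(\<lambda>i. i - 1) ` L_set p q \<omega>" "(\<lambda>i. i - 1) ` I_set p q \<omega>" "(\<lambda>i. i - 1) ` L'_set p q \<omega>"
  "(\<lambda>j. p + j - 1) ` M_set p q \<omega>" "(\<lambda>j. p + j - 1) ` J_set p q \<omega>" "(\<lambda>j. p + j - 1) ` M'_set p q \<omega>" mate
  by (rule matched_slice)

context orbit_matrix
begin

text \<open>Columns are counted by their first 1. For a matched column this lies in the upper block,
  so the rows of \<open>I\<close> occur and those of \<open>J\<close> do not.\<close>

lemma card_columns: "r = card ((\<lambda>i. i - 1) ` Lset \<union> (\<lambda>j. p + j - 1) ` Mset \<union> (\<lambda>i. i - 1) ` Iset)"
proof -
  have fin: "finite (col_ones \<omega> c)" for c by (simp add: col_ones_def)
  have Min_mem: "Min (col_ones \<omega> c) \<in> col_ones \<omega> c" if "c < r" for c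
    by (rule Min_in[OF fin col_ones_nonempty[OF that]])
  have Min_matched: "Min {zp i, zm j} = zp i" if "matched p q \<omega> i j" for i j
    using zp_less[OF matchedD(1)[OF that]] zm_ge[OF matchedD(2)[OF that]] by (simp add: min_def)
  have "bij_betw (\<lambda>c. Min (col_ones \<omega> c)) {..<r} (zp ` Lset \<union> zm ` Mset \<union> zp ` Iset)"
    unfolding bij_betw_def
  proof
    show "inj_on (\<lambda>c. Min (col_ones \<omega> c)) {..<r}"
    proof (rule inj_onI)
      fix c c' assume c: "c \<in> {..<r}" "c' \<in> {..<r}" "Min (col_ones \<omega> c) = Min (col_ones \<omega> c')"
      then show "c = c'" using col_ones_inj[of c c' "Min (col_ones \<omega> c)"] Min_mem[of c] Min_mem[of c'] by simp
    qed
    show "(\<lambda>c. Min (col_ones \<omega> c)) ` {..<r} = zp ` Lset \<union> zm ` Mset \<union> zp ` Iset"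
    proof (intro equalityI subsetI)
      fix l assume "l \<in> (\<lambda>c. Min (col_ones \<omega> c)) ` {..<r}"
      then obtain c where c: "c < r" "l = Min (col_ones \<omega> c)" by blast
      from col_ones_cases[OF c(1)] show "l \<in> zp ` Lset \<union> zm ` Mset \<union> zp ` Iset"
      proof (elim disjE bexE exE conjE)
        fix i j assume m: "matched p q \<omega> i j" "col_ones \<omega> c = {zp i, zm j}"
        then have "l = zp i" unfolding c(2) using Min_matched by simp
        moreover have "i \<in> Iset" using m unfolding I_set_def by blast
        ultimately show ?thesis by blast
      qed (use c(2) in auto)
    next
      fix l assume "l \<in> zp ` Lset \<union> zm ` Mset \<union> zp ` Iset"
      then consider i where "i \<in> Lset" "l = zp i" | j where "j \<in> Mset" "l = zm j"
        | i j where "matched p q \<omega> i j" "l = zp i" unfolding I_set_def by blast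
      then have "\<exists>c<r. Min (col_ones \<omega> c) = l"
      proof cases
        case 1
        then show ?thesis using L_D[of i] by force
      next
        case 2
        then show ?thesis using M_D[of j] by force
      next
        case 3
        then show ?thesis using matchedD(3)[OF 3(1)] Min_matched by metis
      qed
      then show "l \<in> (\<lambda>c. Min (col_ones \<omega> c)) ` {..<r}" by blast
    qed
  qed
  from bij_betw_same_card[OF this] show ?thesis by simp
qed

lemma col_space_eq_W0: "vec_space.col_space (p + q) \<omega> = plus.W0"
proof -
  have cs: "vec_space.col_space (p + q) \<omega> = {y \<in> carrier_vec (p + q). \<exists>x\<in>carrier_vec r. \<omega> *\<^sub>v x = y}"
    using vec_space.col_space_eq[OF carrier] carrier by simp
  have val: "(\<omega> *\<^sub>v x) $ l = (\<Sum>c<r. if l \<in> col_ones \<omega> c then x $ c else 0)" if "x \<in> carrier_vec r" "l < p + q" for x l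
    unfolding mult_mat_vec_sum[OF carrier that] by (rule sum.cong) (use entry that in auto)
  have unmatched: "l \<notin> col_ones \<omega> c" if l: "l \<in> zp ` Lset' \<union> zm ` Mset'" and c: "c < r" for l c
  proof
    assume lc: "l \<in> col_ones \<omega> c"
    have "l \<in> zp ` Lset \<union> zp ` Iset \<union> zm ` Mset \<union> zm ` Jset"
      using col_ones_cases[OF c]
    proof (elim disjE bexE exE conjE)
      fix i j assume m: "matched p q \<omega> i j" "col_ones \<omega> c = {zp i, zm j}"
      have "i \<in> Iset" "j \<in> Jset" using m(1) unfolding I_set_def J_set_def by blast+
      then show ?thesis using lc m(2) by blast
    qed (use lc in auto)
    then show False using plus.unmatched_iff[OF plus.unmatched_less[OF l]] l by simp
  qed
  have same_col: "zp i \<in> col_ones \<omega> c \<longleftrightarrow> zm j \<in> col_ones \<omega> c" if m: "matched p q \<omega> i j" and c: "c < r" for i j c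
  proof -
    obtain c' where c': "c' < r" "col_ones \<omega> c' = {zp i, zm j}" using matchedD(3)[OF m] by blast
    then have "zp i \<in> col_ones \<omega> c'" "zm j \<in> col_ones \<omega> c'" by blast+
    then show ?thesis using col_ones_inj[OF c c'(1)] by blast
  qed
  have I_matched: "\<exists>i j. matched p q \<omega> i j \<and> l = zp i \<and> mate l = zm j" if l: "l \<in> zp ` Iset" for l
  proof -
    obtain i j where ij: "matched p q \<omega> i j" "l = zp i" using l unfolding I_set_def by blast
    then have "i \<in> Iset" "j \<in> Jset" unfolding I_set_def J_set_def by blast+
    moreover have "sigma p q \<omega> j = i" by (rule sigma_eq[OF ij(1)])
    ultimately have "mate l = zm j" using mate_zp sigma_inv_sigma ij(2) by metis
    then show ?thesis using ij by blast
  qed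
  show ?thesis
  proof (intro equalityI subsetI)
    fix y assume "y \<in> vec_space.col_space (p + q) \<omega>"
    then obtain x where x: "x \<in> carrier_vec r" "y = \<omega> *\<^sub>v x" and y: "y \<in> carrier_vec (p + q)" unfolding cs by blast
    show "y \<in> plus.W0"
    proof (rule plus.W0I[OF y])
      fix l assume l: "l \<in> zp ` Lset' \<union> zm ` Mset'"
      then have "l < p + q" by (rule plus.unmatched_less)
      then show "y $ l = 0" unfolding x(2) val[OF x(1) \<open>l < p + q\<close>] using unmatched[OF l] by simp
    next
      fix l assume l: "l \<in> zp ` Iset"
      obtain i j where m: "matched p q \<omega> i j" "l = zp i" "mate l = zm j" using I_matched[OF l] by blast
      show "y $ l = y $ mate l"
        unfolding x(2) val[OF x(1) plus.index_less(1)[OF l]] val[OF x(1) plus.index_less(3)[OF l]] m(2,3)[symmetric]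
        unfolding m(3) unfolding m(2) by (rule sum.cong) (use same_col[OF m(1)] in auto)
    qed
  next
    fix y assume y: "y \<in> plus.W0"
    note D = plus.W0D[OF y]
    \<comment> \<open>Each row has a 1 in at most one column, so the coefficient of a column can be
      read off from \<open>y\<close> at any row where that column has a 1; the first such row is
      used. For matched columns the two choices agree because \<open>y\<close> satisfies the
      equations of \<open>W0\<close>.\<close>
    define x where "x = vec r (\<lambda>c. y $ Min (col_ones \<omega> c))"
    have xr: "x \<in> carrier_vec r" by (simp add: x_def)
    have col: "y $ Min (col_ones \<omega> c) = y $ l" if c: "c < r" and l: "l \<in> col_ones \<omega> c" for c l
      using col_ones_cases[OF c]
    proof (elim disjE bexE exE conjE)
      fix i j assume m: "matched p q \<omega> i j" "col_ones \<omega> c = {zp i, zm j}"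
      have i: "i \<in> Iset" "j \<in> Jset" using m(1) unfolding I_set_def J_set_def by blast+
      have "sigma p q \<omega> j = i" by (rule sigma_eq[OF m(1)])
      then have "mate (zp i) = zm j" using mate_zp[OF i(1)] sigma_inv_sigma[OF i(2)] by simp
      then have "y $ zp i = y $ zm j" using D(3)[of "zp i"] i(1) by auto
      moreover have "Min {zp i, zm j} = zp i" using zp_less[OF matchedD(1)[OF m(1)]] zm_ge[OF matchedD(2)[OF m(1)]] by (simp add: min_def)
      ultimately show ?thesis using l m(2) by auto
    qed (use l in auto)
    have "\<omega> *\<^sub>v x = y"
    proof (rule eq_vecI)
      fix l assume "l < dim_vec y"
      then have l: "l < p + q" using D(1) by simp
      show "(\<omega> *\<^sub>v x) $ l = y $ l"
      proof (cases "\<exists>c<r. l \<in> col_ones \<omega> c")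
        case True
        then obtain c where c: "c < r" "l \<in> col_ones \<omega> c" by blast
        have "(\<omega> *\<^sub>v x) $ l = (\<Sum>c'<r. if c' = c then y $ l else 0)"
          unfolding val[OF xr l]
        proof (rule sum.cong[OF refl])
          fix c' assume "c' \<in> {..<r}"
          then have "l \<in> col_ones \<omega> c' \<longleftrightarrow> c' = c" using col_ones_inj[of c' c l] c by blast
          moreover have "x $ c = y $ l" using col[OF c] c(1) by (simp add: x_def)
          ultimately show "(if l \<in> col_ones \<omega> c' then x $ c' else 0) = (if c' = c then y $ l else 0)" by simp
        qed
        then show ?thesis using c by simp
      next
        case False
        have "l \<in> zp ` Lset' \<union> zm ` Mset'"
        proof (rule ccontr)
          assume n: "l \<notin> zp ` Lset' \<union> zm ` Mset'"
          then have "l \<in> zp ` Lset \<union> zp ` Iset \<union> zm ` Mset \<union> zm ` Jset"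
            using plus.unmatched_iff[OF l] by simp
          then show False
          proof (elim UnE imageE)
            fix i assume i: "i \<in> Lset" "l = zp i"
            obtain c where "c < r" "col_ones \<omega> c = {zp i}" using L_D[OF i(1)] by blast
            then show False using False i(2) by blast
          next
            fix i assume i: "i \<in> Iset" "l = zp i"
            then obtain j where "matched p q \<omega> i j" unfolding I_set_def by blast
            then obtain c where "c < r" "col_ones \<omega> c = {zp i, zm j}" using matchedD(3) by blast
            then show False using False i(2) by blast
          next
            fix j assume j: "j \<in> Mset" "l = zm j"
            obtain c where "c < r" "col_ones \<omega> c = {zm j}" using M_D[OF j(1)] by blast
            then show False using False j(2) by blast
          next
            fix j assume j: "j \<in> Jset" "l = zm j"
            then obtain i where "matched p q \<omega> i j" unfolding J_set_def by blast
            then obtain c where "c < r" "col_ones \<omega> c = {zp i, zm j}" using matchedD(3) by blast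
            then show False using False j(2) by blast
          qed
        qed
        then have "y $ l = 0" by (rule D(2))
        then show ?thesis unfolding val[OF xr l] using False by (simp add: sum.neutral)
      qed
    qed (use carrier D(1) in simp)
    then show "y \<in> vec_space.col_space (p + q) \<omega>" unfolding cs using xr D(1) by blast
  qed
qed

end

lemma greene_poset_boxes_le:
  assumes "greene_poset Y pr lam"
  shows "boxes_upto lam m \<le> card Y"
  using boxes_upto_add[of lam m] assms unfolding greene_poset_def by linarith

context orbit_matrix
begin

lemma strict_mono_labels: "X \<subseteq> {1..p} \<Longrightarrow> strict_mono_on X (\<lambda>i. i - 1)" "X' \<subseteq> {1..q} \<Longrightarrow> strict_mono_on X' (\<lambda>j. p + j - 1)"
  by (auto simp: strict_mono_on_def intro!: diff_less_mono)

lemma unions: "Lset \<union> Iset \<union> Lset' = {1..p}" "Mset \<union> Jset \<union> Mset' = {1..q}"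
  using sets_subset unfolding L'_set_def M'_set_def by auto

lemma mate_sigma:
  "j \<in> Jset \<Longrightarrow> mate (zp (sigma p q \<omega> j)) = zm j"
  "i \<in> Iset \<Longrightarrow> mate (zm (sigma_inv p q \<omega> i)) = zp i"
  using mate_zp mate_zm sigma_inv_sigma sigma_sigma_inv bij_sigma bij_sigma_inv unfolding bij_betw_def by force+

lemma greene_slice:
  "greene_slice p (p + q) {i. i < p + q \<and> (i < p) = True} {i. i < p + q \<and> (i < p) \<noteq> True}
  (zp ` Lset) (zp ` Iset) (zp ` Lset')
  (zm ` Mset) (zm ` Jset) (zm ` Mset') mate
  (shape (RS1 {1..int p} (w_k_plus p q \<omega>))) (shape (RS1 {1..int q} (w_k_minus p q \<omega>)))
  (shape (RS1 (dom_s_plus p q \<omega>) (w_s_plus p q \<omega>))) (shape (RS1 (dom_s_minus p q \<omega>) (w_s_minus p q \<omega>)))"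
proof
  note sub = sets_subset
  have IL: "Iset \<inter> Lset' = {}" "Jset \<inter> Mset' = {}"
    unfolding L'_set_def M'_set_def by auto
  have un: "Jset \<union> Mset \<subseteq> {1..q}" "Iset \<union> Lset \<subseteq> {1..p}"
    "Iset \<union> Lset' \<subseteq> {1..p}" "Jset \<union> Mset' \<subseteq> {1..q}"
    using sub by auto
  show "greene_poset {i. i < p + q \<and> (i < p) = True} plus.pr_k (shape (RS1 {1..int p} (w_k_plus p q \<omega>)))"
    unfolding w_k_plus_def
    by (rule plus.greene_two_line_k[OF strict_mono_labels(1)[OF subset_refl] strict_mono_labels(2)[OF sub(2)]
      unions(1) finite_sets(2) refl refl refl bij_sigma mate_sigma(1)])
  show "greene_poset {i. i < p + q \<and> (i < p) \<noteq> True} minus.pr_k (shape (RS1 {1..int q} (w_k_minus p q \<omega>)))"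
    unfolding w_k_minus_def
    by (rule minus.greene_two_line_k[OF strict_mono_labels(2)[OF subset_refl] strict_mono_labels(1)[OF sub(1)]
      unions(2) finite_sets(1) refl refl refl bij_sigma_inv mate_sigma(2)])
  show "greene_poset plus.Y_s plus.pr_s (shape (RS1 (dom_s_plus p q \<omega>) (w_s_plus p q \<omega>)))"
    unfolding w_s_plus_def dom_s_plus_def
    by (rule plus.greene_two_line_s[OF strict_mono_labels(1)[OF un(3)] strict_mono_labels(2)[OF un(1)]
      finite_sets(5) un(1) refl refl refl bij_sigma mate_zm IL(1)])
  show "greene_poset minus.Y_s minus.pr_s (shape (RS1 (dom_s_minus p q \<omega>) (w_s_minus p q \<omega>)))"
    unfolding w_s_minus_def dom_s_minus_def
    by (rule minus.greene_two_line_s[OF strict_mono_labels(2)[OF un(4)] strict_mono_labels(1)[OF un(2)]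
      finite_sets(6) un(2) refl refl refl bij_sigma_inv mate_zp IL(2)])
qed

text \<open>With \<open>card I = card J\<close>, replacing \<open>L\<close> by \<open>M\<close> in
  the index set changes its size by \<open>t - s\<close>. Subtracting ranks from \<open>p\<close>
  and \<open>q\<close> then produces the shifts in the odd columns.\<close>

lemma card_parts:
  "card {i. i < p + q \<and> (i < p) = True} = p" "card {i. i < p + q \<and> (i < p) \<noteq> True} = q"
  "card plus.Y_s + card (Lset) = p + card (Mset)"
  "card minus.Y_s + card (Mset) = q + card (Lset)"
proof -
  show cA: "card {i. i < p + q \<and> (i < p) = True} = p" and cB: "card {i. i < p + q \<and> (i < p) \<noteq> True} = q"
    using graded_dim_eq[of p q] by simp_all
  have card3: "card (X \<union> Y \<union> Z) = card X + card Y + card Z"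
    if "finite X" "finite Y" "finite Z" "X \<inter> Y = {}" "X \<inter> Z = {}" "Y \<inter> Z = {}" for X Y Z :: "nat set"
    using that by (simp add: card_Un_disjoint Int_Un_distrib2)
  have cz: "card (zp ` X) = card X" if "X \<subseteq> {1..p}" for X by (rule card_image[OF inj_on_subset[OF zp_inj_on that]])
  have cm: "card (zm ` X) = card X" if "X \<subseteq> {1..q}" for X by (rule card_image[OF inj_on_subset[OF zm_inj_on that]])
  note c = cz[OF sets_subset(1)] cm[OF sets_subset(2)] cz[OF sets_subset(3)] cm[OF sets_subset(4)]
    cz[OF sets_subset(5)] cm[OF sets_subset(6)]
  have IJ: "card (Iset) = card (Jset)" using bij_betw_same_card[OF bij_sigma] by simp
  have A: "p = card (Lset) + card (Iset) + card (Lset')"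
    using card3[OF plus.finite_parts(1-3) plus.A_split(2-4)] cA unfolding plus.A_split(1) c by simp
  have B: "q = card (Mset) + card (Jset) + card (Mset')"
    using card3[OF plus.finite_parts(4-6) plus.B_split(2-4)] cB unfolding plus.B_split(1) c by simp
  have "card plus.Y_s = card (Jset) + card (Mset) + card (Lset')"
    unfolding plus.Y_s_def using card3[OF plus.finite_parts(5,4,3)] plus.B_split(2) plus.disjoint_parts(3,4)
    unfolding c by (simp add: Int_commute)
  then show "card plus.Y_s + card (Lset) = p + card (Mset)" using A IJ by simp
  have "card minus.Y_s = card (Iset) + card (Lset) + card (Mset')"
    unfolding minus.Y_s_def using card3[OF minus.finite_parts(5,4,3)] minus.B_split(2) minus.disjoint_parts(3,4)
    unfolding c by (simp add: Int_commute)
  then show "card minus.Y_s + card (Mset) = q + card (Lset)" using B IJ by simp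
qed

theorem Steinberg_maps_of_orbit:
  fixes lam mu lam' mu'
  defines "lam \<equiv> shape (RS1 {1..int p} (w_k_plus p q \<omega>))"
    and "mu \<equiv> shape (RS1 {1..int q} (w_k_minus p q \<omega>))"
    and "lam' \<equiv> shape (RS1 (dom_s_plus p q \<omega>) (w_s_plus p q \<omega>))"
    and "mu' \<equiv> shape (RS1 (dom_s_minus p q \<omega>) (w_s_minus p q \<omega>))"
  shows "Phi_k p q r (orbit_of p q \<omega>) = orbit_k p q lam mu"
    and "\<exists>\<Lambda>. Phi_s p q r (orbit_of p q \<omega>) = orbit_s p q \<Lambda> \<and> signed_young_diagram p q \<Lambda> \<and>
      (\<forall>c\<ge>1. even c \<longrightarrow> signs_upto \<Lambda> c Plus = boxes_upto lam c \<and> signs_upto \<Lambda> c Minus = boxes_upto mu c) \<and>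
      (\<forall>c\<ge>1. odd c \<longrightarrow>
        int (signs_upto \<Lambda> c Plus) = int (card (Lset)) - int (card (Mset)) + int (boxes_upto lam' c) \<and>
        int (signs_upto \<Lambda> c Minus) = int (card (Mset)) - int (card (Lset)) + int (boxes_upto mu' c))"
proof -
  interpret gs: greene_slice p "p + q" "{i. i < p + q \<and> (i < p) = True}" "{i. i < p + q \<and> (i < p) \<noteq> True}"
    "zp ` Lset" "zp ` Iset" "zp ` Lset'"
    "zm ` Mset" "zm ` Jset" "zm ` Mset'" mate lam mu lam' mu'
    unfolding lam_def mu_def lam'_def mu'_def by (rule greene_slice)
  interpret k: linear_slice p "p + q" True "kpart p (p + q) ` plus.slice" gs.R_k "p + q" by (rule gs.linear_slice_k)
  interpret s: linear_slice p "p + q" False "spart p (p + q) ` plus.slice" gs.R_s "p + q" by (rule gs.linear_slice_s)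
  note img = plus.conormal_image[OF refl col_space_eq_W0 card_columns]
  have orb: "adjoint_orbit p q ` hom_nilpotents p (p + q) e = K_orbit p (p + q) ` hom_nilpotents p (p + q) e" for e
    by (rule image_cong[OF refl]) (simp add: adjoint_orbit_eq hom_nilpotents_def)
  have R_k: "boxes_upto lam m + gs.R_k m True = p" "boxes_upto mu m + gs.R_k m False = q" for m
    using greene_poset_boxes_le[OF gs.greene_k(1), of m] greene_poset_boxes_le[OF gs.greene_k(2), of m]
    unfolding gs.R_k_def card_parts(1,2) by simp_all
  have "Phi_k p q r (orbit_of p q \<omega>) = k.generic_orbit"
    unfolding Phi_k_def N_k_eq orb img(1) using k.the_open_dense_orbit unfolding k.saturation_def .
  also have "\<dots> = orbit_k p q lam mu"
    by (rule k.generic_orbit_k[OF refl refl]) (rule R_k)+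
  finally show "Phi_k p q r (orbit_of p q \<omega>) = orbit_k p q lam mu" .
  obtain \<Lambda> where L: "signed_young_diagram p q \<Lambda>" "s.generic_orbit = orbit_s p q \<Lambda>"
    "\<forall>m\<ge>1. signs_upto \<Lambda> m Plus + gs.R_s m True = p \<and> signs_upto \<Lambda> m Minus + gs.R_s m False = q"
    using s.generic_orbit_s[OF refl refl] by blast
  have Ph: "Phi_s p q r (orbit_of p q \<omega>) = orbit_s p q \<Lambda>"
    unfolding L(2)[symmetric] Phi_s_def N_s_eq orb img(2) using s.the_open_dense_orbit unfolding s.saturation_def .
  have even: "signs_upto \<Lambda> c Plus = boxes_upto lam c \<and> signs_upto \<Lambda> c Minus = boxes_upto mu c" if "c \<ge> 1" "even c" for c
  proof -
    have "signs_upto \<Lambda> c Plus + gs.R_k c True = p" "signs_upto \<Lambda> c Minus + gs.R_k c False = q"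
      using L(3) that unfolding gs.R_s_def by auto
    then show ?thesis using R_k[of c] by (metis add_right_cancel)
  qed
  have odd: "int (signs_upto \<Lambda> c Plus) = int (card (Lset)) - int (card (Mset)) + int (boxes_upto lam' c) \<and>
        int (signs_upto \<Lambda> c Minus) = int (card (Mset)) - int (card (Lset)) + int (boxes_upto mu' c)"
    if "c \<ge> 1" "odd c" for c
  proof -
    have "signs_upto \<Lambda> c Plus + (card plus.Y_s - boxes_upto lam' c) = p"
      "signs_upto \<Lambda> c Minus + (card minus.Y_s - boxes_upto mu' c) = q"
      using L(3) that unfolding gs.R_s_def by auto
    then show ?thesis
      using greene_poset_boxes_le[OF gs.greene_s(1), of c] greene_poset_boxes_le[OF gs.greene_s(2), of c] card_parts(3,4)
      by linarith
  qed
  show "\<exists>\<Lambda>. Phi_s p q r (orbit_of p q \<omega>) = orbit_s p q \<Lambda> \<and> signed_young_diagram p q \<Lambda> \<and>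
      (\<forall>c\<ge>1. even c \<longrightarrow> signs_upto \<Lambda> c Plus = boxes_upto lam c \<and> signs_upto \<Lambda> c Minus = boxes_upto mu c) \<and>
      (\<forall>c\<ge>1. odd c \<longrightarrow>
        int (signs_upto \<Lambda> c Plus) = int (card (Lset)) - int (card (Mset)) + int (boxes_upto lam' c) \<and>
        int (signs_upto \<Lambda> c Minus) = int (card (Mset)) - int (card (Lset)) + int (boxes_upto mu' c))"
    using Ph L(1) even odd by blast
qed

end

theorem theorem2p5:
  fixes p q r :: nat and \<omega> :: "complex mat" and s t :: nat
    and lam mu lam' mu' :: "nat list"
  assumes "1 \<le> p" and "1 \<le> q" and "r \<le> p + q"
    and "\<omega> \<in> T_mats p q r"
    and "s = card (L_set p q \<omega>)" and "t = card (M_set p q \<omega>)"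
    and "lam = shape (RS1 {1..int p} (w_k_plus p q \<omega>))"
    and "mu = shape (RS1 {1..int q} (w_k_minus p q \<omega>))"
    and "lam' = shape (RS1 (dom_s_plus p q \<omega>) (w_s_plus p q \<omega>))"
    and "mu' = shape (RS1 (dom_s_minus p q \<omega>) (w_s_minus p q \<omega>))"
  shows "Phi_k p q r (orbit_of p q \<omega>) = orbit_k p q lam mu \<and>
    (\<exists>\<Lambda>. Phi_s p q r (orbit_of p q \<omega>) = orbit_s p q \<Lambda> \<and>
      (\<forall>\<Lambda>'.
        (signed_young_diagram p q \<Lambda>' \<and>
         (\<forall>c \<ge> 1. even c \<longrightarrow>
            signs_upto \<Lambda>' c Plus = boxes_upto lam c \<and>
            signs_upto \<Lambda>' c Minus = boxes_upto mu c) \<and>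
         (\<forall>c \<ge> 1. odd c \<longrightarrow>
            int (signs_upto \<Lambda>' c Plus) = int s - int t + int (boxes_upto lam' c) \<and>
            int (signs_upto \<Lambda>' c Minus) = int t - int s + int (boxes_upto mu' c)))
        \<longleftrightarrow> \<Lambda>' = \<Lambda>))"
proof -
  interpret orbit_matrix p q r \<omega> by unfold_locales (rule assms(4))
  define cond where "cond \<Lambda> \<longleftrightarrow> signed_young_diagram p q \<Lambda> \<and>
    (\<forall>c \<ge> 1. even c \<longrightarrow> signs_upto \<Lambda> c Plus = boxes_upto lam c \<and> signs_upto \<Lambda> c Minus = boxes_upto mu c) \<and>
    (\<forall>c \<ge> 1. odd c \<longrightarrow> int (signs_upto \<Lambda> c Plus) = int s - int t + int (boxes_upto lam' c) \<and>
      int (signs_upto \<Lambda> c Minus) = int t - int s + int (boxes_upto mu' c))" for \<Lambda>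
  \<comment> \<open>The conditions fix the sign counts of all initial segments of columns, and these
    determine the diagram. With existence this gives the equivalence.\<close>
  have unique: "\<Lambda>' = \<Lambda>" if c: "cond \<Lambda>'" "cond \<Lambda>" for \<Lambda> \<Lambda>'
  proof (rule signed_diagram_eqI)
    show "signed_young_diagram p q \<Lambda>'" "signed_young_diagram p q \<Lambda>" using c unfolding cond_def by blast+
    fix d :: nat and e :: sign assume d: "d \<ge> 1"
    have "signs_upto \<Lambda>' d Plus = signs_upto \<Lambda> d Plus \<and> signs_upto \<Lambda>' d Minus = signs_upto \<Lambda> d Minus"
    proof (cases "even d")
      case True
      then show ?thesis using c d unfolding cond_def by metis
    next
      case False
      then have "int (signs_upto \<Lambda>' d Plus) = int (signs_upto \<Lambda> d Plus)" "int (signs_upto \<Lambda>' d Minus) = int (signs_upto \<Lambda> d Minus)"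
        using c d unfolding cond_def by metis+
      then show ?thesis by simp
    qed
    then show "signs_upto \<Lambda>' d e = signs_upto \<Lambda> d e" by (cases e) simp_all
  qed
  obtain \<Lambda> where L: "Phi_s p q r (orbit_of p q \<omega>) = orbit_s p q \<Lambda>" "cond \<Lambda>"
    using Steinberg_maps_of_orbit(2) unfolding cond_def assms(5-10) by blast
  have "cond \<Lambda>' \<longleftrightarrow> \<Lambda>' = \<Lambda>" for \<Lambda>' using unique L(2) by blast
  then show ?thesis
    using Steinberg_maps_of_orbit(1) L(1) unfolding cond_def assms(7,8) by blast
qed

end
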